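(* Let $m\ge 6$. The branching of the irreducible $\mathfrak{sp}(2m)$-representation $\mathbb{S}_1^\infty$ with respect to the subalgebra $\mathfrak{so}(m)$ can be described in a multiplicity-free way as a direct sum of irreducible $\mathfrak{so}(m)\times\mathfrak{sl}_d(2)$-representations, each occurring exactly once, as follows: $$\mathbb{S}_1^\infty\cong \bigoplus_{a\ge 1}(a)\otimes\mathbb{V}^\infty_{\frac m2+a-2}\ \oplus\ \bigoplus_{a\ge 1}(a,1)\otimes\mathbb{V}^\infty_{\frac m2+a-1}\ \oplus\ \bigoplus_{a\ge 1}(a)\otimes\mathbb{V}^\infty_{\frac m2+a}\ \oplus\ \bigoplus_{a\ge 1}(a,1)\otimes\mathbb{V}^\infty_{\frac m2+a+1}\ \oplus\ \bigoplus_{a\ge 0}(a)\otimes\mathbb{V}^\infty_{\frac m2+a+2}.$$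
   Context: All Lie algebras are complex. Let $\underline x,\underline y,\underline z\in\mathbb{R}^m$ be three vector variables, $\langle\cdot,\cdot\rangle$ the standard (bilinear) pairing, $\underline\partial_x=(\partial_{x_1},\dots,\partial_{x_m})$ and similarly for $y,z$; $\mathbb{E}_x=\sum_j x_j\partial_{x_j}$ etc. are Euler operators and $\Delta_z=\sum_j\partial_{z_j}^2$. $\mathcal{P}_k(\mathbb{R}^{2m},\mathbb{C})$ is the space of complex polynomials in $(\underline x,\underline y)$ homogeneous of total degree $k$, and $\mathcal{P}(\mathbb{R}^m,\mathbb{C})$ is the space of complex polynomials in $\underline z$. The symplectic Dirac operator is $D_s=\langle\underline z,\underline\partial_y\rangle-\langle\underline\partial_x,\underline\partial_z\rangle$, and $\mathbb{S}_k^\infty=\ker(D_s)\cap(\mathcal{P}_k(\mathbb{R}^{2m},\mathbb{C})\otimes\mathcal{P}(\mathbb{R}^m,\mathbb{C}))$. (The parity splitting in $\underline z$ is ignored: "irreducible" for $\mathbb{S}^\infty_k$ is meant up to splitting into the parts of even and odd spinors.) The Lie algebra $\mathfrak{sp}(2m)$ acts by the operators $X_{jk}=x_j\partial_{x_k}-y_k\partial_{y_j}-(z_k\partial_{z_j}+\frac12\delta_{jk})$ for $1\le j,k\le m$; $Y_{jk}=x_j\partial_{y_k}+x_k\partial_{y_j}-\partial_{z_j}\partial_{z_k}$ and $Z_{jk}=y_j\partial_{x_k}+y_k\partial_{x_j}+z_jz_k$ for $j<k$; $Y_{jj}=x_j\partial_{y_j}-\frac12\partial_{z_j}^2$ and $Z_{jj}=y_j\partial_{x_j}+\frac12z_j^2$.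 These commute with $D_s$. The subalgebra $\mathfrak{so}(m)$ is spanned by $\mathcal{L}_{ab}=X_{ab}-X_{ba}=(x_a\partial_{x_b}-x_b\partial_{x_a})+(y_a\partial_{y_b}-y_b\partial_{y_a})+(z_a\partial_{z_b}-z_b\partial_{z_a})$. The algebra $\mathfrak{sl}_d(2)\cong\mathfrak{sl}(2)$ is spanned by $R=\langle\underline y,\underline\partial_x\rangle+\frac12|\underline z|^2$, $L=\langle\underline x,\underline\partial_y\rangle-\frac12\Delta_z$ and $\mathcal{E}=\mathbb{E}_y-\mathbb{E}_x+\mathbb{E}_z+\frac m2$, in the roles of $X,Y,H$ with $[X,Y]=H$, $[H,X]=2X$, $[H,Y]=-2Y$. It commutes with $\mathfrak{so}(m)$ and with $D_s$. $\mathbb{V}^\infty_\lambda$ is the lowest weight Verma module for $\mathfrak{sl}(2)$: it has basis $\{X^nv: n\in\mathbb{N}\}$ with $Yv=0$, $Hv=\lambda v$. The symbols $(a)$ and $(a,1)$ denote the irreducible $\mathfrak{so}(m)$-modules with highest weights $(a,0,\dots,0)$ and $(a,1,0,\dots,0)$. *)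

theory Defs
  imports Complex_Main "HOL-Library.Poly_Mapping" "Jordan_Normal_Form.Matrix"
begin

section \<open>Complex vector spaces\<close>

text \<open>
  All vector spaces are subspaces of spaces of finitely supported functions
  \<open>'k \<Rightarrow>\<^sub>0 complex\<close>.  After a choice of basis every complex vector space has this form.
\<close>

definition cscale :: "complex \<Rightarrow> ('k \<Rightarrow>\<^sub>0 complex) \<Rightarrow> ('k \<Rightarrow>\<^sub>0 complex)" where
  "cscale c f = Poly_Mapping.map (\<lambda>u. c * u) f"

lemma lookup_cscale [simp]: "Poly_Mapping.lookup (cscale c f) k = c * Poly_Mapping.lookup f k"
  unfolding cscale_def by transfer (simp add: when_def)

interpretation cv: vector_space cscale
  by unfold_locales (auto intro!: poly_mapping_eqI simp: lookup_add algebra_simps)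

definition basis_of :: "('k \<Rightarrow>\<^sub>0 complex) set \<Rightarrow> ('k \<Rightarrow>\<^sub>0 complex) set \<Rightarrow> bool" where
  "basis_of B V \<longleftrightarrow> cv.independent B \<and> cv.span B = V"

definition linear_map_on ::
  "('k \<Rightarrow>\<^sub>0 complex) set \<Rightarrow> (('k \<Rightarrow>\<^sub>0 complex) \<Rightarrow> ('l \<Rightarrow>\<^sub>0 complex)) \<Rightarrow> bool" where
  "linear_map_on V f \<longleftrightarrow>
     (\<forall>u\<in>V. \<forall>v\<in>V. f (u + v) = f u + f v) \<and> (\<forall>c. \<forall>v\<in>V. f (cscale c v) = cscale c (f v))"

definition bilinear_map_on ::
  "('k \<Rightarrow>\<^sub>0 complex) set \<Rightarrow> ('l \<Rightarrow>\<^sub>0 complex) set \<Rightarrow>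
   (('k \<Rightarrow>\<^sub>0 complex) \<Rightarrow> ('l \<Rightarrow>\<^sub>0 complex) \<Rightarrow> ('t \<Rightarrow>\<^sub>0 complex)) \<Rightarrow> bool" where
  "bilinear_map_on M N \<tau> \<longleftrightarrow>
     (\<forall>n\<in>N. linear_map_on M (\<lambda>u. \<tau> u n)) \<and> (\<forall>u\<in>M. linear_map_on N (\<tau> u))"

text \<open>
  \<open>T\<close> is the tensor product of \<open>M\<close> and \<open>N\<close>, where \<open>\<tau> u n\<close> plays the role of the pure tensor
  of \<open>u\<close> and \<open>n\<close>: the pure tensors of basis vectors form a basis of \<open>T\<close>.  The lemmas
  below show that this gives the usual universal property.
\<close>

definition tensor_product ::
  "('k \<Rightarrow>\<^sub>0 complex) set \<Rightarrow> ('l \<Rightarrow>\<^sub>0 complex) set \<Rightarrow> ('t \<Rightarrow>\<^sub>0 complex) set \<Rightarrow>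
   (('k \<Rightarrow>\<^sub>0 complex) \<Rightarrow> ('l \<Rightarrow>\<^sub>0 complex) \<Rightarrow> ('t \<Rightarrow>\<^sub>0 complex)) \<Rightarrow> bool" where
  "tensor_product M N T \<tau> \<longleftrightarrow> bilinear_map_on M N \<tau> \<and>
     (\<exists>B C. basis_of B M \<and> basis_of C N \<and>
        inj_on (\<lambda>(b, c). \<tau> b c) (B \<times> C) \<and> basis_of ((\<lambda>(b, c). \<tau> b c) ` (B \<times> C)) T)"

lemma linear_map_on_eq_on_span:
  assumes "linear_map_on (cv.span B) f" "linear_map_on (cv.span B) g"
    and "\<And>b. b \<in> B \<Longrightarrow> f b = g b" and "v \<in> cv.span B"
  shows "f v = g v"
proof -
  have "v \<in> cv.span B \<and> f v = g v" using assms(4)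
  proof (induction rule: cv.span_induct_alt)
    case base
    have "f (cscale 0 0) = cscale 0 (f 0)" "g (cscale 0 0) = cscale 0 (g 0)"
      using assms(1,2) cv.span_zero unfolding linear_map_on_def by blast+
    then show ?case by (simp add: cv.span_zero)
  next
    case (step c x y)
    have 1: "x \<in> cv.span B" "cscale c x \<in> cv.span B" "y \<in> cv.span B"
      using step by (auto intro: cv.span_base cv.span_scale)
    have "f (cscale c x + y) = cscale c (f x) + f y" "g (cscale c x + y) = cscale c (g x) + g y"
      using assms(1,2) 1 unfolding linear_map_on_def by metis+
    then show ?case using step assms(3) 1 by (auto intro: cv.span_add)
  qed
  then show ?thesis by blast
qed

lemma bilinear_map_on_eq:
  assumes "bilinear_map_on M N \<alpha>" "bilinear_map_on M N \<beta>" "basis_of B M" "basis_of C N"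
    and eq: "\<And>b c. b \<in> B \<Longrightarrow> c \<in> C \<Longrightarrow> \<alpha> b c = \<beta> b c" and "u \<in> M" "n \<in> N"
  shows "\<alpha> u n = \<beta> u n"
proof -
  have M: "M = cv.span B" and N: "N = cv.span C"
    using assms(3,4) by (auto simp: basis_of_def)
  have *: "\<alpha> b n = \<beta> b n" if "b \<in> B" for b
  proof (rule linear_map_on_eq_on_span[where B = C])
    show "linear_map_on (cv.span C) (\<alpha> b)" "linear_map_on (cv.span C) (\<beta> b)"
      using assms(1,2) that cv.span_base unfolding bilinear_map_on_def M N by blast+
  qed (use eq that \<open>n \<in> N\<close> N in auto)
  show ?thesis
  proof (rule linear_map_on_eq_on_span[where B = B and f = "\<lambda>u. \<alpha> u n" and g = "\<lambda>u. \<beta> u n"])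
    show "linear_map_on (cv.span B) (\<lambda>u. \<alpha> u n)" "linear_map_on (cv.span B) (\<lambda>u. \<beta> u n)"
      using assms(1,2) \<open>n \<in> N\<close> unfolding bilinear_map_on_def M by blast+
  qed (use * \<open>u \<in> M\<close> M in auto)
qed

lemma tensor_product_universal:
  fixes \<beta> :: "('k \<Rightarrow>\<^sub>0 complex) \<Rightarrow> ('l \<Rightarrow>\<^sub>0 complex) \<Rightarrow> ('s \<Rightarrow>\<^sub>0 complex)"
    and T :: "('t \<Rightarrow>\<^sub>0 complex) set"
  assumes T: "tensor_product M N T \<tau>" and \<beta>: "bilinear_map_on M N \<beta>"
  shows "\<exists>f. linear_map_on T f \<and> (\<forall>u\<in>M. \<forall>n\<in>N. f (\<tau> u n) = \<beta> u n)"
proof -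
  obtain B C where BC: "basis_of B M" "basis_of C N" "inj_on (\<lambda>(b, c). \<tau> b c) (B \<times> C)"
      "basis_of ((\<lambda>(b, c). \<tau> b c) ` (B \<times> C)) T" and \<tau>: "bilinear_map_on M N \<tau>"
    using T unfolding tensor_product_def by blast
  interpret P: vector_space_pair "cscale :: complex \<Rightarrow> ('t \<Rightarrow>\<^sub>0 complex) \<Rightarrow> _"
      "cscale :: complex \<Rightarrow> ('s \<Rightarrow>\<^sub>0 complex) \<Rightarrow> _" ..
  define h where "h = the_inv_into (B \<times> C) (\<lambda>(b, c). \<tau> b c)"
  obtain f where f: "Vector_Spaces.linear cscale cscale f"
      "\<forall>x\<in>(\<lambda>(b, c). \<tau> b c) ` (B \<times> C). f x = (\<lambda>(b, c). \<beta> b c) (h x)"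
    using P.linear_independent_extend[of "(\<lambda>(b, c). \<tau> b c) ` (B \<times> C)" "\<lambda>x. (\<lambda>(b, c). \<beta> b c) (h x)"]
      BC(4) unfolding basis_of_def by blast
  interpret f: Vector_Spaces.linear cscale cscale f by (fact f)
  have fb: "f (\<tau> b c) = \<beta> b c" if "b \<in> B" "c \<in> C" for b c
    using f(2) that the_inv_into_f_f[OF BC(3), of "(b, c)"] by (auto simp: h_def)
  have "bilinear_map_on M N (\<lambda>u n. f (\<tau> u n))"
    using \<tau> unfolding bilinear_map_on_def linear_map_on_def by (simp add: f.add f.scale)
  then have "f (\<tau> u n) = \<beta> u n" if "u \<in> M" "n \<in> N" for u n
    using bilinear_map_on_eq[OF _ \<beta> BC(1,2) _ that, of "\<lambda>u n. f (\<tau> u n)"] fb by blast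
  moreover have "linear_map_on T f"
    by (simp add: linear_map_on_def f.add f.scale)
  ultimately show ?thesis by blast
qed

lemma tensor_product_unique:
  assumes T: "tensor_product M N T \<tau>" and f: "linear_map_on T f" and g: "linear_map_on T g"
    and eq: "\<And>u n. u \<in> M \<Longrightarrow> n \<in> N \<Longrightarrow> f (\<tau> u n) = g (\<tau> u n)" and "t \<in> T"
  shows "f t = g t"
proof -
  obtain B C where BC: "basis_of B M" "basis_of C N" "basis_of ((\<lambda>(b, c). \<tau> b c) ` (B \<times> C)) T"
    using T unfolding tensor_product_def by blast
  let ?D = "(\<lambda>(b, c). \<tau> b c) ` (B \<times> C)"
  have T': "T = cv.span ?D" using BC by (simp add: basis_of_def)
  show ?thesis
  proof (rule linear_map_on_eq_on_span[where B = ?D])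
    show "f x = g x" if "x \<in> ?D" for x
      using that eq BC(1,2) unfolding basis_of_def by (auto intro: cv.span_base)
  qed (use f g \<open>t \<in> T\<close> T' in auto)
qed

definition internal_direct_sum ::
  "('k \<Rightarrow>\<^sub>0 complex) set \<Rightarrow> 'i set \<Rightarrow> ('i \<Rightarrow> ('k \<Rightarrow>\<^sub>0 complex) set) \<Rightarrow> bool" where
  "internal_direct_sum V I W \<longleftrightarrow>
     (\<forall>i\<in>I. cv.subspace (W i)) \<and> V = cv.span (\<Union>i\<in>I. W i) \<and>
     (\<forall>J w. finite J \<and> J \<subseteq> I \<and> (\<forall>i\<in>J. w i \<in> W i) \<and> (\<Sum>i\<in>J. w i) = 0 \<longrightarrow> (\<forall>i\<in>J. w i = 0))"


section \<open>Lie algebras and their representations\<close>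

definition irreducible_under ::
  "(('k \<Rightarrow>\<^sub>0 complex) \<Rightarrow> ('k \<Rightarrow>\<^sub>0 complex)) set \<Rightarrow> ('k \<Rightarrow>\<^sub>0 complex) set \<Rightarrow> bool" where
  "irreducible_under Ops V \<longleftrightarrow>
     cv.subspace V \<and> V \<noteq> {0} \<and> (\<forall>F\<in>Ops. F ` V \<subseteq> V) \<and>
     (\<forall>U. cv.subspace U \<and> U \<subseteq> V \<and> (\<forall>F\<in>Ops. F ` U \<subseteq> U) \<longrightarrow> U = {0} \<or> U = V)"

record 'g lie_algebra =
  lie_carrier :: "'g set"
  lie_add :: "'g \<Rightarrow> 'g \<Rightarrow> 'g"
  lie_scale :: "complex \<Rightarrow> 'g \<Rightarrow> 'g"
  lie_bracket :: "'g \<Rightarrow> 'g \<Rightarrow> 'g"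

definition matrix_lie_algebra :: "complex mat set \<Rightarrow> complex mat lie_algebra" where
  "matrix_lie_algebra S =
     \<lparr>lie_carrier = S, lie_add = (+), lie_scale = (\<cdot>\<^sub>m), lie_bracket = (\<lambda>A B. A * B - B * A)\<rparr>"

definition so :: "nat \<Rightarrow> complex mat lie_algebra" where
  "so m = matrix_lie_algebra {A \<in> carrier_mat m m. transpose_mat A = - A}"

definition sl2 :: "complex mat lie_algebra" where
  "sl2 = matrix_lie_algebra {A \<in> carrier_mat 2 2. A $$ (0,0) + A $$ (1,1) = 0}"

definition sl2_X :: "complex mat" where "sl2_X = mat_of_rows_list 2 [[0, 1], [0, 0]]"
definition sl2_Y :: "complex mat" where "sl2_Y = mat_of_rows_list 2 [[0, 0], [1, 0]]"
definition sl2_H :: "complex mat" where "sl2_H = mat_of_rows_list 2 [[1, 0], [0, -1]]"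

definition lie_prod :: "'g lie_algebra \<Rightarrow> 'h lie_algebra \<Rightarrow> ('g \<times> 'h) lie_algebra" where
  "lie_prod g h =
     \<lparr>lie_carrier = lie_carrier g \<times> lie_carrier h,
      lie_add = (\<lambda>(A, B) (A', B'). (lie_add g A A', lie_add h B B')),
      lie_scale = (\<lambda>c (A, B). (lie_scale g c A, lie_scale h c B)),
      lie_bracket = (\<lambda>(A, B) (A', B'). (lie_bracket g A A', lie_bracket h B B'))\<rparr>"

definition representation ::
  "'g lie_algebra \<Rightarrow> ('k \<Rightarrow>\<^sub>0 complex) set \<Rightarrow> ('g \<Rightarrow> ('k \<Rightarrow>\<^sub>0 complex) \<Rightarrow> ('k \<Rightarrow>\<^sub>0 complex)) \<Rightarrow> bool"
  where
  "representation g V \<rho> \<longleftrightarrow>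
     cv.subspace V \<and>
     (\<forall>A\<in>lie_carrier g. \<rho> A ` V \<subseteq> V \<and> linear_map_on V (\<rho> A)) \<and>
     (\<forall>A\<in>lie_carrier g. \<forall>B\<in>lie_carrier g. \<forall>v\<in>V.
        \<rho> (lie_add g A B) v = \<rho> A v + \<rho> B v \<and>
        \<rho> (lie_bracket g A B) v = \<rho> A (\<rho> B v) - \<rho> B (\<rho> A v)) \<and>
     (\<forall>c. \<forall>A\<in>lie_carrier g. \<forall>v\<in>V. \<rho> (lie_scale g c A) v = cscale c (\<rho> A v))"

definition irreducible_rep ::
  "'g lie_algebra \<Rightarrow> ('k \<Rightarrow>\<^sub>0 complex) set \<Rightarrow> ('g \<Rightarrow> ('k \<Rightarrow>\<^sub>0 complex) \<Rightarrow> ('k \<Rightarrow>\<^sub>0 complex)) \<Rightarrow> bool"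
  where
  "irreducible_rep g V \<rho> \<longleftrightarrow> representation g V \<rho> \<and> irreducible_under (\<rho> ` lie_carrier g) V"

definition isomorphic_rep ::
  "'g lie_algebra \<Rightarrow> ('k \<Rightarrow>\<^sub>0 complex) set \<Rightarrow> ('g \<Rightarrow> ('k \<Rightarrow>\<^sub>0 complex) \<Rightarrow> ('k \<Rightarrow>\<^sub>0 complex)) \<Rightarrow>
   ('l \<Rightarrow>\<^sub>0 complex) set \<Rightarrow> ('g \<Rightarrow> ('l \<Rightarrow>\<^sub>0 complex) \<Rightarrow> ('l \<Rightarrow>\<^sub>0 complex)) \<Rightarrow> bool"
  where
  "isomorphic_rep g V \<rho> V' \<rho>' \<longleftrightarrow>
     (\<exists>\<phi>. linear_map_on V \<phi> \<and> bij_betw \<phi> V V' \<and>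
          (\<forall>A\<in>lie_carrier g. \<forall>v\<in>V. \<phi> (\<rho> A v) = \<rho>' A (\<phi> v)))"

text \<open>
  The representation \<open>\<pi>\<close> of the product of \<open>g\<close> and \<open>h\<close> on \<open>T\<close> is (isomorphic to) the outer
  tensor product of the representation \<open>\<rho>\<close> of \<open>g\<close> on \<open>M\<close> and \<open>\<sigma>\<close> of \<open>h\<close> on \<open>N\<close>.
\<close>

definition outer_tensor_rep ::
  "'g lie_algebra \<Rightarrow> ('k \<Rightarrow>\<^sub>0 complex) set \<Rightarrow> ('g \<Rightarrow> ('k \<Rightarrow>\<^sub>0 complex) \<Rightarrow> ('k \<Rightarrow>\<^sub>0 complex)) \<Rightarrow>
   'h lie_algebra \<Rightarrow> ('l \<Rightarrow>\<^sub>0 complex) set \<Rightarrow> ('h \<Rightarrow> ('l \<Rightarrow>\<^sub>0 complex) \<Rightarrow> ('l \<Rightarrow>\<^sub>0 complex)) \<Rightarrow>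
   ('t \<Rightarrow>\<^sub>0 complex) set \<Rightarrow> ('g \<times> 'h \<Rightarrow> ('t \<Rightarrow>\<^sub>0 complex) \<Rightarrow> ('t \<Rightarrow>\<^sub>0 complex)) \<Rightarrow> bool"
  where
  "outer_tensor_rep g M \<rho> h N \<sigma> T \<pi> \<longleftrightarrow>
     (\<exists>\<tau>. tensor_product M N T \<tau> \<and>
        (\<forall>A\<in>lie_carrier g. \<forall>B\<in>lie_carrier h. \<forall>u\<in>M. \<forall>n\<in>N.
           \<pi> (A, B) (\<tau> u n) = \<tau> (\<rho> A u) n + \<tau> u (\<sigma> B n)))"

text \<open>
  The standard Cartan subalgebra of \<open>so m\<close>: \<open>so_cartan m j\<close> acts on the plane spanned by the
  unit vectors \<open>e\<close> with indices \<open>2j\<close> and \<open>2j + 1\<close> and has eigenvalue 1 on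
  \<open>e\<^bsub>2j\<^esub> + \<i> e\<^bsub>2j+1\<^esub>\<close>.  Weights are given by their values on these elements.
\<close>

definition so_cartan :: "nat \<Rightarrow> nat \<Rightarrow> complex mat" where
  "so_cartan m j = mat m m (\<lambda>(a, b). if a = 2*j \<and> b = 2*j + 1 then - \<i>
                                     else if a = 2*j + 1 \<and> b = 2*j then \<i> else 0)"

definition so_root_vector :: "nat \<Rightarrow> (nat \<Rightarrow> int) \<Rightarrow> complex mat \<Rightarrow> bool" where
  "so_root_vector m \<alpha> A \<longleftrightarrow> A \<in> lie_carrier (so m) \<and>
     (\<forall>j < m div 2. lie_bracket (so m) (so_cartan m j) A = of_int (\<alpha> j) \<cdot>\<^sub>m A)"

text \<open>
  The lexicographically positive roots are the usual ones: \<open>\<epsilon>\<^sub>i \<plusminus> \<epsilon>\<^sub>j\<close> for \<open>i < j\<close> and, if \<open>m\<close> is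
  odd, also \<open>\<epsilon>\<^sub>i\<close>.
\<close>

definition so_positive :: "nat \<Rightarrow> (nat \<Rightarrow> int) \<Rightarrow> bool" where
  "so_positive m \<alpha> \<longleftrightarrow> (\<exists>j < m div 2. \<alpha> j > 0 \<and> (\<forall>i<j. \<alpha> i = 0))"

definition so_highest_weight_vector ::
  "nat \<Rightarrow> (complex mat \<Rightarrow> ('k \<Rightarrow>\<^sub>0 complex) \<Rightarrow> ('k \<Rightarrow>\<^sub>0 complex)) \<Rightarrow> (nat \<Rightarrow> int) \<Rightarrow> ('k \<Rightarrow>\<^sub>0 complex) \<Rightarrow> bool"
  where
  "so_highest_weight_vector m \<rho> \<mu> v \<longleftrightarrow> v \<noteq> 0 \<and>
     (\<forall>j < m div 2. \<rho> (so_cartan m j) v = cscale (of_int (\<mu> j)) v) \<and>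
     (\<forall>\<alpha> A. so_positive m \<alpha> \<and> so_root_vector m \<alpha> A \<longrightarrow> \<rho> A v = 0)"

definition so_irrep ::
  "nat \<Rightarrow> (nat \<Rightarrow> int) \<Rightarrow> ('k \<Rightarrow>\<^sub>0 complex) set \<Rightarrow>
   (complex mat \<Rightarrow> ('k \<Rightarrow>\<^sub>0 complex) \<Rightarrow> ('k \<Rightarrow>\<^sub>0 complex)) \<Rightarrow> bool"
  where
  "so_irrep m \<mu> M \<rho> \<longleftrightarrow>
     irreducible_rep (so m) M \<rho> \<and> (\<exists>v\<in>M. so_highest_weight_vector m \<rho> \<mu> v)"

definition two_row_weight :: "nat \<Rightarrow> nat \<Rightarrow> nat \<Rightarrow> int" where
  "two_row_weight a b j = (if j = 0 then int a else if j = 1 then int b else 0)"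

definition lowest_weight_verma ::
  "complex \<Rightarrow> ('k \<Rightarrow>\<^sub>0 complex) set \<Rightarrow> (complex mat \<Rightarrow> ('k \<Rightarrow>\<^sub>0 complex) \<Rightarrow> ('k \<Rightarrow>\<^sub>0 complex)) \<Rightarrow> bool"
  where
  "lowest_weight_verma c N \<sigma> \<longleftrightarrow>
     representation sl2 N \<sigma> \<and>
     (\<exists>v\<in>N. \<sigma> sl2_Y v = 0 \<and> \<sigma> sl2_H v = cscale c v \<and>
        inj (\<lambda>n. (\<sigma> sl2_X ^^ n) v) \<and> basis_of (range (\<lambda>n. (\<sigma> sl2_X ^^ n) v)) N)"


section \<open>Polynomials in three vector variables\<close>

text \<open>Coordinates are numbered from 0, so the coordinates of vectors of dimension \<open>m\<close> are \<open>j < m\<close>.\<close>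

datatype var = VX nat | VY nat | VZ nat

fun var_index :: "var \<Rightarrow> nat" where
  "var_index (VX j) = j" | "var_index (VY j) = j" | "var_index (VZ j) = j"

type_synonym cpoly = "(var \<Rightarrow>\<^sub>0 nat) \<Rightarrow>\<^sub>0 complex"

definition polys :: "nat \<Rightarrow> cpoly set" where
  "polys m = {f. \<forall>t\<in>Poly_Mapping.keys f. \<forall>v\<in>Poly_Mapping.keys t. var_index v < m}"

definition xy_degree :: "nat \<Rightarrow> (var \<Rightarrow>\<^sub>0 nat) \<Rightarrow> nat" where
  "xy_degree m t = (\<Sum>j<m. Poly_Mapping.lookup t (VX j) + Poly_Mapping.lookup t (VY j))"

definition z_degree :: "nat \<Rightarrow> (var \<Rightarrow>\<^sub>0 nat) \<Rightarrow> nat" where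
  "z_degree m t = (\<Sum>j<m. Poly_Mapping.lookup t (VZ j))"

definition mult_var :: "var \<Rightarrow> cpoly \<Rightarrow> cpoly" where
  "mult_var v f = Poly_Mapping.single (Poly_Mapping.single v 1) 1 * f"

definition partial :: "var \<Rightarrow> cpoly \<Rightarrow> cpoly" where
  "partial v f = (\<Sum>t\<in>Poly_Mapping.keys f.
     Poly_Mapping.single (t - Poly_Mapping.single v 1) (of_nat (Poly_Mapping.lookup t v) * Poly_Mapping.lookup f t))"

abbreviation "mx j \<equiv> mult_var (VX j)"
abbreviation "my j \<equiv> mult_var (VY j)"
abbreviation "mz j \<equiv> mult_var (VZ j)"
abbreviation "dx j \<equiv> partial (VX j)"
abbreviation "dy j \<equiv> partial (VY j)"
abbreviation "dz j \<equiv> partial (VZ j)"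

definition D_s :: "nat \<Rightarrow> cpoly \<Rightarrow> cpoly" where
  "D_s m f = (\<Sum>j<m. mz j (dy j f)) - (\<Sum>j<m. dx j (dz j f))"

definition symplectic_monogenics :: "nat \<Rightarrow> nat \<Rightarrow> cpoly set" where
  "symplectic_monogenics m k = {f \<in> polys m. (\<forall>t\<in>Poly_Mapping.keys f. xy_degree m t = k) \<and> D_s m f = 0}"

definition even_spinors :: "nat \<Rightarrow> cpoly set" where
  "even_spinors m = {f. \<forall>t\<in>Poly_Mapping.keys f. even (z_degree m t)}"

definition odd_spinors :: "nat \<Rightarrow> cpoly set" where
  "odd_spinors m = {f. \<forall>t\<in>Poly_Mapping.keys f. odd (z_degree m t)}"

subsection \<open>The action of the symplectic Lie algebra\<close>

definition sp_X :: "nat \<Rightarrow> nat \<Rightarrow> cpoly \<Rightarrow> cpoly" where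
  "sp_X j k f = mx j (dx k f) - my k (dy j f) - (mz k (dz j f) + (if j = k then cscale (1/2) f else 0))"

definition sp_Y :: "nat \<Rightarrow> nat \<Rightarrow> cpoly \<Rightarrow> cpoly" where
  "sp_Y j k f =
     (if j = k then mx j (dy j f) - cscale (1/2) (dz j (dz j f))
      else mx j (dy k f) + mx k (dy j f) - dz j (dz k f))"

definition sp_Z :: "nat \<Rightarrow> nat \<Rightarrow> cpoly \<Rightarrow> cpoly" where
  "sp_Z j k f =
     (if j = k then my j (dx j f) + cscale (1/2) (mz j (mz j f))
      else my j (dx k f) + my k (dx j f) + mz j (mz k f))"

text \<open>These operators span the action of \<open>sp(2m)\<close>.\<close>

definition sp_operators :: "nat \<Rightarrow> (cpoly \<Rightarrow> cpoly) set" where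
  "sp_operators m = {sp_X j k | j k. j < m \<and> k < m} \<union>
     {sp_Y j k | j k. j \<le> k \<and> k < m} \<union> {sp_Z j k | j k. j \<le> k \<and> k < m}"

subsection \<open>The actions of \<open>so m\<close> and \<open>sl2\<close>\<close>

definition so_L :: "nat \<Rightarrow> nat \<Rightarrow> cpoly \<Rightarrow> cpoly" where
  "so_L a b f = sp_X a b f - sp_X b a f"

lemma so_L_eq:
  "so_L a b f = (mx a (dx b f) - mx b (dx a f)) + (my a (dy b f) - my b (dy a f))
              + (mz a (dz b f) - mz b (dz a f))"
  by (simp add: so_L_def sp_X_def)

text \<open>
  A skew-symmetric matrix is the combination of the matrices \<open>E\<^bsub>ab\<^esub> - E\<^bsub>ba\<^esub>\<close>, \<open>a < b\<close>, with its
  upper triangular entries as coefficients; \<open>E\<^bsub>ab\<^esub> - E\<^bsub>ba\<^esub>\<close> acts by \<open>so_L a b\<close>.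
\<close>

definition so_action :: "nat \<Rightarrow> complex mat \<Rightarrow> cpoly \<Rightarrow> cpoly" where
  "so_action m A f = (\<Sum>b<m. \<Sum>a<b. cscale (A $$ (a, b)) (so_L a b f))"

definition sl2_raise :: "nat \<Rightarrow> cpoly \<Rightarrow> cpoly" where
  "sl2_raise m f = (\<Sum>j<m. my j (dx j f)) + cscale (1/2) (\<Sum>j<m. mz j (mz j f))"

definition sl2_lower :: "nat \<Rightarrow> cpoly \<Rightarrow> cpoly" where
  "sl2_lower m f = (\<Sum>j<m. mx j (dy j f)) - cscale (1/2) (\<Sum>j<m. dz j (dz j f))"

definition sl2_euler :: "nat \<Rightarrow> cpoly \<Rightarrow> cpoly" where
  "sl2_euler m f = (\<Sum>j<m. my j (dy j f)) - (\<Sum>j<m. mx j (dx j f)) + (\<Sum>j<m. mz j (dz j f))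
                 + cscale (of_nat m / 2) f"

definition sl2_action :: "nat \<Rightarrow> complex mat \<Rightarrow> cpoly \<Rightarrow> cpoly" where
  "sl2_action m B f =
     cscale (B $$ (0,1)) (sl2_raise m f) + cscale (B $$ (1,0)) (sl2_lower m f)
     + cscale (B $$ (0,0)) (sl2_euler m f)"

definition so_sl2_action :: "nat \<Rightarrow> complex mat \<times> complex mat \<Rightarrow> cpoly \<Rightarrow> cpoly" where
  "so_sl2_action m = (\<lambda>(A, B) f. so_action m A f + sl2_action m B f)"

subsection \<open>The index set of the decomposition\<close>

text \<open>
  The triple \<open>(a, b, s)\<close> stands for the tensor product of the irreducible \<open>so m\<close>-module of highest
  weight \<open>(a, b, 0, \<dots>, 0)\<close> with the lowest weight Verma module of lowest weight \<open>m/2 + s\<close>.  The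
  five families are pairwise disjoint.
\<close>

definition branching_index :: "(nat \<times> nat \<times> int) set" where
  "branching_index =
     {(a, 0, int a - 2) | a. a \<ge> 1} \<union>
     {(a, 1, int a - 1) | a. a \<ge> 1} \<union>
     {(a, 0, int a) | a. a \<ge> 1} \<union>
     {(a, 1, int a + 1) | a. a \<ge> 1} \<union>
     {(a, 0, int a + 2) | a. a \<ge> 0}"

end

theory Submission
  imports Defs
begin

text \<open>
  An element of \<open>\<S>\<^sub>1\<close> has the form \<open>\<Sum>\<^sub>i x\<^sub>i F\<^sub>i(z) + \<Sum>\<^sub>i y\<^sub>i G\<^sub>i(z)\<close>.  The lowering operator \<open>L\<close> is locally
  nilpotent on this space, and it is surjective on every lowest weight module whose weights do not
  vanish, so it suffices to determine the kernel of \<open>L\<close>.  An element of the kernel that does not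
  involve \<open>y\<close> is a divergence-free vector of harmonic polynomials in \<open>z\<close>; after subtraction of a
  gradient of a harmonic polynomial it is also orthogonal to \<open>z\<close>, which gives the first two
  families.  A general element \<open>f\<close> of the kernel is determined modulo these by
  \<open>\<langle>x, \<partial>\<^sub>y\<rangle> f\<close>, again a vector of harmonic polynomials, whose three components give the other
  three families.  The Casimir operators of \<open>so(m)\<close> and \<open>sl(2)\<close> separate the five
  families, so the sum is direct and its summands are pairwise non-isomorphic.

  For \<open>sp(2m)\<close>, every nonzero invariant subspace contains a vector killed by all \<open>Y\<^sub>j\<^sub>k\<close>, and from
  it a fixed vector \<open>k\<close>.  Let \<open>J\<close> change the sign of \<open>y\<close>.  With respect to the form
  \<open>\<langle>J f, g\<rangle>\<close> built from the Fischer inner product, \<open>X\<^sub>j\<^sub>k\<close> is adjoint to \<open>X\<^sub>k\<^sub>j\<close> and \<open>Y\<^sub>j\<^sub>k\<close> to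
  \<open>- Z\<^sub>j\<^sub>k\<close>, so the orthogonal complement of a proper invariant subspace would be a second one, and
  \<open>k\<close> would be orthogonal to \<open>J k = k\<close>.
\<close>

section \<open>Calculus of polynomials\<close>

text \<open>The operators of sl(2) and \<open>D_s\<close> commute with so(m) and are built from
  polarizations, mixed Laplacians and quadratic forms in three vectors, so their relations reduce to
  commutators of these. The modules (a) and (a,1) are shown to be irreducible without weight theory.
  A nonzero invariant subspace contains a vector killed by the commuting raising operators of one
  isotropic line. In (a) this vector is unique up to scalars; in (a,1) the killed vectors form the
  vector representation of so(m-2), whose rotations lead to a fixed vector. Since so(m) is skew for
  the Fischer product, the orthogonal complement of a proper submodule would contain the same
  vector. Every weight m/2 + s is positive because s >= -1 and m >= 6. Hence L does not kill R^k v
  for k >= 1 and a lowest weight vector v, and the five families can share one locale. Positivity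
  also makes the sl(2) Casimir determine s: its other solution s' has s + s' = 2 - m. With s known,
  the so(m) Casimir determines a and b. The symplectic modules are infinite-dimensional, so
  orthogonal projection is carried out inside a single weight space of the Euler operator.\<close>

definition Var :: "var \<Rightarrow> cpoly" where
  "Var v = Poly_Mapping.single (Poly_Mapping.single v 1) 1"

definition Cst :: "complex \<Rightarrow> cpoly" where
  "Cst c = Poly_Mapping.single 0 c"

lemma mult_var_eq: "mult_var v f = Var v * f"
  by (simp add: mult_var_def Var_def)

lemma cscale_eq: "cscale c f = Cst c * f"
  unfolding cscale_def Cst_def by (rule mult_map_scale_conv_mult)

lemma cscale_mult_left: "cscale c f * g = cscale c (f * g)" for f g :: cpoly
  by (simp add: cscale_eq mult.assoc)

lemma cscale_mult_right: "f * cscale c g = cscale c (f * g)" for f g :: cpoly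
  by (simp add: cscale_eq mult.left_commute)

lemma cscale_of_nat: "cscale (of_nat n) f = of_nat n * f" for f :: cpoly
  by (simp add: cscale_eq Cst_def)

lemma poly_mapping_add_induct [case_names zero single add]:
  fixes f :: "'a \<Rightarrow>\<^sub>0 'b::monoid_add"
  assumes "P 0" "\<And>t a. P (Poly_Mapping.single t a)" "\<And>f g. P f \<Longrightarrow> P g \<Longrightarrow> P (f + g)"
  shows "P f"
proof (induction f rule: update_induct)
  case const
  then show ?case using assms(1) by simp
next
  case (update f a b)
  have "Poly_Mapping.update a b f = f + Poly_Mapping.single a b"
    using update(1) by (intro poly_mapping_eqI)
      (auto simp: lookup_update lookup_add lookup_single in_keys_iff when_def)
  then show ?case using update assms by simp
qed

text \<open>This coefficient formula turns most identities between operators into comparisons of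
  coefficients.\<close>

lemma lookup_partial:
  "Poly_Mapping.lookup (partial v f) t =
     of_nat (Poly_Mapping.lookup t v + 1) * Poly_Mapping.lookup f (t + Poly_Mapping.single v 1)"
proof -
  let ?e = "Poly_Mapping.single v (1::nat)"
  \<comment> \<open>Subtraction of exponents truncates, so \<open>s - ?e = t\<close> also holds for
    \<open>s = t\<close> if \<open>v\<close> does not occur in \<open>t\<close>. Such monomials
    carry the factor 0, hence the second conjunct.\<close>
  have *: "s - ?e = t \<and> Poly_Mapping.lookup s v \<noteq> 0 \<longleftrightarrow> s = t + ?e" for s
  proof
    assume a: "s - ?e = t \<and> Poly_Mapping.lookup s v \<noteq> 0"
    then have t: "t = s - ?e" by simp
    show "s = t + ?e" unfolding t
    proof (rule poly_mapping_eqI)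
      fix k
      show "Poly_Mapping.lookup s k = Poly_Mapping.lookup (s - ?e + ?e) k"
        using conjunct2[OF a] by (cases "k = v") (simp_all add: lookup_add lookup_minus lookup_single)
    qed
  next
    assume "s = t + ?e"
    then show "s - ?e = t \<and> Poly_Mapping.lookup s v \<noteq> 0"
      by (simp add: lookup_add)
  qed
  have "Poly_Mapping.lookup (partial v f) t = (\<Sum>s\<in>Poly_Mapping.keys f.
      (of_nat (Poly_Mapping.lookup s v) * Poly_Mapping.lookup f s when s - ?e = t))"
    unfolding partial_def by (simp add: lookup_sum lookup_single)
  also have "\<dots> = (\<Sum>s\<in>Poly_Mapping.keys f. if s = t + ?e then
      of_nat (Poly_Mapping.lookup s v) * Poly_Mapping.lookup f s else 0)"
  proof (intro sum.cong refl)
    fix s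
    show "(of_nat (Poly_Mapping.lookup s v) * Poly_Mapping.lookup f s when s - ?e = t)
        = (if s = t + ?e then of_nat (Poly_Mapping.lookup s v) * Poly_Mapping.lookup f s else 0)"
      using *[of s] by (cases "Poly_Mapping.lookup s v = 0") (simp_all add: when_def)
  qed
  also have "\<dots> = of_nat (Poly_Mapping.lookup t v + 1) * Poly_Mapping.lookup f (t + ?e)"
    by (simp add: lookup_add in_keys_iff del: One_nat_def)
  finally show ?thesis .
qed

lemma lookup_Var_mult:
  "Poly_Mapping.lookup (Var v * f) t =
     (if Poly_Mapping.lookup t v = 0 then 0 else Poly_Mapping.lookup f (t - Poly_Mapping.single v 1))"
proof (induction f rule: poly_mapping_add_induct)
  case (single s a)
  let ?e = "Poly_Mapping.single v (1::nat)"
  have *: "?e + s = t \<longleftrightarrow> Poly_Mapping.lookup t v \<noteq> 0 \<and> s = t - ?e"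
  proof
    assume a: "Poly_Mapping.lookup t v \<noteq> 0 \<and> s = t - ?e"
    show "?e + s = t"
    proof (rule poly_mapping_eqI)
      fix k
      show "Poly_Mapping.lookup (?e + s) k = Poly_Mapping.lookup t k"
        using a by (cases "k = v") (auto simp: lookup_add lookup_minus lookup_single when_def)
    qed
  qed (auto simp: lookup_add)
  show ?case using * by (auto simp: Var_def mult_single lookup_single when_def)
qed (auto simp: algebra_simps lookup_add)

lemma lookup_Var_partial:
  "Poly_Mapping.lookup (Var v * partial v f) t = of_nat (Poly_Mapping.lookup t v) * Poly_Mapping.lookup f t"
proof (cases "Poly_Mapping.lookup t v = 0")
  case False
  have "t - Poly_Mapping.single v 1 + Poly_Mapping.single v 1 = t"
  proof (rule poly_mapping_eqI)
    fix k
    show "Poly_Mapping.lookup (t - Poly_Mapping.single v 1 + Poly_Mapping.single v 1) k = Poly_Mapping.lookup t k"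
      using False by (cases "k = v") (auto simp: lookup_add lookup_minus lookup_single when_def)
  qed
  moreover have "Poly_Mapping.lookup (t - Poly_Mapping.single v 1) v + 1 = Poly_Mapping.lookup t v"
    using False by (simp add: lookup_minus)
  ultimately show ?thesis using False by (simp only: lookup_Var_mult lookup_partial if_False)
qed (simp add: lookup_Var_mult)

lemma partial_add [simp]: "partial v (f + g) = partial v f + partial v g"
  by (intro poly_mapping_eqI) (simp add: lookup_partial lookup_add algebra_simps)

lemma partial_cscale: "partial v (cscale c f) = cscale c (partial v f)"
  by (intro poly_mapping_eqI) (simp add: lookup_partial algebra_simps)

lemma partial_commute: "partial v (partial w f) = partial w (partial v f)"
proof (cases "v = w")
  case False
  then show ?thesis
    by (intro poly_mapping_eqI) (simp add: lookup_partial lookup_add lookup_single add.assoc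
        add.commute[of "Poly_Mapping.single v (Suc 0)" "Poly_Mapping.single w (Suc 0)"])
qed simp

lemma partial_Cst [simp]: "partial v (Cst c) = 0"
proof (rule poly_mapping_eqI)
  fix t
  have "t + Poly_Mapping.single v (1::nat) \<noteq> 0"
  proof
    assume "t + Poly_Mapping.single v (1::nat) = 0"
    then have "Poly_Mapping.lookup (t + Poly_Mapping.single v (1::nat)) v = 0" by simp
    then show False by (simp add: lookup_add)
  qed
  then have "Poly_Mapping.lookup (Cst c) (t + Poly_Mapping.single v 1) = 0"
    by (metis Cst_def lookup_single_not_eq)
  then show "Poly_Mapping.lookup (partial v (Cst c)) t = Poly_Mapping.lookup 0 t"
    by (simp only: lookup_partial mult_zero_right lookup_zero)
qed

lemma partial_Var [simp]: "partial v (Var w) = (if v = w then 1 else 0)"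
proof (rule poly_mapping_eqI)
  fix t
  have "Poly_Mapping.single w (1::nat) = t + Poly_Mapping.single v 1 \<longleftrightarrow> v = w \<and> t = 0"
  proof
    assume a: "Poly_Mapping.single w (1::nat) = t + Poly_Mapping.single v 1"
    then have "Poly_Mapping.lookup (Poly_Mapping.single w (1::nat)) v
        = Poly_Mapping.lookup (t + Poly_Mapping.single v 1) v" by (rule arg_cong)
    then have vw: "v = w"
      by (cases "w = v") (simp_all only: lookup_add lookup_single when_def if_True if_False refl)
    moreover have "t = 0"
      using a unfolding vw by (metis add_cancel_left_left)
    ultimately show "v = w \<and> t = 0" ..
  qed auto
  then have *: "Poly_Mapping.lookup (Var w) (t + Poly_Mapping.single v 1) = (1 when v = w \<and> t = 0)"
    by (simp only: Var_def lookup_single)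
  show "Poly_Mapping.lookup (partial v (Var w)) t = Poly_Mapping.lookup (if v = w then 1 else 0) t"
    unfolding lookup_partial * by (auto simp: lookup_one when_def)
qed

lemma partial_Var_mult: "partial v (Var w * f) = Var w * partial v f + (if v = w then f else 0)"
proof (rule poly_mapping_eqI)
  fix t
  let ?e = "\<lambda>v. Poly_Mapping.single v (1::nat)"
  show "Poly_Mapping.lookup (partial v (Var w * f)) t
     = Poly_Mapping.lookup (Var w * partial v f + (if v = w then f else 0)) t"
  proof (cases "v = w")
    case True
    have "Poly_Mapping.lookup (partial v (Var w * f)) t
        = of_nat (Poly_Mapping.lookup t v + 1) * Poly_Mapping.lookup f t"
      using True by (simp add: lookup_partial lookup_Var_mult lookup_add)
    also have "\<dots> = Poly_Mapping.lookup (Var w * partial v f + f) t"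
      using True lookup_Var_partial[of v f t] by (simp add: lookup_add algebra_simps)
    finally show ?thesis using True by simp
  next
    case False
    have "t + ?e v - ?e w = t - ?e w + ?e v" if "Poly_Mapping.lookup t w \<noteq> 0"
    proof (rule poly_mapping_eqI)
      fix k
      show "Poly_Mapping.lookup (t + ?e v - ?e w) k = Poly_Mapping.lookup (t - ?e w + ?e v) k"
        using that by (auto simp: lookup_add lookup_minus lookup_single when_def)
    qed
    then show ?thesis using False
      by (simp add: lookup_partial lookup_Var_mult lookup_add lookup_minus lookup_single when_def)
  qed
qed

lemma single_add_Var:
  "Poly_Mapping.single (Poly_Mapping.single v 1 + t) a = Var v * Poly_Mapping.single t a"
  by (simp add: Var_def mult_single)

text \<open>The variables generate the polynomial ring over the constants; this is the induction
  that matches the Leibniz rule.\<close>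

lemma cpoly_mult_induct [case_names const Var add]:
  assumes const: "\<And>c. P (Cst c)" and Var: "\<And>v f. P f \<Longrightarrow> P (Var v * f)"
    and add: "\<And>f g. P f \<Longrightarrow> P g \<Longrightarrow> P (f + g)"
  shows "P (f :: cpoly)"
proof (induction f rule: poly_mapping_add_induct)
  case zero
  show ?case using const[of 0] by (simp add: Cst_def)
next
  case (single t a)
  have "P f \<Longrightarrow> P (Poly_Mapping.single t 1 * f)" for f
  proof (induction t arbitrary: f rule: poly_mapping_add_induct)
    case (single v n)
    then show ?case
    proof (induction n)
      case (Suc n)
      have "Poly_Mapping.single (Poly_Mapping.single v (Suc n)) 1
          = Var v * (Poly_Mapping.single (Poly_Mapping.single v n) 1 :: cpoly)"
        by (simp only: single_add_Var [symmetric] single_add [symmetric]) simp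
      then show ?case using Var Suc by (simp add: mult.assoc)
    qed simp
  next
    case (add s t)
    have "Poly_Mapping.single (s + t) 1 = (Poly_Mapping.single s 1 :: cpoly) * Poly_Mapping.single t 1"
      by (simp add: mult_single)
    then show ?case using add by (simp add: mult.assoc)
  qed simp
  from this[OF const[of a]] show ?case by (simp add: Cst_def mult_single)
qed (rule add)

section \<open>Derivations and complex linear operators\<close>

definition derivation :: "(cpoly \<Rightarrow> cpoly) \<Rightarrow> bool" where
  "derivation \<delta> \<longleftrightarrow> (\<forall>f g. \<delta> (f + g) = \<delta> f + \<delta> g) \<and> (\<forall>f g. \<delta> (f * g) = \<delta> f * g + f * \<delta> g)
     \<and> (\<forall>c. \<delta> (Cst c) = 0)"

lemma derivationD:
  assumes "derivation \<delta>"
  shows "\<delta> (f + g) = \<delta> f + \<delta> g" "\<delta> (f * g) = \<delta> f * g + f * \<delta> g" "\<delta> (Cst c) = 0"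
  using assms by (auto simp: derivation_def)

text \<open>Commutators of derivations are derivations, so a commutation relation between first
  order operators only has to be checked on variables. This is how the relations of gl(3) and so(m)
  are proved below.\<close>

lemma derivation_eqI:
  assumes \<delta>: "derivation \<delta>" and \<epsilon>: "derivation \<epsilon>" and "\<And>v. \<delta> (Var v) = \<epsilon> (Var v)"
  shows "\<delta> f = \<epsilon> f"
  by (induction f rule: cpoly_mult_induct) (simp_all add: derivationD[OF \<delta>] derivationD[OF \<epsilon>] assms(3))

abbreviation linear_op :: "(('k \<Rightarrow>\<^sub>0 complex) \<Rightarrow> ('l \<Rightarrow>\<^sub>0 complex)) \<Rightarrow> bool" where
  "linear_op F \<equiv> Vector_Spaces.linear cscale cscale F"

lemma linear_opI:
  assumes "\<And>f g. F (f + g) = F f + F g" "\<And>c f. F (cscale c f) = cscale c (F f)"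
  shows "linear_op F"
  by unfold_locales (use assms in \<open>auto intro!: poly_mapping_eqI simp: lookup_add algebra_simps\<close>)

lemma linear_opD:
  assumes "linear_op F"
  shows "F (f + g) = F f + F g" "F (cscale c f) = cscale c (F f)" "F 0 = 0" "F (- f) = - F f"
    "F (f - g) = F f - F g" "F (sum h I) = (\<Sum>i\<in>I. F (h i))"
proof -
  interpret Vector_Spaces.linear cscale cscale F by fact
  show "F (f + g) = F f + F g" "F (cscale c f) = cscale c (F f)" "F 0 = 0" "F (- f) = - F f"
    "F (f - g) = F f - F g" "F (sum h I) = (\<Sum>i\<in>I. F (h i))"
    by (rule add scale zero neg diff sum)+
qed

lemma derivation_linear: "derivation \<delta> \<Longrightarrow> linear_op \<delta>"
  by (intro linear_opI) (simp_all add: derivationD cscale_eq)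

lemma linear_op_partial: "linear_op (partial v)"
  by (intro linear_opI partial_add partial_cscale)

lemmas partial_linear [simp] = linear_opD(3-6)[OF linear_op_partial]

lemma partial_mult: "partial v (f * g) = partial v f * g + f * partial v g"
proof (induction f rule: cpoly_mult_induct)
  case (const c)
  then show ?case by (simp add: partial_cscale flip: cscale_eq)
next
  case (Var w f)
  then show ?case by (simp add: mult.assoc partial_Var_mult distrib_left distrib_right add_ac)
qed (simp add: algebra_simps)

lemma derivation_partial: "derivation (partial v)"
  by (simp add: derivation_def partial_mult)

lemma derivation_zero: "derivation (\<lambda>f. 0)"
  by (simp add: derivation_def)

lemma derivation_mult_left: "derivation \<delta> \<Longrightarrow> derivation (\<lambda>f. g * \<delta> f)"
  by (simp add: derivation_def algebra_simps)

lemma derivation_cscale: "derivation \<delta> \<Longrightarrow> derivation (\<lambda>f. cscale c (\<delta> f))"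
  by (simp add: cscale_eq derivation_mult_left)

lemma derivation_add: "derivation \<delta> \<Longrightarrow> derivation \<epsilon> \<Longrightarrow> derivation (\<lambda>f. \<delta> f + \<epsilon> f)"
  by (simp add: derivation_def algebra_simps)

lemma derivation_diff: "derivation \<delta> \<Longrightarrow> derivation \<epsilon> \<Longrightarrow> derivation (\<lambda>f. \<delta> f - \<epsilon> f)"
  by (simp add: derivation_def algebra_simps)

lemma derivation_if: "(b \<Longrightarrow> derivation \<delta>) \<Longrightarrow> derivation (\<lambda>f. if b then \<delta> f else 0)"
  by (cases b) (simp_all add: derivation_zero)

lemma derivation_sum: "(\<And>i. i \<in> I \<Longrightarrow> derivation (\<delta> i)) \<Longrightarrow> derivation (\<lambda>f. \<Sum>i\<in>I. \<delta> i f)"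
  by (induction I rule: infinite_finite_induct) (auto intro: derivation_zero derivation_add)

lemma derivation_commutator:
  assumes "derivation \<delta>" "derivation \<epsilon>"
  shows "derivation (\<lambda>f. \<delta> (\<epsilon> f) - \<epsilon> (\<delta> f))"
proof -
  have z: "\<delta> 0 = 0" "\<epsilon> 0 = 0"
    using assms by (simp_all add: linear_opD derivation_linear)
  show ?thesis
    unfolding derivation_def using z
    by (auto simp: derivationD[OF assms(1)] derivationD[OF assms(2)] algebra_simps)
qed

text \<open>
  Indexing the vector variables \<open>x\<close>, \<open>y\<close>, \<open>z\<close> by \<open>blk\<close> allows each commutation rule to be
  stated once for all of them.
\<close>

datatype blk = BX | BY | BZ

fun vr :: "blk \<Rightarrow> nat \<Rightarrow> var" where
  "vr BX = VX" | "vr BY = VY" | "vr BZ = VZ"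

lemma UNIV_blk: "UNIV = {BX, BY, BZ}"
  by (auto intro: blk.exhaust)

instance blk :: finite
  by standard (simp add: UNIV_blk)

lemma sum_blk: "(\<Sum>p\<in>UNIV. h p) = h BX + h BY + h BZ" for h :: "blk \<Rightarrow> 'a::comm_monoid_add"
  by (simp add: UNIV_blk add.assoc)

lemma vr_eq_iff [simp]: "vr p i = vr q j \<longleftrightarrow> p = q \<and> i = j"
  by (cases p; cases q) auto

lemma var_index_vr [simp]: "var_index (vr p j) = j"
  by (cases p) auto

lemma ex_vr: "\<exists>p j. v = vr p j"
  by (cases v) (metis vr.simps)+

text \<open>Up to constant shifts, \<open>polar\<close>, \<open>lap\<close> and multiplication by
  \<open>quad\<close> span the copy of sp(6) that is Howe dual to the orthogonal group on
  polynomials in three vectors. The operators R, L, E and D_s of the problem are combinations of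
  them.\<close>

definition polar :: "nat \<Rightarrow> blk \<Rightarrow> blk \<Rightarrow> cpoly \<Rightarrow> cpoly" where
  "polar m p q f = (\<Sum>j<m. Var (vr p j) * partial (vr q j) f)"

definition lap :: "nat \<Rightarrow> blk \<Rightarrow> blk \<Rightarrow> cpoly \<Rightarrow> cpoly" where
  "lap m p q f = (\<Sum>j<m. partial (vr p j) (partial (vr q j) f))"

definition quad :: "nat \<Rightarrow> blk \<Rightarrow> blk \<Rightarrow> cpoly" where
  "quad m p q = (\<Sum>j<m. Var (vr p j) * Var (vr q j))"

lemma derivation_polar: "derivation (polar m p q)"
  unfolding polar_def by (intro derivation_sum derivation_mult_left derivation_partial)

lemma linear_op_polar: "linear_op (polar m p q)"
  by (rule derivation_linear[OF derivation_polar])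

lemma linear_op_lap: "linear_op (lap m p q)"
  by (rule linear_opI) (simp_all add: lap_def sum.distrib partial_cscale cv.scale_sum_right)

lemmas polar_linear = linear_opD[OF linear_op_polar]
lemmas lap_linear = linear_opD[OF linear_op_lap]
lemmas polar_mult = derivationD(2)[OF derivation_polar]

lemma polar_Var: "polar m p q (Var (vr r k)) = (if q = r \<and> k < m then Var (vr p k) else 0)"
  by (auto simp: polar_def if_distrib[of "\<lambda>u. _ * u"] cong: if_cong)

lemma lap_commute: "lap m p q f = lap m q p f"
  by (simp add: lap_def partial_commute)

lemma partial_lap: "partial v (lap m p q f) = lap m p q (partial v f)"
  by (simp add: lap_def partial_commute)

lemma lap_lap: "lap m p q (lap m r s f) = lap m r s (lap m p q f)"
  unfolding lap_def[of m r s] by (simp add: lap_linear partial_lap)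

text \<open>The relations of matrix units in gl(3), with the blocks as indices. Both sides are
  derivations.\<close>

lemma polar_commutator:
  "polar m p q (polar m r s f) - polar m r s (polar m p q f)
     = (if q = r then polar m p s f else 0) - (if p = s then polar m r q f else 0)"
proof (rule derivation_eqI[where \<delta> = "\<lambda>f. polar m p q (polar m r s f) - polar m r s (polar m p q f)"
    and \<epsilon> = "\<lambda>f. (if q = r then polar m p s f else 0) - (if p = s then polar m r q f else 0)"])
  show "derivation (\<lambda>f. polar m p q (polar m r s f) - polar m r s (polar m p q f))"
    by (intro derivation_commutator derivation_polar)
  show "derivation (\<lambda>f. (if q = r then polar m p s f else 0) - (if p = s then polar m r q f else 0))"
    by (intro derivation_diff derivation_if derivation_polar)
  show "polar m p q (polar m r s (Var v)) - polar m r s (polar m p q (Var v)) =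
      (if q = r then polar m p s (Var v) else 0) - (if p = s then polar m r q (Var v) else 0)" for v
  proof -
    obtain t k where "v = vr t k" using ex_vr by blast
    then show ?thesis by (auto simp: polar_Var polar_linear)
  qed
qed

text \<open>The commutator as a rule that swaps two polarizations. As an unrestricted rewrite rule
  it would loop, so it is always used in explicit instances.\<close>

lemma polar_polar:
  "polar m p q (polar m r s f) = polar m r s (polar m p q f)
     + (if q = r then polar m p s f else 0) - (if p = s then polar m r q f else 0)"
  using polar_commutator[of m p q r s f] by (simp add: algebra_simps)

lemma polar_quad:
  "polar m p q (quad m r s) = (if q = r then quad m p s else 0) + (if q = s then quad m r p else 0)"
  by (auto simp: quad_def polar_linear polar_mult polar_Var sum.distrib)

lemma partial_Var_partial:
  "partial v (Var w * partial u f) = Var w * partial u (partial v f) + (if v = w then partial u f else 0)"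
  by (simp add: partial_Var_mult partial_commute)

lemma partial_polar:
  "partial (vr r k) (polar m p q f) = polar m p q (partial (vr r k) f)
     + (if r = p \<and> k < m then partial (vr q k) f else 0)"
  by (auto simp: polar_def partial_Var_partial sum.distrib)

lemma lap_polar:
  "lap m r s (polar m p q f) = polar m p q (lap m r s f)
     + (if r = p then lap m q s f else 0) + (if s = p then lap m q r f else 0)"
proof -
  have "lap m r s (polar m p q f) = (\<Sum>j<m. polar m p q (partial (vr r j) (partial (vr s j) f))
      + (if r = p then partial (vr q j) (partial (vr s j) f) else 0)
      + (if s = p then partial (vr q j) (partial (vr r j) f) else 0))"
    unfolding lap_def by (intro sum.cong refl) (auto simp: partial_polar partial_commute)
  then show ?thesis by (auto simp: sum.distrib lap_def polar_linear)
qed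

lemma partial_quad:
  "partial (vr r k) (quad m p q) = (if r = p \<and> k < m then Var (vr q k) else 0)
     + (if r = q \<and> k < m then Var (vr p k) else 0)"
  by (auto simp: quad_def partial_Var_mult sum.distrib if_distrib[of "\<lambda>u. _ * u"] cong: if_cong)

lemma sum_partial_quad:
  "(\<Sum>j<m. partial (vr s j) (quad m p q) * partial (vr r j) f)
     = (if s = p then polar m q r f else 0) + (if s = q then polar m p r f else 0)"
proof -
  have "(\<Sum>j<m. partial (vr s j) (quad m p q) * partial (vr r j) f)
     = (\<Sum>j<m. (if s = p then Var (vr q j) * partial (vr r j) f else 0)
        + (if s = q then Var (vr p j) * partial (vr r j) f else 0))"
    by (intro sum.cong refl) (simp add: partial_quad distrib_right)
  then show ?thesis by (cases "s = p"; cases "s = q") (simp_all add: sum.distrib polar_def)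
qed

lemma lap_quad:
  "lap m r s (quad m p q) = (if r = p \<and> s = q then of_nat m else 0) + (if r = q \<and> s = p then of_nat m else 0)"
proof -
  have 1: "partial v (if b then Var w else 0) = (if b \<and> v = w then 1 else 0)" for v b w
    by simp
  have 2: "(\<Sum>j<m. if (b \<and> j < m) \<and> vr r j = vr t j then 1 else (0::cpoly)) = (if r = t \<and> b then of_nat m else 0)"
    for b t
  proof -
    have "(\<Sum>j<m. if (b \<and> j < m) \<and> vr r j = vr t j then 1 else (0::cpoly)) = (\<Sum>j<m. if r = t \<and> b then 1 else 0)"
      by (intro sum.cong) auto
    then show ?thesis by simp
  qed
  show ?thesis
    unfolding lap_def partial_quad partial_add 1 sum.distrib 2 by (rule add.commute)
qed

text \<open>Second order Leibniz rule: the mixed terms are first order and become polarizations, and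
  the Laplacian of the quadratic form brings in the dimension \<open>m\<close>.\<close>

lemma lap_quad_mult:
  "lap m r s (quad m p q * f) = quad m p q * lap m r s f
     + (if r = p then polar m q s f else 0) + (if r = q then polar m p s f else 0)
     + (if s = p then polar m q r f else 0) + (if s = q then polar m p r f else 0)
     + (if r = p \<and> s = q then of_nat m * f else 0) + (if r = q \<and> s = p then of_nat m * f else 0)"
proof -
  have "lap m r s (quad m p q * f) = lap m r s (quad m p q) * f
     + (\<Sum>j<m. partial (vr s j) (quad m p q) * partial (vr r j) f)
     + (\<Sum>j<m. partial (vr r j) (quad m p q) * partial (vr s j) f) + quad m p q * lap m r s f"
    by (simp only: lap_def partial_mult partial_add sum.distrib sum_distrib_left sum_distrib_right add_ac)
  moreover have "(if b then x else 0) * f = (if b then x * f else 0)" for b and x :: cpoly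
    by simp
  ultimately show ?thesis
    by (simp only: sum_partial_quad lap_quad distrib_right add_ac)
qed

lemma linear_op_mult: "linear_op (\<lambda>f. g * f)" for g :: cpoly
  by (rule linear_opI) (simp_all add: algebra_simps cscale_mult_right)

section \<open>The commuting actions\<close>

lemmas op_linear = polar_linear lap_linear linear_opD[OF linear_op_partial]

lemma so_L_blk:
  "so_L a b f = (\<Sum>p\<in>UNIV. Var (vr p a) * partial (vr p b) f - Var (vr p b) * partial (vr p a) f)"
  by (simp add: so_L_eq mult_var_eq sum_blk)

lemma derivation_so_L: "derivation (so_L a b)"
  unfolding so_L_blk by (intro derivation_sum derivation_diff derivation_mult_left derivation_partial)

lemma derivation_so_action: "derivation (so_action m A)"
  unfolding so_action_def by (intro derivation_sum derivation_cscale derivation_so_L)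

lemmas linear_op_so_action = derivation_linear[OF derivation_so_action]
lemmas so_action_linear = linear_opD[OF linear_op_so_action]
lemmas linear_op_so_L = derivation_linear[OF derivation_so_L]

lemma so_L_Var:
  "so_L a b (Var (vr p k)) = (if b = k then Var (vr p a) else 0) - (if a = k then Var (vr p b) else 0)"
  by (cases p) (auto simp: so_L_blk sum_blk)

lemma skew_entry:
  assumes "A \<in> lie_carrier (so m)" "i < m" "j < m"
  shows "A $$ (i, j) = - A $$ (j, i)"
proof -
  have A: "A \<in> carrier_mat m m" "transpose_mat A = - A"
    using assms(1) by (auto simp: so_def matrix_lie_algebra_def)
  then have "transpose_mat A $$ (j, i) = (- A) $$ (j, i)" by simp
  then show ?thesis using A(1) assms(2,3) by simp
qed

lemma so_carrier: "A \<in> lie_carrier (so m) \<Longrightarrow> A \<in> carrier_mat m m"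
  by (auto simp: so_def matrix_lie_algebra_def)

lemma skew_sum:
  assumes "A \<in> lie_carrier (so m)"
  shows "(\<Sum>k<m. \<Sum>b<m. cscale (A $$ (b, k)) (h k b)) = - (\<Sum>k<m. \<Sum>b<m. cscale (A $$ (k, b)) (h k b))"
proof -
  have "cscale (A $$ (b, k)) (h k b) = - cscale (A $$ (k, b)) (h k b)" if "k < m" "b < m" for k b
    by (subst skew_entry[OF assms that(2,1)]) (rule cv.scale_minus_left)
  then show ?thesis by (simp add: sum_negf)
qed

text \<open>The definition of \<open>so_action\<close> reads only the upper triangle of
  \<open>A\<close>. Skew symmetry restores the lower one, so that each block of variables carries
  the defining representation.\<close>

lemma so_action_Var:
  assumes A: "A \<in> lie_carrier (so m)"
  shows "so_action m A (Var (vr p k)) = (if k < m then \<Sum>a<m. cscale (A $$ (a, k)) (Var (vr p a)) else 0)"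
proof (cases "k < m")
  case True
  have "so_action m A (Var (vr p k)) = (\<Sum>b<m. \<Sum>a<b. if b = k then cscale (A $$ (a, b)) (Var (vr p a)) else 0)
      - (\<Sum>b<m. \<Sum>a<b. if a = k then cscale (A $$ (a, b)) (Var (vr p b)) else 0)"
    unfolding so_action_def sum_subtractf [symmetric] so_L_Var
    by (intro sum.cong refl) (simp add: cv.scale_right_diff_distrib)
  also have "(\<Sum>b<m. \<Sum>a<b. if b = k then cscale (A $$ (a, b)) (Var (vr p a)) else 0)
      = (\<Sum>b<m. if b = k then (\<Sum>a<b. cscale (A $$ (a, b)) (Var (vr p a))) else 0)"
    by (intro sum.cong refl) simp
  also have "\<dots> = (\<Sum>a<k. cscale (A $$ (a, k)) (Var (vr p a)))"
    using True by simp
  also have "(\<Sum>b<m. \<Sum>a<b. if a = k then cscale (A $$ (a, b)) (Var (vr p b)) else 0)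
      = (\<Sum>b<m. if k < b then cscale (A $$ (k, b)) (Var (vr p b)) else 0)"
    by (intro sum.cong refl) auto
  also have "\<dots> = - (\<Sum>b<m. if k < b then cscale (A $$ (b, k)) (Var (vr p b)) else 0)"
    unfolding sum_negf [symmetric]
  proof (intro sum.cong refl)
    fix b assume "b \<in> {..<m}"
    then have "A $$ (k, b) = - A $$ (b, k)" using skew_entry[OF A True] by blast
    then show "(if k < b then cscale (A $$ (k, b)) (Var (vr p b)) else 0)
        = - (if k < b then cscale (A $$ (b, k)) (Var (vr p b)) else 0)"
      by (cases "k < b") (simp_all only: cv.scale_minus_left minus_zero if_True if_False)
  qed
  also have "(\<Sum>a<k. cscale (A $$ (a, k)) (Var (vr p a))) - \<dots>
      = (\<Sum>a<m. (if a < k then cscale (A $$ (a, k)) (Var (vr p a)) else 0)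
           + (if k < a then cscale (A $$ (a, k)) (Var (vr p a)) else 0))"
  proof -
    have "(\<Sum>a<m. if a < k then cscale (A $$ (a, k)) (Var (vr p a)) else 0)
        = (\<Sum>a<k. cscale (A $$ (a, k)) (Var (vr p a)))"
      using True by (intro sum.mono_neutral_cong_right) auto
    then show ?thesis by (simp add: sum.distrib)
  qed
  also have "\<dots> = (\<Sum>a<m. cscale (A $$ (a, k)) (Var (vr p a)))"
  proof (intro sum.cong refl)
    fix a assume "a \<in> {..<m}"
    have "A $$ (k, k) = 0" using skew_entry[OF A True True] by simp
    then show "(if a < k then cscale (A $$ (a, k)) (Var (vr p a)) else 0)
           + (if k < a then cscale (A $$ (a, k)) (Var (vr p a)) else 0) = cscale (A $$ (a, k)) (Var (vr p a))"
      by (cases a k rule: linorder_cases) auto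
  qed
  finally show ?thesis using True by simp
next
  case False
  then show ?thesis by (auto simp: so_action_def so_L_Var intro!: sum.neutral)
qed

lemma so_action_add:
  assumes "A \<in> lie_carrier (so m)" "B \<in> lie_carrier (so m)"
  shows "so_action m (lie_add (so m) A B) f = so_action m A f + so_action m B f"
proof -
  have "so_action m (A + B) f = (\<Sum>b<m. \<Sum>a<b. cscale (A $$ (a, b)) (so_L a b f) + cscale (B $$ (a, b)) (so_L a b f))"
    unfolding so_action_def using so_carrier[OF assms(1)] so_carrier[OF assms(2)]
    by (intro sum.cong refl) (simp add: cv.scale_left_distrib)
  then show ?thesis by (simp add: so_action_def sum.distrib so_def matrix_lie_algebra_def)
qed

lemma so_action_scale:
  assumes "A \<in> lie_carrier (so m)"
  shows "so_action m (lie_scale (so m) c A) f = cscale c (so_action m A f)"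
proof -
  have "so_action m (c \<cdot>\<^sub>m A) f = (\<Sum>b<m. \<Sum>a<b. cscale c (cscale (A $$ (a, b)) (so_L a b f)))"
    unfolding so_action_def using so_carrier[OF assms(1)]
    by (intro sum.cong refl) simp
  then show ?thesis by (simp add: so_action_def cv.scale_sum_right so_def matrix_lie_algebra_def)
qed

lemma so_closed:
  assumes "A \<in> lie_carrier (so m)" "B \<in> lie_carrier (so m)"
  shows "lie_add (so m) A B \<in> lie_carrier (so m)" "lie_scale (so m) c A \<in> lie_carrier (so m)"
    "lie_bracket (so m) A B \<in> lie_carrier (so m)"
proof -
  have A: "A \<in> carrier_mat m m" "transpose_mat A = - A" and B: "B \<in> carrier_mat m m" "transpose_mat B = - B"
    using assms by (auto simp: so_def matrix_lie_algebra_def)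
  have "transpose_mat (A + B) = - (A + B)"
  proof (intro eq_matI)
    fix i j assume "i < dim_row (- (A + B))" "j < dim_col (- (A + B))"
    then have ij: "i < m" "j < m" using B by auto
    show "transpose_mat (A + B) $$ (i, j) = (- (A + B)) $$ (i, j)"
      using skew_entry[OF assms(1) ij] skew_entry[OF assms(2) ij] ij A B by simp
  qed (use A B in auto)
  then show "lie_add (so m) A B \<in> lie_carrier (so m)"
    using A B by (simp add: so_def matrix_lie_algebra_def)
  have "transpose_mat (c \<cdot>\<^sub>m A) = - (c \<cdot>\<^sub>m A)"
  proof (intro eq_matI)
    fix i j assume "i < dim_row (- (c \<cdot>\<^sub>m A))" "j < dim_col (- (c \<cdot>\<^sub>m A))"
    then have ij: "i < m" "j < m" using A by auto
    show "transpose_mat (c \<cdot>\<^sub>m A) $$ (i, j) = (- (c \<cdot>\<^sub>m A)) $$ (i, j)"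
      using skew_entry[OF assms(1) ij] ij A by simp
  qed (use A in auto)
  then show "lie_scale (so m) c A \<in> lie_carrier (so m)"
    using A B by (simp add: so_def matrix_lie_algebra_def)
  have "transpose_mat (A * B) = (- B) * (- A)" "transpose_mat (B * A) = (- A) * (- B)"
    using A B by (simp_all add: transpose_mult)
  then have "transpose_mat (A * B) = B * A" "transpose_mat (B * A) = A * B"
    using A B by (simp_all add: uminus_mult_left_mat uminus_mult_right_mat)
  then have "transpose_mat (A * B - B * A) = B * A - A * B"
    using transpose_minus[OF mult_carrier_mat[OF A(1) B(1)] mult_carrier_mat[OF B(1) A(1)]] by simp
  also have "\<dots> = - (A * B - B * A)"
    using A B by (intro eq_matI) auto
  finally have "transpose_mat (A * B - B * A) = - (A * B - B * A)" .
  moreover have "A * B - B * A \<in> carrier_mat m m"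
    using A(1) B(1) by (meson minus_carrier_mat mult_carrier_mat)
  ultimately show "lie_bracket (so m) A B \<in> lie_carrier (so m)"
    by (simp add: so_def matrix_lie_algebra_def)
qed

text \<open>Both sides are derivations, and on variables they reduce to the product of
  matrices.\<close>

lemma so_action_bracket:
  assumes "A \<in> lie_carrier (so m)" "B \<in> lie_carrier (so m)"
  shows "so_action m (lie_bracket (so m) A B) f = so_action m A (so_action m B f) - so_action m B (so_action m A f)"
proof (rule derivation_eqI[where \<delta> = "so_action m (lie_bracket (so m) A B)" and
    \<epsilon> = "\<lambda>f. so_action m A (so_action m B f) - so_action m B (so_action m A f)"])
  show "so_action m (lie_bracket (so m) A B) (Var v)
      = so_action m A (so_action m B (Var v)) - so_action m B (so_action m A (Var v))" for v
  proof -
    obtain p k where v: "v = vr p k" using ex_vr by blast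
    have prod: "so_action m A (\<Sum>b<m. cscale (B $$ (b, k)) (Var (vr p b)))
        = (\<Sum>a<m. cscale ((A * B) $$ (a, k)) (Var (vr p a)))" 
      if "k < m" "A \<in> lie_carrier (so m)" "B \<in> lie_carrier (so m)" for A B
    proof -
      have c: "A \<in> carrier_mat m m" "B \<in> carrier_mat m m" using that so_carrier by auto
      have "so_action m A (\<Sum>b<m. cscale (B $$ (b, k)) (Var (vr p b)))
        = (\<Sum>b<m. \<Sum>a<m. cscale (B $$ (b, k) * A $$ (a, b)) (Var (vr p a)))"
        using that by (simp add: so_action_linear so_action_Var cv.scale_sum_right)
      also have "\<dots> = (\<Sum>a<m. \<Sum>b<m. cscale (B $$ (b, k) * A $$ (a, b)) (Var (vr p a)))"
        by (rule sum.swap)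
      also have "\<dots> = (\<Sum>a<m. cscale ((A * B) $$ (a, k)) (Var (vr p a)))"
      proof (intro sum.cong refl)
        fix a assume "a \<in> {..<m}"
        then have "(A * B) $$ (a, k) = (\<Sum>b<m. B $$ (b, k) * A $$ (a, b))"
          using c \<open>k < m\<close> by (simp add: scalar_prod_def atLeast0LessThan mult.commute)
        then show "(\<Sum>b<m. cscale (B $$ (b, k) * A $$ (a, b)) (Var (vr p a))) = cscale ((A * B) $$ (a, k)) (Var (vr p a))"
          by (simp add: cv.scale_sum_left)
      qed
      finally show ?thesis .
    qed
    show ?thesis
    proof (cases "k < m")
      case True
      have "lie_bracket (so m) A B $$ (a, k) = (A * B) $$ (a, k) - (B * A) $$ (a, k)" if "a < m" for a
        using that True so_carrier[OF assms(1)] so_carrier[OF assms(2)]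
        by (simp add: so_def matrix_lie_algebra_def)
      then have "so_action m (lie_bracket (so m) A B) (Var v)
         = (\<Sum>a<m. cscale ((A * B) $$ (a, k)) (Var (vr p a))) - (\<Sum>a<m. cscale ((B * A) $$ (a, k)) (Var (vr p a)))"
        using True so_closed(3)[OF assms] 
        by (simp add: v so_action_Var cv.scale_left_diff_distrib flip: sum_subtractf)
      then show ?thesis using True assms by (simp add: v so_action_Var[of _ m p k] prod)
    next
      case False
      then show ?thesis using assms so_closed(3)[OF assms] by (simp add: v so_action_Var so_action_linear)
    qed
  qed
qed (intro derivation_so_action derivation_commutator)+

lemma so_action_polar:
  assumes A: "A \<in> lie_carrier (so m)"
  shows "so_action m A (polar m p q f) = polar m p q (so_action m A f)"
proof -
  have "so_action m A (polar m p q f) - polar m p q (so_action m A f) = 0"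
  proof (rule derivation_eqI[where \<delta> = "\<lambda>f. so_action m A (polar m p q f) - polar m p q (so_action m A f)"
      and \<epsilon> = "\<lambda>f. 0"])
    show "so_action m A (polar m p q (Var v)) - polar m p q (so_action m A (Var v)) = 0" for v
    proof -
      obtain t k where "v = vr t k" using ex_vr by blast
      then show ?thesis using A by (auto simp: so_action_Var polar_Var polar_linear so_action_linear)
    qed
  qed (intro derivation_so_action derivation_polar derivation_commutator derivation_zero)+
  then show ?thesis by simp
qed

lemma so_action_quad:
  assumes A: "A \<in> lie_carrier (so m)"
  shows "so_action m A (quad m p q) = 0"
proof -
  have "so_action m A (quad m p q) = (\<Sum>k<m. \<Sum>a<m. cscale (A $$ (a, k)) (Var (vr p a) * Var (vr q k)))
      + (\<Sum>k<m. \<Sum>a<m. cscale (A $$ (a, k)) (Var (vr p k) * Var (vr q a)))"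
    using A by (simp add: quad_def so_action_linear derivationD[OF derivation_so_action] so_action_Var
        sum.distrib sum_distrib_left sum_distrib_right cscale_mult_left cscale_mult_right)
  also have "(\<Sum>k<m. \<Sum>a<m. cscale (A $$ (a, k)) (Var (vr p k) * Var (vr q a)))
      = (\<Sum>k<m. \<Sum>a<m. cscale (A $$ (k, a)) (Var (vr p a) * Var (vr q k)))"
    by (rule sum.swap)
  finally show ?thesis by (simp add: skew_sum[OF A])
qed

text \<open>Derivatives transform under the dual representation. Since \<open>A\<close> is skew, the
  correction terms cancel in every \<open>lap\<close>.\<close>

lemma so_action_partial:
  assumes A: "A \<in> lie_carrier (so m)" and k: "k < m"
  shows "so_action m A (partial (vr p k) f)
     = partial (vr p k) (so_action m A f) - (\<Sum>b<m. cscale (A $$ (k, b)) (partial (vr p b) f))"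
proof -
  have "partial (vr p k) (so_action m A f) - so_action m A (partial (vr p k) f)
      = (\<Sum>b<m. cscale (A $$ (k, b)) (partial (vr p b) f))"
  proof (rule derivation_eqI[where \<delta> = "\<lambda>f. partial (vr p k) (so_action m A f) - so_action m A (partial (vr p k) f)"
      and \<epsilon> = "\<lambda>f. \<Sum>b<m. cscale (A $$ (k, b)) (partial (vr p b) f)"])
    show "partial (vr p k) (so_action m A (Var v)) - so_action m A (partial (vr p k) (Var v))
      = (\<Sum>b<m. cscale (A $$ (k, b)) (partial (vr p b) (Var v)))" for v
    proof -
      obtain t j where v: "v = vr t j" using ex_vr by blast
      have 1: "so_action m A 1 = 0"
        using derivationD(3)[OF derivation_so_action, of m A 1] by (simp add: Cst_def)
      show ?thesis using A k
        by (cases "p = t"; cases "j < m")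
          (auto simp: v so_action_Var so_action_linear 1 partial_cscale if_distrib[of "cscale _"]
            if_distrib[of "so_action m A"] cong: if_cong)
    qed
  qed (intro derivation_so_action derivation_partial derivation_commutator derivation_cscale derivation_sum)+
  then show ?thesis by (simp add: algebra_simps)
qed

lemma so_action_lap:
  assumes A: "A \<in> lie_carrier (so m)"
  shows "so_action m A (lap m p q f) = lap m p q (so_action m A f)"
proof -
  have "so_action m A (lap m p q f) = lap m p q (so_action m A f)
      - (\<Sum>k<m. \<Sum>b<m. cscale (A $$ (k, b)) (partial (vr p k) (partial (vr q b) f)))
      - (\<Sum>k<m. \<Sum>b<m. cscale (A $$ (k, b)) (partial (vr p b) (partial (vr q k) f)))"
    using A by (simp add: lap_def so_action_linear so_action_partial sum_subtractf partial_cscale)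
  also have "(\<Sum>k<m. \<Sum>b<m. cscale (A $$ (k, b)) (partial (vr p b) (partial (vr q k) f)))
      = (\<Sum>k<m. \<Sum>b<m. cscale (A $$ (b, k)) (partial (vr p k) (partial (vr q b) f)))"
    by (rule sum.swap)
  finally show ?thesis by (simp add: skew_sum[OF A])
qed

section \<open>The operators of sl(2) and the symplectic Dirac operator\<close>

lemma sl2_raise_eq: "sl2_raise m f = polar m BY BX f + cscale (1/2) (quad m BZ BZ * f)"
  by (simp add: sl2_raise_def polar_def quad_def mult_var_eq sum_distrib_right mult.assoc)

lemma sl2_lower_eq: "sl2_lower m f = polar m BX BY f - cscale (1/2) (lap m BZ BZ f)"
  by (simp add: sl2_lower_def polar_def lap_def mult_var_eq)

lemma sl2_euler_eq:
  "sl2_euler m f = polar m BY BY f - polar m BX BX f + polar m BZ BZ f + cscale (of_nat m / 2) f"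
  by (simp add: sl2_euler_def polar_def mult_var_eq)

lemma D_s_eq: "D_s m f = polar m BZ BY f - lap m BX BZ f"
  by (simp add: D_s_def polar_def lap_def mult_var_eq)

text \<open>In the computations below numbers occur both as constant polynomials and as scalars of
  \<open>cscale\<close>. On coefficients the two forms agree, which is why many identities are
  finished there.\<close>

lemma lookup_scalar_mult:
  fixes f :: cpoly
  shows "Poly_Mapping.lookup (numeral n * f) k = numeral n * Poly_Mapping.lookup f k"
    "Poly_Mapping.lookup (f * numeral n) k = numeral n * Poly_Mapping.lookup f k"
    "Poly_Mapping.lookup (of_nat i * f) k = of_nat i * Poly_Mapping.lookup f k"
    "Poly_Mapping.lookup (f * of_nat i) k = of_nat i * Poly_Mapping.lookup f k"
    "Poly_Mapping.lookup (f * (numeral n * g)) k = numeral n * Poly_Mapping.lookup (f * g) k"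
proof -
  show *: "Poly_Mapping.lookup (of_nat i * f) k = of_nat i * Poly_Mapping.lookup f k" for i and f :: cpoly
    by (simp flip: cscale_of_nat)
  show "Poly_Mapping.lookup (f * of_nat i) k = of_nat i * Poly_Mapping.lookup f k" for i
    using * by (simp add: mult.commute)
  show "Poly_Mapping.lookup (numeral n * f) k = numeral n * Poly_Mapping.lookup f k"
    using *[of "numeral n"] by simp
  then show "Poly_Mapping.lookup (f * numeral n) k = numeral n * Poly_Mapping.lookup f k"
    by (simp add: mult.commute)
  show "Poly_Mapping.lookup (f * (numeral n * g)) k = numeral n * Poly_Mapping.lookup (f * g) k"
    using *[of "numeral n" "f * g"] by (simp add: cscale_mult_right mult.left_commute)
qed

lemmas lookup_simps = lookup_add lookup_minus lookup_scalar_mult cscale_mult_left cscale_mult_right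

lemma linear_op_sl2:
  "linear_op (sl2_raise m)" "linear_op (sl2_lower m)" "linear_op (sl2_euler m)" "linear_op (D_s m)"
  "linear_op (so_sl2_action m (A, B))" "linear_op (sl2_action m B)"
proof -
  show 1: "linear_op (sl2_raise m)" "linear_op (sl2_lower m)" "linear_op (sl2_euler m)" "linear_op (D_s m)"
    by (intro linear_opI; simp add: sl2_raise_eq sl2_lower_eq sl2_euler_eq D_s_eq op_linear;
        intro poly_mapping_eqI; simp add: lookup_simps algebra_simps)+
  show 2: "linear_op (sl2_action m B)"
    by (intro linear_opI; simp add: sl2_action_def 1[THEN linear_opD(1)] 1[THEN linear_opD(2)];
        intro poly_mapping_eqI; simp add: lookup_simps algebra_simps)
  show "linear_op (so_sl2_action m (A, B))"
    by (intro linear_opI; simp add: so_sl2_action_def so_action_linear 2[THEN linear_opD(1)] 2[THEN linear_opD(2)];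
        intro poly_mapping_eqI; simp add: lookup_simps algebra_simps)
qed

lemmas sl2_linear = linear_op_sl2[THEN linear_opD(1)] linear_op_sl2[THEN linear_opD(2)]
  linear_op_sl2[THEN linear_opD(3)] linear_op_sl2[THEN linear_opD(4)]
  linear_op_sl2[THEN linear_opD(5)] linear_op_sl2[THEN linear_opD(6)]

lemmas calculus = op_linear polar_mult polar_quad lap_quad_mult lap_polar lap_lap
  cscale_mult_left cscale_mult_right distrib_left distrib_right right_diff_distrib
  cv.scale_right_distrib cv.scale_right_diff_distrib

text \<open>The parts in x and y give E_y - E_x. The parts in z give one quarter of the commutator
  of the Laplacian with the squared norm, which is E_z + m/2.\<close>

lemma raise_lower: "sl2_raise m (sl2_lower m f) - sl2_lower m (sl2_raise m f) = sl2_euler m f"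
  unfolding sl2_raise_eq sl2_lower_eq sl2_euler_eq
  by (simp add: calculus polar_polar[of m BX BY BY BX f] flip: cscale_of_nat)
    (rule poly_mapping_eqI, simp add: lookup_simps algebra_simps)

lemma euler_raise: "sl2_euler m (sl2_raise m f) = sl2_raise m (sl2_euler m f) + cscale 2 (sl2_raise m f)"
  unfolding sl2_raise_eq sl2_euler_eq
  by (simp add: calculus polar_polar[of m BX BX BY BX f] polar_polar[of m BY BY BY BX f]
      polar_polar[of m BZ BZ BY BX f] flip: cscale_of_nat)
    (rule poly_mapping_eqI, simp add: lookup_simps algebra_simps)

lemma euler_lower: "sl2_euler m (sl2_lower m f) = sl2_lower m (sl2_euler m f) - cscale 2 (sl2_lower m f)"
  unfolding sl2_lower_eq sl2_euler_eq
  by (simp add: calculus polar_polar[of m BX BX BX BY f] polar_polar[of m BY BY BX BY f]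
      polar_polar[of m BZ BZ BX BY f] flip: cscale_of_nat)
    (rule poly_mapping_eqI, simp add: lookup_simps algebra_simps)

lemma D_s_raise: "D_s m (sl2_raise m f) = sl2_raise m (D_s m f)"
  unfolding sl2_raise_eq D_s_eq
  by (simp add: calculus polar_polar[of m BZ BY BY BX f] flip: cscale_of_nat)
    (rule poly_mapping_eqI, simp add: lookup_simps algebra_simps)

lemma D_s_lower: "D_s m (sl2_lower m f) = sl2_lower m (D_s m f)"
  unfolding sl2_lower_eq D_s_eq
  by (simp add: calculus polar_polar[of m BZ BY BX BY f] lap_commute[of m BX BZ] flip: cscale_of_nat)
    (rule poly_mapping_eqI, simp add: lookup_simps algebra_simps)

lemma D_s_euler: "D_s m (sl2_euler m f) = sl2_euler m (D_s m f)"
  unfolding sl2_euler_eq D_s_eq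
  by (simp add: calculus polar_polar[of m BZ BY BX BX f] polar_polar[of m BZ BY BY BY f] 
      polar_polar[of m BZ BY BZ BZ f] lap_commute[of m BX BZ] flip: cscale_of_nat)

lemma so_action_commute:
  assumes "A \<in> lie_carrier (so m)"
  shows "so_action m A (sl2_raise m f) = sl2_raise m (so_action m A f)"
    "so_action m A (sl2_lower m f) = sl2_lower m (so_action m A f)"
    "so_action m A (sl2_euler m f) = sl2_euler m (so_action m A f)"
    "so_action m A (D_s m f) = D_s m (so_action m A f)"
    "so_action m A (sl2_action m B f) = sl2_action m B (so_action m A f)"
proof -
  show 1: "so_action m A (sl2_raise m f) = sl2_raise m (so_action m A f)"
    "so_action m A (sl2_lower m f) = sl2_lower m (so_action m A f)"
    "so_action m A (sl2_euler m f) = sl2_euler m (so_action m A f)"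
    "so_action m A (D_s m f) = D_s m (so_action m A f)"
    unfolding sl2_raise_eq sl2_lower_eq sl2_euler_eq D_s_eq
    using assms by (simp_all add: so_action_linear so_action_polar so_action_lap so_action_quad
        derivationD[OF derivation_so_action])
  show "so_action m A (sl2_action m B f) = sl2_action m B (so_action m A f)"
    by (simp add: sl2_action_def so_action_linear 1)
qed

lemma sl2_carrier:
  assumes "B \<in> lie_carrier sl2"
  shows "B \<in> carrier_mat 2 2" "B $$ (1, 1) = - B $$ (0, 0)"
  using assms by (auto simp: sl2_def matrix_lie_algebra_def eq_neg_iff_add_eq_0 add.commute)

lemma sl2_action_add:
  assumes "B \<in> lie_carrier sl2" "C \<in> lie_carrier sl2"
  shows "sl2_action m (lie_add sl2 B C) f = sl2_action m B f + sl2_action m C f"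
  using sl2_carrier[OF assms(1)] sl2_carrier[OF assms(2)]
  by (simp add: sl2_action_def sl2_def matrix_lie_algebra_def cv.scale_left_distrib)

lemma sl2_action_scale:
  assumes "B \<in> lie_carrier sl2"
  shows "sl2_action m (lie_scale sl2 c B) f = cscale c (sl2_action m B f)"
  using sl2_carrier[OF assms(1)]
  by (simp add: sl2_action_def sl2_def matrix_lie_algebra_def cv.scale_right_distrib)

lemma sl2_action_bracket:
  assumes "B \<in> lie_carrier sl2" "C \<in> lie_carrier sl2"
  shows "sl2_action m (lie_bracket sl2 B C) f = sl2_action m B (sl2_action m C f) - sl2_action m C (sl2_action m B f)"
proof -
  have RL: "sl2_raise m (sl2_lower m f) = sl2_lower m (sl2_raise m f) + sl2_euler m f"
    using raise_lower[of m f] by (simp add: algebra_simps)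
  have e: "lie_bracket sl2 B C $$ (0, 0) = B $$ (0,1) * C $$ (1,0) - C $$ (0,1) * B $$ (1,0)"
    "lie_bracket sl2 B C $$ (0, 1) = 2 * (B $$ (0,0) * C $$ (0,1) - C $$ (0,0) * B $$ (0,1))"
    "lie_bracket sl2 B C $$ (1, 0) = 2 * (C $$ (0,0) * B $$ (1,0) - B $$ (0,0) * C $$ (1,0))"
    using sl2_carrier[OF assms(1)] sl2_carrier[OF assms(2)]
    by (auto simp: sl2_def matrix_lie_algebra_def scalar_prod_def numeral_2_eq_2 algebra_simps)
  show ?thesis
    unfolding sl2_action_def e
    by (simp add: sl2_linear RL euler_raise euler_lower)
      (rule poly_mapping_eqI, simp add: lookup_simps algebra_simps)
qed

text \<open>From here on variables keep the form \<open>vr p j\<close>, so that the rules stated for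
  all blocks match.\<close>

declare vr.simps [simp del]

subsection \<open>The Casimir operator\<close>

text \<open>Each pair of indices is counted twice and the generators are skew, so the eigenvalue on
  harmonics of degree a is -2 a (a + m - 2).\<close>

definition so_casimir :: "nat \<Rightarrow> cpoly \<Rightarrow> cpoly" where
  "so_casimir m f = (\<Sum>i<m. \<Sum>j<m. so_L i j (so_L i j f))"

definition elem_skew :: "nat \<Rightarrow> nat \<Rightarrow> nat \<Rightarrow> complex mat" where
  "elem_skew m i j = mat m m (\<lambda>(a, b). (if a = i \<and> b = j then 1 else 0) - (if a = j \<and> b = i then 1 else 0))"

lemma elem_skew_so: "elem_skew m i j \<in> lie_carrier (so m)"
proof -
  have "transpose_mat (elem_skew m i j) = - elem_skew m i j"
    by (rule eq_matI) (simp_all add: elem_skew_def conj_commute)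
  then show ?thesis by (simp add: so_def matrix_lie_algebra_def elem_skew_def)
qed

lemma so_L_action:
  assumes "i < m" "j < m"
  shows "so_L i j f = so_action m (elem_skew m i j) f"
proof (rule derivation_eqI[where \<delta> = "so_L i j"])
  show "so_L i j (Var v) = so_action m (elem_skew m i j) (Var v)" for v
  proof -
    obtain p k where v: "v = vr p k" using ex_vr by blast
    show ?thesis
    proof (cases "k < m")
      case True
      have "(\<Sum>a<m. cscale (elem_skew m i j $$ (a, k)) (Var (vr p a)))
          = (\<Sum>a<m. (if a = i then if j = k then Var (vr p a) else 0 else 0))
            - (\<Sum>a<m. (if a = j then if i = k then Var (vr p a) else 0 else 0))"
        unfolding sum_subtractf [symmetric] using True
        by (intro sum.cong refl) (auto simp: elem_skew_def cv.scale_left_diff_distrib)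
      then show ?thesis using True assms by (simp add: v so_L_Var so_action_Var elem_skew_so)
    next
      case False
      then show ?thesis using assms by (simp add: v so_L_Var so_action_Var elem_skew_so)
    qed
  qed
qed (rule derivation_so_L derivation_so_action)+

lemma so_casimir_action:
  "so_casimir m f = (\<Sum>i<m. \<Sum>j<m. so_action m (elem_skew m i j) (so_action m (elem_skew m i j) f))"
  unfolding so_casimir_def by (intro sum.cong refl) (simp add: so_L_action)

lemma linear_op_so_casimir: "linear_op (so_casimir m)"
  by (rule linear_opI)
    (simp_all add: so_casimir_def sum.distrib linear_opD[OF linear_op_so_L] cv.scale_sum_right)

text \<open>A Capelli type identity: the Casimir operator of so(m) is expressed through the dual
  operators, and can then be evaluated on any vector whose polarizations and Laplacians are
  known.\<close>

lemma so_casimir_eq: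
  "so_casimir m f = cscale 2 ((\<Sum>p\<in>UNIV. \<Sum>q\<in>UNIV. quad m p q * lap m p q f
      - polar m p q (polar m q p f) + polar m p p f) + cscale (1 - of_nat m) (\<Sum>p\<in>UNIV. polar m p p f))"
proof -
  define a where "a p i j g = Var (vr p i) * partial (vr p j) g" for p i j g
  have a_lin: "a p i j (g - h) = a p i j g - a p i j h" "a p i j (sum k I) = (\<Sum>x\<in>I. a p i j (k x))" for p i j g h k and I :: "blk set"
    by (simp_all add: a_def algebra_simps sum_distrib_left)
  have L: "so_L i j g = (\<Sum>p\<in>UNIV. a p i j g - a p j i g)" for i j g
    by (simp add: so_L_blk a_def)
  \<comment> \<open>Expanding the square of a skew combination leaves two types of products. After
    normal ordering, \<open>S\<close> yields \<open>quad\<close> times \<open>lap\<close> and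
    \<open>T\<close> a product of two polarizations, both up to first order terms.\<close>
  define S where "S p q = (\<Sum>i<m. \<Sum>j<m. a p i j (a q i j f))" for p q
  define T where "T p q = (\<Sum>i<m. \<Sum>j<m. a p i j (a q j i f))" for p q
  have "so_casimir m f = (\<Sum>i<m. \<Sum>j<m. \<Sum>p\<in>UNIV. \<Sum>q\<in>UNIV.
      a p i j (a q i j f) - a p i j (a q j i f) - a p j i (a q i j f) + a p j i (a q j i f))"
    unfolding so_casimir_def L a_lin sum_subtractf [symmetric]
    by (simp add: algebra_simps)
  also have "\<dots> = (\<Sum>p\<in>UNIV. \<Sum>q\<in>UNIV. \<Sum>i<m. \<Sum>j<m.
      a p i j (a q i j f) - a p i j (a q j i f) - a p j i (a q i j f) + a p j i (a q j i f))"
    by (simp only: sum.swap[of _ "UNIV :: blk set" "{..<m}"])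
  also have "\<dots> = (\<Sum>p\<in>UNIV. \<Sum>q\<in>UNIV. cscale 2 (S p q - T p q))"
  proof (intro sum.cong refl)
    fix p q
    have "(\<Sum>i<m. \<Sum>j<m. a p j i (a q i j f)) = T p q" "(\<Sum>i<m. \<Sum>j<m. a p j i (a q j i f)) = S p q"
      unfolding S_def T_def by (rule sum.swap)+
    then show "(\<Sum>i<m. \<Sum>j<m. a p i j (a q i j f) - a p i j (a q j i f) - a p j i (a q i j f) + a p j i (a q j i f))
        = cscale 2 (S p q - T p q)"
      by (simp add: sum.distrib sum_subtractf flip: S_def T_def)
        (rule poly_mapping_eqI, simp add: lookup_simps algebra_simps)
  qed
  also have "\<dots> = (\<Sum>p\<in>UNIV. \<Sum>q\<in>UNIV. cscale 2 (quad m p q * lap m p q f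
      - polar m p q (polar m q p f) + polar m p p f + (if p = q then cscale (1 - of_nat m) (polar m p p f) else 0)))"
  proof (intro sum.cong refl)
    fix p q
    have "S p q = (\<Sum>i<m. \<Sum>j<m. Var (vr p i) * Var (vr q i) * partial (vr p j) (partial (vr q j) f)
        + (if i = j then if p = q then Var (vr p i) * partial (vr q j) f else 0 else 0))"
      unfolding S_def a_def by (intro sum.cong refl) (auto simp: partial_Var_mult algebra_simps)
    also have "\<dots> = quad m p q * lap m p q f + (if p = q then polar m p p f else 0)"
      by (simp add: sum.distrib quad_def lap_def polar_def sum_product)
    finally have S: "S p q = quad m p q * lap m p q f + (if p = q then polar m p p f else 0)" .
    define U where "U = (\<Sum>i<m. \<Sum>j<m. Var (vr p i) * Var (vr q j) * partial (vr p j) (partial (vr q i) f))"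
    have "T p q = (\<Sum>i<m. \<Sum>j<m. Var (vr p i) * Var (vr q j) * partial (vr p j) (partial (vr q i) f)
        + (if p = q then Var (vr p i) * partial (vr q i) f else 0))"
      unfolding T_def a_def by (intro sum.cong refl) (auto simp: partial_Var_mult algebra_simps)
    also have "\<dots> = U + (if p = q then of_nat m * polar m p p f else 0)"
      by (simp add: sum.distrib U_def polar_def sum_distrib_left)
    finally have T: "T p q = U + (if p = q then of_nat m * polar m p p f else 0)" .
    have "polar m p q (polar m q p f)
        = (\<Sum>i<m. \<Sum>j<m. Var (vr p i) * Var (vr q j) * partial (vr p j) (partial (vr q i) f)
           + (if i = j then Var (vr p i) * partial (vr p j) f else 0))"
      unfolding polar_def[of m p q] polar_def[of m q p] partial_linear sum_distrib_left
      by (intro sum.cong refl) (auto simp: partial_Var_mult partial_commute algebra_simps)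
    also have "\<dots> = U + polar m p p f"
      by (simp add: sum.distrib U_def polar_def)
    finally have P: "polar m p q (polar m q p f) = U + polar m p p f" .
    show "cscale 2 (S p q - T p q) = cscale 2 (quad m p q * lap m p q f
      - polar m p q (polar m q p f) + polar m p p f + (if p = q then cscale (1 - of_nat m) (polar m p p f) else 0))"
      unfolding S T P
      by (cases "p = q") (simp_all, rule poly_mapping_eqI, simp add: lookup_simps algebra_simps)
  qed
  also have "\<dots> = cscale 2 ((\<Sum>p\<in>UNIV. \<Sum>q\<in>UNIV. quad m p q * lap m p q f
      - polar m p q (polar m q p f) + polar m p p f) + cscale (1 - of_nat m) (\<Sum>p\<in>UNIV. polar m p p f))"
    by (simp add: sum_blk) (rule poly_mapping_eqI, simp add: lookup_simps algebra_simps)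
  finally show ?thesis .
qed

section \<open>Linear algebra\<close>

text \<open>The separating operator may depend on the pair, as is needed when one pair is separated
  by one Casimir operator and another pair by the other. Subtracting the eigenvalue of
  \<open>w j\<close> removes \<open>w j\<close> from the sum and rescales the other vectors, to
  which the induction applies. With \<open>U = {0}\<close> the statement becomes linear
  independence.\<close>

lemma eigenvector_components_in_subspace:
  assumes "finite J" "cv.subspace U" "(\<Sum>i\<in>J. w i) \<in> U"
    and sep: "\<And>i j. i \<in> J \<Longrightarrow> j \<in> J \<Longrightarrow> i \<noteq> j \<Longrightarrow>
      \<exists>F \<mu>. linear_op F \<and> F ` U \<subseteq> U \<and> (\<forall>k\<in>J. F (w k) = cscale (\<mu> k) (w k)) \<and> \<mu> i \<noteq> \<mu> j"
    and "i \<in> J"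
  shows "w i \<in> U"
  using assms(1,3-5)
proof (induction J arbitrary: w i rule: finite_induct)
  case empty then show ?case by simp
next
  case (insert j J)
  have J: "w i \<in> U" if i: "i \<in> J" for i
  proof -
    obtain F \<mu> where F: "linear_op F" "F ` U \<subseteq> U" "\<And>k. k \<in> insert j J \<Longrightarrow> F (w k) = cscale (\<mu> k) (w k)"
      and ne: "\<mu> i \<noteq> \<mu> j"
      using insert.prems(2)[of i j] i insert.hyps by blast
    let ?s = "\<Sum>k\<in>insert j J. w k"
    have "F ?s - cscale (\<mu> j) ?s = (\<Sum>k\<in>insert j J. cscale (\<mu> k - \<mu> j) (w k))"
      using F(3) by (simp add: linear_opD[OF F(1)] cv.scale_sum_right sum_subtractf cv.scale_left_diff_distrib
          del: sum.insert)
    also have "\<dots> = (\<Sum>k\<in>J. cscale (\<mu> k - \<mu> j) (w k))"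
      using insert.hyps by simp
    finally have "(\<Sum>k\<in>J. cscale (\<mu> k - \<mu> j) (w k)) \<in> U"
      using F(2) insert.prems(1) assms(2) by (metis cv.subspace_diff cv.subspace_scale image_subset_iff)
    then have "cscale (\<mu> i - \<mu> j) (w i) \<in> U"
    proof (rule insert.IH[OF _ _ i])
      fix a b assume ab: "a \<in> J" "b \<in> J" "a \<noteq> b"
      then obtain G \<nu> where G: "linear_op G" "G ` U \<subseteq> U" "\<forall>k\<in>insert j J. G (w k) = cscale (\<nu> k) (w k)" "\<nu> a \<noteq> \<nu> b"
        using insert.prems(2)[of a b] by blast
      then show "\<exists>F \<nu>. linear_op F \<and> F ` U \<subseteq> U \<and>
          (\<forall>k\<in>J. F (cscale (\<mu> k - \<mu> j) (w k)) = cscale (\<nu> k) (cscale (\<mu> k - \<mu> j) (w k))) \<and> \<nu> a \<noteq> \<nu> b"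
        by (intro exI[of _ G] exI[of _ \<nu>]) (auto simp: linear_opD[OF G(1)] mult.commute)
    qed
    then have "cscale (inverse (\<mu> i - \<mu> j)) (cscale (\<mu> i - \<mu> j) (w i)) \<in> U"
      using assms(2) cv.subspace_scale by blast
    then show ?thesis using ne by simp
  qed
  show ?case
  proof (cases "i = j")
    case True
    have "(\<Sum>k\<in>insert j J. w k) - (\<Sum>k\<in>J. w k) \<in> U"
      using J by (intro cv.subspace_diff[OF assms(2) insert.prems(1)] cv.subspace_sum[OF assms(2)])
    moreover have "(\<Sum>k\<in>insert j J. w k) - (\<Sum>k\<in>J. w k) = w j"
      using insert.hyps by simp
    ultimately show ?thesis by (simp only: True)
  next
    case False
    then show ?thesis using J insert.prems(3) by simp
  qed
qed

lemma funpow_last_nonzero: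
  assumes "(F ^^ n) u = 0" "u \<noteq> 0"
  shows "\<exists>k. (F ^^ k) u \<noteq> 0 \<and> F ((F ^^ k) u) = 0"
  using assms(1)
proof (induction n)
  case 0
  then show ?case using assms(2) by simp
next
  case (Suc n)
  then show ?case by (cases "(F ^^ n) u = 0") auto
qed

lemma funpow_in: "F ` U \<subseteq> U \<Longrightarrow> u \<in> U \<Longrightarrow> (F ^^ n) u \<in> U"
  by (induction n) auto

text \<open>Operators are added one at a time: the last nonzero power of a new operator on a vector
  killed by the old ones is still killed by them, because all commute.\<close>

lemma common_kernel_nonzero:
  assumes "finite I" "u \<in> U" "u \<noteq> 0"
    and inv: "\<And>i. i \<in> I \<Longrightarrow> F i ` U \<subseteq> U"
    and nil: "\<And>i u. i \<in> I \<Longrightarrow> u \<in> U \<Longrightarrow> \<exists>n. (F i ^^ n) u = 0"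
    and comm: "\<And>i j u. i \<in> I \<Longrightarrow> j \<in> I \<Longrightarrow> u \<in> U \<Longrightarrow> F i (F j u) = F j (F i u)"
    and zero: "\<And>i. i \<in> I \<Longrightarrow> F i 0 = 0"
  shows "\<exists>v\<in>U. v \<noteq> 0 \<and> (\<forall>i\<in>I. F i v = 0)"
  using assms(1,4-)
proof (induction I rule: finite_induct)
  case empty
  then show ?case using assms(2,3) by auto
next
  case (insert j I)
  then obtain v where v: "v \<in> U" "v \<noteq> 0" "\<forall>i\<in>I. F i v = 0" by auto
  obtain n where "(F j ^^ n) v = 0" using insert.prems(2) v(1) by blast
  then obtain k where k: "(F j ^^ k) v \<noteq> 0" "F j ((F j ^^ k) v) = 0"
    using funpow_last_nonzero v(2) by blast
  have U: "(F j ^^ n) v \<in> U" for n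
    using insert.prems(1)[of j] v(1) by (intro funpow_in) auto
  have "F i ((F j ^^ n) v) = 0" if "i \<in> I" for i n
  proof (induction n)
    case (Suc n)
    then show ?case using insert.prems(3)[of i j "(F j ^^ n) v"] U[of n] that insert.prems(4)[of j] by simp
  qed (use v that in simp)
  then show ?case using k U by auto
qed

section \<open>Spaces of polynomials\<close>

text \<open>With membership expressed by derivatives, closure under the operators follows from the
  rules of calculus.\<close>

lemma polys_iff: "f \<in> polys m \<longleftrightarrow> (\<forall>v. m \<le> var_index v \<longrightarrow> partial v f = 0)"
proof
  assume f: "f \<in> polys m"
  show "\<forall>v. m \<le> var_index v \<longrightarrow> partial v f = 0"
  proof (intro allI impI poly_mapping_eqI)
    fix v and t :: "var \<Rightarrow>\<^sub>0 nat" assume v: "m \<le> var_index v"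
    have "v \<in> Poly_Mapping.keys (t + Poly_Mapping.single v 1)"
      by (simp add: in_keys_iff lookup_add)
    then have "t + Poly_Mapping.single v 1 \<notin> Poly_Mapping.keys f"
      using f v unfolding polys_def by force
    then show "Poly_Mapping.lookup (partial v f) t = Poly_Mapping.lookup 0 t"
      by (simp only: lookup_partial in_keys_iff) simp
  qed
next
  assume d: "\<forall>v. m \<le> var_index v \<longrightarrow> partial v f = 0"
  show "f \<in> polys m" unfolding polys_def
  proof (intro CollectI ballI, rule ccontr)
    fix t v assume t: "t \<in> Poly_Mapping.keys f" "v \<in> Poly_Mapping.keys t" "\<not> var_index v < m"
    then have "Poly_Mapping.lookup (Var v * partial v f) t = 0" using d by simp
    then show False using t by (simp add: lookup_Var_partial in_keys_iff)
  qed
qed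

lemma subspace_polys: "cv.subspace (polys m)"
  by (rule cv.subspaceI) (auto simp: polys_iff partial_cscale)

lemma polys_partial: "f \<in> polys m \<Longrightarrow> partial v f \<in> polys m"
  by (auto simp: polys_iff partial_commute[of _ v])

lemma polys_mult: "f \<in> polys m \<Longrightarrow> g \<in> polys m \<Longrightarrow> f * g \<in> polys m"
  by (auto simp: polys_iff partial_mult)

lemma polys_Var: "j < m \<Longrightarrow> Var (vr p j) \<in> polys m"
  by (auto simp: polys_iff)

lemma polys_sum: "(\<And>i. i \<in> I \<Longrightarrow> h i \<in> polys m) \<Longrightarrow> sum h I \<in> polys m"
  by (rule cv.subspace_sum[OF subspace_polys])

lemma polys_Cst: "Cst c \<in> polys m"
  by (simp add: polys_iff)

lemmas polys_lin = cv.subspace_add[OF subspace_polys] cv.subspace_diff[OF subspace_polys]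
  cv.subspace_scale[OF subspace_polys] cv.subspace_0[OF subspace_polys]

lemma polys_ops:
  assumes "f \<in> polys m"
  shows "polar m p q f \<in> polys m" "lap m p q f \<in> polys m" "quad m p q * f \<in> polys m"
    "so_action m A f \<in> polys m" "sl2_raise m f \<in> polys m" "sl2_lower m f \<in> polys m"
    "sl2_euler m f \<in> polys m"
proof -
  show 1: "polar m p q f \<in> polys m" "lap m p q f \<in> polys m" "quad m p q * f \<in> polys m" for p q
    unfolding polar_def lap_def quad_def using assms
    by (auto intro!: polys_sum polys_mult polys_Var polys_partial)
  show "so_action m A f \<in> polys m"
    unfolding so_action_def so_L_blk using assms
    by (auto intro!: polys_sum polys_mult polys_Var polys_partial polys_lin)
  show "sl2_raise m f \<in> polys m" "sl2_lower m f \<in> polys m" "sl2_euler m f \<in> polys m"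
    unfolding sl2_raise_eq sl2_lower_eq sl2_euler_eq using 1 assms by (auto intro!: polys_lin)
qed

lemma lookup_polar_self:
  "Poly_Mapping.lookup (polar m p p f) t = of_nat (\<Sum>j<m. Poly_Mapping.lookup t (vr p j)) * Poly_Mapping.lookup f t"
  by (simp add: polar_def lookup_sum lookup_Var_partial sum_distrib_right)

definition z_only :: "nat \<Rightarrow> cpoly set" where
  "z_only m = {f \<in> polys m. \<forall>i. partial (vr BX i) f = 0 \<and> partial (vr BY i) f = 0}"

text \<open>Total degree one in (x,y) is encoded as an eigenvalue equation of the Euler operator, so
  invariance under an operator is a commutation relation.\<close>

definition xy_linear :: "nat \<Rightarrow> cpoly set" where
  "xy_linear m = {f \<in> polys m. polar m BX BX f + polar m BY BY f = f}"

lemma lookup_xy_euler: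
  "Poly_Mapping.lookup (polar m BX BX f + polar m BY BY f) t = of_nat (xy_degree m t) * Poly_Mapping.lookup f t"
  by (simp add: lookup_add lookup_polar_self xy_degree_def sum.distrib vr.simps algebra_simps)

lemma symplectic_monogenics_1: "symplectic_monogenics m 1 = {f \<in> xy_linear m. D_s m f = 0}"
proof -
  have "(\<forall>t\<in>Poly_Mapping.keys f. xy_degree m t = 1) \<longleftrightarrow> polar m BX BX f + polar m BY BY f = f" for f
  proof -
    have e: "of_nat (xy_degree m t) * c = c \<longleftrightarrow> c = 0 \<or> xy_degree m t = 1" for t and c :: complex
      by (metis mult_cancel_right1 of_nat_eq_1_iff)
    show ?thesis unfolding poly_mapping_eq_iff fun_eq_iff lookup_xy_euler e by (auto simp: in_keys_iff)
  qed
  then show ?thesis by (auto simp: symplectic_monogenics_def xy_linear_def)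
qed

lemma xy_degree_0_partial:
  assumes "g \<in> polys m" "polar m BX BX g + polar m BY BY g = 0" "p \<noteq> BZ"
  shows "partial (vr p i) g = 0"
proof (cases "i < m")
  case True
  show ?thesis
  proof (rule poly_mapping_eqI)
    fix t :: "var \<Rightarrow>\<^sub>0 nat"
    let ?s = "t + Poly_Mapping.single (vr p i) 1"
    have "of_nat (xy_degree m ?s) * Poly_Mapping.lookup g ?s
        = Poly_Mapping.lookup (polar m BX BX g + polar m BY BY g) ?s"
      by (rule lookup_xy_euler [symmetric])
    also have "\<dots> = 0" using assms(2) by simp
    finally have z: "xy_degree m ?s = 0 \<or> Poly_Mapping.lookup g ?s = 0" by simp
    have "Poly_Mapping.lookup ?s (VX i) + Poly_Mapping.lookup ?s (VY i) \<noteq> 0"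
      using assms(3) by (cases p) (auto simp: lookup_add vr.simps)
    then have "xy_degree m ?s \<noteq> 0"
      unfolding xy_degree_def using True by (simp only: sum_eq_0_iff finite_lessThan) auto
    then show "Poly_Mapping.lookup (partial (vr p i) g) t = Poly_Mapping.lookup 0 t"
      using z by (simp only: lookup_partial) simp
  qed
next
  case False
  then show ?thesis using assms(1) by (simp add: polys_iff)
qed

lemma xy_linear_partial:
  assumes f: "f \<in> xy_linear m" and p: "p \<noteq> BZ"
  shows "partial (vr p i) f \<in> z_only m"
proof (cases "i < m")
  case True
  have f': "f \<in> polys m" "polar m BX BX f + polar m BY BY f = f" using f by (auto simp: xy_linear_def)
  let ?g = "partial (vr p i) f"
  have "?g = partial (vr p i) (polar m BX BX f + polar m BY BY f)" by (simp add: f'(2))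
  also have "\<dots> = polar m BX BX ?g + polar m BY BY ?g + ?g"
    using p True by (cases p) (auto simp: partial_polar)
  finally have "polar m BX BX ?g + polar m BY BY ?g = 0" by simp
  then show ?thesis
    using xy_degree_0_partial[OF polys_partial[OF f'(1)]] by (simp add: z_only_def polys_partial[OF f'(1)])
next
  case False
  then show ?thesis using f by (simp add: z_only_def xy_linear_def polys_iff)
qed

lemma z_onlyD:
  assumes "g \<in> z_only m"
  shows "p \<noteq> BZ \<Longrightarrow> partial (vr p i) g = 0" "g \<in> polys m"
    "q \<noteq> BZ \<Longrightarrow> polar m p q g = 0" "q \<noteq> BZ \<Longrightarrow> lap m p q g = 0" "q \<noteq> BZ \<Longrightarrow> lap m q p g = 0"
proof -
  show *: "p \<noteq> BZ \<Longrightarrow> partial (vr p i) g = 0" for p i using assms by (cases p) (auto simp: z_only_def)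
  show "g \<in> polys m" using assms by (simp add: z_only_def)
  show "q \<noteq> BZ \<Longrightarrow> polar m p q g = 0" by (simp add: polar_def *)
  show "q \<noteq> BZ \<Longrightarrow> lap m p q g = 0" by (simp add: lap_def *)
  then show "q \<noteq> BZ \<Longrightarrow> lap m q p g = 0" by (simp add: lap_commute)
qed

lemma subspace_z_only: "cv.subspace (z_only m)"
  by (rule cv.subspaceI) (auto simp: z_only_def partial_cscale polys_lin)

lemma subspace_xy_linear: "cv.subspace (xy_linear m)"
  by (rule cv.subspaceI) (auto simp: xy_linear_def polys_lin op_linear algebra_simps simp flip: cv.scale_right_distrib)

lemma subspace_kernel: "linear_op F \<Longrightarrow> cv.subspace V \<Longrightarrow> cv.subspace {f \<in> V. F f = 0}"
  by (rule cv.subspaceI) (auto simp: linear_opD cv.subspace_add cv.subspace_scale cv.subspace_0)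

lemma subspace_symplectic_monogenics: "cv.subspace (symplectic_monogenics m 1)"
  unfolding symplectic_monogenics_1 by (intro subspace_kernel linear_op_sl2 subspace_xy_linear)

lemma xy_linear_ops:
  assumes f: "f \<in> xy_linear m"
  shows "A \<in> lie_carrier (so m) \<Longrightarrow> so_action m A f \<in> xy_linear m"
    "sl2_raise m f \<in> xy_linear m" "sl2_lower m f \<in> xy_linear m" "sl2_euler m f \<in> xy_linear m"
proof -
  have f': "f \<in> polys m" "polar m BX BX f + polar m BY BY f = f" using f by (auto simp: xy_linear_def)
  have e: "polar m BX BX (F f) + polar m BY BY (F f) = F f"
    if "F (polar m BX BX f + polar m BY BY f) = polar m BX BX (F f) + polar m BY BY (F f)" for F
    using that f'(2) by simp
  show "A \<in> lie_carrier (so m) \<Longrightarrow> so_action m A f \<in> xy_linear m"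
    unfolding xy_linear_def using f'(1) polys_ops e[of "so_action m A"]
    by (simp add: so_action_linear so_action_polar)
  show "sl2_raise m f \<in> xy_linear m"
    unfolding xy_linear_def using f'(1) polys_ops
    by (intro CollectI conjI e) (simp_all add: sl2_raise_eq calculus polar_polar[of m BX BX BY BX f]
       polar_polar[of m BY BY BY BX f] algebra_simps)
  show "sl2_lower m f \<in> xy_linear m"
    unfolding xy_linear_def using f'(1) polys_ops
    by (intro CollectI conjI e) (simp_all add: sl2_lower_eq calculus polar_polar[of m BX BX BX BY f]
       polar_polar[of m BY BY BX BY f] algebra_simps)
  show "sl2_euler m f \<in> xy_linear m"
    unfolding xy_linear_def using f'(1) polys_ops
    by (intro CollectI conjI e) (simp_all add: sl2_euler_eq calculus polar_polar[of m BX BX BY BY f]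
       polar_polar[of m BX BX BZ BZ f] polar_polar[of m BY BY BZ BZ f] algebra_simps)
qed

lemma xy_linear_expand:
  assumes "f \<in> xy_linear m"
  shows "f = (\<Sum>i<m. Var (vr BX i) * partial (vr BX i) f) + (\<Sum>i<m. Var (vr BY i) * partial (vr BY i) f)"
  using assms by (simp add: xy_linear_def polar_def)

section \<open>Weights of the Euler operator\<close>

definition weight :: "nat \<Rightarrow> (var \<Rightarrow>\<^sub>0 nat) \<Rightarrow> int" where
  "weight m t = int (\<Sum>j<m. Poly_Mapping.lookup t (vr BY j)) - int (\<Sum>j<m. Poly_Mapping.lookup t (vr BX j))
     + int (\<Sum>j<m. Poly_Mapping.lookup t (vr BZ j))"

lemma lookup_euler:
  "Poly_Mapping.lookup (sl2_euler m f) t = (of_nat m / 2 + of_int (weight m t)) * Poly_Mapping.lookup f t"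
  unfolding sl2_euler_eq lookup_add lookup_minus lookup_polar_self lookup_cscale
  by (simp add: weight_def algebra_simps)

text \<open>The operator is diagonal on monomials, so \<open>f\<close> splits by weight; the
  components stay in \<open>U\<close> because their eigenvalues differ.\<close>

lemma weight_decomposition:
  assumes U: "cv.subspace U" "sl2_euler m ` U \<subseteq> U" and f: "f \<in> U"
  obtains J w where "finite J" "f = (\<Sum>n\<in>J. w n)"
    "\<And>n. n \<in> J \<Longrightarrow> w n \<in> U" "\<And>n. sl2_euler m (w n) = cscale (of_nat m / 2 + of_int n) (w n)"
proof -
  define w where "w n = (\<Sum>t\<in>Poly_Mapping.keys f. if weight m t = n then Poly_Mapping.single t (Poly_Mapping.lookup f t) else 0)" for n
  have lw: "Poly_Mapping.lookup (w n) t = (if weight m t = n then Poly_Mapping.lookup f t else 0)" for n t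
  proof -
    have "Poly_Mapping.lookup (w n) t = (\<Sum>s\<in>Poly_Mapping.keys f. if s = t then (if weight m t = n then Poly_Mapping.lookup f t else 0) else 0)"
      unfolding w_def lookup_sum by (intro sum.cong refl) (auto simp: lookup_single)
    then show ?thesis by (auto simp: in_keys_iff)
  qed
  define J where "J = weight m ` Poly_Mapping.keys f"
  have E: "sl2_euler m (w n) = cscale (of_nat m / 2 + of_int n) (w n)" for n
    by (rule poly_mapping_eqI) (simp add: lookup_euler lw)
  have sum: "f = (\<Sum>n\<in>J. w n)"
    by (rule poly_mapping_eqI) (auto simp: lookup_sum lw J_def in_keys_iff)
  have "w n \<in> U" if "n \<in> J" for n
  proof (rule eigenvector_components_in_subspace[OF _ U(1) _ _ that])
    show "finite J" by (simp add: J_def)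
    show "sum w J \<in> U" using f sum by simp
    fix i j :: int assume "i \<noteq> j"
    then show "\<exists>F \<mu>. linear_op F \<and> F ` U \<subseteq> U \<and> (\<forall>k\<in>J. F (w k) = cscale (\<mu> k) (w k)) \<and> \<mu> i \<noteq> \<mu> j"
      using E U(2) by (intro exI[of _ "sl2_euler m"] exI[of _ "\<lambda>n. of_nat m / 2 + of_int n"])
        (simp add: linear_op_sl2)
  qed
  moreover have "finite J" by (simp add: J_def)
  ultimately show ?thesis using that[OF _ sum _ E] by blast
qed

text \<open>A monomial with one factor from x and y has weight at least -1, the value being attained
  by a single variable of x.\<close>

lemma weight_bound:
  assumes f: "f \<in> xy_linear m" and E: "sl2_euler m f = cscale (of_nat m / 2 + of_int n) f" and n: "n < - 1"
  shows "f = 0"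
proof (rule poly_mapping_eqI)
  fix t
  have "(of_nat m / 2 + of_int (weight m t)) * Poly_Mapping.lookup f t = (of_nat m / 2 + of_int n) * Poly_Mapping.lookup f t"
    by (metis E lookup_cscale lookup_euler)
  then have 1: "Poly_Mapping.lookup f t = 0 \<or> weight m t = n"
    by (metis add_left_cancel mult_right_cancel of_int_eq_iff)
  have "of_nat (xy_degree m t) * Poly_Mapping.lookup f t = Poly_Mapping.lookup f t"
    using f lookup_xy_euler[of m f t] by (simp add: xy_linear_def)
  then have "Poly_Mapping.lookup f t = 0 \<or> xy_degree m t = 1"
    by (metis mult_cancel_right1 of_nat_eq_1_iff)
  then have "Poly_Mapping.lookup f t = 0 \<or>
      (\<Sum>j<m. Poly_Mapping.lookup t (vr BX j)) + (\<Sum>j<m. Poly_Mapping.lookup t (vr BY j)) = 1"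
    by (simp add: xy_degree_def sum.distrib vr.simps)
  then have "Poly_Mapping.lookup f t = 0 \<or> weight m t \<ge> - 1"
    unfolding weight_def by linarith
  then show "Poly_Mapping.lookup f t = Poly_Mapping.lookup 0 t" using 1 n by auto
qed

text \<open>Weights drop by 2 in each step and are bounded below. This serves both
  \<open>sl2_lower\<close> and the operators Y of the symplectic algebra.\<close>

lemma weight_lowering_nilpotent:
  assumes F: "linear_op F" "F ` xy_linear m \<subseteq> xy_linear m"
    and c: "\<And>f. sl2_euler m (F f) = F (sl2_euler m f) - cscale 2 (F f)" and f: "f \<in> xy_linear m"
  shows "\<exists>n. (F ^^ n) f = 0"
proof -
  have "sl2_euler m ` xy_linear m \<subseteq> xy_linear m" using xy_linear_ops by auto
  then obtain J w where J: "finite J" "f = (\<Sum>n\<in>J. w n)" "\<And>n. n \<in> J \<Longrightarrow> w n \<in> xy_linear m"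
    "\<And>n. sl2_euler m (w n) = cscale (of_nat m / 2 + of_int n) (w n)"
    using weight_decomposition[OF subspace_xy_linear _ f] by metis
  \<comment> \<open>Inserting 0 makes the maximum exist and be nonnegative; then
    \<open>n - 2 * int N\<close> is at most -4 for each \<open>n\<close> in
    \<open>J\<close>.\<close>
  define N where "N = nat (Max (insert 0 J)) + 2"
  have wt: "sl2_euler m ((F ^^ k) (w n)) = cscale (of_nat m / 2 + of_int (n - 2 * int k)) ((F ^^ k) (w n))" for k n
  proof (induction k)
    case (Suc k)
    then show ?case
      by (simp add: c linear_opD[OF F(1)])
        (rule poly_mapping_eqI, simp add: lookup_simps algebra_simps)
  qed (simp add: J(4))
  have "(F ^^ N) (w n) = 0" if n: "n \<in> J" for n
  proof (rule weight_bound[OF _ wt])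
    show "(F ^^ N) (w n) \<in> xy_linear m" using F(2) J(3) n by (intro funpow_in) auto
    have "n \<le> Max (insert 0 J)" "0 \<le> Max (insert 0 J)" using J(1) n by simp_all
    moreover have "int N = Max (insert 0 J) + 2" unfolding N_def using calculation(2) by simp
    ultimately show "n - 2 * int N < - 1" by linarith
  qed
  moreover have "(F ^^ k) (sum w J) = (\<Sum>n\<in>J. (F ^^ k) (w n))" for k
    by (induction k) (simp_all add: linear_opD[OF F(1)])
  ultimately show ?thesis using J(2) by (intro exI[of _ N]) simp
qed

section \<open>The Fischer inner product\<close>

definition mfact :: "(var \<Rightarrow>\<^sub>0 nat) \<Rightarrow> real" where
  "mfact t = (\<Prod>v\<in>Poly_Mapping.keys t. fact (Poly_Mapping.lookup t v))"

definition fischer :: "cpoly \<Rightarrow> cpoly \<Rightarrow> complex" where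
  "fischer f g = (\<Sum>t\<in>Poly_Mapping.keys f. of_real (mfact t) * Poly_Mapping.lookup f t * cnj (Poly_Mapping.lookup g t))"

lemma mfact_superset:
  assumes "finite S" "Poly_Mapping.keys t \<subseteq> S"
  shows "mfact t = (\<Prod>v\<in>S. fact (Poly_Mapping.lookup t v))"
  unfolding mfact_def using assms by (intro prod.mono_neutral_left) (auto simp: in_keys_iff)

lemma mfact_pos: "mfact t > 0"
  by (simp add: mfact_def prod_pos)

lemma mfact_add_single: "mfact (Poly_Mapping.single v 1 + t) = (real (Poly_Mapping.lookup t v) + 1) * mfact t"
proof -
  let ?S = "insert v (Poly_Mapping.keys t)" and ?s = "Poly_Mapping.single v 1 + t"
  have "Poly_Mapping.keys ?s \<subseteq> ?S"
    using keys_add[of "Poly_Mapping.single v 1" t] by auto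
  then have "mfact ?s = (\<Prod>w\<in>?S. fact (Poly_Mapping.lookup ?s w))"
    by (intro mfact_superset) auto
  also have "\<dots> = fact (Poly_Mapping.lookup ?s v) * (\<Prod>w\<in>?S - {v}. fact (Poly_Mapping.lookup ?s w))"
    by (subst prod.remove[of ?S v]) auto
  also have "(\<Prod>w\<in>?S - {v}. fact (Poly_Mapping.lookup ?s w)) = (\<Prod>w\<in>?S - {v}. (fact (Poly_Mapping.lookup t w) :: real))"
    by (intro prod.cong refl) (auto simp: lookup_add lookup_single)
  also have "fact (Poly_Mapping.lookup ?s v) = (real (Poly_Mapping.lookup t v) + 1) * fact (Poly_Mapping.lookup t v)"
    by (simp add: lookup_add algebra_simps)
  also have "(real (Poly_Mapping.lookup t v) + 1) * fact (Poly_Mapping.lookup t v) * (\<Prod>w\<in>?S - {v}. fact (Poly_Mapping.lookup t w))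
      = (real (Poly_Mapping.lookup t v) + 1) * (\<Prod>w\<in>?S. fact (Poly_Mapping.lookup t w))"
    by (subst prod.remove[of ?S v]) auto
  also have "(\<Prod>w\<in>?S. fact (Poly_Mapping.lookup t w)) = mfact t"
    by (intro mfact_superset [symmetric]) auto
  finally show ?thesis .
qed

lemma fischer_superset:
  assumes "finite S" "Poly_Mapping.keys f \<subseteq> S"
  shows "fischer f g = (\<Sum>t\<in>S. of_real (mfact t) * Poly_Mapping.lookup f t * cnj (Poly_Mapping.lookup g t))"
  unfolding fischer_def using assms by (intro sum.mono_neutral_left) (auto simp: in_keys_iff)

lemma fischer_cnj: "fischer g f = cnj (fischer f g)"
proof -
  let ?S = "Poly_Mapping.keys f \<union> Poly_Mapping.keys g"
  have "fischer f g = (\<Sum>t\<in>?S. of_real (mfact t) * Poly_Mapping.lookup f t * cnj (Poly_Mapping.lookup g t))"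
    "fischer g f = (\<Sum>t\<in>?S. of_real (mfact t) * Poly_Mapping.lookup g t * cnj (Poly_Mapping.lookup f t))"
    by (auto intro!: fischer_superset)
  then show ?thesis by (simp add: mult_ac)
qed

lemma fischer_add_left: "fischer (f + g) h = fischer f h + fischer g h"
proof -
  let ?S = "Poly_Mapping.keys f \<union> Poly_Mapping.keys g \<union> Poly_Mapping.keys (f + g)"
  have "fischer k h = (\<Sum>t\<in>?S. of_real (mfact t) * Poly_Mapping.lookup k t * cnj (Poly_Mapping.lookup h t))"
    if "k \<in> {f, g, f + g}" for k
    by (rule fischer_superset) (use that in auto)
  then show ?thesis by (simp add: lookup_add algebra_simps sum.distrib)
qed

lemma fischer_cscale_left: "fischer (cscale c f) h = c * fischer f h"
proof -
  have "fischer (cscale c f) h = (\<Sum>t\<in>Poly_Mapping.keys f. of_real (mfact t) * Poly_Mapping.lookup (cscale c f) t * cnj (Poly_Mapping.lookup h t))"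
    by (rule fischer_superset) (auto simp: in_keys_iff)
  then show ?thesis by (simp add: fischer_def sum_distrib_left mult_ac)
qed

lemma fischer_add_right: "fischer f (g + h) = fischer f g + fischer f h"
  by (metis complex_cnj_add fischer_add_left fischer_cnj)

lemma fischer_cscale_right: "fischer f (cscale c g) = cnj c * fischer f g"
  by (metis complex_cnj_mult fischer_cnj fischer_cscale_left)

lemma fischer_zero [simp]: "fischer 0 g = 0" "fischer g 0 = 0"
  using fischer_cscale_left[of 0 0 g] fischer_cscale_right[of g 0 0] by simp_all

lemma fischer_minus [simp]: "fischer (- f) g = - fischer f g" "fischer f (- g) = - fischer f g"
  using fischer_cscale_left[of "-1" f g] fischer_cscale_right[of f "-1" g]
  by (simp_all add: cv.scale_minus_left)

lemma fischer_diff: "fischer (f - g) h = fischer f h - fischer g h" "fischer h (f - g) = fischer h f - fischer h g"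
  using fischer_add_left[of f "- g" h] fischer_add_right[of h f "- g"] by simp_all

lemma fischer_sum: "fischer (sum w I) h = (\<Sum>i\<in>I. fischer (w i) h)" "fischer h (sum w I) = (\<Sum>i\<in>I. fischer h (w i))"
  by (induction I rule: infinite_finite_induct) (simp_all add: fischer_add_left fischer_add_right)

lemma fischer_single:
  "fischer (Poly_Mapping.single t a) g = of_real (mfact t) * a * cnj (Poly_Mapping.lookup g t)"
  using fischer_superset[of "{t}" "Poly_Mapping.single t a" g] by simp

text \<open>The factorial weights of the Fischer product are chosen for this: multiplication by a
  variable is adjoint to its derivative.\<close>

lemma fischer_Var: "fischer (Var v * f) g = fischer f (partial v g)"
proof (induction f rule: poly_mapping_add_induct)
  case (single t a)
  have "Var v * Poly_Mapping.single t a = Poly_Mapping.single (Poly_Mapping.single v 1 + t) a"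
    by (rule single_add_Var [symmetric])
  then show ?case
    by (simp only: fischer_single mfact_add_single lookup_partial add.commute[of t]) simp
qed (simp_all add: algebra_simps fischer_add_left)

lemma fischer_partial: "fischer (partial v f) g = fischer f (Var v * g)"
  by (metis fischer_Var fischer_cnj)

lemma fischer_self: "fischer f f = 0 \<longleftrightarrow> f = 0"
proof
  assume 0: "fischer f f = 0"
  have "fischer f f = of_real (\<Sum>t\<in>Poly_Mapping.keys f. mfact t * (cmod (Poly_Mapping.lookup f t))\<^sup>2)"
    unfolding fischer_def of_real_sum
    by (intro sum.cong refl) (simp add: mult.assoc flip: complex_norm_square)
  then have "(\<Sum>t\<in>Poly_Mapping.keys f. mfact t * (cmod (Poly_Mapping.lookup f t))\<^sup>2) = 0"
    using 0 by (metis of_real_eq_0_iff)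
  then have "\<forall>t\<in>Poly_Mapping.keys f. mfact t * (cmod (Poly_Mapping.lookup f t))\<^sup>2 = 0"
    by (subst (asm) sum_nonneg_eq_0_iff) (auto simp: mfact_pos less_imp_le)
  then have "Poly_Mapping.lookup f t = 0" for t
    using mfact_pos[of t] by (cases "t \<in> Poly_Mapping.keys f") (auto simp: in_keys_iff)
  then show "f = 0" by (intro poly_mapping_eqI) simp
qed simp

lemma fischer_orthogonal_span:
  assumes "\<And>b. b \<in> B \<Longrightarrow> fischer f b = 0" "u \<in> cv.span B"
  shows "fischer f u = 0"
  using assms(2)
  by (induction rule: cv.span_induct_alt) (simp_all add: assms(1) fischer_add_right fischer_cscale_right)

text \<open>Gram-Schmidt, one spanning vector at a time.\<close>

lemma fischer_projection:
  assumes "finite B"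
  shows "\<exists>u\<in>cv.span B. \<forall>b\<in>cv.span B. fischer (f - u) b = 0"
  using assms
proof (induction B arbitrary: f rule: finite_induct)
  case (insert b B)
  obtain p where p: "p \<in> cv.span B" "\<forall>c\<in>cv.span B. fischer (b - p) c = 0" using insert.IH by blast
  obtain q where q: "q \<in> cv.span B" "\<forall>c\<in>cv.span B. fischer (f - q) c = 0" using insert.IH by blast
  define e where "e = b - p"
  \<comment> \<open>If \<open>e = 0\<close> then \<open>r\<close> is 0 by division by zero, and the
    equation \<open>re\<close> below still holds.\<close>
  define r where "r = fischer f e / fischer e e"
  have sub: "cv.span B \<subseteq> cv.span (insert b B)" by (rule cv.span_mono) auto
  have e: "e \<in> cv.span (insert b B)"
    unfolding e_def using p(1) sub by (intro cv.span_diff) (auto intro: cv.span_base)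
  have u: "q + cscale r e \<in> cv.span (insert b B)"
    using q(1) sub e by (intro cv.span_add cv.span_scale) auto
  have eB: "fischer e c = 0" "fischer c e = 0" if "c \<in> cv.span B" for c
    using p(2) that by (auto simp: e_def fischer_cnj[of c])
  have B: "fischer (f - (q + cscale r e)) c = 0" if "c \<in> cv.span B" for c
    using q(2) that eB[OF that] by (simp add: fischer_diff fischer_add_left fischer_cscale_left)
  have re: "r * fischer e e = fischer f e"
    by (cases "e = 0") (auto simp: r_def fischer_self)
  have "fischer (f - (q + cscale r e)) e = 0"
    using re eB(2)[OF q(1)] by (simp add: fischer_diff fischer_add_left fischer_cscale_left)
  then have "fischer (f - (q + cscale r e)) (e + p) = 0"
    using B[OF p(1)] by (simp add: fischer_add_right)
  then have b: "fischer (f - (q + cscale r e)) b = 0" by (simp add: e_def)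
  have "\<forall>c\<in>cv.span (insert b B). fischer (f - (q + cscale r e)) c = 0"
    using fischer_orthogonal_span[of "insert b B"] B b by (metis cv.span_base insert_iff)
  then show ?case using u by blast
qed auto

lemma finite_exponents:
  assumes "finite V"
  shows "finite {t :: var \<Rightarrow>\<^sub>0 nat. Poly_Mapping.keys t \<subseteq> V \<and> (\<forall>v. Poly_Mapping.lookup t v \<le> N)}"
proof (rule finite_imageD)
  have "Poly_Mapping.lookup ` {t. Poly_Mapping.keys t \<subseteq> V \<and> (\<forall>v. Poly_Mapping.lookup t v \<le> N)}
      \<subseteq> {h. \<forall>v. (v \<in> V \<longrightarrow> h v \<in> {..N}) \<and> (v \<notin> V \<longrightarrow> h v = 0)}"
    by (auto simp: in_keys_iff subset_iff)
  then show "finite (Poly_Mapping.lookup ` {t :: var \<Rightarrow>\<^sub>0 nat. Poly_Mapping.keys t \<subseteq> V \<and> (\<forall>v. Poly_Mapping.lookup t v \<le> N)})"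
    by (rule finite_subset) (intro finite_set_of_finite_funs assms finite_atMost)
qed (auto intro!: inj_onI poly_mapping_eqI)

lemma finite_vars: "finite {v. var_index v < m}"
proof -
  have "{v. var_index v < m} \<subseteq> (\<lambda>(p, j). vr p j) ` (UNIV \<times> {..<m})"
  proof
    fix v assume "v \<in> {v. var_index v < m}"
    moreover obtain p j where "v = vr p j" using ex_vr by blast
    ultimately show "v \<in> (\<lambda>(p, j). vr p j) ` (UNIV \<times> {..<m})" by auto
  qed
  then show ?thesis by (rule finite_subset) simp
qed

lemma finite_dimensional_subspace:
  assumes U: "cv.subspace U" "U \<subseteq> polys m"
    and N: "\<And>f t v. f \<in> U \<Longrightarrow> t \<in> Poly_Mapping.keys f \<Longrightarrow> Poly_Mapping.lookup t v \<le> N"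
  shows "\<exists>B. finite B \<and> cv.span B = U"
proof -
  define S where "S = (\<lambda>t. Poly_Mapping.single t (1::complex)) `
    {t. Poly_Mapping.keys t \<subseteq> {v. var_index v < m} \<and> (\<forall>v. Poly_Mapping.lookup t v \<le> N)}"
  have S: "finite S" unfolding S_def by (intro finite_imageI finite_exponents finite_vars)
  have sub: "U \<subseteq> cv.span S"
  proof
    fix f assume f: "f \<in> U"
    have "f = (\<Sum>t\<in>Poly_Mapping.keys f. cscale (Poly_Mapping.lookup f t) (Poly_Mapping.single t 1))"
    proof (rule poly_mapping_eqI)
      fix s
      have "(\<Sum>t\<in>Poly_Mapping.keys f. Poly_Mapping.lookup f t * Poly_Mapping.lookup (Poly_Mapping.single t 1) s)
          = (\<Sum>t\<in>Poly_Mapping.keys f. if t = s then Poly_Mapping.lookup f s else 0)"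
        by (intro sum.cong refl) (simp add: lookup_single)
      then show "Poly_Mapping.lookup f s = Poly_Mapping.lookup
          (\<Sum>t\<in>Poly_Mapping.keys f. cscale (Poly_Mapping.lookup f t) (Poly_Mapping.single t 1)) s"
        by (simp add: lookup_sum in_keys_iff)
    qed
    also have "\<dots> \<in> cv.span S"
    proof (intro cv.span_sum cv.span_scale cv.span_base)
      fix t assume t: "t \<in> Poly_Mapping.keys f"
      have "Poly_Mapping.keys t \<subseteq> {v. var_index v < m}" using f t U(2) by (auto simp: polys_def)
      then show "Poly_Mapping.single t 1 \<in> S" using N[OF f t] by (auto simp: S_def)
    qed
    finally show "f \<in> cv.span S" .
  qed
  obtain B where B: "B \<subseteq> U" "cv.independent B" "U \<subseteq> cv.span B"
    using cv.maximal_independent_subset[of U] by metis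
  have "finite B" using cv.independent_span_bound[OF S B(2)] B(1) sub by blast
  moreover have "cv.span B = U" using B U(1) by (metis cv.span_minimal subset_antisym)
  ultimately show ?thesis by blast
qed

section \<open>A criterion for the irreducibility of so(m)-modules\<close>

lemma so_action_invariant_iff:
  assumes "cv.subspace U"
  shows "(\<forall>F\<in>so_action m ` lie_carrier (so m). F ` U \<subseteq> U) \<longleftrightarrow> (\<forall>i<m. \<forall>j<m. so_L i j ` U \<subseteq> U)"
proof
  assume "\<forall>F\<in>so_action m ` lie_carrier (so m). F ` U \<subseteq> U"
  then show "\<forall>i<m. \<forall>j<m. so_L i j ` U \<subseteq> U"
    using elem_skew_so so_L_action by fastforce
next
  assume "\<forall>i<m. \<forall>j<m. so_L i j ` U \<subseteq> U"
  then show "\<forall>F\<in>so_action m ` lie_carrier (so m). F ` U \<subseteq> U"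
    unfolding so_action_def
    by (auto intro!: cv.subspace_sum[OF assms] cv.subspace_scale[OF assms] simp: image_subset_iff)
qed

lemma fischer_so_L: "fischer (so_L i j f) g = - fischer f (so_L i j g)"
proof -
  have "fischer (so_L i j f) g = (\<Sum>p\<in>UNIV. fischer f (Var (vr p j) * partial (vr p i) g) - fischer f (Var (vr p i) * partial (vr p j) g))"
    unfolding so_L_blk fischer_sum fischer_diff fischer_Var fischer_partial
    by (rule refl)
  then show ?thesis
    unfolding so_L_blk fischer_sum fischer_diff by (simp add: sum_subtractf)
qed

text \<open>For an invariant \<open>U\<close> other than 0 and \<open>M\<close>, the orthogonal
  complement of \<open>U\<close> in \<open>M\<close> is invariant because the generators are skew
  for the Fischer product, and nonzero by projection onto the finite-dimensional \<open>U\<close>.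
  Both subspaces would contain \<open>v\<close>, which would be orthogonal to itself.\<close>

lemma so_irreducibleI:
  assumes M: "cv.subspace M" "finite B" "cv.span B = M"
    and inv: "\<And>i j. i < m \<Longrightarrow> j < m \<Longrightarrow> so_L i j ` M \<subseteq> M"
    and v: "v \<in> M" "v \<noteq> 0"
    and cyc: "\<And>U. cv.subspace U \<Longrightarrow> U \<subseteq> M \<Longrightarrow> U \<noteq> {0} \<Longrightarrow> (\<And>i j. i < m \<Longrightarrow> j < m \<Longrightarrow> so_L i j ` U \<subseteq> U) \<Longrightarrow> v \<in> U"
  shows "irreducible_under (so_action m ` lie_carrier (so m)) M"
  unfolding irreducible_under_def
proof (intro conjI allI impI)
  show "cv.subspace M" by fact
  show "M \<noteq> {0}" using v by auto
  show "\<forall>F\<in>so_action m ` lie_carrier (so m). F ` M \<subseteq> M"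
    using so_action_invariant_iff[OF M(1)] inv by blast
  fix U assume "cv.subspace U \<and> U \<subseteq> M \<and> (\<forall>F\<in>so_action m ` lie_carrier (so m). F ` U \<subseteq> U)"
  then have U: "cv.subspace U" "U \<subseteq> M" "\<And>i j. i < m \<Longrightarrow> j < m \<Longrightarrow> so_L i j ` U \<subseteq> U"
    using so_action_invariant_iff[of U m] by auto
  show "U = {0} \<or> U = M"
  proof (rule ccontr)
    assume "\<not> (U = {0} \<or> U = M)"
    then obtain f where f: "f \<in> M" "f \<notin> U" and "U \<noteq> {0}" using U(2) by blast
    then have vU: "v \<in> U" using cyc U by blast
    define W where "W = {f \<in> M. \<forall>u\<in>U. fischer f u = 0}"
    have W: "cv.subspace W"
      using M(1) by (auto simp: W_def cv.subspace_def fischer_add_left fischer_cscale_left)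
    have Winv: "so_L i j ` W \<subseteq> W" if "i < m" "j < m" for i j
      using inv[OF that] U(3)[OF that] by (auto simp: W_def fischer_so_L image_subset_iff)
    obtain C where C: "C \<subseteq> U" "cv.independent C" "U \<subseteq> cv.span C"
      using cv.maximal_independent_subset[of U] by metis
    have "finite C" using cv.independent_span_bound[OF M(2) C(2)] C(1) U(2) M(3) by blast
    moreover have CU: "cv.span C = U" using C U(1) by (metis cv.span_minimal subset_antisym)
    ultimately obtain u where u: "u \<in> U" "\<forall>b\<in>U. fischer (f - u) b = 0"
      using fischer_projection[of C f] by auto
    then have "f - u \<in> W" using f U(2) M(1) by (auto simp: W_def intro: cv.subspace_diff)
    moreover have "f - u \<noteq> 0" using f(2) u(1) by auto
    ultimately have "W \<noteq> {0}" by blast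
    moreover have "W \<subseteq> M" by (auto simp: W_def)
    ultimately have "v \<in> W" using cyc[OF W _ _ Winv] by blast
    then have "fischer v v = 0" using vU by (simp add: W_def)
    then show False using v(2) by (simp add: fischer_self)
  qed
qed

lemma polar_self_exponent:
  assumes "polar m p p f = cscale (of_nat d) f" "t \<in> Poly_Mapping.keys f" "j < m"
  shows "Poly_Mapping.lookup t (vr p j) \<le> d"
proof -
  have "of_nat (\<Sum>j<m. Poly_Mapping.lookup t (vr p j)) * Poly_Mapping.lookup f t = of_nat d * Poly_Mapping.lookup f t"
    by (metis lookup_polar_self lookup_cscale assms(1))
  then have "(\<Sum>j<m. Poly_Mapping.lookup t (vr p j)) = d"
    using assms(2) by (metis in_keys_iff mult_right_cancel of_nat_eq_iff)
  then show ?thesis using member_le_sum[of j "{..<m}" "\<lambda>j. Poly_Mapping.lookup t (vr p j)"] assms(3) by simp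
qed

lemma finite_dimensional_multihomogeneous:
  assumes U: "cv.subspace U" "U \<subseteq> polys m"
    and d: "\<And>f p. f \<in> U \<Longrightarrow> polar m p p f = cscale (of_nat (d p)) f"
  shows "\<exists>B. finite B \<and> cv.span B = U"
proof (rule finite_dimensional_subspace[OF U])
  fix f t v assume f: "f \<in> U" "t \<in> Poly_Mapping.keys f"
  show "Poly_Mapping.lookup t v \<le> Max (range d)"
  proof (cases "v \<in> Poly_Mapping.keys t")
    case True
    obtain p j where v: "v = vr p j" using ex_vr by blast
    then have "j < m" using True f U(2) by (force simp: polys_def)
    then have "Poly_Mapping.lookup t v \<le> d p"
      using polar_self_exponent[OF d[OF f(1)] f(2)] v by simp
    also have "\<dots> \<le> Max (range d)" by simp
    finally show ?thesis .
  qed (simp add: in_keys_iff)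
qed

section \<open>Irreducible modules for the orthogonal Lie algebra\<close>

text \<open>
  Null coordinates: \<open>e\<^sub>0 + \<i> e\<^sub>1\<close> is isotropic, so \<open>nd\<close> kills \<open>nv\<close> and powers of \<open>nv\<close> are harmonic.
\<close>

definition nv :: "blk \<Rightarrow> cpoly" where "nv p = Var (vr p 0) + cscale \<i> (Var (vr p 1))"
definition nv' :: "blk \<Rightarrow> cpoly" where "nv' p = Var (vr p 0) - cscale \<i> (Var (vr p 1))"
definition nd :: "blk \<Rightarrow> cpoly \<Rightarrow> cpoly" where
  "nd p f = partial (vr p 0) f + cscale \<i> (partial (vr p 1) f)"
definition nd' :: "blk \<Rightarrow> cpoly \<Rightarrow> cpoly" where
  "nd' p f = partial (vr p 0) f - cscale \<i> (partial (vr p 1) f)"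

lemma derivation_nd: "derivation (nd p)" "derivation (nd' p)"
  unfolding nd_def nd'_def
  by (intro derivation_add derivation_diff derivation_cscale derivation_partial)+

lemmas nd_linear = linear_opD[OF derivation_linear[OF derivation_nd(1)]]
  linear_opD[OF derivation_linear[OF derivation_nd(2)]]
lemmas nd_mult = derivationD(2)[OF derivation_nd(1)] derivationD(2)[OF derivation_nd(2)]

text \<open>The factor \<open>f\<close> on the left avoids the exponent n - 1. Later computations
  are multiplied by \<open>nv\<close> for the same reason and divided by it at the end.\<close>

lemma derivation_power:
  assumes "derivation \<delta>"
  shows "f * \<delta> (f ^ n) = of_nat n * (\<delta> f * f ^ n)"
proof (induction n)
  case 0
  then show ?case using derivationD(3)[OF assms, of 1] by (simp add: Cst_def)
next
  case (Suc n)
  have "f * \<delta> (f ^ Suc n) = \<delta> f * f ^ Suc n + f * (f * \<delta> (f ^ n))"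
    by (simp add: derivationD(2)[OF assms] algebra_simps)
  then show ?case unfolding Suc by (simp add: algebra_simps)
qed

lemma derivation_power_zero:
  assumes "derivation \<delta>" "\<delta> f = 0"
  shows "\<delta> (f ^ n) = 0"
proof (induction n)
  case 0
  then show ?case using derivationD(3)[OF assms(1), of 1] by (simp add: Cst_def)
qed (simp add: derivationD(2)[OF assms(1)] assms(2))

lemma nd_nv:
  "nd p (nv q) = 0" "nd' p (nv q) = (if p = q then 2 else 0)"
  "nd p (nv' q) = (if p = q then 2 else 0)" "nd' p (nv' q) = 0"
proof -
  have i: "cscale \<i> (cscale \<i> f) = - f" for f :: cpoly
    by (rule poly_mapping_eqI) simp
  show "nd p (nv q) = 0" "nd' p (nv q) = (if p = q then 2 else 0)"
    "nd p (nv' q) = (if p = q then 2 else 0)" "nd' p (nv' q) = 0"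
    by (auto simp: nv_def nv'_def nd_def nd'_def partial_cscale i)
qed

lemma partial_nv: "2 \<le> k \<Longrightarrow> partial (vr p k) (nv q) = 0" "2 \<le> k \<Longrightarrow> partial (vr p k) (nv' q) = 0"
  by (auto simp: nv_def nv'_def partial_cscale)

lemma nd_Var: "2 \<le> k \<Longrightarrow> nd p (Var (vr q k)) = 0" "2 \<le> k \<Longrightarrow> nd' p (Var (vr q k)) = 0"
  by (auto simp: nd_def nd'_def)

lemma nd_partial: "nd p (partial v f) = partial v (nd p f)" "nd' p (partial v f) = partial v (nd' p f)"
  by (simp_all add: nd_def nd'_def partial_cscale partial_commute)

lemma nd_nd': "nd p (nd' q f) = nd' q (nd p f)"
  by (simp add: nd_def nd'_def nd_partial[unfolded nd_def nd'_def] partial_cscale cv.scale_right_distrib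
      cv.scale_right_diff_distrib partial_commute algebra_simps)

lemma nv_power:
  "nd p (nv q ^ n) = 0" "2 \<le> k \<Longrightarrow> partial (vr p k) (nv q ^ n) = 0"
  "p \<noteq> q \<Longrightarrow> nd' p (nv q ^ n) = 0" "nv q * nd' q (nv q ^ n) = of_nat (2 * n) * nv q ^ n"
  "p \<noteq> q \<Longrightarrow> partial (vr p j) (nv q ^ n) = 0"
proof -
  show "nd p (nv q ^ n) = 0" "2 \<le> k \<Longrightarrow> partial (vr p k) (nv q ^ n) = 0" "p \<noteq> q \<Longrightarrow> nd' p (nv q ^ n) = 0"
    by (simp_all add: derivation_power_zero[OF derivation_nd(1)] derivation_power_zero[OF derivation_nd(2)]
        derivation_power_zero[OF derivation_partial] nd_nv partial_nv)
  show "nv q * nd' q (nv q ^ n) = of_nat (2 * n) * nv q ^ n"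
    by (simp only: derivation_power[OF derivation_nd(2), of "nv q" q n] nd_nv refl if_True
        of_nat_mult of_nat_numeral mult_ac)
  show "p \<noteq> q \<Longrightarrow> partial (vr p j) (nv q ^ n) = 0"
    by (rule derivation_power_zero[OF derivation_partial]) (simp add: nv_def partial_cscale)
qed

lemma sum_split2:
  fixes h :: "nat \<Rightarrow> 'a::comm_monoid_add"
  assumes "2 \<le> m"
  shows "(\<Sum>i<m. h i) = h 0 + h 1 + (\<Sum>k\<in>{2..<m}. h k)"
proof -
  have "{..<m} = insert 0 (insert 1 {2..<m})" using assms by auto
  then show ?thesis by (simp add: add.assoc)
qed

lemma half_plus_half: "cscale (1/2) (f + f) = f" 
  by (rule poly_mapping_eqI) (simp add: lookup_add)

lemma lap_null:
  assumes "2 \<le> m"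
  shows "lap m p q f = cscale (1/2) (nd p (nd' q f) + nd' p (nd q f)) + (\<Sum>k\<in>{2..<m}. partial (vr p k) (partial (vr q k) f))"
proof -
  have "cscale (1/2) (nd p (nd' q f) + nd' p (nd q f)) = partial (vr p 0) (partial (vr q 0) f) + partial (vr p 1) (partial (vr q 1) f)"
    by (simp add: nd_def nd'_def partial_cscale) (rule poly_mapping_eqI, simp add: lookup_simps algebra_simps)
  then show ?thesis by (simp add: lap_def sum_split2[OF assms])
qed

lemma lap_null_same:
  assumes "2 \<le> m"
  shows "lap m p p f = nd' p (nd p f) + (\<Sum>k\<in>{2..<m}. partial (vr p k) (partial (vr p k) f))"
  by (simp only: lap_null[OF assms] nd_nd'[of p p] half_plus_half)

lemma polar_null:
  assumes "2 \<le> m"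
  shows "polar m p q f = cscale (1/2) (nv p * nd' q f + nv' p * nd q f) + (\<Sum>k\<in>{2..<m}. Var (vr p k) * partial (vr q k) f)"
proof -
  have "cscale (1/2) (nv p * nd' q f + nv' p * nd q f) = Var (vr p 0) * partial (vr q 0) f + Var (vr p 1) * partial (vr q 1) f"
    by (simp add: nd_def nd'_def nv_def nv'_def distrib_left distrib_right left_diff_distrib right_diff_distrib)
       (rule poly_mapping_eqI, simp add: lookup_simps algebra_simps)
  then show ?thesis by (simp add: polar_def sum_split2[OF assms])
qed

text \<open>The coefficient of \<open>nv p * g\<close> at an exponent raised by one in coordinate 0
  is the coefficient of \<open>g\<close> there plus one whose exponent in coordinate 1 is smaller.
  Induction on the latter exponent gives 0.\<close>

lemma nv_mult_eq_0:
  assumes "nv p * g = 0"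
  shows "g = 0"
proof -
  let ?e = "\<lambda>j. Poly_Mapping.single (vr p j) (1::nat)"
  have "Poly_Mapping.lookup g t = 0" if "Poly_Mapping.lookup t (vr p 1) = n" for n t
    using that
  proof (induction n arbitrary: t)
    case (0 t)
    have "Poly_Mapping.lookup (nv p * g) (?e 0 + t) = Poly_Mapping.lookup g t"
      using 0 by (simp add: nv_def distrib_right cscale_mult_left lookup_add lookup_Var_mult lookup_single)
    then show ?case using assms by simp
  next
    case (Suc n t)
    have "Poly_Mapping.lookup (nv p * g) (?e 0 + t) = Poly_Mapping.lookup g t + \<i> * Poly_Mapping.lookup g (?e 0 + t - ?e 1)"
      using Suc.prems by (simp add: nv_def distrib_right cscale_mult_left lookup_add lookup_Var_mult lookup_single)
    moreover have "Poly_Mapping.lookup g (?e 0 + t - ?e 1) = 0"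
      by (rule Suc.IH) (use Suc.prems in \<open>simp add: lookup_add lookup_minus lookup_single\<close>)
    ultimately show ?case using assms by simp
  qed
  then show ?thesis by (intro poly_mapping_eqI) simp
qed

lemma nv_power_neq_0: "nv p ^ n \<noteq> 0"
  by (induction n) (auto dest: nv_mult_eq_0)

lemma nv_mult_cancel: "nv p * f = nv p * g \<longleftrightarrow> f = g"
  using nv_mult_eq_0[of p "f - g"] by (auto simp: algebra_simps)

lemma z_only_degree_0:
  assumes "f \<in> z_only m" "polar m BZ BZ f = 0"
  shows "f = Cst (Poly_Mapping.lookup f 0)"
proof (rule poly_mapping_eqI)
  fix t
  show "Poly_Mapping.lookup f t = Poly_Mapping.lookup (Cst (Poly_Mapping.lookup f 0)) t"
  proof (cases "t = 0")
    case False
    have "Poly_Mapping.lookup f t = 0"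
    proof (rule ccontr)
      assume "Poly_Mapping.lookup f t \<noteq> 0"
      then have t: "t \<in> Poly_Mapping.keys f" by (simp add: in_keys_iff)
      obtain v where v: "Poly_Mapping.lookup t v \<noteq> 0"
        using False by (metis lookup_zero poly_mapping_eqI)
      obtain p j where pj: "v = vr p j" using ex_vr by blast
      show False
      proof (cases "p = BZ")
        case True
        have "f \<in> polys m" "v \<in> Poly_Mapping.keys t" using assms(1) v by (auto simp: z_only_def in_keys_iff)
        then have "var_index v < m" using t unfolding polys_def by blast
        then have "j < m" using pj by simp
        then show False using polar_self_exponent[of m BZ f 0 t j] assms(2) t v pj True by simp
      next
        case False
        then have "partial v f = 0" using assms(1) pj z_onlyD(1) by blast
        then have "of_nat (Poly_Mapping.lookup t v) * Poly_Mapping.lookup f t = 0"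
          using lookup_Var_partial[of v f t] by simp
        then show False using v t by (simp add: in_keys_iff)
      qed
    qed
    then show ?thesis using False by (simp add: Cst_def lookup_single)
  qed (simp add: Cst_def)
qed

lemma z_only_ops:
  assumes "f \<in> z_only m"
  shows "partial v f \<in> z_only m" "nd p f \<in> z_only m" "nd' p f \<in> z_only m"
proof -
  show 1: "partial v f \<in> z_only m" for v
    using assms by (auto simp: z_only_def polys_partial partial_commute[of _ v])
  show "nd p f \<in> z_only m" "nd' p f \<in> z_only m"
    unfolding nd_def nd'_def
    by (intro cv.subspace_add[OF subspace_z_only] cv.subspace_diff[OF subspace_z_only]
        cv.subspace_scale[OF subspace_z_only] 1)+
qed

lemma lap_nd: "lap m p q (nd r f) = nd r (lap m p q f)" "lap m p q (nd' r f) = nd' r (lap m p q f)"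
  by (simp_all add: nd_def nd'_def lap_linear partial_lap)

lemma polar_nd:
  assumes "2 \<le> m"
  shows "polar m p p (nd p f) = nd p (polar m p p f) - nd p f" "polar m p p (nd' p f) = nd' p (polar m p p f) - nd' p f"
  using assms by (simp_all add: nd_def nd'_def op_linear partial_polar algebra_simps cv.scale_right_distrib)

text \<open>The last hypothesis says that the raising operators of the isotropic line kill
  \<open>f\<close>. It is inherited by \<open>nd BZ f\<close>, which is thus a multiple of a power
  of \<open>nv BZ\<close> by induction; the Laplace equation shows that the multiple is 0. Then all
  derivatives except \<open>nd' BZ f\<close> vanish, and the induction hypothesis is applied to that
  one.\<close>

lemma harmonic_null_kernel:
  assumes "3 \<le> m" "f \<in> z_only m" "lap m BZ BZ f = 0" "polar m BZ BZ f = cscale (of_nat a) f"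
    and "\<And>k. k \<in> {2..<m} \<Longrightarrow> nv BZ * partial (vr BZ k) f = Var (vr BZ k) * nd BZ f"
  shows "\<exists>c. f = cscale c (nv BZ ^ a)"
  using assms(2-)
proof (induction a arbitrary: f)
  case (0 f)
  then have "f = Cst (Poly_Mapping.lookup f 0)"
    by (intro z_only_degree_0) auto
  then show ?case by (metis cscale_eq mult.right_neutral power_0)
next
  case (Suc a f)
  have m2: "2 \<le> m" using assms(1) by simp
  note H = Suc.prems
  have "\<exists>c. nd BZ f = cscale c (nv BZ ^ a)"
  proof (rule Suc.IH)
    show "polar m BZ BZ (nd BZ f) = cscale (of_nat a) (nd BZ f)"
      by (simp add: polar_nd[OF m2] H(3) nd_linear)
        (rule poly_mapping_eqI, simp add: lookup_simps algebra_simps)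
    show "nv BZ * partial (vr BZ k) (nd BZ f) = Var (vr BZ k) * nd BZ (nd BZ f)" if "k \<in> {2..<m}" for k
      using arg_cong[OF H(4)[OF that], of "nd BZ"] that
      by (simp add: nd_mult nd_nv nd_Var nd_partial)
  qed (simp_all add: z_only_ops H lap_nd nd_linear)
  then obtain c where c: "nd BZ f = cscale c (nv BZ ^ a)" by blast
  have k: "nv BZ * partial (vr BZ k) (partial (vr BZ k) f) = cscale c (nv BZ ^ a)" if "k \<in> {2..<m}" for k
    using arg_cong[OF H(4)[OF that], of "partial (vr BZ k)"] that
    by (simp add: partial_mult partial_nv c cscale_mult_right partial_cscale nv_power)
  \<comment> \<open>In the Laplace equation times \<open>nv BZ\<close> the null pair contributes
    \<open>2 * a\<close> and each of the other \<open>m - 2\<close> coordinates contributes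
    1.\<close>
  have "0 = nv BZ * lap m BZ BZ f" using H(2) by simp
  also have "\<dots> = cscale c (of_nat (2 * a) * nv BZ ^ a) + (\<Sum>k\<in>{2..<m}. cscale c (nv BZ ^ a))"
    by (simp add: lap_null_same[OF m2] c nd_linear distrib_left sum_distrib_left k
        cscale_mult_right nv_power del: of_nat_mult)
  also have "\<dots> = cscale (c * of_nat (2 * a + (m - 2))) (nv BZ ^ a)"
    by (rule poly_mapping_eqI) (simp add: lookup_simps algebra_simps)
  finally have "c * of_nat (2 * a + (m - 2)) = 0"
    using nv_power_neq_0[of BZ a] by (metis cv.scale_eq_0_iff)
  moreover have "of_nat (2 * a + (m - 2)) \<noteq> (0 :: complex)"
    unfolding of_nat_eq_0_iff using assms(1) by simp
  ultimately have c0: "c = 0" by (metis mult_eq_0_iff)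
  then have D: "nd BZ f = 0" using c by simp
  have dk: "partial (vr BZ k) f = 0" if "k \<in> {2..<m}" for k
    using H(4)[OF that] D nv_mult_eq_0 by simp
  have "\<exists>c. nd' BZ f = cscale c (nv BZ ^ a)"
  proof (rule Suc.IH)
    show "polar m BZ BZ (nd' BZ f) = cscale (of_nat a) (nd' BZ f)"
      by (simp add: polar_nd[OF m2] H(3) nd_linear)
        (rule poly_mapping_eqI, simp add: lookup_simps algebra_simps)
    show "nv BZ * partial (vr BZ k) (nd' BZ f) = Var (vr BZ k) * nd BZ (nd' BZ f)" if "k \<in> {2..<m}" for k
      using dk[OF that] D by (simp add: nd_nd' nd_linear flip: nd_partial)
  qed (simp_all add: z_only_ops H lap_nd nd_linear)
  then obtain c' where c': "nd' BZ f = cscale c' (nv BZ ^ a)" by blast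
  \<comment> \<open>In null coordinates only one term of the Euler operator survives, and it
    recovers \<open>f\<close> from \<open>nd' BZ f\<close>.\<close>
  have "cscale (of_nat (Suc a)) f = cscale (c' / 2) (nv BZ ^ Suc a)"
    using H(3) by (simp add: polar_null[OF m2] D c' dk cscale_mult_right)
  then have "cscale (inverse (of_nat (Suc a))) (cscale (of_nat (Suc a)) f) = cscale (inverse (of_nat (Suc a)) * (c' / 2)) (nv BZ ^ Suc a)"
    by simp
  then have "f = cscale (inverse (of_nat (Suc a)) * (c' / 2)) (nv BZ ^ Suc a)"
    by (simp del: of_nat_Suc)
  then show ?case by blast
qed

section \<open>Nilpotent raising operators of an isotropic line\<close>

lemma derivation_nilpotent_mult:
  assumes "derivation \<delta>" "(\<delta> ^^ p) f = 0" "(\<delta> ^^ q) g = 0"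
  shows "(\<delta> ^^ (p + q)) (f * g) = 0"
proof -
  have add: "(\<delta> ^^ n) (f + g) = (\<delta> ^^ n) f + (\<delta> ^^ n) g" "(\<delta> ^^ n) 0 = 0" for n f g
    by (induction n) (simp_all add: linear_opD[OF derivation_linear[OF assms(1)]])
  have "(\<delta> ^^ n) (f * g) = 0" if "n = p + q" "(\<delta> ^^ p) f = 0" "(\<delta> ^^ q) g = 0" for n
    using that
  proof (induction n arbitrary: p q f g)
    case (Suc n)
    show ?case
    proof (cases "p = 0 \<or> q = 0")
      case True
      then have "f * g = 0" using Suc.prems by auto
      then show ?thesis by (simp only: add)
    next
      case False
      then obtain p' q' where pq: "p = Suc p'" "q = Suc q'" by (metis not0_implies_Suc)
      have "(\<delta> ^^ n) (\<delta> f * g) = 0" using Suc.prems pq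
        by (intro Suc.IH[of p' q]) (simp_all add: funpow_swap1)
      moreover have "(\<delta> ^^ n) (f * \<delta> g) = 0" using Suc.prems pq
        by (intro Suc.IH[of p q']) (simp_all add: funpow_swap1)
      ultimately show ?thesis by (simp add: funpow_swap1 derivationD(2)[OF assms(1)] add)
    qed
  qed simp
  then show ?thesis using assms by blast
qed

text \<open>By the Leibniz rule the orders of nilpotency add under products, so it suffices to look
  at the variables.\<close>

lemma derivation_nilpotent:
  assumes d: "derivation \<delta>" and "\<And>v. \<exists>n. (\<delta> ^^ n) (Var v) = 0"
  shows "\<exists>n. (\<delta> ^^ n) f = 0"
proof (induction f rule: cpoly_mult_induct)
  case (const c)
  then show ?case using derivationD(3)[OF d] by (intro exI[of _ 1]) simp
next
  case (Var v f)
  then show ?case using derivation_nilpotent_mult[OF d] assms(2) by metis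
next
  case (add f g)
  then obtain p q where pq: "(\<delta> ^^ p) f = 0" "(\<delta> ^^ q) g = 0" by blast
  have lin: "(\<delta> ^^ n) (f + g) = (\<delta> ^^ n) f + (\<delta> ^^ n) g" "(\<delta> ^^ n) 0 = 0" for n f g
    by (induction n) (simp_all add: linear_opD[OF derivation_linear[OF d]])
  have "(\<delta> ^^ (p + q)) f = 0" "(\<delta> ^^ (p + q)) g = 0"
    using pq lin(2) by (simp add: add.commute[of p] funpow_add, simp add: funpow_add)
  then show ?case using lin(1) by (intro exI[of _ "p + q"]) simp
qed

text \<open>For \<open>k\<close> at least 2 these elements span the abelian nilradical of the
  parabolic subalgebra that stabilizes the isotropic line of \<open>nv\<close>. Because they
  commute, a common kernel vector is available without a theorem for solvable algebras.\<close>

definition raise_null :: "nat \<Rightarrow> cpoly \<Rightarrow> cpoly" where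
  "raise_null k f = so_L 0 k f + cscale \<i> (so_L 1 k f)"

lemma raise_null_eq: "raise_null k f = (\<Sum>p\<in>UNIV. nv p * partial (vr p k) f - Var (vr p k) * nd p f)"
  unfolding raise_null_def so_L_blk cv.scale_sum_right sum.distrib [symmetric]
  by (intro sum.cong refl) (simp add: nv_def nd_def cv.scale_right_diff_distrib distrib_right
      distrib_left cscale_mult_left cscale_mult_right)

lemma derivation_raise_null: "derivation (raise_null k)"
  unfolding raise_null_def by (intro derivation_add derivation_cscale derivation_so_L)

lemma raise_null_Var:
  "2 \<le> k \<Longrightarrow> raise_null k (Var (vr p j)) = (if k = j then nv p else 0)
     - (if j = 0 then Var (vr p k) else 0) - cscale \<i> (if j = 1 then Var (vr p k) else 0)"
  by (auto simp: raise_null_def so_L_Var nv_def cv.scale_minus_right)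

lemma raise_null_nv: "2 \<le> k \<Longrightarrow> raise_null k (nv p) = 0"
  by (simp add: nv_def linear_opD[OF derivation_linear[OF derivation_raise_null]] raise_null_Var)

lemma raise_null_commute:
  assumes "2 \<le> k" "2 \<le> l"
  shows "raise_null k (raise_null l f) = raise_null l (raise_null k f)"
proof -
  have "raise_null k (raise_null l f) - raise_null l (raise_null k f) = 0"
  proof (rule derivation_eqI[where \<delta> = "\<lambda>f. raise_null k (raise_null l f) - raise_null l (raise_null k f)"
      and \<epsilon> = "\<lambda>f. 0"])
    show "raise_null k (raise_null l (Var v)) - raise_null l (raise_null k (Var v)) = 0" for v
    proof -
      obtain p j where v: "v = vr p j" using ex_vr by blast
      show ?thesis using assms
        by (cases "k = l") (auto simp: v raise_null_Var raise_null_nv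
            linear_opD[OF derivation_linear[OF derivation_raise_null]])
    qed
  qed (intro derivation_raise_null derivation_commutator derivation_zero)+
  then show ?thesis by simp
qed

lemma raise_null_nilpotent:
  assumes "2 \<le> k"
  shows "\<exists>n. (raise_null k ^^ n) f = 0"
proof (rule derivation_nilpotent[OF derivation_raise_null])
  fix v
  obtain p j where v: "v = vr p j" using ex_vr by blast
  \<comment> \<open>The longest chains start at coordinates 0 and 1 and run through coordinate
    \<open>k\<close> to a multiple of \<open>nv p\<close>, which is killed.\<close>
  have "raise_null k (raise_null k (raise_null k (Var v))) = 0"
    using assms by (auto simp: v raise_null_Var raise_null_nv
            linear_opD[OF derivation_linear[OF derivation_raise_null]])
  then show "\<exists>n. (raise_null k ^^ n) (Var v) = 0"
    by (intro exI[of _ 3]) (simp add: numeral_3_eq_3)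
qed

lemma raise_null_kernel:
  assumes U: "cv.subspace U" "U \<noteq> {0}" and inv: "\<And>i j. i < m \<Longrightarrow> j < m \<Longrightarrow> so_L i j ` U \<subseteq> U"
  shows "\<exists>u\<in>U. u \<noteq> 0 \<and> (\<forall>k\<in>{2..<m}. raise_null k u = 0)"
proof -
  obtain u where u: "u \<in> U" "u \<noteq> 0" using U cv.subspace_0 by blast
  show ?thesis
  proof (rule common_kernel_nonzero[OF _ u])
    fix k assume k: "k \<in> {2..<m}"
    then have "so_L 0 k ` U \<subseteq> U" "so_L 1 k ` U \<subseteq> U" using inv by auto
    then show "raise_null k ` U \<subseteq> U"
      using U(1) by (auto simp: raise_null_def intro!: cv.subspace_add cv.subspace_scale)
  qed (auto simp: raise_null_nilpotent raise_null_commute linear_opD[OF derivation_linear[OF derivation_raise_null]])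
qed

lemma polar_self_eq_0_iff:
  assumes "f \<in> polys m"
  shows "polar m p p f = 0 \<longleftrightarrow> (\<forall>i. partial (vr p i) f = 0)"
proof
  assume 0: "polar m p p f = 0"
  show "\<forall>i. partial (vr p i) f = 0"
  proof
    fix i
    show "partial (vr p i) f = 0"
    proof (cases "i < m")
      case True
      have "Poly_Mapping.lookup f (t + Poly_Mapping.single (vr p i) 1) = 0" for t
      proof (rule ccontr)
        assume "Poly_Mapping.lookup f (t + Poly_Mapping.single (vr p i) 1) \<noteq> 0"
        then have "t + Poly_Mapping.single (vr p i) 1 \<in> Poly_Mapping.keys f" by (simp only: in_keys_iff) simp
        then have "Poly_Mapping.lookup (t + Poly_Mapping.single (vr p i) 1) (vr p i) \<le> 0"
          using polar_self_exponent[of m p f 0 _ i] 0 True by simp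
        then show False by (simp add: lookup_add)
      qed
      then show ?thesis by (intro poly_mapping_eqI) (simp only: lookup_partial, simp)
    next
      case False
      then show ?thesis using assms by (simp add: polys_iff)
    qed
  qed
qed (simp add: polar_def)

lemma z_only_iff: "f \<in> z_only m \<longleftrightarrow> f \<in> polys m \<and> polar m BX BX f = 0 \<and> polar m BY BY f = 0"
  by (auto simp: z_only_def polar_self_eq_0_iff)

lemma partial_one [simp]: "partial v 1 = 0"
  using partial_Cst[of v 1] by (simp add: Cst_def)

lemma nd_numeral [simp]: "nd p (numeral n) = 0" "nd' p (numeral n) = 0"
  using derivationD(3)[OF derivation_nd(1), of p "numeral n"] derivationD(3)[OF derivation_nd(2), of p "numeral n"]
  by (simp_all add: Cst_def)

section \<open>The modules (a) and (a,1)\<close>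

definition harmonics :: "nat \<Rightarrow> nat \<Rightarrow> cpoly set" where
  "harmonics m a = {h \<in> z_only m. lap m BZ BZ h = 0 \<and> polar m BZ BZ h = cscale (of_nat a) h}"

text \<open>Simplicial harmonics, the usual model of (a,1). The conditions involving x say that
  \<open>p\<close> is linear in x, divergence-free and, as a vector field in z, orthogonal to
  z.\<close>

definition two_row :: "nat \<Rightarrow> nat \<Rightarrow> cpoly set" where
  "two_row m a = {p \<in> polys m. polar m BX BX p = p \<and> polar m BY BY p = 0 \<and>
     polar m BZ BZ p = cscale (of_nat a) p \<and> lap m BZ BZ p = 0 \<and> lap m BX BZ p = 0 \<and> polar m BZ BX p = 0}"

lemma subspace_harmonics: "cv.subspace (harmonics m a)"
  unfolding harmonics_def
  by (rule cv.subspaceI)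
    (auto simp: cv.subspace_0[OF subspace_z_only] cv.subspace_add[OF subspace_z_only]
      cv.subspace_scale[OF subspace_z_only] op_linear cv.scale_right_distrib mult.commute)

lemma subspace_two_row: "cv.subspace (two_row m a)"
  unfolding two_row_def
  by (rule cv.subspaceI) (auto simp: polys_lin op_linear cv.scale_right_distrib mult.commute)

lemma so_action_harmonics:
  assumes "A \<in> lie_carrier (so m)" "h \<in> harmonics m a"
  shows "so_action m A h \<in> harmonics m a"
  using assms unfolding harmonics_def z_only_iff
  by (simp add: polys_ops so_action_linear flip: so_action_polar so_action_lap)

lemma so_action_two_row:
  assumes "A \<in> lie_carrier (so m)" "h \<in> two_row m a"
  shows "so_action m A h \<in> two_row m a"
  using assms unfolding two_row_def
  by (simp add: polys_ops so_action_linear flip: so_action_polar so_action_lap)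

lemma so_L_two_row:
  assumes "i < m" "j < m"
  shows "so_L i j ` two_row m a \<subseteq> two_row m a" "so_L i j ` harmonics m a \<subseteq> harmonics m a"
  using so_action_two_row[OF elem_skew_so] so_action_harmonics[OF elem_skew_so]
  by (auto simp: so_L_action[OF assms])

lemma finite_dimensional_harmonics: "\<exists>B. finite B \<and> cv.span B = harmonics m a"
proof (rule finite_dimensional_multihomogeneous[where d = "\<lambda>p. if p = BZ then a else 0"])
  show "polar m p p f = cscale (of_nat (if p = BZ then a else 0)) f" if "f \<in> harmonics m a" for f p
    using that by (cases p) (auto simp: harmonics_def z_only_iff)
qed (use subspace_harmonics[of m a] in \<open>auto simp: harmonics_def z_only_def\<close>)

lemma finite_dimensional_two_row: "\<exists>B. finite B \<and> cv.span B = two_row m a"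
proof (rule finite_dimensional_multihomogeneous[where d = "\<lambda>p. if p = BZ then a else if p = BX then 1 else 0"])
  show "polar m p p f = cscale (of_nat (if p = BZ then a else if p = BX then 1 else 0)) f"
    if "f \<in> two_row m a" for f p
    using that by (cases p) (auto simp: two_row_def)
qed (use subspace_two_row[of m a] in \<open>auto simp: two_row_def\<close>)

lemma nv_polys: "2 \<le> m \<Longrightarrow> nv p \<in> polys m" "f \<in> polys m \<Longrightarrow> f ^ n \<in> polys m"
proof -
  show "2 \<le> m \<Longrightarrow> nv p \<in> polys m" by (auto simp: nv_def intro!: polys_lin polys_Var)
  show "f \<in> polys m \<Longrightarrow> f ^ n \<in> polys m"
    using polys_Cst[of 1 m] by (induction n) (auto simp: Cst_def intro: polys_mult)
qed

lemma polar_nv_power: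
  assumes "2 \<le> m"
  shows "polar m r s (nv p) = (if s = p then nv r else 0)"
    "polar m p p (nv p ^ n) = cscale (of_nat n) (nv p ^ n)" "s \<noteq> p \<Longrightarrow> polar m r s (nv p ^ n) = 0"
proof -
  show 1: "polar m r s (nv p) = (if s = p then nv r else 0)" for r s
    using assms by (auto simp: nv_def polar_linear polar_Var)
  have "nv p * polar m p p (nv p ^ n) = nv p * cscale (of_nat n) (nv p ^ n)"
    unfolding derivation_power[OF derivation_polar, of "nv p" m p p n]
    by (simp add: 1 cscale_of_nat cscale_mult_right)
  then show "polar m p p (nv p ^ n) = cscale (of_nat n) (nv p ^ n)"
    by (simp only: nv_mult_cancel)
  show "s \<noteq> p \<Longrightarrow> polar m r s (nv p ^ n) = 0"
    by (rule derivation_power_zero[OF derivation_polar]) (simp add: 1)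
qed

lemma nv_power_harmonic:
  assumes "2 \<le> m"
  shows "nv BZ ^ a \<in> harmonics m a"
  unfolding harmonics_def z_only_iff
  using assms by (simp add: nv_polys polar_nv_power lap_null_same nv_power nd_linear)

lemma harmonics_irreducible:
  assumes "3 \<le> m"
  shows "irreducible_under (so_action m ` lie_carrier (so m)) (harmonics m a)"
proof -
  obtain B where B: "finite B" "cv.span B = harmonics m a" using finite_dimensional_harmonics by blast
  show ?thesis
  proof (rule so_irreducibleI[OF subspace_harmonics B so_L_two_row(2)])
    show "nv BZ ^ a \<in> harmonics m a" using assms by (intro nv_power_harmonic) simp
    show "nv BZ ^ a \<noteq> 0" by (rule nv_power_neq_0)
    fix U assume U: "cv.subspace U" "U \<subseteq> harmonics m a" "U \<noteq> {0}"
      and inv: "\<And>i j. i < m \<Longrightarrow> j < m \<Longrightarrow> so_L i j ` U \<subseteq> U"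
    obtain u where u: "u \<in> U" "u \<noteq> 0" "\<forall>k\<in>{2..<m}. raise_null k u = 0"
      using raise_null_kernel[OF U(1,3) inv] by blast
    have h: "u \<in> z_only m" "lap m BZ BZ u = 0" "polar m BZ BZ u = cscale (of_nat a) u"
      using u(1) U(2) by (auto simp: harmonics_def)
    have "nv BZ * partial (vr BZ k) u = Var (vr BZ k) * nd BZ u" if "k \<in> {2..<m}" for k
      using u(3) that z_onlyD(1)[OF h(1)] by (auto simp: raise_null_eq sum_blk nd_def)
    then obtain c where c: "u = cscale c (nv BZ ^ a)"
      using harmonic_null_kernel[OF assms h] by blast
    then have "c \<noteq> 0" using u(2) by auto
    moreover have "cscale (inverse c) u \<in> U" using u(1) U(1) cv.subspace_scale by blast
    ultimately show "nv BZ ^ a \<in> U" using c by simp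
  qed auto
qed

text \<open>A power of \<open>nv BZ\<close> times the 2 by 2 minor, in the rows z and x, of the
  isotropic coordinate and coordinate \<open>k\<close>. For \<open>k\<close> at least 2 these
  vectors transform like the vector representation of so(m-2).\<close>

definition null_wedge :: "nat \<Rightarrow> nat \<Rightarrow> cpoly" where
  "null_wedge b k = nv BZ ^ b * (nv BZ * Var (vr BX k) - Var (vr BZ k) * nv BX)"

lemma null_wedge_two_row:
  assumes "2 \<le> k" "k < m"
  shows "null_wedge b k \<in> two_row m (Suc b)"
proof -
  have m: "2 \<le> m" using assms by simp
  have "null_wedge b k \<in> polys m"
    using assms unfolding null_wedge_def by (auto intro!: polys_mult polys_lin polys_Var nv_polys)
  moreover have "polar m BX BX (null_wedge b k) = null_wedge b k" "polar m BY BY (null_wedge b k) = 0"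
    "polar m BZ BX (null_wedge b k) = 0"
    using assms by (simp_all add: null_wedge_def polar_mult polar_linear polar_Var polar_nv_power)
  moreover have "polar m BZ BZ (null_wedge b k) = cscale (of_nat (Suc b)) (null_wedge b k)"
    using assms by (simp add: null_wedge_def polar_mult polar_linear polar_Var polar_nv_power cscale_mult_left
        right_diff_distrib cscale_mult_right)
      (rule poly_mapping_eqI, simp add: lookup_simps algebra_simps)
  moreover have nd0: "nd BZ (null_wedge b k) = 0"
    using assms by (simp add: null_wedge_def nd_mult nd_nv nd_Var nv_power nd_linear)
  moreover have "partial (vr BZ l) (partial (vr BZ l) (null_wedge b k)) = 0" if "2 \<le> l" for l
    using assms that by (auto simp: null_wedge_def partial_mult partial_nv nv_power)
  moreover have "nd BX (nd' BZ (null_wedge b k)) = 0"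
    using assms by (simp add: null_wedge_def nd_mult nd_nv nd_Var nv_power nd_linear nd_nd')
  moreover have "partial (vr BX l) (partial (vr BZ l) (null_wedge b k)) = 0" if "2 \<le> l" for l
    using assms that by (auto simp: null_wedge_def partial_mult partial_nv nv_power)
  ultimately show ?thesis
    by (simp add: two_row_def lap_null_same[OF m] lap_null[OF m] nd_linear)
qed

lemma so_L_null_wedge:
  assumes "2 \<le> i" "2 \<le> j" "2 \<le> k"
  shows "so_L i j (null_wedge b k) = (if j = k then null_wedge b i else 0) - (if i = k then null_wedge b j else 0)"
proof -
  note d = derivationD[OF derivation_so_L] linear_opD[OF linear_op_so_L]
  have n: "so_L i j (nv p) = 0" for p using assms by (simp add: nv_def d so_L_Var)
  have "so_L i j (nv p ^ n) = 0" for p n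
    by (rule derivation_power_zero[OF derivation_so_L n])
  then show ?thesis using assms
    by (auto simp: null_wedge_def d n so_L_Var algebra_simps)
qed

lemma null_wedge_neq_0: "cscale c (null_wedge b 2) + cscale d (null_wedge b 3) = 0 \<Longrightarrow> c = 0"
proof -
  assume "cscale c (null_wedge b 2) + cscale d (null_wedge b 3) = 0"
  then have "partial (vr BX 2) (cscale c (null_wedge b 2) + cscale d (null_wedge b 3)) = 0" by simp
  then have "cscale c (nv BZ ^ Suc b) = 0"
    by (simp add: null_wedge_def partial_cscale partial_mult partial_nv nv_power mult.commute)
  then show "c = 0" using nv_power_neq_0[of BZ "Suc b"] cv.scale_eq_0_iff by blast
qed

text \<open>Write \<open>p\<close> as a vector field with components \<open>F i\<close>. The kernel
  equations become linear equations for the components: \<open>\<phi>\<close> solves the homogeneous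
  ones and is a multiple \<open>c\<close> of a power of \<open>nv BZ\<close>, and each
  \<open>F k\<close> is determined up to another such multiple. Orthogonality to z and vanishing
  divergence together force \<open>c = 0\<close>, and orthogonality then determines
  \<open>\<psi>\<close>.\<close>

lemma two_row_null_kernel:
  assumes m: "3 \<le> m" and p: "p \<in> two_row m (Suc b)" and k0: "\<And>k. k \<in> {2..<m} \<Longrightarrow> raise_null k p = 0"
  shows "\<exists>d. p = (\<Sum>k\<in>{2..<m}. cscale (d k) (null_wedge b k))"
proof -
  have m2: "2 \<le> m" using m by simp
  have P: "p \<in> polys m" "polar m BX BX p = p" "polar m BY BY p = 0" "polar m BZ BZ p = cscale (of_nat (Suc b)) p"
    "lap m BZ BZ p = 0" "lap m BX BZ p = 0" "polar m BZ BX p = 0"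
    using p by (auto simp: two_row_def)
  have dY: "partial (vr BY i) p = 0" for i using P(1,3) polar_self_eq_0_iff by blast
  have xl: "p \<in> xy_linear m" using P by (simp add: xy_linear_def)
  define F where "F i = partial (vr BX i) p" for i
  have Fz: "F i \<in> z_only m" for i unfolding F_def using xl by (intro xy_linear_partial) auto
  have Fl: "lap m BZ BZ (F i) = 0" "polar m BZ BZ (F i) = cscale (of_nat (Suc b)) (F i)" for i
  proof -
    show "lap m BZ BZ (F i) = 0" using P(5) by (simp add: F_def flip: partial_lap)
    have "partial (vr BX i) (polar m BZ BZ p) = polar m BZ BZ (F i)"
      unfolding partial_polar F_def by simp
    then show "polar m BZ BZ (F i) = cscale (of_nat (Suc b)) (F i)"
      unfolding P(4) partial_cscale F_def by simp
  qed
  \<comment> \<open>The part of \<open>raise_null k\<close> that acts on z. Its action on x supplies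
    the right sides in \<open>QF\<close>.\<close>
  define Q where "Q k g = nv BZ * partial (vr BZ k) g - Var (vr BZ k) * nd BZ g" for k g
  have Qlin: "linear_op (Q k)" for k
    by (rule linear_opI) (simp_all add: Q_def partial_cscale nd_linear algebra_simps cscale_mult_right)
  have QF: "Q k (F i) = (if i = k then F 0 + cscale \<i> (F 1) else 0) - (if i = 0 then F k else 0)
      - cscale \<i> (if i = 1 then F k else 0)" if "k \<in> {2..<m}" for k i
  proof -
    have ne: "partial (vr BX i) (F j) = 0" for j by (rule z_onlyD(1)[OF Fz]) simp
    have ndX: "nd BX p = F 0 + cscale \<i> (F 1)" by (simp add: nd_def F_def)
    have "raise_null k p = Q k p + nv BX * F k - Var (vr BX k) * (F 0 + cscale \<i> (F 1))"
      using dY by (simp add: raise_null_eq sum_blk Q_def ndX F_def) (simp add: nd_def)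
    moreover have "partial (vr BX i) (Q k p) = Q k (F i)"
      by (simp add: Q_def F_def partial_mult nd_partial partial_commute nv_def partial_cscale)
    moreover have "partial (vr BX i) (nv BX) = (if i = 0 then 1 else 0) + cscale \<i> (if i = 1 then 1 else 0)"
      by (auto simp: nv_def partial_cscale)
    ultimately have "0 = Q k (F i) + ((if i = 0 then 1 else 0) + cscale \<i> (if i = 1 then 1 else 0)) * F k
        - (if i = k then F 0 + cscale \<i> (F 1) else 0)"
      using arg_cong[OF k0[OF that], of "partial (vr BX i)"]
      by (simp add: partial_mult ne partial_cscale)
    then show ?thesis by (cases "i = 0"; cases "i = 1") (auto simp: algebra_simps cscale_mult_left cscale_mult_right)
  qed
  define \<phi> where "\<phi> = F 0 + cscale \<i> (F 1)"
  define \<psi> where "\<psi> = F 0 - cscale \<i> (F 1)"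
  have ii: "cscale \<i> (cscale \<i> f) = - f" for f :: cpoly
    by (rule poly_mapping_eqI) simp
  have lin: "\<phi> \<in> z_only m" "lap m BZ BZ \<phi> = 0" "polar m BZ BZ \<phi> = cscale (of_nat (Suc b)) \<phi>"
    using Fz Fl subspace_z_only
    by (auto simp: \<phi>_def op_linear cv.scale_right_distrib mult.commute simp del: of_nat_Suc
        intro!: cv.subspace_add[OF subspace_z_only] cv.subspace_scale[OF subspace_z_only])
  have "Q k \<phi> = 0" if "k \<in> {2..<m}" for k
    using that by (simp add: \<phi>_def linear_opD[OF Qlin] QF ii cv.scale_minus_right)
  then obtain c where c: "\<phi> = cscale c (nv BZ ^ Suc b)"
    using harmonic_null_kernel[OF m lin] unfolding Q_def by (metis eq_iff_diff_eq_0)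
  have "\<exists>d. F k = cscale c (Var (vr BZ k) * nv BZ ^ b) + cscale d (nv BZ ^ Suc b)" if k: "k \<in> {2..<m}" for k
  proof -
    \<comment> \<open>The subtracted term is a particular solution of the inhomogeneous equations
      for \<open>F k\<close>.\<close>
    define g where "g = F k - cscale c (Var (vr BZ k) * nv BZ ^ b)"
    have zk: "Var (vr BZ k) * nv BZ ^ b \<in> harmonics m (Suc b)"
    proof -
      have "partial (vr BZ l) (partial (vr BZ l) (Var (vr BZ k) * nv BZ ^ b)) = 0" if "2 \<le> l" for l
        using that by (simp add: partial_mult nv_power)
      then show ?thesis
        using k m2 unfolding harmonics_def z_only_iff
        by (simp add: polys_mult polys_Var nv_polys polar_mult polar_Var polar_nv_power lap_null_same nv_power
            nd_mult nd_Var nd_linear cscale_mult_right) (rule poly_mapping_eqI, simp add: lookup_simps algebra_simps)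
    qed
    have Fh: "F k \<in> harmonics m (Suc b)" using Fz Fl by (simp add: harmonics_def)
    have g: "g \<in> harmonics m (Suc b)"
      unfolding g_def using zk Fh subspace_harmonics by (intro cv.subspace_diff cv.subspace_scale)
    have "Q l g = 0" if "l \<in> {2..<m}" for l
    proof -
      have "Q l (Var (vr BZ k) * nv BZ ^ b) = (if l = k then nv BZ ^ Suc b else 0)"
        using that k by (simp add: Q_def partial_mult nd_mult nv_power nd_Var)
      then show ?thesis using that k
        by (auto simp: g_def linear_opD[OF Qlin] QF c \<phi>_def [symmetric] simp del: One_nat_def)
    qed
    then have "\<exists>d. g = cscale d (nv BZ ^ Suc b)"
      using g harmonic_null_kernel[OF m, of g "Suc b"] unfolding harmonics_def Q_def by auto
    then show ?thesis unfolding g_def by (metis add.commute diff_add_cancel)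
  qed
  then obtain d where d: "\<And>k. k \<in> {2..<m} \<Longrightarrow> F k = cscale c (Var (vr BZ k) * nv BZ ^ b) + cscale (d k) (nv BZ ^ Suc b)"
    by metis
  have ndX: "nd BX p = \<phi>" "nd' BX p = \<psi>" by (simp_all add: nd_def nd'_def \<phi>_def \<psi>_def F_def)
  have zF: "cscale (1/2) (nv BZ * \<psi> + nv' BZ * \<phi>) + (\<Sum>k\<in>{2..<m}. Var (vr BZ k) * F k) = 0"
    using P(7) by (simp add: polar_null[OF m2] ndX F_def)
  have dF: "cscale (1/2) (nd' BZ \<phi> + nd BZ \<psi>) + (\<Sum>k\<in>{2..<m}. partial (vr BZ k) (F k)) = 0"
  proof -
    have "lap m BZ BX p = 0" using P(6) lap_commute by metis
    then show ?thesis unfolding lap_null[OF m2] ndX F_def by (simp add: add.commute)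
  qed
  have ndF: "nd BZ (F k) = 0" if "k \<in> {2..<m}" for k
    using that d[OF that] by (simp add: nd_linear nd_mult nd_Var nd_nv nv_power)
  have nd\<phi>: "nd BZ \<phi> = 0" by (simp add: c nd_linear nd_mult nd_nv nv_power)
  \<comment> \<open>Differentiating the orthogonality relation expresses
    \<open>nd BZ \<psi>\<close>, the unknown term of the divergence, through
    \<open>\<phi>\<close>.\<close>
  have "0 = nd BZ (cscale (1/2) (nv BZ * \<psi> + nv' BZ * \<phi>) + (\<Sum>k\<in>{2..<m}. Var (vr BZ k) * F k))"
    by (simp add: zF nd_linear)
  also have "\<dots> = cscale (1/2) (nv BZ * nd BZ \<psi> + 2 * \<phi>)"
    by (simp add: nd_linear nd_mult nd_nv nd\<phi> nd_Var ndF)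
  finally have nd\<psi>: "nv BZ * nd BZ \<psi> = - 2 * \<phi>"
    by (simp add: eq_neg_iff_add_eq_0)
  have nd'\<phi>: "nv BZ * nd' BZ \<phi> = cscale (2 * of_nat (Suc b)) \<phi>"
  proof -
    have "nv BZ * nd' BZ \<phi> = cscale c (cscale (of_nat (2 * Suc b)) (nv BZ ^ Suc b))"
      by (simp only: c nd_linear cscale_mult_right nv_power(4) cscale_of_nat)
    then show ?thesis by (simp only: c cv.scale_scale of_nat_mult of_nat_numeral mult.commute)
  qed
  have dkF: "nv BZ * partial (vr BZ k) (F k) = \<phi>" if "k \<in> {2..<m}" for k
    using that d[OF that] by (simp add: partial_cscale partial_mult nv_power partial_nv c cscale_mult_right)
  \<comment> \<open>In the divergence times \<open>nv BZ\<close> the null pair contributes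
    \<open>(b + 1) - 1\<close> and the other coordinates \<open>m - 2\<close>, each times
    \<open>\<phi>\<close>.\<close>
  have "0 = nv BZ * (cscale (1/2) (nd' BZ \<phi> + nd BZ \<psi>) + (\<Sum>k\<in>{2..<m}. partial (vr BZ k) (F k)))"
    by (simp add: dF)
  also have "\<dots> = cscale (1/2) (nv BZ * nd' BZ \<phi> + nv BZ * nd BZ \<psi>) + (\<Sum>k\<in>{2..<m}. nv BZ * partial (vr BZ k) (F k))"
    by (simp add: distrib_left sum_distrib_left cscale_mult_right)
  also have "\<dots> = cscale (of_nat (b + (m - 2))) \<phi>"
    unfolding nd\<psi> nd'\<phi> by (simp add: dkF) (rule poly_mapping_eqI, simp add: lookup_simps algebra_simps)
  finally have "cscale (of_nat (b + (m - 2))) \<phi> = 0" ..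
  moreover have "of_nat (b + (m - 2)) \<noteq> (0 :: complex)"
    unfolding of_nat_eq_0_iff using m by simp
  ultimately have \<phi>0: "\<phi> = 0" using cv.scale_eq_0_iff by blast
  then have "c = 0" using c nv_power_neq_0[of BZ "Suc b"] by auto
  then have Fk: "F k = cscale (d k) (nv BZ ^ Suc b)" if "k \<in> {2..<m}" for k
    using d[OF that] by simp
  have \<psi>: "cscale (1/2) (nv BZ * \<psi>) = - (\<Sum>k\<in>{2..<m}. Var (vr BZ k) * F k)"
    using zF \<phi>0 by (simp add: eq_neg_iff_add_eq_0)
  have "p = cscale (1/2) (nv BX * \<psi>) + (\<Sum>k\<in>{2..<m}. Var (vr BX k) * F k)"
    using P(2) by (simp add: polar_null[OF m2] ndX \<phi>0 F_def)
  \<comment> \<open>Only the product \<open>nv BZ * \<psi>\<close> is known, so the comparison is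
    made after multiplication by \<open>nv BZ\<close>.\<close>
  then have "nv BZ * p = nv BX * cscale (1/2) (nv BZ * \<psi>) + (\<Sum>k\<in>{2..<m}. nv BZ * (Var (vr BX k) * F k))"
    by (simp add: distrib_left sum_distrib_left cscale_mult_right mult.left_commute)
  also have "\<dots> = (\<Sum>k\<in>{2..<m}. nv BZ * (Var (vr BX k) * F k) - nv BX * (Var (vr BZ k) * F k))"
    unfolding \<psi> by (simp add: sum_subtractf sum_distrib_left)
  also have "\<dots> = (\<Sum>k\<in>{2..<m}. nv BZ * cscale (d k) (null_wedge b k))"
    by (intro sum.cong refl) (simp add: Fk null_wedge_def cscale_mult_right algebra_simps flip: cv.scale_right_diff_distrib)
  finally have "nv BZ * p = nv BZ * (\<Sum>k\<in>{2..<m}. cscale (d k) (null_wedge b k))"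
    by (simp add: sum_distrib_left)
  then show ?thesis using nv_mult_cancel by blast
qed

text \<open>The combination of coordinates 2 and 3 is the next isotropic direction, which makes this
  a highest weight vector of weight (b + 1, 1).\<close>

definition two_row_vector :: "nat \<Rightarrow> cpoly" where
  "two_row_vector b = null_wedge b 2 + cscale \<i> (null_wedge b 3)"

text \<open>A kernel vector is a combination of the \<open>null_wedge b k\<close>. Two rotations in
  so(m-2) isolate one of them, and further rotations reach all the others.\<close>

lemma two_row_irreducible:
  assumes m: "5 \<le> m"
  shows "irreducible_under (so_action m ` lie_carrier (so m)) (two_row m (Suc b))"
proof -
  obtain B where B: "finite B" "cv.span B = two_row m (Suc b)" using finite_dimensional_two_row by blast
  show ?thesis
  proof (rule so_irreducibleI[OF subspace_two_row B so_L_two_row(1)])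
    show "two_row_vector b \<in> two_row m (Suc b)"
      unfolding two_row_vector_def using m
      by (intro cv.subspace_add[OF subspace_two_row] cv.subspace_scale[OF subspace_two_row] null_wedge_two_row) auto
    show "two_row_vector b \<noteq> 0"
      using null_wedge_neq_0[of 1 b \<i>] by (auto simp: two_row_vector_def)
    fix U assume U: "cv.subspace U" "U \<subseteq> two_row m (Suc b)" "U \<noteq> {0}"
      and inv: "\<And>i j. i < m \<Longrightarrow> j < m \<Longrightarrow> so_L i j ` U \<subseteq> U"
    obtain u where u: "u \<in> U" "u \<noteq> 0" "\<forall>k\<in>{2..<m}. raise_null k u = 0"
      using raise_null_kernel[OF U(1,3) inv] by blast
    then obtain d where d: "u = (\<Sum>k\<in>{2..<m}. cscale (d k) (null_wedge b k))"
      using two_row_null_kernel[of m u b] U(2) m by auto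
    then obtain j where j: "j \<in> {2..<m}" "d j \<noteq> 0"
      using u(2) by (metis (no_types, lifting) cv.scale_zero_left sum.neutral)
    note lin = linear_opD[OF linear_op_so_L]
    have L: "so_L l j u = cscale (d j) (null_wedge b l) - cscale (d l) (null_wedge b j)" if "l \<in> {2..<m}" for l
    proof -
      have "so_L l j u = (\<Sum>k\<in>{2..<m}. (if k = j then cscale (d k) (null_wedge b l) else 0)
          - (if k = l then cscale (d k) (null_wedge b j) else 0))"
        unfolding d lin using that j(1)
        by (intro sum.cong refl) (auto simp: so_L_null_wedge lin cv.scale_right_diff_distrib cv.scale_minus_right)
      then show ?thesis using that j(1) by (simp add: sum_subtractf)
    qed
    have mem: "so_L i k f \<in> U" if "f \<in> U" "i < m" "k < m" for i k f
      using inv that by blast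
    have W: "null_wedge b n \<in> U" if n: "n \<in> {2..<m}" "n \<noteq> j" for n
    proof -
      \<comment> \<open>Rotating through a third index removes the unwanted term of
        \<open>L\<close>. Three indices from 2 on exist because \<open>m\<close> is at least
        5.\<close>
      have "\<exists>l\<in>{2..<m}. l \<noteq> j \<and> l \<noteq> n"
      proof (rule ccontr)
        assume "\<not> ?thesis"
        then have "{2, 3, 4} \<subseteq> {j, n}" using m by auto
        then have "card {2, 3, 4 :: nat} \<le> card {j, n}" by (intro card_mono) auto
        then show False using card_insert_le_m1[of 2 "{n}" j] by simp
      qed
      then obtain l where l: "l \<in> {2..<m}" "l \<noteq> j" "l \<noteq> n" by blast
      have "so_L n l (so_L l j u) \<in> U" using mem u(1) n l j by auto
      moreover have "so_L n l (so_L l j u) = cscale (d j) (null_wedge b n)"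
        using n l j by (simp add: L lin so_L_null_wedge)
      ultimately have "cscale (inverse (d j)) (cscale (d j) (null_wedge b n)) \<in> U"
        using U(1) cv.subspace_scale by metis
      then show ?thesis using j(2) by simp
    qed
    have "null_wedge b j \<in> U"
    proof -
      define n where "n = (if j = 2 then 3 else 2 :: nat)"
      have n: "n \<in> {2..<m}" "n \<noteq> j" using m by (auto simp: n_def)
      have "so_L j n (null_wedge b n) \<in> U" using mem W[OF n] n j by auto
      then show ?thesis using n j by (simp add: so_L_null_wedge)
    qed
    then have "null_wedge b n \<in> U" if "n \<in> {2..<m}" for n using W that by blast
    from this[of 2] this[of 3] have "null_wedge b 2 \<in> U" "null_wedge b 3 \<in> U" using m by auto
    then show "two_row_vector b \<in> U"
      unfolding two_row_vector_def using U(1) by (intro cv.subspace_add cv.subspace_scale)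
  qed auto
qed

subsection \<open>Highest weight vectors\<close>

lemma so_cartan_so: "so_cartan m j \<in> lie_carrier (so m)"
proof -
  have "transpose_mat (so_cartan m j) = - so_cartan m j"
    by (rule eq_matI) (auto simp: so_cartan_def)
  then show ?thesis by (simp add: so_def matrix_lie_algebra_def so_cartan_def)
qed

text \<open>The coordinates of \<open>A\<close> applied to the weight vector of the l-th Cartan
  plane.\<close>

definition null_col :: "complex mat \<Rightarrow> nat \<Rightarrow> nat \<Rightarrow> complex" where
  "null_col A l r = A $$ (r, 2 * l) + \<i> * A $$ (r, 2 * l + 1)"

lemma so_action_null_var:
  assumes A: "A \<in> lie_carrier (so m)" and l: "l < m div 2"
  shows "so_action m A (Var (vr p (2 * l)) + cscale \<i> (Var (vr p (2 * l + 1))))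
     = (\<Sum>a<m. cscale (null_col A l a) (Var (vr p a)))"
proof -
  have "2 * l < m" "2 * l + 1 < m" using l by auto
  then show ?thesis
    by (simp add: so_action_linear so_action_Var[OF A] cv.scale_sum_right null_col_def cv.scale_left_distrib sum.distrib)
qed

lemma cartan_entries:
  assumes "A \<in> carrier_mat m m" "j < m div 2" "r < m" "c < m"
  shows "(so_cartan m j * A) $$ (r, c) = (if r = 2 * j then - \<i> * A $$ (2 * j + 1, c) else if r = 2 * j + 1 then \<i> * A $$ (2 * j, c) else 0)"
    "(A * so_cartan m j) $$ (r, c) = (if c = 2 * j + 1 then - \<i> * A $$ (r, 2 * j) else if c = 2 * j then \<i> * A $$ (r, 2 * j + 1) else 0)"
proof -
  have j: "2 * j < m" "2 * j + 1 < m" using assms(2) by auto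
  have "(so_cartan m j * A) $$ (r, c) = (\<Sum>s<m. so_cartan m j $$ (r, s) * A $$ (s, c))"
    using assms by (simp add: so_cartan_def scalar_prod_def atLeast0LessThan)
  also have "\<dots> = (\<Sum>s<m. (if s = 2 * j + 1 then if r = 2 * j then - \<i> * A $$ (s, c) else 0 else 0)
     + (if s = 2 * j then if r = 2 * j + 1 then \<i> * A $$ (s, c) else 0 else 0))"
    using assms(3) by (intro sum.cong refl) (auto simp: so_cartan_def)
  finally show "(so_cartan m j * A) $$ (r, c) = (if r = 2 * j then - \<i> * A $$ (2 * j + 1, c) else if r = 2 * j + 1 then \<i> * A $$ (2 * j, c) else 0)"
    using j by (simp add: sum.distrib)
  have "(A * so_cartan m j) $$ (r, c) = (\<Sum>s<m. A $$ (r, s) * so_cartan m j $$ (s, c))"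
    using assms by (simp add: so_cartan_def scalar_prod_def atLeast0LessThan)
  also have "\<dots> = (\<Sum>s<m. (if s = 2 * j then if c = 2 * j + 1 then - \<i> * A $$ (r, s) else 0 else 0)
     + (if s = 2 * j + 1 then if c = 2 * j then \<i> * A $$ (r, s) else 0 else 0))"
    using assms(4) by (intro sum.cong refl) (auto simp: so_cartan_def)
  finally show "(A * so_cartan m j) $$ (r, c) = (if c = 2 * j + 1 then - \<i> * A $$ (r, 2 * j) else if c = 2 * j then \<i> * A $$ (r, 2 * j + 1) else 0)"
    using j by (simp add: sum.distrib)
qed

text \<open>A root vector shifts weights, so this column is an eigenvector of the j-th Cartan
  element with eigenvalue \<open>\<beta>\<close>. The right side is that element applied to the
  column; it sees only coordinates \<open>2 * j\<close> and \<open>2 * j + 1\<close>.\<close>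

lemma root_vector_col:
  assumes "so_root_vector m \<alpha> A" "l < m div 2" "j < m div 2" "r < m"
  defines "\<beta> \<equiv> of_int (\<alpha> j) + (if l = j then 1 else 0) :: complex"
  shows "\<beta> * null_col A l r = (if r = 2 * j then - \<i> * null_col A l (2 * j + 1) else if r = 2 * j + 1 then \<i> * null_col A l (2 * j) else 0)"
proof -
  have A: "A \<in> carrier_mat m m" using assms(1) so_carrier unfolding so_root_vector_def by blast
  have l: "2 * l < m" "2 * l + 1 < m" using assms(2) by auto
  have eq: "so_cartan m j * A - A * so_cartan m j = of_int (\<alpha> j) \<cdot>\<^sub>m A"
    using assms(1,3) unfolding so_root_vector_def so_def matrix_lie_algebra_def by simp
  have "(so_cartan m j * A) $$ (r, c) - (A * so_cartan m j) $$ (r, c) = of_int (\<alpha> j) * A $$ (r, c)" if "c < m" for c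
    using arg_cong[OF eq, of "\<lambda>B. B $$ (r, c)"] that assms(4) A by (simp add: so_cartan_def)
  note e = this[OF l(1)] this[OF l(2)]
  have par: "2 * l \<noteq> 2 * j + 1" "2 * l + 1 \<noteq> 2 * j" "2 * l + 1 = 2 * j + 1 \<longleftrightarrow> l = j" "2 * l = 2 * j \<longleftrightarrow> l = j"
    by presburger+
  have "(so_cartan m j * A) $$ (r, 2 * l) + \<i> * (so_cartan m j * A) $$ (r, 2 * l + 1)
      = (if r = 2 * j then - \<i> * null_col A l (2 * j + 1) else if r = 2 * j + 1 then \<i> * null_col A l (2 * j) else 0)"
    unfolding cartan_entries(1)[OF A assms(3,4) l(1)] cartan_entries(1)[OF A assms(3,4) l(2)] null_col_def
    by (simp add: algebra_simps)
  moreover have "(A * so_cartan m j) $$ (r, 2 * l) + \<i> * (A * so_cartan m j) $$ (r, 2 * l + 1) = (if l = j then null_col A l r else 0)"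
    unfolding cartan_entries(2)[OF A assms(3,4) l(1)] cartan_entries(2)[OF A assms(3,4) l(2)] null_col_def
    by (simp only: par if_False) (simp add: algebra_simps)
  moreover have "of_int (\<alpha> j) * null_col A l r = (so_cartan m j * A) $$ (r, 2 * l) + \<i> * (so_cartan m j * A) $$ (r, 2 * l + 1)
      - ((A * so_cartan m j) $$ (r, 2 * l) + \<i> * (A * so_cartan m j) $$ (r, 2 * l + 1))"
  proof -
    have "of_int (\<alpha> j) * null_col A l r = of_int (\<alpha> j) * A $$ (r, 2 * l) + \<i> * (of_int (\<alpha> j) * A $$ (r, 2 * l + 1))"
      by (simp add: null_col_def algebra_simps)
    then show ?thesis unfolding e [symmetric] by (simp add: algebra_simps)
  qed
  ultimately show ?thesis by (simp add: \<beta>_def distrib_right)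
qed

text \<open>No list of roots is needed. The Cartan elements have eigenvalues -1, 0 and 1 on the
  defining representation, and at most one of them is nonzero on a weight vector. This excludes
  every weight that exceeds the first one and leaves only the first one above the second.\<close>

lemma positive_root_col:
  assumes A: "so_root_vector m \<alpha> A" and pos: "so_positive m \<alpha>" and m: "4 \<le> m"
  shows "r < m \<Longrightarrow> null_col A 0 r = 0" "r < m \<Longrightarrow> 2 \<le> r \<Longrightarrow> null_col A 1 r = 0" "null_col A 1 1 = \<i> * null_col A 1 0"
proof -
  obtain j0 where j0: "j0 < m div 2" "\<alpha> j0 > 0" "\<And>i. i < j0 \<Longrightarrow> \<alpha> i = 0"
    using pos unfolding so_positive_def by blast
  define \<beta> where "\<beta> l j = \<alpha> j + (if l = j then 1 else 0)" for l j :: nat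
  have E: "of_int (\<beta> l j) * null_col A l r = (if r = 2 * j then - \<i> * null_col A l (2 * j + 1) else if r = 2 * j + 1 then \<i> * null_col A l (2 * j) else 0)"
    if "l < m div 2" "j < m div 2" "r < m" for l j r
    using root_vector_col[OF A that] by (auto simp: \<beta>_def)
  have off: "null_col A l r = 0" if "\<beta> l j \<noteq> 0" "l < m div 2" "j < m div 2" "r < m" "r \<noteq> 2 * j" "r \<noteq> 2 * j + 1" for l j r
    using E[OF that(2-4)] that by simp
  \<comment> \<open>On the plane of \<open>j\<close> the square of the Cartan element is the
    identity, which is incompatible with an eigenvalue of at least 2.\<close>
  have on: "null_col A l r = 0" if b: "2 \<le> \<beta> l j" and lj: "l < m div 2" "j < m div 2" "r < m" for l j r
  proof (cases "r = 2 * j \<or> r = 2 * j + 1")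
    case True
    have r: "2 * j < m" "2 * j + 1 < m" using lj by auto
    have 1: "of_int (\<beta> l j) * null_col A l (2 * j) = - \<i> * null_col A l (2 * j + 1)"
      "of_int (\<beta> l j) * null_col A l (2 * j + 1) = \<i> * null_col A l (2 * j)"
      using E[OF lj(1,2) r(1)] E[OF lj(1,2) r(2)] by auto
    have "of_int (\<beta> l j) * of_int (\<beta> l j) * null_col A l (2 * j) = null_col A l (2 * j)"
      "of_int (\<beta> l j) * of_int (\<beta> l j) * null_col A l (2 * j + 1) = null_col A l (2 * j + 1)"
      by (simp_all only: mult.assoc 1 mult.left_commute[of "of_int _"]) (simp_all add: mult.assoc [symmetric])
    moreover have "of_int (\<beta> l j) * of_int (\<beta> l j) \<noteq> (1 :: complex)"
    proof -
      have "2 * 2 \<le> \<beta> l j * \<beta> l j" using b by (intro mult_mono) auto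
      then have "of_int (\<beta> l j * \<beta> l j) \<noteq> (1 :: complex)" unfolding of_int_eq_1_iff by simp
      then show ?thesis by simp
    qed
    ultimately show ?thesis using True by (metis mult_cancel_right1)
  next
    case False
    then show ?thesis using off[of l j r] b lj by auto
  qed
  have m0: "0 < m div 2" "1 < m div 2" using m by auto
  \<comment> \<open>The shifted weight has entry at least 2 in position 0, or it is nonzero in the
    two positions 0 and \<open>j0\<close>, so that the column would be supported in two disjoint
    planes.\<close>
  show "null_col A 0 r = 0" if r: "r < m" for r
  proof (cases "j0 = 0")
    case True
    then show ?thesis using on[of 0 0 r] j0 m0 r by (simp add: \<beta>_def)
  next
    case False
    then have "\<beta> 0 0 = 1" "\<beta> 0 j0 \<noteq> 0" using j0 by (auto simp: \<beta>_def)
    then show ?thesis using off[of 0 0 r] off[of 0 j0 r] j0 m0 r False by (cases "r < 2") auto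
  qed
  \<comment> \<open>The column can survive only for \<open>j0 = 0\<close> with shifted weight 1
    there; it is then proportional to the first isotropic vector.\<close>
  have "(\<forall>r<m. 2 \<le> r \<longrightarrow> null_col A 1 r = 0) \<and> null_col A 1 1 = \<i> * null_col A 1 0"
  proof (cases "j0 = 0")
    case True
    then have b: "\<beta> 1 0 \<ge> 1" using j0 by (simp add: \<beta>_def)
    show ?thesis
    proof (cases "\<beta> 1 0 = 1")
      case True
      then show ?thesis using off[of 1 0] E[of 1 0 1] m0 m by auto
    next
      case False
      then show ?thesis using on[of 1 0] b m0 m by auto
    qed
  next
    case False
    show ?thesis
    proof (cases "j0 = 1")
      case True
      then show ?thesis using on[of 1 1] j0 m0 m by (simp add: \<beta>_def)
    next
      case j1: False
      then have b: "\<beta> 1 1 = 1" "\<beta> 1 j0 \<noteq> 0" using j0 False by (auto simp: \<beta>_def)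
      have "null_col A 1 r = 0" if r: "r < m" for r
        using off[of 1 1 r] off[of 1 j0 r] b j0 m0 r False j1 by (cases "r = 2 \<or> r = 3") auto
      then show ?thesis using m by simp
    qed
  qed
  then show "r < m \<Longrightarrow> 2 \<le> r \<Longrightarrow> null_col A 1 r = 0" "null_col A 1 1 = \<i> * null_col A 1 0" by auto
qed

definition nv2 :: "blk \<Rightarrow> cpoly" where "nv2 p = Var (vr p 2) + cscale \<i> (Var (vr p 3))"

lemma two_row_vector_eq: "two_row_vector b = nv BZ ^ b * (nv BZ * nv2 BX - nv2 BZ * nv BX)"
  by (simp add: two_row_vector_def null_wedge_def nv2_def distrib_left distrib_right right_diff_distrib
      left_diff_distrib cscale_mult_left cscale_mult_right cv.scale_right_diff_distrib)

lemma positive_root_action: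
  assumes A: "so_root_vector m \<alpha> A" and pos: "so_positive m \<alpha>" and m: "4 \<le> m"
  shows "so_action m A (nv p) = 0" "so_action m A (nv2 p) = cscale (null_col A 1 0) (nv p)"
proof -
  have so: "A \<in> lie_carrier (so m)" using A by (simp add: so_root_vector_def)
  note c = positive_root_col[OF A pos m]
  have m2: "0 < m div 2" "1 < m div 2" using m by auto
  show "so_action m A (nv p) = 0"
    using so_action_null_var[OF so m2(1), of p] c(1) by (simp add: nv_def)
  have "so_action m A (nv2 p) = (\<Sum>a<m. cscale (null_col A 1 a) (Var (vr p a)))"
    using so_action_null_var[OF so m2(2), of p] by (simp add: nv2_def eval_nat_numeral)
  also have "\<dots> = cscale (null_col A 1 0) (Var (vr p 0)) + cscale (null_col A 1 1) (Var (vr p 1))"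
    using m c(2) by (subst sum_split2) auto
  finally show "so_action m A (nv2 p) = cscale (null_col A 1 0) (nv p)"
    using c(3) by (simp add: nv_def cv.scale_right_distrib mult.commute)
qed

lemma cartan_action:
  assumes "j < m div 2" "4 \<le> m"
  shows "so_action m (so_cartan m j) (nv p) = (if j = 0 then nv p else 0)"
    "so_action m (so_cartan m j) (nv2 p) = (if j = 1 then nv2 p else 0)"
proof -
  have j: "2 * j < m" "2 * j + 1 < m" using assms(1) by auto
  have V: "so_action m (so_cartan m j) (Var (vr p k)) =
      (if k = 2 * j + 1 then - cscale \<i> (Var (vr p (2 * j))) else 0) + (if k = 2 * j then cscale \<i> (Var (vr p (2 * j + 1))) else 0)"
    if k: "k < m" for k
  proof -
    have "(\<Sum>a<m. cscale (so_cartan m j $$ (a, k)) (Var (vr p a)))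
        = (\<Sum>a<m. (if a = 2 * j then if k = 2 * j + 1 then - cscale \<i> (Var (vr p a)) else 0 else 0)
         + (if a = 2 * j + 1 then if k = 2 * j then cscale \<i> (Var (vr p a)) else 0 else 0))"
      using k by (intro sum.cong refl) (auto simp: so_cartan_def cv.scale_minus_left)
    then show ?thesis using k j by (simp add: so_action_Var[OF so_cartan_so] sum.distrib)
  qed
  have ii: "cscale \<i> (cscale \<i> f) = - f" for f :: cpoly
    by (rule poly_mapping_eqI) simp
  have p: "(0::nat) = 2 * j \<longleftrightarrow> j = 0" "(1::nat) \<noteq> 2 * j" "(2::nat) = 2 * j \<longleftrightarrow> j = 1" "(3::nat) \<noteq> 2 * j"
    "(0::nat) \<noteq> 2 * j + 1" "(1::nat) = 2 * j + 1 \<longleftrightarrow> j = 0" "(2::nat) \<noteq> 2 * j + 1" "(3::nat) = 2 * j + 1 \<longleftrightarrow> j = 1"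
    by presburger+
  have mm: "0 < m" "1 < m" "2 < m" "3 < m" using assms(2) by auto
  show "so_action m (so_cartan m j) (nv p) = (if j = 0 then nv p else 0)"
    by (simp only: nv_def so_action_linear V mm p if_False)
      (simp add: ii cv.scale_minus_right)
  show "so_action m (so_cartan m j) (nv2 p) = (if j = 1 then nv2 p else 0)"
    by (simp only: nv2_def so_action_linear V mm p if_False)
      (simp add: ii cv.scale_minus_right)
qed

lemma derivation_eigen_power:
  assumes "derivation \<delta>" "\<delta> f = cscale c f"
  shows "\<delta> (f ^ n) = cscale (of_nat n * c) (f ^ n)"
proof (induction n)
  case 0
  then show ?case using derivationD(3)[OF assms(1), of 1] by (simp add: Cst_def)
next
  case (Suc n)
  then show ?case
    by (simp add: derivationD(2)[OF assms(1)] assms(2) cscale_mult_left cscale_mult_right)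
      (rule poly_mapping_eqI, simp add: lookup_simps algebra_simps)
qed

lemma harmonics_highest_weight:
  assumes m: "4 \<le> m"
  shows "so_highest_weight_vector m (so_action m) (two_row_weight a 0) (nv BZ ^ a)"
  unfolding so_highest_weight_vector_def
proof (intro conjI allI impI)
  show "nv BZ ^ a \<noteq> 0" by (rule nv_power_neq_0)
  fix j assume j: "j < m div 2"
  have "so_action m (so_cartan m j) (nv BZ) = cscale (if j = 0 then 1 else 0) (nv BZ)"
    using cartan_action[OF j m] by simp
  from derivation_eigen_power[OF derivation_so_action this]
  show "so_action m (so_cartan m j) (nv BZ ^ a) = cscale (of_int (two_row_weight a 0 j)) (nv BZ ^ a)"
    by (simp add: two_row_weight_def)
next
  fix \<alpha> A assume "so_positive m \<alpha> \<and> so_root_vector m \<alpha> A"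
  then have "so_action m A (nv BZ) = 0" using positive_root_action m by blast
  then show "so_action m A (nv BZ ^ a) = 0"
    by (rule derivation_power_zero[OF derivation_so_action])
qed

lemma two_row_highest_weight:
  assumes m: "4 \<le> m"
  shows "so_highest_weight_vector m (so_action m) (two_row_weight (Suc b) 1) (two_row_vector b)"
  unfolding so_highest_weight_vector_def
proof (intro conjI allI impI)
  show "two_row_vector b \<noteq> 0"
    using null_wedge_neq_0[of 1 b \<i>] by (auto simp: two_row_vector_def)
  note d = derivationD(2)[OF derivation_so_action] so_action_linear
  fix j assume j: "j < m div 2"
  have "so_action m (so_cartan m j) (nv BZ) = cscale (if j = 0 then 1 else 0) (nv BZ)"
    using cartan_action[OF j m] by simp
  note p = derivation_eigen_power[OF derivation_so_action this, of b]
  show "so_action m (so_cartan m j) (two_row_vector b) = cscale (of_int (two_row_weight (Suc b) 1 j)) (two_row_vector b)"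
    unfolding two_row_vector_eq using cartan_action[OF j m]
    by (simp add: d p two_row_weight_def cscale_mult_left)
      (simp add: algebra_simps cv.scale_left_distrib)
next
  fix \<alpha> A assume "so_positive m \<alpha> \<and> so_root_vector m \<alpha> A"
  then have r: "so_action m A (nv p) = 0" "so_action m A (nv2 p) = cscale (null_col A 1 0) (nv p)" for p
    using positive_root_action m by blast+
  have "so_action m A (nv BZ ^ b) = 0"
    by (rule derivation_power_zero[OF derivation_so_action r(1)])
  then show "so_action m A (two_row_vector b) = 0"
    unfolding two_row_vector_eq
    by (simp add: derivationD(2)[OF derivation_so_action] so_action_linear r cscale_mult_left cscale_mult_right mult.commute)
qed

section \<open>Lowest weight modules\<close>

text \<open>The element H^2 + 2XY + 2YX in the order suited to lowest weight vectors, where its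
  value is c (c - 2).\<close>

definition sl2_casimir :: "nat \<Rightarrow> cpoly \<Rightarrow> cpoly" where
  "sl2_casimir m f = cscale 4 (sl2_raise m (sl2_lower m f)) + sl2_euler m (sl2_euler m f) - cscale 2 (sl2_euler m f)"

lemma linear_op_sl2_casimir: "linear_op (sl2_casimir m)"
  by (rule linear_opI) (simp_all add: sl2_casimir_def sl2_linear cv.scale_right_distrib cv.scale_right_diff_distrib mult.commute)

lemma zero_so: "0\<^sub>m m m \<in> lie_carrier (so m)"
proof -
  have "transpose_mat (0\<^sub>m m m) = - (0\<^sub>m m m :: complex mat)" by (rule eq_matI) auto
  then show ?thesis by (simp add: so_def matrix_lie_algebra_def)
qed

lemma so_action_zero: "so_action m (0\<^sub>m m m) f = 0"
  by (auto simp: so_action_def intro!: sum.neutral)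

lemma sl2_elements: "0\<^sub>m 2 2 \<in> lie_carrier sl2" "sl2_X \<in> lie_carrier sl2" "sl2_Y \<in> lie_carrier sl2" "sl2_H \<in> lie_carrier sl2"
  by (auto simp: sl2_def matrix_lie_algebra_def sl2_X_def sl2_Y_def sl2_H_def mat_of_rows_list_def)

lemma sl2_entries:
  "sl2_X $$ (0,0) = 0" "sl2_X $$ (0,1) = 1" "sl2_X $$ (1,0) = 0"
  "sl2_Y $$ (0,0) = 0" "sl2_Y $$ (0,1) = 0" "sl2_Y $$ (1,0) = 1"
  "sl2_H $$ (0,0) = 1" "sl2_H $$ (0,1) = 0" "sl2_H $$ (1,0) = 0"
  by (auto simp: sl2_X_def sl2_Y_def sl2_H_def mat_of_rows_list_def)

lemma sl2_action_elements:
  "sl2_action m (0\<^sub>m 2 2) f = 0" "sl2_action m sl2_X f = sl2_raise m f"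
  "sl2_action m sl2_Y f = sl2_lower m f" "sl2_action m sl2_H f = sl2_euler m f"
  by (simp_all add: sl2_action_def sl2_entries del: One_nat_def)

lemma so_sl2_action_components:
  "so_sl2_action m (A, 0\<^sub>m 2 2) f = so_action m A f"
  "so_sl2_action m (0\<^sub>m m m, sl2_X) f = sl2_raise m f"
  "so_sl2_action m (0\<^sub>m m m, sl2_Y) f = sl2_lower m f"
  "so_sl2_action m (0\<^sub>m m m, sl2_H) f = sl2_euler m f"
  by (simp_all add: so_sl2_action_def sl2_action_elements so_action_zero)

lemma so_sl2_carrier:
  "(A, B) \<in> lie_carrier (lie_prod (so m) sl2) \<longleftrightarrow> A \<in> lie_carrier (so m) \<and> B \<in> lie_carrier sl2"
  by (simp add: lie_prod_def)

lemma representation_so_sl2: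
  assumes W: "cv.subspace W"
    and so: "\<And>A f. A \<in> lie_carrier (so m) \<Longrightarrow> f \<in> W \<Longrightarrow> so_action m A f \<in> W"
    and sl: "\<And>f. f \<in> W \<Longrightarrow> sl2_raise m f \<in> W" "\<And>f. f \<in> W \<Longrightarrow> sl2_lower m f \<in> W" "\<And>f. f \<in> W \<Longrightarrow> sl2_euler m f \<in> W"
  shows "representation (lie_prod (so m) sl2) W (so_sl2_action m)"
proof -
  have inv: "so_sl2_action m (A, B) f \<in> W" if "A \<in> lie_carrier (so m)" "f \<in> W" for A B f
    using that so sl unfolding so_sl2_action_def sl2_action_def
    by (auto intro!: cv.subspace_add[OF W] cv.subspace_scale[OF W])
  have add: "so_sl2_action m (lie_add (lie_prod (so m) sl2) (A, B) (A', B')) f = so_sl2_action m (A, B) f + so_sl2_action m (A', B') f"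
    and br: "so_sl2_action m (lie_bracket (lie_prod (so m) sl2) (A, B) (A', B')) f
      = so_sl2_action m (A, B) (so_sl2_action m (A', B') f) - so_sl2_action m (A', B') (so_sl2_action m (A, B) f)"
    and sc: "so_sl2_action m (lie_scale (lie_prod (so m) sl2) c (A, B)) f = cscale c (so_sl2_action m (A, B) f)"
    if "A \<in> lie_carrier (so m)" "B \<in> lie_carrier sl2" "A' \<in> lie_carrier (so m)" "B' \<in> lie_carrier sl2" for A B A' B' f c
    using that
    by (simp_all add: lie_prod_def so_sl2_action_def so_action_add sl2_action_add so_action_bracket sl2_action_bracket
        so_action_scale sl2_action_scale cv.scale_right_distrib so_action_linear sl2_linear so_action_commute)
  show ?thesis
    unfolding representation_def
  proof (intro conjI ballI allI)
    fix P assume P: "P \<in> lie_carrier (lie_prod (so m) sl2)"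
    obtain A B where AB: "P = (A, B)" by (cases P)
    then show "so_sl2_action m P ` W \<subseteq> W" using P inv by (auto simp: so_sl2_carrier)
    show "linear_map_on W (so_sl2_action m P)"
      using AB by (simp add: linear_map_on_def sl2_linear)
  qed (use W add br sc so_sl2_carrier in auto)
qed

section \<open>Modules generated by lowest weight vectors\<close>

definition linear_extension :: "(nat \<Rightarrow> ('t \<Rightarrow>\<^sub>0 complex)) \<Rightarrow> (nat \<Rightarrow>\<^sub>0 complex) \<Rightarrow> ('t \<Rightarrow>\<^sub>0 complex)" where
  "linear_extension b n = (\<Sum>k\<in>Poly_Mapping.keys n. cscale (Poly_Mapping.lookup n k) (b k))"

lemma linear_extension_superset:
  "finite S \<Longrightarrow> Poly_Mapping.keys n \<subseteq> S \<Longrightarrow> linear_extension b n = (\<Sum>k\<in>S. cscale (Poly_Mapping.lookup n k) (b k))"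
  unfolding linear_extension_def by (intro sum.mono_neutral_left) (auto simp: in_keys_iff)

lemma linear_op_linear_extension: "linear_op (linear_extension b)"
proof (rule linear_opI)
  fix f g :: "nat \<Rightarrow>\<^sub>0 complex" and c
  let ?S = "Poly_Mapping.keys f \<union> Poly_Mapping.keys g \<union> Poly_Mapping.keys (f + g) \<union> Poly_Mapping.keys (cscale c f)"
  have "linear_extension b n = (\<Sum>k\<in>?S. cscale (Poly_Mapping.lookup n k) (b k))" if "n \<in> {f, g, f + g, cscale c f}" for n
    by (rule linear_extension_superset) (use that in auto)
  then show "linear_extension b (f + g) = linear_extension b f + linear_extension b g"
    "linear_extension b (cscale c f) = cscale c (linear_extension b f)"
    by (simp_all add: lookup_add cv.scale_left_distrib sum.distrib cv.scale_sum_right)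
qed

lemma linear_extension_single: "linear_extension b (Poly_Mapping.single k c) = cscale c (b k)"
  using linear_extension_superset[of "{k}" "Poly_Mapping.single k c" b] by simp

lemma single_eq_cscale: "Poly_Mapping.single k c = cscale c (Poly_Mapping.single k 1)"
  by (rule poly_mapping_eqI) (simp add: lookup_single when_def)

lemma linear_op_eq_on_single:
  assumes "linear_op F" "linear_op G" "\<And>k. F (Poly_Mapping.single k 1) = G (Poly_Mapping.single k 1)"
  shows "F n = G n"
proof (induction n rule: poly_mapping_add_induct)
  case (single k c)
  show ?case unfolding single_eq_cscale[of k c] using assms by (simp add: linear_opD)
qed (use assms in \<open>simp_all add: linear_opD\<close>)

lemma linear_op_comp: "linear_op F \<Longrightarrow> linear_op G \<Longrightarrow> linear_op (\<lambda>f. F (G f))"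
  by (rule linear_opI) (simp_all add: linear_opD)

lemma linear_op_add: "linear_op F \<Longrightarrow> linear_op G \<Longrightarrow> linear_op (\<lambda>f. F f + G f)"
  by (rule linear_opI) (simp_all add: linear_opD cv.scale_right_distrib)

lemma linear_op_cscale: "linear_op F \<Longrightarrow> linear_op (\<lambda>f. cscale c (F f))"
  by (rule linear_opI) (simp_all add: linear_opD cv.scale_right_distrib mult.commute)

lemma basis_of_single: "basis_of (range (\<lambda>k. Poly_Mapping.single k (1::complex))) (UNIV :: ('k \<Rightarrow>\<^sub>0 complex) set)"
  unfolding basis_of_def
proof
  show "cv.independent (range (\<lambda>k. Poly_Mapping.single k (1::complex)) :: ('k \<Rightarrow>\<^sub>0 complex) set)"
    unfolding cv.independent_explicit_module
  proof (intro allI impI)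
    fix t :: "('k \<Rightarrow>\<^sub>0 complex) set" and u v
    assume t: "finite t" "t \<subseteq> range (\<lambda>k. Poly_Mapping.single k 1)" "(\<Sum>v\<in>t. cscale (u v) v) = 0" "v \<in> t"
    then obtain k where k: "v = Poly_Mapping.single k 1" by auto
    have "0 = (\<Sum>w\<in>t. u w * Poly_Mapping.lookup w k)"
      using arg_cong[OF t(3), of "\<lambda>f. Poly_Mapping.lookup f k"] by (simp add: lookup_sum)
    also have "\<dots> = (\<Sum>w\<in>t. if w = v then u v else 0)"
    proof (intro sum.cong refl)
      fix w assume "w \<in> t"
      then obtain j where "w = Poly_Mapping.single j 1" using t(2) by auto
      then show "u w * Poly_Mapping.lookup w k = (if w = v then u v else 0)"
        using k by (cases "j = k") (auto simp: lookup_single when_def dest: arg_cong[of _ _ "\<lambda>f. Poly_Mapping.lookup f k"])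
    qed
    finally show "u v = 0" using t(1,4) by simp
  qed
  have "f \<in> cv.span (range (\<lambda>k. Poly_Mapping.single k 1))" for f :: "'k \<Rightarrow>\<^sub>0 complex"
  proof (induction f rule: poly_mapping_add_induct)
    case (single t a)
    then show ?case unfolding single_eq_cscale[of t a] by (intro cv.span_scale cv.span_base) auto
  qed (auto intro: cv.span_zero cv.span_add)
  then show "cv.span (range (\<lambda>k. Poly_Mapping.single k (1::complex))) = (UNIV :: ('k \<Rightarrow>\<^sub>0 complex) set)" by auto
qed

text \<open>The common form of the five families: \<open>\<phi>\<close> places a copy of the
  so(m)-module \<open>M\<close> among the lowest weight vectors of weight \<open>c\<close>. The last
  assumption excludes c = 0, -1, -2, ..., the values at which the Verma module is reducible; it
  yields irreducibility and the surjectivity of \<open>sl2_lower\<close>.\<close>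

locale lowest_weight_embedding =
  fixes m :: nat and M :: "cpoly set" and \<phi> :: "cpoly \<Rightarrow> cpoly" and c :: complex
  assumes irreducible: "irreducible_under (so_action m ` lie_carrier (so m)) M"
    and linear: "linear_op \<phi>"
    and mono: "h \<in> M \<Longrightarrow> \<phi> h \<in> symplectic_monogenics m 1"
    and lower: "h \<in> M \<Longrightarrow> sl2_lower m (\<phi> h) = 0"
    and euler: "h \<in> M \<Longrightarrow> sl2_euler m (\<phi> h) = cscale c (\<phi> h)"
    and equivariant: "A \<in> lie_carrier (so m) \<Longrightarrow> \<phi> (so_action m A h) = so_action m A (\<phi> h)"
    and injective: "h \<in> M \<Longrightarrow> \<phi> h = 0 \<Longrightarrow> h = 0"
    and nonint: "c + of_nat k \<noteq> 0"
begin

definition W :: "cpoly set" where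
  "W = cv.span (\<Union>k. (\<lambda>h. (sl2_raise m ^^ k) (\<phi> h)) ` M)"

lemma M: "cv.subspace M" "M \<noteq> {0}" "A \<in> lie_carrier (so m) \<Longrightarrow> h \<in> M \<Longrightarrow> so_action m A h \<in> M"
  using irreducible unfolding irreducible_under_def by blast+

lemma subspace_W: "cv.subspace W"
  by (simp add: W_def)

lemma linear_pow: "linear_op (\<lambda>h. (sl2_raise m ^^ k) (\<phi> h))"
proof (induction k)
  case (Suc k)
  then show ?case using linear_op_comp[OF linear_op_sl2(1) Suc] by simp
qed (simp add: linear)

lemmas pow_linear = linear_opD[OF linear_pow]

lemma euler_pow: "h \<in> M \<Longrightarrow> sl2_euler m ((sl2_raise m ^^ k) (\<phi> h)) = cscale (c + 2 * of_nat k) ((sl2_raise m ^^ k) (\<phi> h))"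
proof (induction k)
  case 0
  then show ?case by (simp add: euler)
next
  case (Suc k)
  then show ?case by (simp add: euler_raise sl2_linear)
      (rule poly_mapping_eqI, simp add: lookup_simps algebra_simps)
qed

lemma lower_raise: "sl2_lower m (sl2_raise m f) = sl2_raise m (sl2_lower m f) - sl2_euler m f"
  using raise_lower[of m f] by (simp add: algebra_simps)

text \<open>Moving \<open>sl2_lower\<close> past one more raising operator subtracts the current
  weight c + 2 i; the weights for i from 0 to k add up to (k + 1)(c + k).\<close>

lemma lower_pow:
  assumes "h \<in> M"
  shows "sl2_lower m ((sl2_raise m ^^ Suc k) (\<phi> h)) = cscale (- (of_nat (Suc k) * (c + of_nat k))) ((sl2_raise m ^^ k) (\<phi> h))"
proof (induction k)
  case 0
  then show ?case using assms by (simp add: lower_raise lower euler sl2_linear cv.scale_minus_left)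
next
  case (Suc k)
  have "sl2_lower m ((sl2_raise m ^^ Suc (Suc k)) (\<phi> h))
      = sl2_raise m (sl2_lower m ((sl2_raise m ^^ Suc k) (\<phi> h))) - sl2_euler m ((sl2_raise m ^^ Suc k) (\<phi> h))"
    by (simp add: lower_raise)
  also have "\<dots> = cscale (- (of_nat (Suc k) * (c + of_nat k))) ((sl2_raise m ^^ Suc k) (\<phi> h))
      - cscale (c + 2 * of_nat (Suc k)) ((sl2_raise m ^^ Suc k) (\<phi> h))"
    unfolding Suc euler_pow[OF assms] by (simp add: sl2_linear)
  also have "\<dots> = cscale (- (of_nat (Suc (Suc k)) * (c + of_nat (Suc k)))) ((sl2_raise m ^^ Suc k) (\<phi> h))"
    unfolding cv.scale_left_diff_distrib [symmetric] by (simp add: algebra_simps)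
  finally show ?case .
qed

lemma lower_coeff_neq_0: "- (of_nat (Suc k) * (c + of_nat k)) \<noteq> (0 :: complex)"
  using nonint[of k] by (simp del: of_nat_Suc)

lemma pow_eq_0: "h \<in> M \<Longrightarrow> (sl2_raise m ^^ k) (\<phi> h) = 0 \<Longrightarrow> h = 0"
proof (induction k)
  case 0
  then show ?case using injective by simp
next
  case (Suc k)
  then have "cscale (- (of_nat (Suc k) * (c + of_nat k))) ((sl2_raise m ^^ k) (\<phi> h)) = 0"
    using lower_pow[of h k] by (simp add: sl2_linear)
  then have "(sl2_raise m ^^ k) (\<phi> h) = 0" using lower_coeff_neq_0 cv.scale_eq_0_iff by blast
  then show ?case using Suc by blast
qed

lemma pow_in_W: "h \<in> M \<Longrightarrow> (sl2_raise m ^^ k) (\<phi> h) \<in> W"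
  unfolding W_def by (intro cv.span_base) auto

text \<open>There is no case for scalars because \<open>M\<close> is a subspace and absorbs
  them.\<close>

lemma W_induct [consumes 1, case_names zero pow add]:
  assumes "f \<in> W" "P 0" "\<And>h k. h \<in> M \<Longrightarrow> P ((sl2_raise m ^^ k) (\<phi> h))"
    "\<And>f g. f \<in> W \<Longrightarrow> g \<in> W \<Longrightarrow> P f \<Longrightarrow> P g \<Longrightarrow> P (f + g)"
  shows "P f"
proof -
  have "f \<in> W \<and> P f" using assms(1) unfolding W_def
  proof (induction rule: cv.span_induct_alt)
    case base
    then show ?case using assms(2) cv.span_zero by blast
  next
    case (step a x y)
    then obtain k h where h: "h \<in> M" "x = (sl2_raise m ^^ k) (\<phi> h)" by auto
    then have ax: "cscale a x = (sl2_raise m ^^ k) (\<phi> (cscale a h))" by (simp add: pow_linear)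
    moreover have "cscale a h \<in> M" using h M(1) cv.subspace_scale by blast
    ultimately have "P (cscale a x)" "cscale a x \<in> W" using assms(3) pow_in_W by auto
    moreover have "y \<in> W" "P y" using step(2) by (auto simp: W_def)
    ultimately show ?case using assms(4) cv.subspace_add[OF subspace_W] by (auto simp flip: W_def)
  qed
  then show ?thesis by blast
qed

lemma W_raise: "f \<in> W \<Longrightarrow> sl2_raise m f \<in> W"
proof (induction rule: W_induct)
  case (pow h k)
  then show ?case using pow_in_W[of h "Suc k"] by simp
qed (auto simp: sl2_linear intro: cv.subspace_add[OF subspace_W] cv.subspace_0[OF subspace_W])

lemma W_lower: "f \<in> W \<Longrightarrow> sl2_lower m f \<in> W"
proof (induction rule: W_induct)
  case (pow h k)
  show ?case
  proof (cases k)
    case 0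
    then show ?thesis using pow lower cv.subspace_0[OF subspace_W] by simp
  next
    case (Suc n)
    then show ?thesis using lower_pow[OF pow] pow_in_W[OF pow] cv.subspace_scale[OF subspace_W] by metis
  qed
qed (auto simp: sl2_linear intro: cv.subspace_add[OF subspace_W] cv.subspace_0[OF subspace_W])

lemma W_euler: "f \<in> W \<Longrightarrow> sl2_euler m f \<in> W"
proof (induction rule: W_induct)
  case (pow h k)
  then show ?case using euler_pow pow_in_W cv.subspace_scale[OF subspace_W] by metis
qed (auto simp: sl2_linear intro: cv.subspace_add[OF subspace_W] cv.subspace_0[OF subspace_W])

lemma so_action_pow:
  "A \<in> lie_carrier (so m) \<Longrightarrow> so_action m A ((sl2_raise m ^^ k) (\<phi> h)) = (sl2_raise m ^^ k) (\<phi> (so_action m A h))"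
  by (induction k) (simp_all add: equivariant so_action_commute)

lemma W_so:
  assumes "A \<in> lie_carrier (so m)"
  shows "f \<in> W \<Longrightarrow> so_action m A f \<in> W"
proof (induction rule: W_induct)
  case (pow h k)
  then show ?case using assms M(3) by (simp add: so_action_pow pow_in_W)
qed (auto simp: so_action_linear intro: cv.subspace_add[OF subspace_W] cv.subspace_0[OF subspace_W])

lemma W_monogenic: "f \<in> W \<Longrightarrow> f \<in> symplectic_monogenics m 1"
proof (induction rule: W_induct)
  case (pow h k)
  show ?case
  proof (induction k)
    case (Suc k)
    then show ?case unfolding symplectic_monogenics_1 by (simp add: xy_linear_ops D_s_raise sl2_linear)
  qed (use mono[OF pow] in simp)
qed (use cv.subspace_add[OF subspace_symplectic_monogenics] cv.subspace_0[OF subspace_symplectic_monogenics] in simp_all)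

lemma lower_surj: "f \<in> W \<Longrightarrow> \<exists>g\<in>W. sl2_lower m g = f"
proof (induction rule: W_induct)
  case zero
  show ?case using cv.subspace_0[OF subspace_W] linear_opD(3)[OF linear_op_sl2(2)] by blast
next
  case (pow h k)
  let ?c = "- (of_nat (Suc k) * (c + of_nat k))"
  have "sl2_lower m (cscale (inverse ?c) ((sl2_raise m ^^ Suc k) (\<phi> h))) = (sl2_raise m ^^ k) (\<phi> h)"
    unfolding linear_opD(2)[OF linear_op_sl2(2)] lower_pow[OF pow]
    by (simp only: cv.scale_scale left_inverse[OF lower_coeff_neq_0] cv.scale_one)
  then show ?case using cv.subspace_scale[OF subspace_W] pow_in_W[OF pow] by blast
next
  case (add f g)
  then show ?case using cv.subspace_add[OF subspace_W] linear_opD(1)[OF linear_op_sl2(2)] by metis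
qed

lemma W_expand: "f \<in> W \<Longrightarrow> \<exists>n h. (\<forall>k. h k \<in> M) \<and> f = (\<Sum>k<n. (sl2_raise m ^^ k) (\<phi> (h k)))"
proof (induction rule: W_induct)
  case zero
  then show ?case using M(1) cv.subspace_0 by (intro exI[of _ 0] exI[of _ "\<lambda>k. 0"]) simp
next
  case (pow h k)
  have "(\<Sum>i<Suc k. (sl2_raise m ^^ i) (\<phi> (if i = k then h else 0))) = (sl2_raise m ^^ k) (\<phi> h)"
    using pow_linear(3) by simp
  then show ?case using pow M(1) cv.subspace_0
    by (intro exI[of _ "Suc k"] exI[of _ "\<lambda>i. if i = k then h else 0"]) auto
next
  case (add f g)
  then obtain n n' h h' where h: "\<forall>k. h k \<in> M" "f = (\<Sum>k<n. (sl2_raise m ^^ k) (\<phi> (h k)))"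
    and h': "\<forall>k. h' k \<in> M" "g = (\<Sum>k<n'. (sl2_raise m ^^ k) (\<phi> (h' k)))" by blast
  define q where "q k = (if k < n then h k else 0) + (if k < n' then h' k else 0)" for k
  have "(\<Sum>k<n. (sl2_raise m ^^ k) (\<phi> (h k))) = (\<Sum>k<max n n'. (sl2_raise m ^^ k) (\<phi> (if k < n then h k else 0)))"
    by (intro sum.mono_neutral_cong_left) (auto simp: pow_linear)
  moreover have "(\<Sum>k<n'. (sl2_raise m ^^ k) (\<phi> (h' k))) = (\<Sum>k<max n n'. (sl2_raise m ^^ k) (\<phi> (if k < n' then h' k else 0)))"
    by (intro sum.mono_neutral_cong_left) (auto simp: pow_linear)
  ultimately have "f + g = (\<Sum>k<max n n'. (sl2_raise m ^^ k) (\<phi> (q k)))"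
    by (simp add: h h' q_def pow_linear sum.distrib)
  moreover have "\<forall>k. q k \<in> M"
    using h(1) h'(1) M(1) by (auto simp: q_def intro!: cv.subspace_add cv.subspace_0)
  ultimately show ?case by blast
qed

lemma sum_pow_eq_0:
  assumes "finite K" "\<And>k. k \<in> K \<Longrightarrow> h k \<in> M" "(\<Sum>k\<in>K. (sl2_raise m ^^ k) (\<phi> (h k))) = 0" "k \<in> K"
  shows "h k = 0"
proof -
  have "(sl2_raise m ^^ k) (\<phi> (h k)) \<in> {0}"
  proof (rule eigenvector_components_in_subspace[OF assms(1) _ _ _ assms(4), where w = "\<lambda>k. (sl2_raise m ^^ k) (\<phi> (h k))"])
    fix i j :: nat assume "i \<noteq> j"
    then show "\<exists>F \<mu>. linear_op F \<and> F ` {0} \<subseteq> {0} \<and> (\<forall>k\<in>K. F ((sl2_raise m ^^ k) (\<phi> (h k))) = cscale (\<mu> k) ((sl2_raise m ^^ k) (\<phi> (h k)))) \<and> \<mu> i \<noteq> \<mu> j"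
      using euler_pow assms(2)
      by (intro exI[of _ "sl2_euler m"] exI[of _ "\<lambda>k. c + 2 * of_nat k"]) (simp add: linear_op_sl2 sl2_linear)
  qed (use assms in \<open>auto simp: cv.subspace_def\<close>)
  then show ?thesis using pow_eq_0 assms(2,4) by auto
qed

text \<open>Lowering shifts the powers of R down by one with nonzero coefficients, and different
  powers have different weights, so only the term without R can remain.\<close>

lemma lower_kernel:
  assumes "f \<in> W" "sl2_lower m f = 0"
  shows "\<exists>h\<in>M. f = \<phi> h"
proof -
  obtain n h where h: "\<And>k. h k \<in> M" "f = (\<Sum>k<n. (sl2_raise m ^^ k) (\<phi> (h k)))" using W_expand[OF assms(1)] by blast
  \<comment> \<open>Padding the coefficients with 0 lets the term without R be split off even when
    \<open>n = 0\<close>.\<close>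
  define n' where "n' = n - 1"
  define h' where "h' k = (if k < n then h k else 0)" for k
  have h'M: "h' k \<in> M" for k using h(1) M(1) cv.subspace_0 by (auto simp: h'_def)
  have f: "f = \<phi> (h' 0) + (\<Sum>k<n'. (sl2_raise m ^^ Suc k) (\<phi> (h' (Suc k))))"
  proof (cases n)
    case 0
    then show ?thesis using h(2) by (simp add: n'_def h'_def linear_opD(3)[OF linear])
  next
    case (Suc i)
    have "f = (\<Sum>k<Suc i. (sl2_raise m ^^ k) (\<phi> (h' k)))" using h(2) Suc by (auto simp: h'_def)
    then show ?thesis using Suc by (simp only: sum.lessThan_Suc_shift n'_def diff_Suc_1 funpow_0)
  qed
  have "(\<Sum>k<n'. (sl2_raise m ^^ k) (\<phi> (cscale (- (of_nat (Suc k) * (c + of_nat k))) (h' (Suc k))))) = 0"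
    using assms(2) unfolding f linear_opD(1,6)[OF linear_op_sl2(2)] lower[OF h'M] lower_pow[OF h'M] pow_linear by simp
  then have z: "cscale (- (of_nat (Suc k) * (c + of_nat k))) (h' (Suc k)) = 0" if "k < n'" for k
    by (rule sum_pow_eq_0[rotated 2]) (use that h'M cv.subspace_scale[OF M(1)] in blast)+
  have "h' (Suc k) = 0" if "k < n'" for k
    using z[OF that] lower_coeff_neq_0[of k] cv.scale_eq_0_iff by blast
  then have "f = \<phi> (h' 0)" using f by (simp add: pow_linear del: funpow.simps)
  then show ?thesis using h'M by blast
qed

lemma W_lower_nilpotent: "f \<in> W \<Longrightarrow> \<exists>n. (sl2_lower m ^^ n) f = 0"
proof -
  assume "f \<in> W"
  then have "f \<in> xy_linear m" using W_monogenic unfolding symplectic_monogenics_1 by blast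
  then show ?thesis
    by (intro weight_lowering_nilpotent[of "sl2_lower m" m f]) (auto simp: linear_op_sl2 xy_linear_ops euler_lower)
qed

lemma W_representation: "representation (lie_prod (so m) sl2) W (so_sl2_action m)"
  by (rule representation_so_sl2[OF subspace_W W_so W_raise W_lower W_euler])

text \<open>Lowering a nonzero vector of an invariant \<open>U\<close> ends in a nonzero
  \<open>\<phi> h\<close> in \<open>U\<close>. The preimage of \<open>U\<close> under
  \<open>\<phi>\<close> is an so(m)-submodule of the irreducible \<open>M\<close>, hence all of it,
  and raising then gives \<open>W\<close>.\<close>

lemma W_irreducible: "irreducible_rep (lie_prod (so m) sl2) W (so_sl2_action m)"
  unfolding irreducible_rep_def irreducible_under_def
proof (intro conjI allI impI)
  show "representation (lie_prod (so m) sl2) W (so_sl2_action m)" by (rule W_representation)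
  show "cv.subspace W" by (rule subspace_W)
  obtain h where h: "h \<in> M" "h \<noteq> 0" using M(1,2) cv.subspace_0 by blast
  then show "W \<noteq> {0}" using pow_in_W[of h 0] injective by auto
  show "\<forall>F\<in>so_sl2_action m ` lie_carrier (lie_prod (so m) sl2). F ` W \<subseteq> W"
    using W_representation unfolding representation_def by blast
  fix U assume U: "cv.subspace U \<and> U \<subseteq> W \<and> (\<forall>F\<in>so_sl2_action m ` lie_carrier (lie_prod (so m) sl2). F ` U \<subseteq> U)"
  have act: "so_sl2_action m (A, B) f \<in> U" if "A \<in> lie_carrier (so m)" "B \<in> lie_carrier sl2" "f \<in> U" for A B f
    using U that so_sl2_carrier by blast
  have so: "so_action m A f \<in> U" if "A \<in> lie_carrier (so m)" "f \<in> U" for A f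
    using act[OF that(1) sl2_elements(1) that(2)] by (simp add: so_sl2_action_components)
  have R: "sl2_raise m f \<in> U" and L: "sl2_lower m f \<in> U" if "f \<in> U" for f
    using act[OF zero_so sl2_elements(2) that] act[OF zero_so sl2_elements(3) that]
    by (simp_all add: so_sl2_action_components)
  show "U = {0} \<or> U = W"
  proof (cases "U = {0}")
    case False
    then obtain u where u: "u \<in> U" "u \<noteq> 0" using U cv.subspace_0 by blast
    then obtain n where "(sl2_lower m ^^ n) u = 0" using W_lower_nilpotent U by blast
    then obtain k where k: "(sl2_lower m ^^ k) u \<noteq> 0" "sl2_lower m ((sl2_lower m ^^ k) u) = 0"
      using funpow_last_nonzero u(2) by blast
    have kU: "(sl2_lower m ^^ k) u \<in> U" using L u(1) by (intro funpow_in) auto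
    then obtain h where h: "h \<in> M" "(sl2_lower m ^^ k) u = \<phi> h" using lower_kernel k(2) U by blast
    define H where "H = {h \<in> M. \<phi> h \<in> U}"
    have "cv.subspace H"
      using M(1) U unfolding H_def
      by (auto simp: cv.subspace_def linear_opD[OF linear])
    moreover have "\<forall>F\<in>so_action m ` lie_carrier (so m). F ` H \<subseteq> H"
      using M(3) so by (auto simp: H_def equivariant)
    moreover have "h \<in> H" "h \<noteq> 0" using h kU k(1) linear_opD(3)[OF linear] by (auto simp: H_def)
    ultimately have "H = M" using irreducible unfolding irreducible_under_def H_def by blast
    then have "\<phi> h \<in> U" if "h \<in> M" for h using that by (auto simp: H_def)
    then have pow: "(sl2_raise m ^^ k) (\<phi> h) \<in> U" if "h \<in> M" for h k
      using that R by (intro funpow_in) auto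
    have "f \<in> U" if "f \<in> W" for f
      using that by (induction rule: W_induct) (use U pow cv.subspace_0 cv.subspace_add in auto)
    then show ?thesis using U by blast
  qed simp
qed

lemma so_casimir_W:
  assumes k: "\<And>h. h \<in> M \<Longrightarrow> so_casimir m h = cscale \<kappa> h" and f: "f \<in> W"
  shows "so_casimir m f = cscale \<kappa> f"
  using f
proof (induction rule: W_induct)
  case (pow h n)
  have "so_casimir m ((sl2_raise m ^^ n) (\<phi> h)) = (sl2_raise m ^^ n) (\<phi> (so_casimir m h))"
    by (simp add: so_casimir_action so_action_pow elem_skew_so pow_linear)
  then show ?case using k[OF pow] by (simp add: pow_linear)
qed (simp_all add: linear_opD[OF linear_op_so_casimir] cv.scale_right_distrib)

lemma sl2_casimir_W:
  assumes f: "f \<in> W"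
  shows "sl2_casimir m f = cscale (c * (c - 2)) f"
  using f
proof (induction rule: W_induct)
  case (pow h n)
  show ?case
  proof (cases n)
    case 0
    then show ?thesis using pow by (simp add: sl2_casimir_def lower euler sl2_linear)
        (rule poly_mapping_eqI, simp add: lookup_simps algebra_simps)
  next
    case (Suc k)
    define X where "X = (sl2_raise m ^^ n) (\<phi> h)"
    define Y where "Y = (sl2_raise m ^^ k) (\<phi> h)"
    define a where "a = - (of_nat (Suc k) * (c + of_nat k))"
    define e where "e = c + 2 * of_nat n"
    have "sl2_lower m X = cscale a Y" "sl2_euler m X = cscale e X" "sl2_raise m Y = X"
      using lower_pow[OF pow, of k] euler_pow[OF pow, of n] Suc by (simp_all add: X_def Y_def a_def e_def)
    then have "sl2_casimir m X = cscale (4 * a + e * e - 2 * e) X"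
      by (simp add: sl2_casimir_def sl2_linear cv.scale_left_distrib cv.scale_left_diff_distrib)
    then have "sl2_casimir m ((sl2_raise m ^^ n) (\<phi> h)) = cscale (4 * (- (of_nat (Suc k) * (c + of_nat k))) + (c + 2 * of_nat n) * (c + 2 * of_nat n) - 2 * (c + 2 * of_nat n)) ((sl2_raise m ^^ n) (\<phi> h))"
      by (simp only: X_def a_def e_def)
    also have "4 * (- (of_nat (Suc k) * (c + of_nat k))) + (c + 2 * of_nat n) * (c + 2 * of_nat n) - 2 * (c + 2 * of_nat n) = c * (c - 2)"
      unfolding Suc by (simp add: algebra_simps)
    finally show ?thesis .
  qed
qed (simp_all add: linear_opD[OF linear_op_sl2_casimir] cv.scale_right_distrib)

end

section \<open>The outer tensor product structure\<close>

context lowest_weight_embedding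
begin

definition tens :: "cpoly \<Rightarrow> (nat \<Rightarrow>\<^sub>0 complex) \<Rightarrow> cpoly" where
  "tens h = linear_extension (\<lambda>k. (sl2_raise m ^^ k) (\<phi> h))"

text \<open>The Verma module on finitely supported sequences, where
  \<open>Poly_Mapping.single k 1\<close> stands for X^k v. The lowering coefficient is that of
  \<open>lower_pow\<close> with the index shifted; it vanishes at \<open>k = 0\<close>, where
  \<open>k - 1\<close> truncates.\<close>

definition verma :: "complex mat \<Rightarrow> (nat \<Rightarrow>\<^sub>0 complex) \<Rightarrow> (nat \<Rightarrow>\<^sub>0 complex)" where
  "verma B n = cscale (B $$ (0, 1)) (linear_extension (\<lambda>k. Poly_Mapping.single (Suc k) 1) n)
     + cscale (B $$ (1, 0)) (linear_extension (\<lambda>k. cscale (- (of_nat k * (c + of_nat k - 1))) (Poly_Mapping.single (k - 1) 1)) n)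
     + cscale (B $$ (0, 0)) (linear_extension (\<lambda>k. cscale (c + 2 * of_nat k) (Poly_Mapping.single k 1)) n)"

lemma linear_op_tens: "linear_op (tens h)"
  unfolding tens_def by (rule linear_op_linear_extension)

lemmas tens_linear = linear_opD[OF linear_op_tens]

lemma linear_op_verma: "linear_op (verma B)"
  unfolding verma_def
  by (intro linear_op_add linear_op_cscale linear_op_linear_extension)

lemma tens_single: "tens h (Poly_Mapping.single k 1) = (sl2_raise m ^^ k) (\<phi> h)"
  by (simp add: tens_def linear_extension_single)

lemma tens_add: "tens (h + h') n = tens h n + tens h' n" "tens (cscale a h) n = cscale a (tens h n)"
  by (simp_all add: tens_def linear_extension_def pow_linear cv.scale_right_distrib sum.distrib cv.scale_sum_right mult.commute)

lemma tens_verma: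
  assumes h: "h \<in> M"
  shows "tens h (verma B n) = sl2_action m B (tens h n)"
proof (rule linear_op_eq_on_single[OF linear_op_comp[OF linear_op_tens linear_op_verma] linear_op_comp[OF linear_op_sl2(6) linear_op_tens]])
  fix k
  have "sl2_lower m ((sl2_raise m ^^ k) (\<phi> h)) = cscale (- (of_nat k * (c + of_nat k - 1))) ((sl2_raise m ^^ (k - 1)) (\<phi> h))"
    using lower_pow[OF h, of "k - 1"] lower[OF h] by (cases k) simp_all
  then show "tens h (verma B (Poly_Mapping.single k 1)) = sl2_action m B (tens h (Poly_Mapping.single k 1))"
    by (simp only: verma_def linear_extension_single cv.scale_one tens_linear tens_single sl2_action_def euler_pow[OF h])
      simp
qed

lemma tens_injective:
  assumes h: "h \<in> M" "h \<noteq> 0" and eq: "tens h n = tens h n'"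
  shows "n = n'"
proof -
  let ?d = "n - n'"
  have "tens h ?d = 0" using eq by (simp add: tens_linear)
  then have "(\<Sum>k\<in>Poly_Mapping.keys ?d. (sl2_raise m ^^ k) (\<phi> (cscale (Poly_Mapping.lookup ?d k) h))) = 0"
    by (simp add: tens_def linear_extension_def pow_linear)
  then have "cscale (Poly_Mapping.lookup ?d k) h = 0" if "k \<in> Poly_Mapping.keys ?d" for k
    by (rule sum_pow_eq_0[rotated 2]) (use that h M(1) in \<open>auto simp: cv.subspace_scale\<close>)
  then have "Poly_Mapping.lookup ?d k = 0" for k
    using h(2) by (cases "k \<in> Poly_Mapping.keys ?d") (auto simp: in_keys_iff)
  then have "?d = 0" by (intro poly_mapping_eqI) simp
  then show ?thesis by simp
qed

text \<open>For a fixed nonzero \<open>h\<close> the map \<open>tens h\<close> is injective and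
  intertwines \<open>verma\<close> with the action on polynomials, so the laws are inherited from
  there.\<close>

lemma verma_representation: "representation sl2 UNIV verma"
proof -
  obtain h where h: "h \<in> M" "h \<noteq> 0" using M(1,2) cv.subspace_0 by blast
  note inj = tens_injective[OF h] and v = tens_verma[OF h(1)]
  show ?thesis unfolding representation_def linear_map_on_def
    by (auto intro!: inj simp: cv.subspace_UNIV linear_opD[OF linear_op_verma] v tens_linear sl2_action_add sl2_action_bracket
        sl2_action_scale)
qed

lemma lowest_weight_verma_verma: "lowest_weight_verma c UNIV verma"
  unfolding lowest_weight_verma_def
proof (intro conjI bexI)
  show "representation sl2 UNIV verma" by (rule verma_representation)
  let ?v = "Poly_Mapping.single 0 1 :: nat \<Rightarrow>\<^sub>0 complex"
  show "verma sl2_Y ?v = 0" "verma sl2_H ?v = cscale c ?v"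
    by (simp_all only: verma_def linear_extension_single sl2_entries) simp_all
  have X: "(verma sl2_X ^^ n) ?v = Poly_Mapping.single n 1" for n
  proof (induction n)
    case (Suc n)
    have "verma sl2_X (Poly_Mapping.single n 1) = Poly_Mapping.single (Suc n) 1"
      by (simp only: verma_def linear_extension_single sl2_entries) simp
    then show ?case using Suc by simp
  qed simp
  show "inj (\<lambda>n. (verma sl2_X ^^ n) ?v)"
    unfolding X by (rule injI) (metis lookup_single_eq lookup_single_not_eq zero_neq_one)
  show "basis_of (range (\<lambda>n. (verma sl2_X ^^ n) ?v)) UNIV"
    unfolding X by (rule basis_of_single)
qed simp

text \<open>Independence in two stages: terms with different powers of R have different weights, and
  for each single power the independence of \<open>B\<close> applies.\<close>

lemma tensor_basis:
  assumes B: "cv.independent B" "B \<subseteq> M" "finite P" "P \<subseteq> B \<times> UNIV"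
    and s: "(\<Sum>(b, k)\<in>P. cscale (u (b, k)) ((sl2_raise m ^^ k) (\<phi> b))) = 0" and x: "(b, k) \<in> P"
  shows "u (b, k) = 0"
proof -
  define S where "S k = {b. (b, k) \<in> P}" for k
  have S: "finite (S k)" "S k \<subseteq> B" for k
  proof -
    have "S k \<subseteq> fst ` P" by (auto simp: S_def intro: rev_image_eqI)
    then show "finite (S k)" using B(3) finite_subset by blast
    show "S k \<subseteq> B" using B(4) by (auto simp: S_def)
  qed
  define h where "h k = (\<Sum>b\<in>S k. cscale (u (b, k)) b)" for k
  have "P = (\<lambda>(k, b). (b, k)) ` (SIGMA k:snd ` P. S k)"
  proof
    show "P \<subseteq> (\<lambda>(k, b). (b, k)) ` (SIGMA k:snd ` P. S k)"
    proof
      fix z assume z: "z \<in> P"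
      then have "(snd z, fst z) \<in> (SIGMA k:snd ` P. S k)" by (auto simp: S_def)
      then show "z \<in> (\<lambda>(k, b). (b, k)) ` (SIGMA k:snd ` P. S k)" by (rule rev_image_eqI) simp
    qed
  qed (auto simp: S_def)
  then have "(\<Sum>(b, k)\<in>P. cscale (u (b, k)) ((sl2_raise m ^^ k) (\<phi> b)))
      = (\<Sum>z\<in>(\<lambda>(k, b). (b, k)) ` (SIGMA k:snd ` P. S k). case z of (b, k) \<Rightarrow> cscale (u (b, k)) ((sl2_raise m ^^ k) (\<phi> b)))"
    by simp
  also have "\<dots> = (\<Sum>(k, b)\<in>(SIGMA k:snd ` P. S k). cscale (u (b, k)) ((sl2_raise m ^^ k) (\<phi> b)))"
    by (subst sum.reindex) (auto simp: inj_on_def case_prod_unfold intro!: sum.cong)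
  also have "\<dots> = (\<Sum>k\<in>snd ` P. \<Sum>b\<in>S k. cscale (u (b, k)) ((sl2_raise m ^^ k) (\<phi> b)))"
    using B(3) S(1) by (intro sum.Sigma [symmetric]) auto
  also have "\<dots> = (\<Sum>k\<in>snd ` P. (sl2_raise m ^^ k) (\<phi> (h k)))"
    by (simp add: h_def pow_linear)
  finally have "(\<Sum>k\<in>snd ` P. (sl2_raise m ^^ k) (\<phi> (h k))) = 0" using s by simp
  moreover have "h k \<in> M" for k
    unfolding h_def using S(2)[of k] B(2) by (intro cv.subspace_sum[OF M(1)] cv.subspace_scale[OF M(1)]) auto
  moreover have "k \<in> snd ` P" using x by force
  ultimately have "h k = 0" using sum_pow_eq_0[of "snd ` P" h k] B(3) by blast
  then have 0: "(\<Sum>b\<in>S k. cscale (u (b, k)) b) = 0" by (simp add: h_def)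
  have "b \<in> S k" using x by (simp add: S_def)
  then show ?thesis
    by (rule B(1)[unfolded cv.independent_explicit_module, rule_format, of "S k" "\<lambda>b. u (b, k)" b, OF S 0])
qed

lemma tensor_product_W: "tensor_product M UNIV W tens"
  unfolding tensor_product_def
proof (intro conjI)
  show "bilinear_map_on M UNIV tens"
    by (simp add: bilinear_map_on_def linear_map_on_def tens_linear tens_add)
  obtain B where B: "B \<subseteq> M" "cv.independent B" "M \<subseteq> cv.span B"
    using cv.maximal_independent_subset[of M] by metis
  then have bB: "basis_of B M" unfolding basis_of_def by (metis M(1) cv.span_minimal subset_antisym)
  let ?C = "range (\<lambda>k. Poly_Mapping.single k (1::complex)) :: (nat \<Rightarrow>\<^sub>0 complex) set"
  let ?g = "\<lambda>(b, k). (sl2_raise m ^^ k) (\<phi> b)"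
  have ginj: "inj_on ?g (B \<times> UNIV)"
  proof (rule inj_onI, clarify)
    fix b k b' k' assume b: "b \<in> B" "b' \<in> B" and e: "(sl2_raise m ^^ k) (\<phi> b) = (sl2_raise m ^^ k') (\<phi> b')"
    show "b = b' \<and> k = k'"
    proof (rule ccontr)
      assume ne: "\<not> (b = b' \<and> k = k')"
      \<comment> \<open>Equal images of two distinct pairs would give a linear relation with
        coefficients 1 and -1.\<close>
      define u :: "cpoly \<times> nat \<Rightarrow> complex" where "u z = (if z = (b, k) then 1 else -1)" for z
      have ne': "(b, k) \<noteq> (b', k')" using ne by simp
      have u: "u (b, k) = 1" "u (b', k') = - 1" using ne' by (auto simp: u_def)
      have "(\<Sum>(x, i)\<in>{(b, k), (b', k')}. cscale (u (x, i)) ((sl2_raise m ^^ i) (\<phi> x)))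
          = cscale 1 ((sl2_raise m ^^ k) (\<phi> b)) + cscale (- 1) ((sl2_raise m ^^ k') (\<phi> b'))"
        using ne' by (subst sum.insert) (simp_all only: sum.insert sum.empty finite.emptyI empty_iff insert_iff
          finite.insertI case_prod_conv u add_0_right not_False_eq_True simp_thms)
      also have "\<dots> = 0" using e by (simp only: cv.scale_minus_left cv.scale_one) simp
      finally have "(\<Sum>(x, i)\<in>{(b, k), (b', k')}. cscale (u (x, i)) ((sl2_raise m ^^ i) (\<phi> x))) = 0" .
      then have "u (b, k) = 0"
        by (rule tensor_basis[OF B(2,1), rotated 2]) (use b in auto)
      then show False by (simp add: u_def)
    qed
  qed
  have im: "(\<lambda>(b, c). tens b c) ` (B \<times> ?C) = ?g ` (B \<times> UNIV)"
  proof -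
    have "B \<times> ?C = (\<lambda>(b, k). (b, Poly_Mapping.single k 1)) ` (B \<times> UNIV)" by auto
    then show ?thesis by (simp add: image_image case_prod_unfold tens_single)
  qed
  have "inj_on (\<lambda>(b, c). tens b c) (B \<times> ?C)"
  proof (rule inj_onI, clarify)
    fix b b' k k'
    assume "b \<in> B" "b' \<in> B" "tens b (Poly_Mapping.single k 1) = tens b' (Poly_Mapping.single k' 1)"
    then have "(b, k) = (b', k')" using inj_onD[OF ginj, of "(b, k)" "(b', k')"] by (simp add: tens_single)
    then show "b = b' \<and> Poly_Mapping.single k (1::complex) = Poly_Mapping.single k' 1" by simp
  qed
  moreover have "basis_of (?g ` (B \<times> UNIV)) W"
    unfolding basis_of_def
  proof
    show "cv.independent (?g ` (B \<times> UNIV))"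
      unfolding cv.independent_explicit_module
    proof (intro allI impI)
      fix t u v assume t: "finite t" "t \<subseteq> ?g ` (B \<times> UNIV)" "(\<Sum>v\<in>t. cscale (u v) v) = 0" "v \<in> t"
      then obtain P where P: "P \<subseteq> B \<times> UNIV" "finite P" "t = ?g ` P"
        using finite_subset_image[OF t(1,2)] by blast
      have "inj_on ?g P" using ginj P(1) inj_on_subset by blast
      then have "(\<Sum>z\<in>P. cscale (u (?g z)) (?g z)) = 0" using t(3) P(3) by (simp add: sum.reindex)
      then have s: "(\<Sum>(b, k)\<in>P. cscale ((\<lambda>z. u (?g z)) (b, k)) ((sl2_raise m ^^ k) (\<phi> b))) = 0"
        by (simp add: case_prod_unfold)
      obtain b k where "(b, k) \<in> P" "v = ?g (b, k)" using t(4) P(3) by auto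
      then show "u v = 0" using tensor_basis[OF B(2,1) P(2,1) s] by auto
    qed
    show "cv.span (?g ` (B \<times> UNIV)) = W"
    proof
      have "?g ` (B \<times> UNIV) \<subseteq> W" using pow_in_W B(1) by auto
      then show "cv.span (?g ` (B \<times> UNIV)) \<subseteq> W" by (rule cv.span_minimal[OF _ subspace_W])
      have "(sl2_raise m ^^ k) (\<phi> h) \<in> cv.span (?g ` (B \<times> UNIV))" if "h \<in> M" for h k
      proof -
        have "h \<in> cv.span B" using that B(3) by blast
        then show ?thesis
        proof (induction rule: cv.span_induct_alt)
          case (step a x y)
          have "(sl2_raise m ^^ k) (\<phi> x) \<in> cv.span (?g ` (B \<times> UNIV))"
            using step(1) by (intro cv.span_base) force
          then show ?case using step(2) by (simp add: pow_linear cv.span_add cv.span_scale)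
        qed (simp add: pow_linear cv.span_zero)
      qed
      then show "W \<subseteq> cv.span (?g ` (B \<times> UNIV))"
        unfolding W_def by (intro cv.span_minimal) auto
    qed
  qed
  ultimately show "\<exists>B C. basis_of B M \<and> basis_of C UNIV \<and> inj_on (\<lambda>(b, c). tens b c) (B \<times> C) \<and> basis_of ((\<lambda>(b, c). tens b c) ` (B \<times> C)) W"
    using bB basis_of_single im by metis
qed

lemma outer_tensor_W:
  "outer_tensor_rep (so m) M (so_action m) sl2 UNIV verma W (so_sl2_action m)"
  unfolding outer_tensor_rep_def
proof (intro exI conjI ballI)
  show "tensor_product M UNIV W tens" by (rule tensor_product_W)
  fix A B h and n :: "nat \<Rightarrow>\<^sub>0 complex" assume A: "A \<in> lie_carrier (so m)" and h: "h \<in> M"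
  have "so_action m A (tens h n) = tens (so_action m A h) n"
    by (simp add: tens_def linear_extension_def so_action_linear so_action_pow[OF A])
  then show "so_sl2_action m (A, B) (tens h n) = tens (so_action m A h) n + tens h (verma B n)"
    by (simp add: so_sl2_action_def tens_verma[OF h])
qed

lemma M_representation: "representation (so m) M (so_action m)"
  unfolding representation_def linear_map_on_def
  using M by (auto simp: so_action_linear so_action_add so_action_bracket so_action_scale)

lemma M_irreducible: "irreducible_rep (so m) M (so_action m)"
  using M_representation irreducible by (simp add: irreducible_rep_def)

end

text \<open>Both Casimir operators are polynomials in the action and therefore commute with an
  isomorphism. Their eigenvalues are invariants of the module.\<close>

lemma isomorphic_casimirs:
  assumes iso: "isomorphic_rep (lie_prod (so m) sl2) V (so_sl2_action m) V' (so_sl2_action m)"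
    and V: "representation (lie_prod (so m) sl2) V (so_sl2_action m)" "V \<noteq> {0}"
    and V': "representation (lie_prod (so m) sl2) V' (so_sl2_action m)"
    and so: "\<And>f. f \<in> V \<Longrightarrow> so_casimir m f = cscale \<kappa> f" "\<And>f. f \<in> V' \<Longrightarrow> so_casimir m f = cscale \<kappa>' f"
    and sl: "\<And>f. f \<in> V \<Longrightarrow> sl2_casimir m f = cscale \<mu> f" "\<And>f. f \<in> V' \<Longrightarrow> sl2_casimir m f = cscale \<mu>' f"
  shows "\<kappa> = \<kappa>' \<and> \<mu> = \<mu>'"
proof -
  obtain \<psi> where \<psi>: "linear_map_on V \<psi>" "bij_betw \<psi> V V'"
    and eq: "\<And>A B f. A \<in> lie_carrier (so m) \<Longrightarrow> B \<in> lie_carrier sl2 \<Longrightarrow> f \<in> V \<Longrightarrow> \<psi> (so_sl2_action m (A, B) f) = so_sl2_action m (A, B) (\<psi> f)"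
    using iso unfolding isomorphic_rep_def so_sl2_carrier by (metis so_sl2_carrier)
  have sub: "cv.subspace V" using V(1) by (simp add: representation_def)
  have inv: "so_sl2_action m (A, B) f \<in> V" if "A \<in> lie_carrier (so m)" "B \<in> lie_carrier sl2" "f \<in> V" for A B f
    using V(1) that unfolding representation_def by (meson image_subset_iff so_sl2_carrier)
  have \<psi>V: "\<psi> f \<in> V'" if "f \<in> V" for f using \<psi>(2) that by (auto simp: bij_betw_def)
  have lin: "\<psi> (f + g) = \<psi> f + \<psi> g" "\<psi> (cscale a f) = cscale a (\<psi> f)" if "f \<in> V" "g \<in> V" for f g a
    using \<psi>(1) that by (auto simp: linear_map_on_def)
  have \<psi>0: "\<psi> 0 = 0" using lin(2)[OF cv.subspace_0[OF sub] cv.subspace_0[OF sub], of 0] by simp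
  have sum: "\<psi> (\<Sum>i\<in>I. h i) = (\<Sum>i\<in>I. \<psi> (h i))" if "finite I" "\<And>i. i \<in> I \<Longrightarrow> h i \<in> V" for h and I :: "nat set"
    using that by (induction I rule: finite_induct) (auto simp: \<psi>0 lin cv.subspace_sum[OF sub])
  obtain f where f: "f \<in> V" "f \<noteq> 0" using V(2) sub cv.subspace_0 by blast
  have ne: "\<psi> f \<noteq> 0"
  proof
    assume "\<psi> f = 0"
    then have "\<psi> f = \<psi> 0" by (simp add: \<psi>0)
    then show False using f \<psi>(2) cv.subspace_0[OF sub] by (metis bij_betw_def inj_onD)
  qed
  have soV: "so_action m A f \<in> V" "\<psi> (so_action m A f) = so_action m A (\<psi> f)" if "A \<in> lie_carrier (so m)" "f \<in> V" for A f
    using inv[OF that(1) sl2_elements(1) that(2)] eq[OF that(1) sl2_elements(1) that(2)]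
    by (simp_all add: so_sl2_action_components)
  have slV: "sl2_raise m f \<in> V" "\<psi> (sl2_raise m f) = sl2_raise m (\<psi> f)"
    "sl2_lower m f \<in> V" "\<psi> (sl2_lower m f) = sl2_lower m (\<psi> f)"
    "sl2_euler m f \<in> V" "\<psi> (sl2_euler m f) = sl2_euler m (\<psi> f)" if "f \<in> V" for f
    using inv[OF zero_so sl2_elements(2) that] eq[OF zero_so sl2_elements(2) that]
      inv[OF zero_so sl2_elements(3) that] eq[OF zero_so sl2_elements(3) that]
      inv[OF zero_so sl2_elements(4) that] eq[OF zero_so sl2_elements(4) that]
    by (simp_all add: so_sl2_action_components)
  have "\<psi> (so_casimir m f) = so_casimir m (\<psi> f)"
    unfolding so_casimir_action using f(1)
    by (simp add: sum soV elem_skew_so cv.subspace_sum[OF sub])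
  then have "cscale \<kappa> (\<psi> f) = cscale \<kappa>' (\<psi> f)"
    using so f(1) \<psi>V lin(2) by metis
  moreover have "\<psi> (sl2_casimir m f) = sl2_casimir m (\<psi> f)"
  proof -
    have d: "\<psi> (f - g) = \<psi> f - \<psi> g" if "f \<in> V" "g \<in> V" for f g
      using lin(1)[of "f - g" g] that cv.subspace_diff[OF sub] by simp
    show ?thesis unfolding sl2_casimir_def
      using f(1) by (simp add: lin d slV cv.subspace_add[OF sub] cv.subspace_scale[OF sub])
  qed
  then have "cscale \<mu> (\<psi> f) = cscale \<mu>' (\<psi> f)"
    using sl f(1) \<psi>V lin(2) by metis
  ultimately show ?thesis using ne by (simp only: cv.scale_cancel_right) simp
qed

section \<open>The five families\<close>

lemma polys_no_Y:
  assumes "f \<in> polys m" "polar m BY BY f = 0"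
  shows "polar m q BY f = 0" "lap m q BY f = 0" "lap m BY q f = 0"
proof -
  show "polar m q BY f = 0" and l: "lap m q BY f = 0"
    using assms polar_self_eq_0_iff[OF assms(1), of BY] by (auto simp: polar_def lap_def)
  then show "lap m BY q f = 0" by (simp add: lap_commute)
qed

lemma harmonicsD:
  assumes "h \<in> harmonics m a"
  shows "h \<in> z_only m" "h \<in> polys m" "polar m BZ BZ h = cscale (of_nat a) h"
    "polar m q BX h = 0" "polar m q BY h = 0" "lap m p q h = 0"
proof -
  show h: "h \<in> z_only m" "h \<in> polys m" "polar m BZ BZ h = cscale (of_nat a) h"
    using assms by (auto simp: harmonics_def z_only_iff)
  show "polar m q BX h = 0" "polar m q BY h = 0" using z_onlyD(3)[OF h(1)] by auto
  show "lap m p q h = 0"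
    using z_onlyD(4,5)[OF h(1)] assms by (cases p; cases q) (auto simp: harmonics_def)
qed

text \<open>Vector fields in z with harmonic components of degree \<open>d\<close>, where the
  variables of x stand for the basis vectors. In this reading \<open>lap m BX BZ\<close> is the
  divergence, \<open>polar m BX BZ\<close> the gradient and \<open>polar m BZ BX\<close> the inner
  product with z.\<close>

definition harmonic_vectors :: "nat \<Rightarrow> nat \<Rightarrow> cpoly set" where
  "harmonic_vectors m d = {p \<in> polys m. polar m BX BX p = p \<and> polar m BY BY p = 0 \<and>
     polar m BZ BZ p = cscale (of_nat d) p \<and> lap m BZ BZ p = 0}"

lemma subspace_harmonic_vectors: "cv.subspace (harmonic_vectors m d)"
  unfolding harmonic_vectors_def
  by (rule cv.subspaceI) (auto simp: polys_lin op_linear cv.scale_right_distrib mult.commute)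

lemma harmonic_vectorsD:
  assumes "p \<in> harmonic_vectors m d"
  shows "p \<in> polys m" "p \<in> xy_linear m" "polar m BX BX p = p" "polar m BZ BZ p = cscale (of_nat d) p" "lap m BZ BZ p = 0"
    "polar m q BY p = 0" "lap m q BY p = 0" "lap m BY q p = 0" "lap m BX BX p = 0"
proof -
  show p: "p \<in> polys m" "p \<in> xy_linear m" "polar m BX BX p = p" "polar m BZ BZ p = cscale (of_nat d) p" "lap m BZ BZ p = 0"
    using assms by (auto simp: harmonic_vectors_def xy_linear_def)
  show "polar m q BY p = 0" "lap m q BY p = 0" "lap m BY q p = 0"
    using assms polys_no_Y by (auto simp: harmonic_vectors_def)
  show "lap m BX BX p = 0"
    using z_onlyD(1)[OF xy_linear_partial[OF p(2)]] by (simp add: lap_def)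
qed

lemma two_row_iff:
  "p \<in> two_row m a \<longleftrightarrow> p \<in> harmonic_vectors m a \<and> lap m BX BZ p = 0 \<and> polar m BZ BX p = 0"
  by (auto simp: two_row_def harmonic_vectors_def)

lemma so_casimir_harmonics:
  assumes h: "h \<in> harmonics m a"
  shows "so_casimir m h = cscale (- 2 * (of_nat a * (of_nat a + of_nat m - 2))) h"
proof -
  note H = harmonicsD[OF h]
  have "polar m BZ BX (polar m BX BZ h) = cscale (of_nat a) h" "polar m BZ BY (polar m BY BZ h) = cscale (of_nat a) h"
    using polar_polar[of m BZ BX BX BZ h] polar_polar[of m BZ BY BY BZ h] by (simp_all add: H op_linear)
  then show ?thesis
    by (simp add: so_casimir_eq sum_blk H op_linear)
      (rule poly_mapping_eqI, simp add: lookup_simps algebra_simps)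
qed

lemma so_casimir_two_row:
  assumes p: "p \<in> two_row m a"
  shows "so_casimir m p = cscale (- 2 * (of_nat a * (of_nat a + of_nat m - 2) + of_nat m - 3)) p"
proof -
  have p': "p \<in> harmonic_vectors m a" "lap m BX BZ p = 0" "lap m BZ BX p = 0" "polar m BZ BX p = 0"
    using p two_row_iff lap_commute by metis+
  note H = harmonic_vectorsD[OF p'(1)] p'(2-)
  have "polar m BZ BX (polar m BX BZ p) = cscale (of_nat a) p - p" "polar m BZ BY (polar m BY BZ p) = cscale (of_nat a) p"
    "polar m BX BY (polar m BY BX p) = p"
    using polar_polar[of m BZ BX BX BZ p] polar_polar[of m BZ BY BY BZ p] polar_polar[of m BX BY BY BX p]
    by (simp_all add: H op_linear)
  then show ?thesis
    by (simp add: so_casimir_eq sum_blk H op_linear)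
      (rule poly_mapping_eqI, simp add: lookup_simps algebra_simps)
qed

text \<open>A constant vector field orthogonal to z vanishes. This is why the families with (a,1)
  start at a = 1.\<close>

lemma two_row_0: 
  assumes "q \<in> two_row m 0"
  shows "q = 0"
proof -
  have q: "q \<in> harmonic_vectors m 0" "polar m BZ BX q = 0" using assms two_row_iff by blast+
  have "polar m BZ BZ q = 0" using harmonic_vectorsD(4)[OF q(1)] by simp
  then have "partial (vr BZ i) q = 0" for i
    using polar_self_eq_0_iff[OF harmonic_vectorsD(1)[OF q(1)]] by blast
  then have "polar m BX BZ q = 0" by (simp add: polar_def)
  then show ?thesis
    using polar_polar[of m BZ BX BX BZ q] q(2) \<open>polar m BZ BZ q = 0\<close> harmonic_vectorsD(3)[OF q(1)]
    by (simp add: op_linear)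
qed

text \<open>
  The coefficients are chosen as follows: \<open>double_up m d p\<close> is killed by \<open>sl2_lower\<close> when \<open>p\<close> is
  harmonic of degree \<open>d\<close> in \<open>z\<close>, \<open>mult_up m a h\<close> is harmonic in \<open>z\<close> with divergence
  \<open>div_coeff m a\<close> times \<open>h\<close>, and \<open>mix_up m a h\<close> is killed by \<open>D_s\<close>.
\<close>

definition double_up :: "nat \<Rightarrow> nat \<Rightarrow> cpoly \<Rightarrow> cpoly" where
  "double_up m d p = polar m BY BX p + cscale (1 / (of_nat m + 2 * of_nat d)) (quad m BZ BZ * p)"

definition mult_up :: "nat \<Rightarrow> nat \<Rightarrow> cpoly \<Rightarrow> cpoly" where
  "mult_up m a h = quad m BX BZ * h - cscale (1 / (of_nat m + 2 * of_nat a - 2)) (quad m BZ BZ * polar m BX BZ h)"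

definition div_coeff :: "nat \<Rightarrow> nat \<Rightarrow> complex" where
  "div_coeff m a = of_nat a + of_nat m - 2 * of_nat a / (of_nat m + 2 * of_nat a - 2)"

definition mix_coeff :: "nat \<Rightarrow> nat \<Rightarrow> complex" where
  "mix_coeff m a = (1 - 2 / (of_nat m + 2 * of_nat a - 2)) * of_nat a / div_coeff m a"

definition mix_up :: "nat \<Rightarrow> nat \<Rightarrow> cpoly \<Rightarrow> cpoly" where
  "mix_up m a h = double_up m (a - 1) (polar m BX BZ h) + cscale (mix_coeff m a) (mult_up m a h)"

lemma linear_op_ups: "linear_op (double_up m d)" "linear_op (mult_up m a)" "linear_op (mix_up m a)"
proof -
  show 1: "linear_op (double_up m d)" "linear_op (mult_up m a)" for d a
    unfolding double_up_def mult_up_def diff_conv_add_uminus cv.scale_minus_left [symmetric]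
    by (intro linear_op_add linear_op_cscale linear_op_mult linear_op_polar
        linear_op_comp[OF linear_op_mult linear_op_polar])+
  show "linear_op (mix_up m a)"
    unfolding mix_up_def by (intro linear_op_add linear_op_cscale linear_op_comp[OF 1(1) linear_op_polar] 1)
qed

lemma ups_equivariant:
  assumes "A \<in> lie_carrier (so m)"
  shows "double_up m d (so_action m A h) = so_action m A (double_up m d h)"
    "mult_up m a (so_action m A h) = so_action m A (mult_up m a h)"
    "mix_up m a (so_action m A h) = so_action m A (mix_up m a h)"
  using assms by (simp_all add: double_up_def mult_up_def mix_up_def so_action_linear derivationD(2)[OF derivation_so_action]
      so_action_quad flip: so_action_polar)

section \<open>Lowest weight vectors of the five families\<close>

context
  fixes m :: nat
  assumes m: "6 \<le> m"
begin

lemma denom_neq_0: "of_nat m + 2 * of_nat a - 2 \<noteq> (0::complex)" "of_nat m + 2 * of_nat a \<noteq> (0::complex)"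
proof -
  have "of_nat m + 2 * of_nat a - 2 = (of_nat (m + 2 * a - 2) :: complex)" using m by (simp add: of_nat_diff)
  moreover have "of_nat (m + 2 * a - 2) \<noteq> (0 :: complex)" unfolding of_nat_eq_0_iff using m by simp
  ultimately show "of_nat m + 2 * of_nat a - 2 \<noteq> (0::complex)" by metis
  have "of_nat m + 2 * of_nat a = (of_nat (m + 2 * a) :: complex)" by simp
  moreover have "of_nat (m + 2 * a) \<noteq> (0 :: complex)" unfolding of_nat_eq_0_iff using m by simp
  ultimately show "of_nat m + 2 * of_nat a \<noteq> (0::complex)" by metis
qed

text \<open>Clearing denominators in \<open>div_coeff m a = 0\<close> gives
  \<open>(a + m) * (m + 2 * a - 2) = 2 * a\<close>. The second factor is at least 2, so the left
  side is too large.\<close>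

lemma div_coeff_neq_0: "div_coeff m a \<noteq> 0"
proof
  assume 0: "div_coeff m a = 0"
  have "(of_nat a + of_nat m) * (of_nat m + 2 * of_nat a - 2) - 2 * of_nat a
      = div_coeff m a * (of_nat m + 2 * of_nat a - 2 :: complex)"
    using denom_neq_0(1)[of a] by (simp add: div_coeff_def field_simps)
  then have "(of_nat a + of_nat m) * (of_nat m + 2 * of_nat a - 2) = (2 * of_nat a :: complex)" using 0 by simp
  then have "of_nat ((a + m) * (m + 2 * a - 2)) = (of_nat (2 * a) :: complex)" using m by (simp add: of_nat_diff)
  then have e: "(a + m) * (m + 2 * a - 2) = 2 * a" unfolding of_nat_eq_iff .
  have "(a + m) * 2 \<le> (a + m) * (m + 2 * a - 2)" using m by (intro mult_le_mono2) simp
  then show False using e m by simp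
qed

lemma grad_harmonics:
  assumes h: "h \<in> harmonics m (Suc d)"
  shows "polar m BX BZ h \<in> harmonic_vectors m d" "lap m BX BZ (polar m BX BZ h) = 0"
    "polar m BZ BX (polar m BX BZ h) = cscale (of_nat (Suc d)) h"
proof -
  note H = harmonicsD[OF h]
  have "polar m BX BX (polar m BX BZ h) = polar m BX BZ h" "polar m BY BY (polar m BX BZ h) = 0"
    "polar m BZ BZ (polar m BX BZ h) = cscale (of_nat d) (polar m BX BZ h)"
    using polar_polar[of m BX BX BX BZ h] polar_polar[of m BY BY BX BZ h] polar_polar[of m BZ BZ BX BZ h]
    by (simp_all add: H op_linear) (rule poly_mapping_eqI, simp add: lookup_simps algebra_simps)
  then show "polar m BX BZ h \<in> harmonic_vectors m d"
    by (simp add: harmonic_vectors_def polys_ops H lap_polar op_linear)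
  show "lap m BX BZ (polar m BX BZ h) = 0" by (simp add: H lap_polar op_linear)
  show "polar m BZ BX (polar m BX BZ h) = cscale (of_nat (Suc d)) h"
    using polar_polar[of m BZ BX BX BZ h] by (simp add: H op_linear)
qed

lemma grad_harmonics_general:
  assumes h: "h \<in> harmonics m a"
  shows "lap m p q (polar m BX BZ h) = 0" "polar m BZ BX (polar m BX BZ h) = cscale (of_nat a) h"
    "polar m BX BX (polar m BX BZ h) = polar m BX BZ h" "polar m q BY (polar m BX BZ h) = 0"
    "polar m BZ BZ (polar m BX BZ h) = cscale (of_nat a - 1) (polar m BX BZ h)"
proof -
  note H = harmonicsD[OF h]
  show "lap m p q (polar m BX BZ h) = 0" by (simp add: H lap_polar op_linear)
  show "polar m BZ BX (polar m BX BZ h) = cscale (of_nat a) h" "polar m BX BX (polar m BX BZ h) = polar m BX BZ h"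
    using polar_polar[of m BZ BX BX BZ h] polar_polar[of m BX BX BX BZ h] by (simp_all add: H op_linear)
  show "polar m BZ BZ (polar m BX BZ h) = cscale (of_nat a - 1) (polar m BX BZ h)"
    using polar_polar[of m BZ BZ BX BZ h] by (simp add: H op_linear cv.scale_left_diff_distrib)
  show "polar m q BY (polar m BX BZ h) = 0"
    using polar_polar[of m q BY BX BZ h] polar_polar[of m BZ BY BX BZ h] by (cases q) (simp_all add: H op_linear)
qed

lemma mult_up_harmonics:
  assumes h: "h \<in> harmonics m a"
  shows "mult_up m a h \<in> harmonic_vectors m (Suc a)" "lap m BX BZ (mult_up m a h) = cscale (div_coeff m a) h"
    "polar m BZ BX (mult_up m a h) = cscale (1 - of_nat a / (of_nat m + 2 * of_nat a - 2)) (quad m BZ BZ * h)"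
proof -
  note H = harmonicsD[OF h] grad_harmonics_general[OF h]
  define c where "c = (1 / (of_nat m + 2 * of_nat a - 2) :: complex)"
  \<comment> \<open>The term \<open>quad m BX BZ * h\<close> contributes twice the gradient, and the
    squared norm times the gradient, which has degree a - 1, contributes 2 m + 4 (a - 1) times it.
    This fixes the constant in \<open>mult_up\<close>.\<close>
  have "lap m BZ BZ (mult_up m a h) = cscale (2 - c * (2 * of_nat m + 4 * (of_nat a - 1))) (polar m BX BZ h)"
    by (simp add: mult_up_def op_linear lap_quad_mult H c_def [symmetric])
      (rule poly_mapping_eqI, simp add: lookup_simps algebra_simps)
  also have "2 - c * (2 * of_nat m + 4 * (of_nat a - 1)) = 0"
    using denom_neq_0(1)[of a] by (simp add: c_def field_simps)
  finally have l: "lap m BZ BZ (mult_up m a h) = 0" by simp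
  show "mult_up m a h \<in> harmonic_vectors m (Suc a)"
    unfolding harmonic_vectors_def
  proof (intro CollectI conjI l)
    show "mult_up m a h \<in> polys m"
      unfolding mult_up_def using H by (auto intro!: polys_lin polys_ops)
    show "polar m BX BX (mult_up m a h) = mult_up m a h" "polar m BY BY (mult_up m a h) = 0"
      by (simp_all add: mult_up_def op_linear polar_mult polar_quad H)
    show "polar m BZ BZ (mult_up m a h) = cscale (of_nat (Suc a)) (mult_up m a h)"
      by (simp add: mult_up_def op_linear polar_mult polar_quad H)
        (rule poly_mapping_eqI, simp add: lookup_simps algebra_simps add_divide_distrib)
  qed
  show "lap m BX BZ (mult_up m a h) = cscale (div_coeff m a) h"
    by (simp add: mult_up_def op_linear lap_quad_mult H div_coeff_def)
      (rule poly_mapping_eqI, simp add: lookup_simps algebra_simps)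
  show "polar m BZ BX (mult_up m a h) = cscale (1 - of_nat a / (of_nat m + 2 * of_nat a - 2)) (quad m BZ BZ * h)"
    by (simp add: mult_up_def op_linear polar_mult polar_quad H)
      (rule poly_mapping_eqI, simp add: lookup_simps algebra_simps)
qed

text \<open>In the absence of y the operator \<open>D_s\<close> is minus the divergence, so
  monogenic means divergence-free.\<close>

lemma harmonic_vectors_lowest:
  assumes p: "p \<in> harmonic_vectors m d"
  shows "sl2_lower m p = 0" "sl2_euler m p = cscale (of_nat m / 2 + (of_nat d - 1)) p" "D_s m p = - lap m BX BZ p"
  using harmonic_vectorsD[OF p]
  by (simp_all add: sl2_lower_eq sl2_euler_eq D_s_eq) (rule poly_mapping_eqI, simp add: lookup_simps algebra_simps)

lemma double_up_lowest:
  assumes p: "p \<in> harmonic_vectors m d"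
  shows "sl2_lower m (double_up m d p) = 0"
    "sl2_euler m (double_up m d p) = cscale (of_nat m / 2 + (of_nat d + 1)) (double_up m d p)"
    "double_up m d p \<in> xy_linear m" "polar m BX BY (double_up m d p) = p"
    "D_s m (double_up m d p) = cscale (1 - 2 / (of_nat m + 2 * of_nat d)) (polar m BZ BX p)
        - cscale (1 / (of_nat m + 2 * of_nat d)) (quad m BZ BZ * lap m BX BZ p)"
proof -
  note H = harmonic_vectorsD[OF p]
  define c where "c = (1 / (of_nat m + 2 * of_nat d) :: complex)"
  have XY: "polar m BX BY (polar m BY BX p) = p" "polar m BZ BY (polar m BY BX p) = polar m BZ BX p"
    using polar_polar[of m BX BY BY BX p] polar_polar[of m BZ BY BY BX p] by (simp_all add: H op_linear)
  have deg: "polar m BX BX (polar m BY BX p) = 0" "polar m BY BY (polar m BY BX p) = polar m BY BX p"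
    "polar m BZ BZ (polar m BY BX p) = cscale (of_nat d) (polar m BY BX p)"
    using polar_polar[of m BX BX BY BX p] polar_polar[of m BY BY BY BX p] polar_polar[of m BZ BZ BY BX p]
    by (simp_all add: H op_linear)
  show "polar m BX BY (double_up m d p) = p"
    by (simp add: double_up_def op_linear polar_mult polar_quad H XY)
  \<comment> \<open>Half the Laplacian of the squared norm times \<open>p\<close> is (m + 2 d) times
    \<open>p\<close>, which is the origin of the constant in \<open>double_up\<close>.\<close>
  have "sl2_lower m (double_up m d p) = cscale (1 - c * (of_nat m + 2 * of_nat d)) p"
    unfolding double_up_def c_def [symmetric]
    by (simp add: sl2_lower_eq op_linear polar_mult polar_quad lap_quad_mult lap_polar H XY flip: cscale_of_nat)
      (rule poly_mapping_eqI, simp add: lookup_simps algebra_simps)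
  then show "sl2_lower m (double_up m d p) = 0" using denom_neq_0(2)[of d] by (simp add: c_def)
  show "sl2_euler m (double_up m d p) = cscale (of_nat m / 2 + (of_nat d + 1)) (double_up m d p)"
    unfolding double_up_def c_def [symmetric]
    by (simp add: sl2_euler_eq op_linear polar_mult polar_quad H deg)
      (rule poly_mapping_eqI, simp add: lookup_simps algebra_simps)
  have "double_up m d p \<in> polys m"
    unfolding double_up_def using H by (auto intro!: polys_lin polys_ops)
  then show "double_up m d p \<in> xy_linear m"
    by (simp add: xy_linear_def double_up_def op_linear polar_mult polar_quad H deg)
  \<comment> \<open>The divergence of \<open>p\<close> no longer contains x, so replacing x by y in
    it gives 0.\<close>
  have 0: "partial (vr BX i) (partial (vr BX j) p) = 0" for i j
    by (rule z_onlyD(1)[OF xy_linear_partial[OF H(2)]]) simp_all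
  have "partial (vr BX i) (partial (vr BX j) (partial (vr BZ j) p)) = 0" for i j
    unfolding partial_commute[of "vr BX j" "vr BZ j" p] partial_commute[of "vr BX i" "vr BZ j"] by (simp add: 0)
  then have "polar m BY BX (lap m BX BZ p) = 0"
    by (simp add: polar_def lap_def)
  then show "D_s m (double_up m d p) = cscale (1 - 2 / (of_nat m + 2 * of_nat d)) (polar m BZ BX p)
        - cscale (1 / (of_nat m + 2 * of_nat d)) (quad m BZ BZ * lap m BX BZ p)"
    by (simp add: double_up_def D_s_eq op_linear polar_mult polar_quad lap_quad_mult lap_polar H XY)
      (rule poly_mapping_eqI, simp add: lookup_simps algebra_simps)
qed

lemma monogenic_iff: "f \<in> symplectic_monogenics m 1 \<longleftrightarrow> f \<in> xy_linear m \<and> D_s m f = 0"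
  unfolding symplectic_monogenics_1 by blast

lemma weight_neq_0:
  assumes "- 2 < s"
  shows "of_nat m / 2 + of_int s + of_nat k \<noteq> (0 :: complex)"
proof
  assume "of_nat m / 2 + of_int s + of_nat k = (0 :: complex)"
  then have "of_int (int m + 2 * s + 2 * int k) = (0 :: complex)" by (simp add: field_simps)
  then have "int m + 2 * s + 2 * int k = 0" unfolding of_int_eq_0_iff .
  then show False using m assms by linarith
qed

text \<open>The gradient has components of degree a - 1, hence weight m/2 + a - 2. It is injective
  because its inner product with z is a times \<open>h\<close>.\<close>

lemma embedding_grad:
  assumes "1 \<le> a"
  shows "lowest_weight_embedding m (harmonics m a) (polar m BX BZ) (of_nat m / 2 + of_int (int a - 2))"
proof (rule lowest_weight_embedding.intro)
  obtain d where d: "a = Suc d" using assms by (cases a) auto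
  show "irreducible_under (so_action m ` lie_carrier (so m)) (harmonics m a)" using m by (intro harmonics_irreducible) simp
  fix h assume h: "h \<in> harmonics m a"
  then have g: "polar m BX BZ h \<in> harmonic_vectors m d" "lap m BX BZ (polar m BX BZ h) = 0"
    using grad_harmonics d by blast+
  show "polar m BX BZ h \<in> symplectic_monogenics m 1"
    using harmonic_vectors_lowest(3)[OF g(1)] g harmonic_vectorsD(2) by (simp only: monogenic_iff) simp
  show "sl2_lower m (polar m BX BZ h) = 0"
    "sl2_euler m (polar m BX BZ h) = cscale (of_nat m / 2 + of_int (int a - 2)) (polar m BX BZ h)"
    using harmonic_vectors_lowest[OF g(1)] d by (simp_all add: algebra_simps)
  show "polar m BX BZ h = 0 \<Longrightarrow> h = 0"
    using grad_harmonics(3)[of h d] h d by (simp add: op_linear del: of_nat_Suc)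
next
  show "of_nat m / 2 + of_int (int a - 2) + of_nat k \<noteq> (0::complex)" for k
    by (rule weight_neq_0) (use assms in simp)
qed (auto simp: so_action_polar intro: linear_op_polar)

lemma embedding_id:
  assumes "1 \<le> a"
  shows "lowest_weight_embedding m (two_row m a) (\<lambda>p. p) (of_nat m / 2 + of_int (int a - 1))"
proof (rule lowest_weight_embedding.intro)
  show "irreducible_under (so_action m ` lie_carrier (so m)) (two_row m a)"
    using two_row_irreducible[of m "a - 1"] m assms by simp
  fix p assume p: "p \<in> two_row m a"
  then have g: "p \<in> harmonic_vectors m a" "lap m BX BZ p = 0" using two_row_iff by blast+
  show "p \<in> symplectic_monogenics m 1"
    using harmonic_vectors_lowest(3)[OF g(1)] g harmonic_vectorsD(2) by (simp only: monogenic_iff) simp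
  show "sl2_lower m p = 0" "sl2_euler m p = cscale (of_nat m / 2 + of_int (int a - 1)) p"
    using harmonic_vectors_lowest[OF g(1)] by simp_all
next
  show "of_nat m / 2 + of_int (int a - 1) + of_nat k \<noteq> (0::complex)" for k
    by (rule weight_neq_0) (use assms in simp)
qed (auto intro: linear_opI)

lemma embedding_double_up:
  assumes "1 \<le> a"
  shows "lowest_weight_embedding m (two_row m a) (double_up m a) (of_nat m / 2 + of_int (int a + 1))"
proof (rule lowest_weight_embedding.intro)
  show "irreducible_under (so_action m ` lie_carrier (so m)) (two_row m a)"
    using two_row_irreducible[of m "a - 1"] m assms by simp
  fix p assume p: "p \<in> two_row m a"
  then have g: "p \<in> harmonic_vectors m a" "lap m BX BZ p = 0" "polar m BZ BX p = 0" using two_row_iff by blast+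
  show "double_up m a p \<in> symplectic_monogenics m 1"
    using double_up_lowest[OF g(1)] g by (simp only: monogenic_iff) simp
  show "sl2_lower m (double_up m a p) = 0"
    "sl2_euler m (double_up m a p) = cscale (of_nat m / 2 + of_int (int a + 1)) (double_up m a p)"
    using double_up_lowest[OF g(1)] by simp_all
  show "double_up m a p = 0 \<Longrightarrow> p = 0"
    using double_up_lowest(4)[OF g(1)] by (simp add: op_linear)
next
  show "of_nat m / 2 + of_int (int a + 1) + of_nat k \<noteq> (0::complex)" for k
    by (rule weight_neq_0) (use assms in simp)
qed (auto simp: ups_equivariant intro: linear_op_ups)

lemma mix_up_lowest:
  assumes h: "h \<in> harmonics m a" and a: "1 \<le> a"
  shows "mix_up m a h \<in> symplectic_monogenics m 1" "sl2_lower m (mix_up m a h) = 0"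
    "sl2_euler m (mix_up m a h) = cscale (of_nat m / 2 + of_int (int a)) (mix_up m a h)"
    "polar m BX BY (mix_up m a h) = polar m BX BZ h"
proof -
  obtain d where d: "a = Suc d" using a by (cases a) auto
  have g: "polar m BX BZ h \<in> harmonic_vectors m d" "lap m BX BZ (polar m BX BZ h) = 0"
    "polar m BZ BX (polar m BX BZ h) = cscale (of_nat a) h"
    using grad_harmonics h d by blast+
  note D = double_up_lowest[OF g(1)]
  note Z = mult_up_harmonics[OF h]
  note Zl = harmonic_vectors_lowest[OF Z(1)]
  have e: "mix_up m a h = double_up m d (polar m BX BZ h) + cscale (mix_coeff m a) (mult_up m a h)"
    by (simp add: mix_up_def d)
  show "sl2_lower m (mix_up m a h) = 0" by (simp add: e sl2_linear D Zl)
  show "sl2_euler m (mix_up m a h) = cscale (of_nat m / 2 + of_int (int a)) (mix_up m a h)"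
    by (simp add: e sl2_linear D Zl) (simp add: d cv.scale_right_distrib mult_ac add_ac)
  show "polar m BX BY (mix_up m a h) = polar m BX BZ h"
    by (simp add: e op_linear D harmonic_vectorsD[OF Z(1)])
  have "mix_up m a h \<in> xy_linear m"
    unfolding e using D(3) harmonic_vectorsD(2)[OF Z(1)] subspace_xy_linear
    by (intro cv.subspace_add cv.subspace_scale)
  moreover have "D_s m (mix_up m a h) = 0"
  proof -
    have dd: "of_nat m + 2 * of_nat d = (of_nat m + 2 * of_nat a - 2 :: complex)" by (simp add: d)
    \<comment> \<open>\<open>D_s\<close> maps \<open>double_up\<close> of the gradient to the right
      side times \<open>h\<close>, and \<open>mult_up m a h\<close> to
      \<open>- div_coeff m a\<close> times \<open>h\<close>. Their ratio is
      \<open>mix_coeff\<close>.\<close>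
    have "mix_coeff m a * div_coeff m a = (1 - 2 / (of_nat m + 2 * of_nat a - 2)) * of_nat a"
      using div_coeff_neq_0 by (simp add: mix_coeff_def)
    then show ?thesis by (simp add: e sl2_linear D(5) Zl g Z(2) dd cv.scale_minus_right)
  qed
  ultimately show "mix_up m a h \<in> symplectic_monogenics m 1" by (simp only: monogenic_iff)
qed

lemma embedding_mix_up:
  assumes "1 \<le> a"
  shows "lowest_weight_embedding m (harmonics m a) (mix_up m a) (of_nat m / 2 + of_int (int a))"
proof (rule lowest_weight_embedding.intro)
  show "irreducible_under (so_action m ` lie_carrier (so m)) (harmonics m a)" using m by (intro harmonics_irreducible) simp
  fix h assume h: "h \<in> harmonics m a"
  show "mix_up m a h \<in> symplectic_monogenics m 1" "sl2_lower m (mix_up m a h) = 0"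
    "sl2_euler m (mix_up m a h) = cscale (of_nat m / 2 + of_int (int a)) (mix_up m a h)"
    using mix_up_lowest[OF h assms] by blast+
  show "mix_up m a h = 0 \<Longrightarrow> h = 0"
    using mix_up_lowest(4)[OF h assms] grad_harmonics_general(2)[OF h] assms by (simp add: op_linear)
next
  show "of_nat m / 2 + of_int (int a) + of_nat k \<noteq> (0::complex)" for k
    by (rule weight_neq_0) (use assms in simp)
qed (auto simp: ups_equivariant intro: linear_op_ups)

text \<open>Both terms of \<open>D_s\<close> are multiples of the squared norm times
  \<open>h\<close>, and their coefficients cancel without any correction. The value a = 0 is allowed
  because \<open>mult_up\<close> does not kill constants.\<close>

lemma embedding_double_mult_up:
  "lowest_weight_embedding m (harmonics m a) (\<lambda>h. double_up m (Suc a) (mult_up m a h)) (of_nat m / 2 + of_int (int a + 2))"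
proof (rule lowest_weight_embedding.intro)
  show "irreducible_under (so_action m ` lie_carrier (so m)) (harmonics m a)" using m by (intro harmonics_irreducible) simp
  fix h assume h: "h \<in> harmonics m a"
  note Z = mult_up_harmonics[OF h]
  note D = double_up_lowest[OF Z(1)]
  have s: "of_nat m + 2 * of_nat (Suc a) \<noteq> (0 :: complex)" by (rule denom_neq_0)
  have "(1 - 2 / (of_nat m + 2 * of_nat (Suc a))) * (1 - of_nat a / (of_nat m + 2 * of_nat a - 2))
      - 1 / (of_nat m + 2 * of_nat (Suc a)) * div_coeff m a = 0"
  proof -
    \<comment> \<open>With \<open>x\<close> in place of \<open>m\<close> the denominators are
      \<open>x\<close> and \<open>x + 4\<close>, and the identity becomes one of rational
      functions.\<close>
    define x where "x = (of_nat m + 2 * of_nat a - 2 :: complex)"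
    have x: "x \<noteq> 0" "x + 4 \<noteq> 0" using denom_neq_0(1)[of a] s by (auto simp: x_def algebra_simps)
    have mx: "of_nat m = x - 2 * of_nat a + 2" "of_nat m + 2 * of_nat (Suc a) = x + 4" by (simp_all add: x_def)
    show ?thesis unfolding div_coeff_def mx(2) x_def [symmetric] mx(1) using x by (simp add: field_simps)
  qed
  then have "D_s m (double_up m (Suc a) (mult_up m a h)) = 0"
    unfolding D(5) Z(2,3) by (simp add: cscale_mult_right del: of_nat_Suc flip: cv.scale_left_diff_distrib)
  then show "double_up m (Suc a) (mult_up m a h) \<in> symplectic_monogenics m 1"
    using D(3) by (simp only: monogenic_iff)
  show "sl2_lower m (double_up m (Suc a) (mult_up m a h)) = 0"
    "sl2_euler m (double_up m (Suc a) (mult_up m a h)) = cscale (of_nat m / 2 + of_int (int a + 2)) (double_up m (Suc a) (mult_up m a h))"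
    using D by (simp_all add: add_ac)
  show "double_up m (Suc a) (mult_up m a h) = 0 \<Longrightarrow> h = 0"
    using D(4) Z(2) div_coeff_neq_0[of a] by (simp add: op_linear)
next
  show "of_nat m / 2 + of_int (int a + 2) + of_nat k \<noteq> (0::complex)" for k
    by (rule weight_neq_0) simp
qed (auto simp: ups_equivariant intro: linear_op_ups linear_op_comp)

end

section \<open>Completeness of the five families\<close>

context
  fixes m :: nat
  assumes m: "6 \<le> m"
begin

lemma divergence_harmonic:
  assumes p: "p \<in> harmonic_vectors m (Suc d)"
  shows "lap m BX BZ p \<in> harmonics m d"
proof -
  note H = harmonic_vectorsD[OF p]
  have "lap m BX BZ p = (\<Sum>j<m. partial (vr BZ j) (partial (vr BX j) p))"
    by (simp add: lap_def partial_commute)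
  also have "\<dots> \<in> z_only m"
    by (rule cv.subspace_sum[OF subspace_z_only], rule z_only_ops(1), rule xy_linear_partial[OF H(2)]) simp
  finally have z: "lap m BX BZ p \<in> z_only m" .
  have "lap m BX BZ (polar m BZ BZ p) = polar m BZ BZ (lap m BX BZ p) + lap m BX BZ p"
    by (simp add: lap_polar lap_commute[of m BZ BX])
  then have "polar m BZ BZ (lap m BX BZ p) = cscale (of_nat d) (lap m BX BZ p)"
    unfolding H(4) by (simp add: op_linear cv.scale_left_distrib)
  moreover have "lap m BZ BZ (lap m BX BZ p) = 0"
    unfolding lap_lap[of m BZ BZ BX BZ] H(5) by (simp add: op_linear)
  ultimately show ?thesis using z by (simp add: harmonics_def)
qed

text \<open>The divergence of \<open>p\<close> is harmonic of degree one less, and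
  \<open>mult_up\<close> produces a vector field with a prescribed divergence up to the nonzero
  factor \<open>div_coeff\<close>.\<close>

lemma remove_divergence:
  assumes p: "p \<in> harmonic_vectors m d"
  obtains h where "h \<in> harmonics m (d - 1)" "d = 0 \<Longrightarrow> h = 0" "p - mult_up m (d - 1) h \<in> harmonic_vectors m d"
    "lap m BX BZ (p - mult_up m (d - 1) h) = 0"
proof (cases d)
  case 0
  \<comment> \<open>A constant vector field has no divergence, so \<open>h = 0\<close> works despite
    the truncated \<open>d - 1\<close>.\<close>
  then have "polar m BZ BZ p = 0" using harmonic_vectorsD(4)[OF p] by simp
  then have "partial (vr BZ i) p = 0" for i
    using polar_self_eq_0_iff[OF harmonic_vectorsD(1)[OF p]] by blast
  then have "lap m BX BZ p = 0" by (simp add: lap_def)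
  then show ?thesis using that[of 0] p cv.subspace_0[OF subspace_harmonics]
    by (simp add: linear_opD(3)[OF linear_op_ups(2)])
next
  case (Suc e)
  define h where "h = cscale (inverse (div_coeff m e)) (lap m BX BZ p)"
  have h: "h \<in> harmonics m e"
    unfolding h_def using divergence_harmonic p Suc by (intro cv.subspace_scale[OF subspace_harmonics]) simp
  note Z = mult_up_harmonics[OF m h]
  have "p - mult_up m e h \<in> harmonic_vectors m d"
    using p Z(1) Suc by (intro cv.subspace_diff[OF subspace_harmonic_vectors]) simp_all
  moreover have "lap m BX BZ (p - mult_up m e h) = 0"
    using div_coeff_neq_0[OF m, of e] by (simp add: op_linear Z(2)) (simp add: h_def)
  ultimately show ?thesis using that[of h] h Suc by simp
qed

text \<open>The Laplacian of the inner product of z with \<open>p\<close> is twice the divergence,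
  so this product is harmonic, of degree d + 1. The gradient of its multiple by 1/(d + 1) has the
  same inner product with z, by the Euler identity.\<close>

lemma remove_gradient:
  assumes p: "p \<in> harmonic_vectors m d" "lap m BX BZ p = 0"
  obtains h where "h \<in> harmonics m (Suc d)" "p - polar m BX BZ h \<in> two_row m d"
proof -
  note H = harmonic_vectorsD[OF p(1)]
  let ?t = "polar m BZ BX p"
  have "lap m BZ BZ ?t = 0"
    using p(2) by (simp add: lap_polar H op_linear lap_commute[of m BZ BX])
  moreover have "polar m BZ BZ ?t = cscale (of_nat (Suc d)) ?t" "polar m BX BX ?t = 0" "polar m BY BY ?t = 0"
    using polar_polar[of m BZ BZ BZ BX p] polar_polar[of m BX BX BZ BX p] polar_polar[of m BY BY BZ BX p]
    by (simp_all add: H op_linear cv.scale_left_distrib)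
  ultimately have t: "?t \<in> harmonics m (Suc d)"
    by (simp add: harmonics_def z_only_iff polys_ops H)
  define h where "h = cscale (inverse (of_nat (Suc d))) ?t"
  have h: "h \<in> harmonics m (Suc d)"
    unfolding h_def using t by (intro cv.subspace_scale[OF subspace_harmonics])
  note G = grad_harmonics[OF m h]
  have "p - polar m BX BZ h \<in> harmonic_vectors m d"
    using p(1) G(1) by (intro cv.subspace_diff[OF subspace_harmonic_vectors])
  moreover have "lap m BX BZ (p - polar m BX BZ h) = 0" by (simp add: op_linear p(2) G(2))
  moreover have "polar m BZ BX (p - polar m BX BZ h) = 0"
    unfolding polar_linear G(3) by (simp add: h_def del: of_nat_Suc)
  ultimately show ?thesis using that h two_row_iff by blast
qed

definition branch_module :: "nat \<Rightarrow> nat \<Rightarrow> cpoly set" where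
  "branch_module a b = (if b = 0 then harmonics m a else two_row m a)"

text \<open>For each \<open>b\<close> the offset \<open>s - int a\<close> identifies the family; the
  last alternatives stand for \<open>s = int a + 2\<close> and \<open>s = int a + 1\<close>.\<close>

definition branch_map :: "nat \<Rightarrow> nat \<Rightarrow> int \<Rightarrow> cpoly \<Rightarrow> cpoly" where
  "branch_map a b s = (if b = 0 then
       if s = int a - 2 then polar m BX BZ else if s = int a then mix_up m a
       else (\<lambda>h. double_up m (Suc a) (mult_up m a h))
     else if s = int a - 1 then (\<lambda>p. p) else double_up m a)"

lemma branching_index_iff:
  "(a, b, s) \<in> branching_index \<longleftrightarrow>
     b = 0 \<and> 1 \<le> a \<and> s = int a - 2 \<or> b = 1 \<and> 1 \<le> a \<and> s = int a - 1 \<or> b = 0 \<and> 1 \<le> a \<and> s = int a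
     \<or> b = 1 \<and> 1 \<le> a \<and> s = int a + 1 \<or> b = 0 \<and> s = int a + 2"
  by (auto simp: branching_index_def)

lemma branch_embedding:
  assumes "(a, b, s) \<in> branching_index"
  shows "lowest_weight_embedding m (branch_module a b) (branch_map a b s) (of_nat m / 2 + of_int s)"
  using assms unfolding branching_index_iff
proof (elim disjE conjE)
qed (simp_all only: branch_module_def branch_map_def, simp_all add: embedding_grad[OF m, simplified] embedding_id[OF m, simplified]
    embedding_mix_up[OF m, simplified] embedding_double_up[OF m, simplified] embedding_double_mult_up[OF m, simplified])

definition branch :: "nat \<times> nat \<times> int \<Rightarrow> cpoly set" where
  "branch = (\<lambda>(a, b, s). lowest_weight_embedding.W m (branch_module a b) (branch_map a b s))"

definition branch_sum :: "cpoly set" where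
  "branch_sum = cv.span (\<Union>i\<in>branching_index. branch i)"

lemma branch_map_in_sum:
  assumes "(a, b, s) \<in> branching_index" "h \<in> branch_module a b"
  shows "branch_map a b s h \<in> branch_sum"
proof -
  interpret lowest_weight_embedding m "branch_module a b" "branch_map a b s" "of_nat m / 2 + of_int s"
    by (rule branch_embedding[OF assms(1)])
  have "branch_map a b s h \<in> branch (a, b, s)"
    using pow_in_W[OF assms(2), of 0] by (simp add: branch_def)
  then show ?thesis unfolding branch_sum_def using assms(1) by (intro cv.span_base) blast
qed

lemma subspace_branch_sum: "cv.subspace branch_sum"
  by (simp add: branch_sum_def)

text \<open>\<open>polar m BX BY f\<close> is the part of \<open>f\<close> with y, written with x
  instead, and \<open>polar m BY BX\<close> changes it back. If it vanishes, then \<open>f\<close>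
  does not involve y.\<close>

lemma polar_YX_XY:
  assumes "f \<in> xy_linear m"
  shows "polar m BY BX (polar m BX BY f) = polar m BY BY f"
proof -
  have "polar m BY BX (partial (vr BY j) f) = 0" for j
    using z_onlyD(3)[OF xy_linear_partial[OF assms]] by simp
  then show ?thesis
    unfolding polar_def[of m BX BY f] polar_def[of m BY BY f] by (simp add: op_linear polar_mult polar_Var)
qed

text \<open>The field \<open>p\<close> is harmonic, so removing its divergence and then a gradient
  splits it into three parts. Each part is the image under \<open>polar m BX BY\<close> of a known
  lowest weight vector of the same weight as \<open>f\<close>.\<close>

lemma lowest_in_branch_sum_homogeneous:
  assumes f: "f \<in> symplectic_monogenics m 1" "sl2_lower m f = 0"
    and E: "sl2_euler m f = cscale (of_nat m / 2 + of_int n) f"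
  shows "f \<in> branch_sum"
proof -
  have fxy: "f \<in> xy_linear m" "D_s m f = 0" using f(1) unfolding symplectic_monogenics_1 by blast+
  \<comment> \<open>The general case reduces to this one: subtract an element with the same image under
    \<open>polar m BX BY\<close>.\<close>
  have no_y: "f \<in> branch_sum"
    if f: "f \<in> symplectic_monogenics m 1" "sl2_lower m f = 0" "polar m BX BY f = 0"
      and E: "sl2_euler m f = cscale (of_nat m / 2 + of_int n) f" for f
  proof (cases "n < - 1")
    case True
    then have "f = 0" using weight_bound[OF _ E] f(1) unfolding symplectic_monogenics_1 by blast
    then show ?thesis using cv.subspace_0[OF subspace_branch_sum] by simp
  next
    case False
    \<comment> \<open>A weight vector with one factor x and none from y has weight one less than its
      degree in z.\<close>
    define d where "d = nat (n + 1)"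
    have "n + 1 = int d" using False by (simp add: d_def)
    from arg_cong[OF this, of "of_int :: int \<Rightarrow> complex"] have d: "of_int n + 1 = (of_nat d :: complex)" by simp
    have fxy: "f \<in> xy_linear m" "D_s m f = 0" using f(1) unfolding symplectic_monogenics_1 by blast+
    have YY: "polar m BY BY f = 0" using polar_YX_XY[OF fxy(1)] f(3) by (simp add: op_linear)
    then have XX: "polar m BX BX f = f" and pol: "f \<in> polys m" using fxy(1) by (auto simp: xy_linear_def)
    have ZZ: "polar m BZ BZ f = cscale (of_nat d) f"
      using E by (simp add: sl2_euler_eq XX YY flip: d) (simp add: cv.scale_left_distrib algebra_simps)
    have "cscale (1/2) (lap m BZ BZ f) = 0" using f(2,3) by (simp add: sl2_lower_eq)
    then have "lap m BZ BZ f = 0" by simp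
    then have hv: "f \<in> harmonic_vectors m d" using XX YY ZZ pol by (simp add: harmonic_vectors_def)
    have "lap m BX BZ f = 0" using fxy(2) harmonic_vectors_lowest(3)[OF m hv] by simp
    then obtain h where h: "h \<in> harmonics m (Suc d)" "f - polar m BX BZ h \<in> two_row m d"
      using remove_gradient[OF hv] by blast
    have 1: "polar m BX BZ h \<in> branch_sum"
      using branch_map_in_sum[of "Suc d" 0 "int (Suc d) - 2" h] h(1) by (simp add: branching_index_iff branch_module_def branch_map_def)
    have 2: "f - polar m BX BZ h \<in> branch_sum"
    proof (cases "d = 0")
      case True
      then have "f - polar m BX BZ h = 0" using h(2) two_row_0 by metis
      then show ?thesis using cv.subspace_0[OF subspace_branch_sum] by simp
    next
      case False
      then show ?thesis
        using branch_map_in_sum[of d 1 "int d - 1" "f - polar m BX BZ h"] h(2) by (simp add: branching_index_iff branch_module_def branch_map_def)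
    qed
    show ?thesis using cv.subspace_add[OF subspace_branch_sum 1 2] by simp
  qed
  define p where "p = polar m BX BY f"
  have pf: "polar m BX BY f = cscale (1/2) (lap m BZ BZ f)" using f(2) by (simp add: sl2_lower_eq)
  have p_xy: "polar m BX BX p = p" "polar m BY BY p = 0" "p \<in> polys m" "polar m BX BY p = 0"
  proof -
    show pol: "p \<in> polys m" unfolding p_def using fxy(1) by (auto simp: xy_linear_def intro: polys_ops)
    have z: "polar m q BX (partial (vr BY j) f) = 0" "polar m q BY (partial (vr BY j) f) = 0" for q j
      using z_onlyD(3)[OF xy_linear_partial[OF fxy(1)]] by simp_all
    show "polar m BX BX p = p" "polar m BY BY p = 0" "polar m BX BY p = 0"
      unfolding p_def polar_def[of m BX BY f] by (simp_all add: op_linear polar_mult polar_Var z)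
  qed
  have pE: "sl2_euler m p = cscale (of_nat m / 2 + of_int (n - 2)) p"
  proof -
    have "sl2_euler m p = polar m BX BY (sl2_euler m f) - cscale 2 p"
      unfolding sl2_euler_eq p_def
      by (simp add: op_linear polar_polar[of m BX BX BX BY f] polar_polar[of m BY BY BX BY f] polar_polar[of m BZ BZ BX BY f])
        (rule poly_mapping_eqI, simp add: lookup_simps algebra_simps)
    then show ?thesis unfolding E polar_linear p_def [symmetric]
      by (simp add: cv.scale_left_diff_distrib cv.scale_left_distrib algebra_simps)
  qed
  \<comment> \<open>By \<open>pf\<close> the Laplacian of \<open>f\<close> is 2 \<open>p\<close>.
    Applying \<open>polar m BX BY\<close> once more gives 0, since \<open>p\<close> does not involve
    y.\<close>
  have pL: "lap m BZ BZ p = 0"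
  proof -
    have "lap m BZ BZ p = polar m BX BY (cscale 2 (cscale (1/2) (lap m BZ BZ f)))"
      by (simp add: p_def lap_polar)
    then show ?thesis unfolding pf [symmetric] p_def [symmetric] by (simp add: op_linear p_xy)
  qed
  have pxl: "p \<in> xy_linear m" using p_xy by (simp add: xy_linear_def)
  show ?thesis
  proof (cases "n - 2 < - 1")
    case True
    then have "p = 0" using weight_bound[OF pxl pE] by blast
    then show ?thesis using no_y f E by (simp add: p_def)
  next
    case False
    \<comment> \<open>Replacing y by x lowers the weight by 2, so \<open>p\<close> has weight
      \<open>n - 2\<close> and degree \<open>n - 1\<close> in z.\<close>
    define d where "d = nat (n - 1)"
    have "n - 1 = int d" using False by (simp add: d_def)
    then have "n = int d + 1" by simp
    then have d: "of_int n - 1 = (of_nat d :: complex)" "n = int d + 1" by simp_all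
    have "polar m BZ BZ p = cscale (of_nat d) p"
      using pE cv.scale_left_distrib[of 1 1 p] by (simp add: sl2_euler_eq p_xy flip: d(1)) (simp add: cv.scale_left_distrib cv.scale_left_diff_distrib algebra_simps)
    then have hv: "p \<in> harmonic_vectors m d" using p_xy pL by (simp add: harmonic_vectors_def)
    obtain h0 where h0: "h0 \<in> harmonics m (d - 1)" "d = 0 \<Longrightarrow> h0 = 0" "p - mult_up m (d - 1) h0 \<in> harmonic_vectors m d"
      "lap m BX BZ (p - mult_up m (d - 1) h0) = 0" using remove_divergence[OF hv] by blast
    obtain h1 where h1: "h1 \<in> harmonics m (Suc d)" "p - mult_up m (d - 1) h0 - polar m BX BZ h1 \<in> two_row m d"
      using remove_gradient[OF h0(3,4)] by blast
    define q where "q = p - mult_up m (d - 1) h0 - polar m BX BZ h1"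
    have q: "q \<in> two_row m d" using h1(2) by (simp add: q_def)
    have ps: "p = mult_up m (d - 1) h0 + polar m BX BZ h1 + q" by (simp add: q_def)
    have ok: "\<exists>g\<in>branch_sum. g \<in> symplectic_monogenics m 1 \<and> sl2_lower m g = 0 \<and>
        sl2_euler m g = cscale (of_nat m / 2 + of_int n) g \<and> polar m BX BY g = r"
      if r: "r = mult_up m (d - 1) h0 \<or> r = polar m BX BZ h1 \<or> r = q" for r
    proof -
      have zero: ?thesis if "r = 0"
        using that cv.subspace_0[OF subspace_branch_sum] cv.subspace_0[OF subspace_symplectic_monogenics]
        by (intro bexI[of _ 0]) (simp_all add: sl2_linear op_linear)
      \<comment> \<open>For \<open>d = 0\<close> the first and third part vanish; the indices of
        their families would not exist.\<close>
      consider "r = 0" | "d \<noteq> 0" "r = mult_up m (d - 1) h0" | "r = polar m BX BZ h1" | "d \<noteq> 0" "r = q"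
        using r q h0(2) two_row_0 linear_opD(3)[OF linear_op_ups(2)] by metis
      then show ?thesis
      proof cases
        case 1
        then show ?thesis by (rule zero)
      next
        case 2
        have i: "(d - 1, 0, int (d - 1) + 2) \<in> branching_index" by (simp add: branching_index_iff)
        interpret lowest_weight_embedding m "branch_module (d - 1) 0" "branch_map (d - 1) 0 (int (d - 1) + 2)" "of_nat m / 2 + of_int (int (d - 1) + 2)"
          by (rule branch_embedding[OF i])
        have h: "h0 \<in> branch_module (d - 1) 0" using h0(1) by (simp add: branch_module_def)
        have e: "branch_map (d - 1) 0 (int (d - 1) + 2) h0 = double_up m d (mult_up m (d - 1) h0)"
          using 2 by (simp add: branch_map_def)
        have "mult_up m (d - 1) h0 \<in> harmonic_vectors m d" using mult_up_harmonics(1)[OF m h0(1)] 2 by simp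
        then show ?thesis
          using branch_map_in_sum[OF i h] mono[OF h] lower[OF h] euler[OF h] double_up_lowest(4)[OF m] 2 d(2)
          unfolding e by (intro bexI[of _ "double_up m d (mult_up m (d - 1) h0)"]) (auto simp: algebra_simps)
      next
        case 3
        have i: "(Suc d, 0, int (Suc d)) \<in> branching_index" by (simp add: branching_index_iff)
        interpret lowest_weight_embedding m "branch_module (Suc d) 0" "branch_map (Suc d) 0 (int (Suc d))" "of_nat m / 2 + of_int (int (Suc d))"
          by (rule branch_embedding[OF i])
        have h: "h1 \<in> branch_module (Suc d) 0" using h1(1) by (simp add: branch_module_def)
        have e: "branch_map (Suc d) 0 (int (Suc d)) h1 = mix_up m (Suc d) h1" by (simp add: branch_map_def)
        show ?thesis
          using branch_map_in_sum[OF i h] mono[OF h] lower[OF h] euler[OF h] mix_up_lowest(4)[OF m h1(1)] 3 d(2)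
          unfolding e by (intro bexI[of _ "mix_up m (Suc d) h1"]) (auto simp: algebra_simps)
      next
        case 4
        have i: "(d, 1, int d + 1) \<in> branching_index" using 4 by (simp add: branching_index_iff)
        interpret lowest_weight_embedding m "branch_module d 1" "branch_map d 1 (int d + 1)" "of_nat m / 2 + of_int (int d + 1)"
          by (rule branch_embedding[OF i])
        have h: "q \<in> branch_module d 1" using q by (simp add: branch_module_def)
        have e: "branch_map d 1 (int d + 1) q = double_up m d q" by (simp add: branch_map_def)
        have "q \<in> harmonic_vectors m d" using q two_row_iff by blast
        then show ?thesis
          using branch_map_in_sum[OF i h] mono[OF h] lower[OF h] euler[OF h] double_up_lowest(4)[OF m] 4 d(2)
          unfolding e by (intro bexI[of _ "double_up m d q"]) (auto simp: algebra_simps)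
      qed
    qed
    obtain g1 where g1: "g1 \<in> branch_sum" "g1 \<in> symplectic_monogenics m 1" "sl2_lower m g1 = 0"
      "sl2_euler m g1 = cscale (of_nat m / 2 + of_int n) g1" "polar m BX BY g1 = mult_up m (d - 1) h0" using ok by blast
    obtain g2 where g2: "g2 \<in> branch_sum" "g2 \<in> symplectic_monogenics m 1" "sl2_lower m g2 = 0"
      "sl2_euler m g2 = cscale (of_nat m / 2 + of_int n) g2" "polar m BX BY g2 = polar m BX BZ h1" using ok by blast
    obtain g3 where g3: "g3 \<in> branch_sum" "g3 \<in> symplectic_monogenics m 1" "sl2_lower m g3 = 0"
      "sl2_euler m g3 = cscale (of_nat m / 2 + of_int n) g3" "polar m BX BY g3 = q" using ok by blast
    have "f - (g1 + g2 + g3) \<in> branch_sum"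
    proof (rule no_y)
      show "f - (g1 + g2 + g3) \<in> symplectic_monogenics m 1"
        using f(1) g1(2) g2(2) g3(2) by (intro cv.subspace_diff[OF subspace_symplectic_monogenics] cv.subspace_add[OF subspace_symplectic_monogenics])
      show "polar m BX BY (f - (g1 + g2 + g3)) = 0"
        by (simp add: op_linear g1(5) g2(5) g3(5) flip: p_def) (simp add: ps)
    qed (simp_all add: sl2_linear f(2) E g1 g2 g3 cv.scale_right_distrib cv.scale_right_diff_distrib)
    then have "f - (g1 + g2 + g3) + (g1 + g2 + g3) \<in> branch_sum"
      using g1(1) g2(1) g3(1) by (intro cv.subspace_add[OF subspace_branch_sum])
    then show ?thesis by simp
  qed
qed

lemma lowest_in_branch_sum:
  assumes f: "f \<in> symplectic_monogenics m 1" "sl2_lower m f = 0"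
  shows "f \<in> branch_sum"
proof -
  let ?U = "{f \<in> symplectic_monogenics m 1. sl2_lower m f = 0}"
  have U: "cv.subspace ?U" by (intro subspace_kernel linear_op_sl2 subspace_symplectic_monogenics)
  have "sl2_euler m ` ?U \<subseteq> ?U"
    unfolding symplectic_monogenics_1 using xy_linear_ops(4)
    by (auto simp: D_s_euler sl2_linear) (metis cv.scale_zero_right diff_zero euler_lower linear_opD(3) linear_op_sl2(3) minus_diff_eq minus_zero)
  then obtain J w where J: "finite J" "f = (\<Sum>n\<in>J. w n)" "\<And>n. n \<in> J \<Longrightarrow> w n \<in> ?U"
    "\<And>n. sl2_euler m (w n) = cscale (of_nat m / 2 + of_int n) (w n)"
    using weight_decomposition[OF U, of m f] f by blast
  then have "w n \<in> branch_sum" if "n \<in> J" for n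
    using lowest_in_branch_sum_homogeneous[of "w n" n] that by blast
  then show ?thesis unfolding J(2) by (rule cv.subspace_sum[OF subspace_branch_sum])
qed

lemma branch_sum_lower_surj: "f \<in> branch_sum \<Longrightarrow> \<exists>g\<in>branch_sum. sl2_lower m g = f"
  unfolding branch_sum_def
proof (induction rule: cv.span_induct_alt)
  case base
  then show ?case using cv.span_zero linear_opD(3)[OF linear_op_sl2(2)] by blast
next
  case (step c x y)
  then obtain a b s where i: "(a, b, s) \<in> branching_index" "x \<in> branch (a, b, s)" by auto
  interpret lowest_weight_embedding m "branch_module a b" "branch_map a b s" "of_nat m / 2 + of_int s"
    by (rule branch_embedding[OF i(1)])
  obtain g where g: "g \<in> branch (a, b, s)" "sl2_lower m g = x" using lower_surj i(2) by (auto simp: branch_def)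
  obtain g' where g': "g' \<in> cv.span (\<Union>i\<in>branching_index. branch i)" "sl2_lower m g' = y" using step by blast
  have "g \<in> cv.span (\<Union>i\<in>branching_index. branch i)" using g(1) i(1) by (intro cv.span_base) blast
  then have "cscale c g + g' \<in> cv.span (\<Union>i\<in>branching_index. branch i)" using g'(1) by (intro cv.span_add cv.span_scale)
  moreover have "sl2_lower m (cscale c g + g') = cscale c x + y" by (simp add: sl2_linear g g')
  ultimately show ?case by blast
qed

lemma branch_monogenic: "i \<in> branching_index \<Longrightarrow> branch i \<subseteq> symplectic_monogenics m 1"
proof
  fix f assume i: "i \<in> branching_index" and f: "f \<in> branch i"
  obtain a b s where abs: "i = (a, b, s)" by (cases i)
  interpret lowest_weight_embedding m "branch_module a b" "branch_map a b s" "of_nat m / 2 + of_int s"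
    using i abs branch_embedding by blast
  show "f \<in> symplectic_monogenics m 1" using W_monogenic f by (simp add: abs branch_def)
qed

text \<open>Induction on the order of nilpotency of \<open>sl2_lower\<close>: if the image of
  \<open>f\<close> lies in the sum, it has a preimage \<open>g\<close> there, and
  \<open>f - g\<close> is a lowest weight vector.\<close>

lemma branch_sum_eq: "branch_sum = symplectic_monogenics m 1"
proof
  show sub: "branch_sum \<subseteq> symplectic_monogenics m 1"
    unfolding branch_sum_def
    by (rule cv.span_minimal[OF _ subspace_symplectic_monogenics]) (use branch_monogenic in blast)
  show "symplectic_monogenics m 1 \<subseteq> branch_sum"
  proof
    fix f assume f: "f \<in> symplectic_monogenics m 1"
    then have "f \<in> xy_linear m" unfolding symplectic_monogenics_1 by blast
    moreover have "sl2_lower m ` xy_linear m \<subseteq> xy_linear m" using xy_linear_ops(3) by blast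
    ultimately obtain n where "(sl2_lower m ^^ n) f = 0"
      using weight_lowering_nilpotent[OF linear_op_sl2(2) _ euler_lower] by blast
    then show "f \<in> branch_sum" using f
    proof (induction n arbitrary: f)
      case 0
      then show ?case using cv.subspace_0[OF subspace_branch_sum] by simp
    next
      case (Suc n)
      have "sl2_lower m f \<in> symplectic_monogenics m 1"
        using Suc.prems(2) unfolding symplectic_monogenics_1 by (simp add: xy_linear_ops D_s_lower sl2_linear)
      then have "sl2_lower m f \<in> branch_sum" using Suc by (simp add: funpow_swap1)
      then obtain g where g: "g \<in> branch_sum" "sl2_lower m g = sl2_lower m f" using branch_sum_lower_surj by blast
      have "f - g \<in> branch_sum"
        using g sub Suc.prems(2) by (intro lowest_in_branch_sum cv.subspace_diff[OF subspace_symplectic_monogenics]) (auto simp: sl2_linear)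
      then have "f - g + g \<in> branch_sum" using g(1) by (rule cv.subspace_add[OF subspace_branch_sum])
      then show ?case by simp
    qed
  qed
qed

section \<open>Separation of the families by Casimir eigenvalues\<close>

definition so_eigenvalue :: "nat \<Rightarrow> nat \<Rightarrow> int" where
  "so_eigenvalue a b = - 2 * (int a * (int a + int m - 2) + int b * (int m - 3))"

lemma branch_so_casimir:
  assumes "(a, b, s) \<in> branching_index" "f \<in> branch (a, b, s)"
  shows "so_casimir m f = cscale (of_int (so_eigenvalue a b)) f"
proof -
  interpret lowest_weight_embedding m "branch_module a b" "branch_map a b s" "of_nat m / 2 + of_int s"
    using assms branch_embedding by blast
  have "b = 0 \<or> b = 1" using assms(1) by (auto simp: branching_index_iff)
  then have "so_casimir m h = cscale (of_int (so_eigenvalue a b)) h" if "h \<in> branch_module a b" for h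
  proof
    assume b: "b = 0"
    have e: "(of_int (so_eigenvalue a b) :: complex) = - 2 * (of_nat a * (of_nat a + of_nat m - 2))"
      by (simp add: b so_eigenvalue_def)
    show ?thesis unfolding e using that by (intro so_casimir_harmonics) (simp add: branch_module_def b)
  next
    assume b: "b = 1"
    have e: "(of_int (so_eigenvalue a b) :: complex) = - 2 * (of_nat a * (of_nat a + of_nat m - 2) + of_nat m - 3)"
      by (simp add: b so_eigenvalue_def)
    show ?thesis unfolding e using that by (intro so_casimir_two_row) (simp add: branch_module_def b)
  qed
  moreover have "f \<in> W" using assms(2) by (simp add: branch_def)
  ultimately show ?thesis by (rule so_casimir_W)
qed

lemma branch_sl2_casimir:
  assumes "(a, b, s) \<in> branching_index" "f \<in> branch (a, b, s)"
  shows "sl2_casimir m f = cscale ((of_nat m / 2 + of_int s) * (of_nat m / 2 + of_int s - 2)) f"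
proof -
  interpret lowest_weight_embedding m "branch_module a b" "branch_map a b s" "of_nat m / 2 + of_int s"
    using assms branch_embedding by blast
  show ?thesis using assms(2) sl2_casimir_W by (simp add: branch_def)
qed

text \<open>Equal sl(2) eigenvalues mean s = s' or s + s' = 2 - m; the second is impossible as both
  are at least -1. With s fixed, a is known up to the offset s - a, which takes five values.\<close>

lemma casimirs_separate:
  assumes i: "(a, b, s) \<in> branching_index" and j: "(a', b', s') \<in> branching_index"
    and so: "so_eigenvalue a b = so_eigenvalue a' b'"
    and sl: "(of_nat m / 2 + of_int s) * (of_nat m / 2 + of_int s - 2) = ((of_nat m / 2 + of_int s') * (of_nat m / 2 + of_int s' - 2) :: complex)"
  shows "(a, b, s) = (a', b', s')"
proof -
  have "(y + u) * (y + u - 2) - (y + v) * (y + v - 2) = (u - v) * (2 * y + u + v - 2)" for y u v :: complex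
    by (simp add: algebra_simps)
  from this[of "of_nat m / 2" "of_int s" "of_int s'"]
  have "(of_int (s - s') * of_int (int m + s + s' - 2) :: complex) = 0"
    using sl by simp
  then have "s = s' \<or> int m + s + s' - 2 = 0" by (metis mult_eq_0_iff of_int_eq_0_iff right_minus_eq)
  moreover have "- 1 \<le> s" "- 1 \<le> s'" using i j by (auto simp: branching_index_iff)
  ultimately have ss: "s = s'" using m by linarith
  have so': "int a * (int a + int m - 2) + int b * (int m - 3) = int a' * (int a' + int m - 2) + int b' * (int m - 3)"
    using so by (simp add: so_eigenvalue_def)
  obtain k where k: "int a' = int a + k" by (metis add.commute diff_add_cancel)
  have e: "int b * (int m - 3) = k * (2 * int a + int m - 2 + k) + int b' * (int m - 3)"
    using so' unfolding k by (simp add: algebra_simps)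
  \<comment> \<open>Once both offsets are chosen, \<open>k\<close> is a number and \<open>e\<close>
    becomes linear in \<open>a\<close> and \<open>m\<close>, so each of the finitely many cases is
    linear arithmetic.\<close>
  define d where "d = s - int a"
  define d' where "d' = s - int a'"
  have d: "d = -2 \<and> int b = 0 \<and> 1 \<le> a \<or> d = -1 \<and> int b = 1 \<and> 1 \<le> a \<or> d = 0 \<and> int b = 0 \<and> 1 \<le> a
      \<or> d = 1 \<and> int b = 1 \<and> 1 \<le> a \<or> d = 2 \<and> int b = 0"
    using i by (auto simp: branching_index_iff d_def)
  have d': "d' = -2 \<and> int b' = 0 \<and> 1 \<le> a' \<or> d' = -1 \<and> int b' = 1 \<and> 1 \<le> a' \<or> d' = 0 \<and> int b' = 0 \<and> 1 \<le> a'
      \<or> d' = 1 \<and> int b' = 1 \<and> 1 \<le> a' \<or> d' = 2 \<and> int b' = 0"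
    using j unfolding ss [symmetric] by (auto simp: branching_index_iff d'_def)
  have "k = d - d'" using k by (simp add: d_def d'_def)
  then have "k = 0 \<and> int b = int b'"
    using d d' e m k by (elim disjE conjE) simp_all
  then show ?thesis using k ss by simp
qed

end

section \<open>Irreducibility under the symplectic Lie algebra\<close>

text \<open>Operators that are diagonal on monomials. For a sign \<open>\<chi>\<close> that is
  multiplicative in the exponents they commute up to sign with multiplication by a variable and with
  derivatives.\<close>

definition twist :: "((var \<Rightarrow>\<^sub>0 nat) \<Rightarrow> complex) \<Rightarrow> cpoly \<Rightarrow> cpoly" where
  "twist \<chi> f = (\<Sum>t\<in>Poly_Mapping.keys f. Poly_Mapping.single t (\<chi> t * Poly_Mapping.lookup f t))"

lemma lookup_twist [simp]: "Poly_Mapping.lookup (twist \<chi> f) t = \<chi> t * Poly_Mapping.lookup f t"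
proof -
  have "Poly_Mapping.lookup (twist \<chi> f) t = (\<Sum>s\<in>Poly_Mapping.keys f. if s = t then \<chi> t * Poly_Mapping.lookup f t else 0)"
    unfolding twist_def lookup_sum by (intro sum.cong refl) (simp add: lookup_single)
  then show ?thesis by (auto simp: in_keys_iff)
qed

lemma linear_op_twist: "linear_op (twist \<chi>)"
  by (rule linear_opI) (rule poly_mapping_eqI, simp add: lookup_add algebra_simps)+

lemmas twist_linear = linear_opD[OF linear_op_twist]

lemma twist_Var:
  assumes "\<And>t. \<chi> (t + Poly_Mapping.single v 1) = \<epsilon> * \<chi> t"
  shows "twist \<chi> (Var v * f) = cscale \<epsilon> (Var v * twist \<chi> f)"
proof (rule poly_mapping_eqI)
  fix t
  show "Poly_Mapping.lookup (twist \<chi> (Var v * f)) t = Poly_Mapping.lookup (cscale \<epsilon> (Var v * twist \<chi> f)) t"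
  proof (cases "Poly_Mapping.lookup t v = 0")
    case False
    have "t - Poly_Mapping.single v 1 + Poly_Mapping.single v 1 = t"
    proof (rule poly_mapping_eqI)
      fix k
      show "Poly_Mapping.lookup (t - Poly_Mapping.single v 1 + Poly_Mapping.single v 1) k = Poly_Mapping.lookup t k"
        using False by (cases "k = v") (auto simp: lookup_add lookup_minus lookup_single when_def)
    qed
    then have "\<chi> t = \<epsilon> * \<chi> (t - Poly_Mapping.single v 1)" using assms by metis
    then show ?thesis using False by (simp add: lookup_Var_mult)
  qed (simp add: lookup_Var_mult)
qed

lemma twist_partial:
  assumes "\<And>t. \<chi> (t + Poly_Mapping.single v 1) = \<epsilon> * \<chi> t" "\<epsilon> * \<epsilon> = 1"
  shows "twist \<chi> (partial v f) = cscale \<epsilon> (partial v (twist \<chi> f))"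
proof (rule poly_mapping_eqI)
  fix t
  show "Poly_Mapping.lookup (twist \<chi> (partial v f)) t = Poly_Mapping.lookup (cscale \<epsilon> (partial v (twist \<chi> f))) t"
    unfolding lookup_twist lookup_cscale lookup_partial assms(1)
    using assms(2) by (simp add: mult.assoc [symmetric])
qed

definition z_parity :: "nat \<Rightarrow> cpoly \<Rightarrow> cpoly" where
  "z_parity m = twist (\<lambda>t. (- 1) ^ z_degree m t)"

definition y_sign :: "nat \<Rightarrow> cpoly \<Rightarrow> cpoly" where
  "y_sign m = twist (\<lambda>t. (- 1) ^ (\<Sum>j<m. Poly_Mapping.lookup t (vr BY j)))"

lemma block_degree_add:
  "(\<Sum>j<m. Poly_Mapping.lookup (t + Poly_Mapping.single (vr q k) 1) (vr p j))
     = (\<Sum>j<m. Poly_Mapping.lookup t (vr p j)) + (if q = p \<and> k < m then 1 else (0::nat))"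
  by (auto simp: lookup_add lookup_single sum.distrib when_def)

lemma z_parity_ops:
  assumes "k < m"
  shows "z_parity m (Var (vr p k) * f) = cscale (if p = BZ then -1 else 1) (Var (vr p k) * z_parity m f)"
    "z_parity m (partial (vr p k) f) = cscale (if p = BZ then -1 else 1) (partial (vr p k) (z_parity m f))"
proof -
  have "(- 1 :: complex) ^ z_degree m (t + Poly_Mapping.single (vr p k) 1) = (if p = BZ then -1 else 1) * (- 1) ^ z_degree m t" for t
    using block_degree_add[of t p k BZ m] assms by (simp add: z_degree_def vr.simps)
  from twist_Var[where \<chi> = "\<lambda>t. (- 1) ^ z_degree m t", OF this] twist_partial[where \<chi> = "\<lambda>t. (- 1) ^ z_degree m t", OF this]
  show "z_parity m (Var (vr p k) * f) = cscale (if p = BZ then -1 else 1) (Var (vr p k) * z_parity m f)"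
    "z_parity m (partial (vr p k) f) = cscale (if p = BZ then -1 else 1) (partial (vr p k) (z_parity m f))"
    by (simp_all add: z_parity_def)
qed

lemma y_sign_ops:
  assumes "k < m"
  shows "y_sign m (Var (vr p k) * f) = cscale (if p = BY then -1 else 1) (Var (vr p k) * y_sign m f)"
    "y_sign m (partial (vr p k) f) = cscale (if p = BY then -1 else 1) (partial (vr p k) (y_sign m f))"
proof -
  have "(- 1 :: complex) ^ (\<Sum>j<m. Poly_Mapping.lookup (t + Poly_Mapping.single (vr p k) 1) (vr BY j))
      = (if p = BY then -1 else 1) * (- 1) ^ (\<Sum>j<m. Poly_Mapping.lookup t (vr BY j))" for t
    unfolding block_degree_add using assms by simp
  note * = this
  show "y_sign m (Var (vr p k) * f) = cscale (if p = BY then -1 else 1) (Var (vr p k) * y_sign m f)"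
    unfolding y_sign_def by (rule twist_Var) (rule *)
  show "y_sign m (partial (vr p k) f) = cscale (if p = BY then -1 else 1) (partial (vr p k) (y_sign m f))"
    unfolding y_sign_def by (rule twist_partial) (rule *, simp)
qed

lemma spinor_parity: "f \<in> even_spinors m \<longleftrightarrow> z_parity m f = f" "f \<in> odd_spinors m \<longleftrightarrow> z_parity m f = - f"
proof -
  have "(- 1) ^ n * c = c \<longleftrightarrow> c = 0 \<or> even n" "(- 1) ^ n * c = - c \<longleftrightarrow> c = 0 \<or> odd n" for c :: complex and n
    by (cases "even n"; simp add: eq_neg_iff_add_eq_0 neg_eq_iff_add_eq_0)+
  then show "f \<in> even_spinors m \<longleftrightarrow> z_parity m f = f" "f \<in> odd_spinors m \<longleftrightarrow> z_parity m f = - f"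
    unfolding poly_mapping_eq_iff fun_eq_iff z_parity_def even_spinors_def odd_spinors_def
    by (auto simp: in_keys_iff)
qed

lemmas z_parity_linear = twist_linear[of "\<lambda>t. (- 1) ^ z_degree m t" for m, folded z_parity_def]
lemmas y_sign_linear = twist_linear[of "\<lambda>t. (- 1) ^ (\<Sum>j<m. Poly_Mapping.lookup t (vr BY j))" for m, folded y_sign_def]

lemma y_sign_y_sign: "y_sign m (y_sign m f) = f"
  unfolding y_sign_def
  by (rule poly_mapping_eqI) (simp add: mult.assoc [symmetric] flip: power_add)

text \<open>Without the constant shift of X and the halves on the diagonals of Y and Z, the formulas
  are uniform in the indices; the invariant subspaces are the same.\<close>

definition spX :: "nat \<Rightarrow> nat \<Rightarrow> cpoly \<Rightarrow> cpoly" where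
  "spX j k f = Var (vr BX j) * partial (vr BX k) f - Var (vr BY k) * partial (vr BY j) f - Var (vr BZ k) * partial (vr BZ j) f"

definition spY :: "nat \<Rightarrow> nat \<Rightarrow> cpoly \<Rightarrow> cpoly" where
  "spY j k f = Var (vr BX j) * partial (vr BY k) f + Var (vr BX k) * partial (vr BY j) f - partial (vr BZ j) (partial (vr BZ k) f)"

definition spZ :: "nat \<Rightarrow> nat \<Rightarrow> cpoly \<Rightarrow> cpoly" where
  "spZ j k f = Var (vr BY j) * partial (vr BX k) f + Var (vr BY k) * partial (vr BX j) f + Var (vr BZ j) * (Var (vr BZ k) * f)"

lemma sp_blk:
  "sp_X j k f = spX j k f - (if j = k then cscale (1/2) f else 0)"
  "sp_Y j k f = cscale (if j = k then 1/2 else 1) (spY j k f)"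
  "sp_Z j k f = cscale (if j = k then 1/2 else 1) (spZ j k f)"
proof -
  have h: "cscale (1/2) (g + g) = g" "cscale (1/2) (2 * g) = g" for g :: cpoly
    using half_plus_half[of g] by (simp_all only: mult_2)
  show "sp_X j k f = spX j k f - (if j = k then cscale (1/2) f else 0)"
    by (simp add: sp_X_def spX_def mult_var_eq vr.simps)
  show "sp_Y j k f = cscale (if j = k then 1/2 else 1) (spY j k f)"
    by (cases "j = k") (simp_all add: sp_Y_def spY_def mult_var_eq vr.simps cv.scale_right_diff_distrib h)
  show "sp_Z j k f = cscale (if j = k then 1/2 else 1) (spZ j k f)"
    by (cases "j = k") (simp_all add: sp_Z_def spZ_def mult_var_eq vr.simps cv.scale_right_distrib h)
qed

lemma linear_op_sp: "linear_op (spX j k)" "linear_op (spY j k)" "linear_op (spZ j k)"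
  by (rule linear_opI; simp add: spX_def spY_def spZ_def partial_cscale cscale_mult_right algebra_simps
      cv.scale_right_distrib cv.scale_right_diff_distrib del: mult.commute mult.assoc)+

lemma sp_invariant_iff:
  assumes U: "cv.subspace U"
  shows "(\<forall>F\<in>sp_operators m. F ` U \<subseteq> U) \<longleftrightarrow>
    (\<forall>j<m. \<forall>k<m. \<forall>f\<in>U. spX j k f \<in> U \<and> spY j k f \<in> U \<and> spZ j k f \<in> U)"
proof
  assume a: "\<forall>F\<in>sp_operators m. F ` U \<subseteq> U"
  show "\<forall>j<m. \<forall>k<m. \<forall>f\<in>U. spX j k f \<in> U \<and> spY j k f \<in> U \<and> spZ j k f \<in> U"
  proof (intro allI impI ballI)
    fix j k f assume jk: "j < m" "k < m" and f: "f \<in> U"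
    have "sp_X j k \<in> sp_operators m" using jk by (auto simp: sp_operators_def)
    then have "sp_X j k f \<in> U" using a f by blast
    moreover have "spX j k f = sp_X j k f + (if j = k then cscale (1/2) f else 0)" by (simp add: sp_blk)
    ultimately have 1: "spX j k f \<in> U"
      using f by (auto intro: cv.subspace_add[OF U] cv.subspace_scale[OF U])
    have 2: "spY j k f \<in> U \<and> spZ j k f \<in> U" if "j \<le> k" "k < m" for j k
    proof -
      have "sp_Y j k \<in> sp_operators m" "sp_Z j k \<in> sp_operators m" using that by (auto simp: sp_operators_def)
      then have "sp_Y j k f \<in> U" "sp_Z j k f \<in> U" using a f by blast+
      then have "cscale (if j = k then 2 else 1) (sp_Y j k f) \<in> U" "cscale (if j = k then 2 else 1) (sp_Z j k f) \<in> U"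
        using U cv.subspace_scale by blast+
      then show ?thesis unfolding sp_blk by (simp split: if_splits)
    qed
    have s: "spY j k f = spY k j f" "spZ j k f = spZ k j f"
      by (simp_all add: spY_def spZ_def partial_commute mult.left_commute add.commute)
    show "spX j k f \<in> U \<and> spY j k f \<in> U \<and> spZ j k f \<in> U"
      using 1 2[of j k] 2[of k j] s jk by (cases "j \<le> k") simp_all
  qed
next
  assume a: "\<forall>j<m. \<forall>k<m. \<forall>f\<in>U. spX j k f \<in> U \<and> spY j k f \<in> U \<and> spZ j k f \<in> U"
  show "\<forall>F\<in>sp_operators m. F ` U \<subseteq> U"
    using a U unfolding sp_operators_def
    by (auto simp: sp_blk intro!: cv.subspace_diff[OF U] cv.subspace_scale[OF U])
qed

lemma D_s_Var_partial:
  assumes "j < m"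
  shows "D_s m (Var (vr p j) * f) = Var (vr p j) * D_s m f
      + (case p of BX \<Rightarrow> - partial (vr BZ j) f | BY \<Rightarrow> Var (vr BZ j) * f | BZ \<Rightarrow> - partial (vr BX j) f)"
    "D_s m (partial (vr p j) f) = partial (vr p j) (D_s m f)
      - (case p of BZ \<Rightarrow> partial (vr BY j) f | _ \<Rightarrow> 0)"
proof -
  have l: "lap m BX BZ (Var (vr p j) * f) = Var (vr p j) * lap m BX BZ f
      + (if p = BX then partial (vr BZ j) f else 0) + (if p = BZ then partial (vr BX j) f else 0)" for p
  proof -
    have "lap m BX BZ (Var (vr p j) * f) = (\<Sum>i<m. Var (vr p j) * partial (vr BX i) (partial (vr BZ i) f)
      + (if i = j then if p = BX then partial (vr BZ i) f else 0 else 0) + (if i = j then if p = BZ then partial (vr BX i) f else 0 else 0))"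
      unfolding lap_def by (intro sum.cong refl) (auto simp: partial_Var_mult)
    then show ?thesis using assms by (simp add: sum.distrib lap_def sum_distrib_left)
  qed
  show "D_s m (Var (vr p j) * f) = Var (vr p j) * D_s m f
      + (case p of BX \<Rightarrow> - partial (vr BZ j) f | BY \<Rightarrow> Var (vr BZ j) * f | BZ \<Rightarrow> - partial (vr BX j) f)"
    using assms by (cases p) (simp_all add: D_s_eq l polar_mult polar_Var algebra_simps del: mult.commute mult.assoc)
  show "D_s m (partial (vr p j) f) = partial (vr p j) (D_s m f) - (case p of BZ \<Rightarrow> partial (vr BY j) f | _ \<Rightarrow> 0)"
    using assms by (cases p) (simp_all add: D_s_eq partial_polar partial_lap)
qed

lemma D_s_sp:
  assumes "j < m" "k < m"
  shows "D_s m (spX j k f) = spX j k (D_s m f)" "D_s m (spY j k f) = spY j k (D_s m f)" "D_s m (spZ j k f) = spZ j k (D_s m f)"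
  unfolding spX_def spY_def spZ_def sl2_linear
  using assms by (simp_all add: D_s_Var_partial partial_Var_mult partial_commute algebra_simps del: mult.commute mult.assoc)

lemma xy_linear_sp:
  assumes f: "f \<in> xy_linear m" and jk: "j < m" "k < m"
  shows "spX j k f \<in> xy_linear m" "spY j k f \<in> xy_linear m" "spZ j k f \<in> xy_linear m"
proof -
  have f': "f \<in> polys m" "polar m BX BX f + polar m BY BY f = f" using f by (auto simp: xy_linear_def)
  define e where "e f = polar m BX BX f + polar m BY BY f" for f
  have lin: "linear_op e" unfolding e_def by (intro linear_op_add linear_op_polar)
  have pp: "polar m r r (partial (vr p i) f) = partial (vr p i) (polar m r r f) - (if p = r \<and> i < m then partial (vr r i) f else 0)" for r p i f
    by (simp add: partial_polar)
  have V: "e (Var (vr p i) * g) = Var (vr p i) * e g + (if p = BZ then 0 else Var (vr p i) * g)" if "i < m" for p i g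
    using that by (cases p) (simp_all add: e_def polar_mult polar_Var algebra_simps del: mult.commute mult.assoc)
  have P: "e (partial (vr p i) g) = partial (vr p i) (e g) - (if p = BZ then 0 else partial (vr p i) g)" if "i < m" for p i g
    using that by (cases p) (simp_all add: e_def pp)
  have ef: "e f = f" using f'(2) by (simp add: e_def)
  have "e (spX j k f) = spX j k f" "e (spY j k f) = spY j k f" "e (spZ j k f) = spZ j k f"
    unfolding spX_def spY_def spZ_def linear_opD[OF lin] using jk by (simp_all add: V P ef algebra_simps del: mult.commute mult.assoc)
  moreover have "spX j k f \<in> polys m" "spY j k f \<in> polys m" "spZ j k f \<in> polys m"
    unfolding spX_def spY_def spZ_def using jk f'(1)
    by (auto intro!: polys_lin polys_mult polys_Var polys_partial)
  ultimately show "spX j k f \<in> xy_linear m" "spY j k f \<in> xy_linear m" "spZ j k f \<in> xy_linear m"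
    by (simp_all add: xy_linear_def e_def)
qed

lemma z_parity_sp:
  assumes "j < m" "k < m"
  shows "z_parity m (spX j k f) = spX j k (z_parity m f)" "z_parity m (spY j k f) = spY j k (z_parity m f)"
    "z_parity m (spZ j k f) = spZ j k (z_parity m f)"
  using assms by (simp_all add: spX_def spY_def spZ_def z_parity_linear z_parity_ops cscale_mult_right partial_cscale)

lemma fischer_sp:
  assumes "j < m" "k < m"
  shows "fischer (y_sign m (spX j k f)) g = fischer (y_sign m f) (spX k j g)"
    "fischer (y_sign m (spY j k f)) g = - fischer (y_sign m f) (spZ j k g)"
    "fischer (y_sign m (spZ j k f)) g = - fischer (y_sign m f) (spY j k g)"
  using assms
  by (simp_all add: spX_def spY_def spZ_def y_sign_linear y_sign_ops cscale_mult_right partial_cscale cv.scale_minus_left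
      fischer_diff fischer_add_left fischer_add_right fischer_Var fischer_partial partial_commute mult.left_commute)

text \<open>The Euler operator lies in the span of the diagonal X and the identity, so invariant
  subspaces split into weight spaces.\<close>

lemma euler_spX: "sl2_euler m f = cscale (of_nat m / 2) f - (\<Sum>j<m. spX j j f)"
  by (simp add: sl2_euler_eq spX_def polar_def sum_subtractf)

lemma cscale_numeral: "cscale (numeral n) f = numeral n * f" for f :: cpoly
  using cscale_of_nat[of "numeral n" f] by simp

lemma spY_weight:
  assumes "j < m" "k < m"
  shows "sl2_euler m (spY j k f) = spY j k (sl2_euler m f) - cscale 2 (spY j k f)"
proof -
  have pp: "polar m r r (partial (vr p i) f) = partial (vr p i) (polar m r r f) - (if p = r \<and> i < m then partial (vr r i) f else 0)" for r p i f
    by (simp add: partial_polar)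
  show ?thesis using assms
    by (simp add: sl2_euler_eq spY_def op_linear polar_mult polar_Var pp cscale_mult_right right_diff_distrib distrib_left
        cv.scale_right_distrib cv.scale_right_diff_distrib cscale_numeral)
qed

lemma spY_commute: "spY j k (spY i l f) = spY i l (spY j k f)"
  by (simp add: spY_def partial_Var_mult partial_commute mult.left_commute right_diff_distrib distrib_left add_ac)

text \<open>Degree one in (x,y) and a fixed weight bound the degree in z. This makes orthogonal
  projection available in the infinite-dimensional module.\<close>

lemma finite_dimensional_weight_space:
  assumes U: "cv.subspace U" "U \<subseteq> xy_linear m"
    and E: "\<And>f. f \<in> U \<Longrightarrow> sl2_euler m f = cscale (of_nat m / 2 + of_int n) f"
  shows "\<exists>B. finite B \<and> cv.span B = U"
proof (rule finite_dimensional_subspace[OF U(1)])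
  show "U \<subseteq> polys m" using U(2) by (auto simp: xy_linear_def)
  fix f t v assume f: "f \<in> U" and t: "t \<in> Poly_Mapping.keys f"
  have xy: "f \<in> xy_linear m" using f U(2) by blast
  have nz: "Poly_Mapping.lookup f t \<noteq> 0" using t by (simp add: in_keys_iff)
  have "(of_nat m / 2 + of_int (weight m t)) * Poly_Mapping.lookup f t = (of_nat m / 2 + of_int n) * Poly_Mapping.lookup f t"
    by (metis E[OF f] lookup_cscale lookup_euler)
  then have w: "weight m t = n" using nz by simp
  have "of_nat (xy_degree m t) * Poly_Mapping.lookup f t = Poly_Mapping.lookup f t"
    using xy lookup_xy_euler[of m f t] by (simp add: xy_linear_def)
  then have "xy_degree m t = 1" using nz by (metis mult_cancel_right1 of_nat_eq_1_iff)
  then have d: "(\<Sum>j<m. Poly_Mapping.lookup t (vr BX j)) + (\<Sum>j<m. Poly_Mapping.lookup t (vr BY j)) = 1"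
    by (simp add: xy_degree_def sum.distrib vr.simps)
  show "Poly_Mapping.lookup t v \<le> nat n + 2"
  proof (cases "v \<in> Poly_Mapping.keys t")
    case True
    obtain p j where v: "v = vr p j" using ex_vr by blast
    have "f \<in> polys m" using xy by (simp add: xy_linear_def)
    then have "var_index v < m" using True t unfolding polys_def by blast
    then have j: "j < m" by (simp add: v)
    have "Poly_Mapping.lookup t (vr p j) \<le> (\<Sum>j<m. Poly_Mapping.lookup t (vr p j))"
      using j by (intro member_le_sum) auto
    also have "\<dots> \<le> nat n + 2"
      using d w unfolding weight_def by (cases p; simp only:; linarith)
    finally show ?thesis by (simp add: v)
  qed (simp add: in_keys_iff)
qed

lemma fischer_euler: "fischer (sl2_euler m f) g = fischer f (sl2_euler m g)"
  unfolding sl2_euler_eq polar_def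
  by (simp add: fischer_diff fischer_add_left fischer_add_right fischer_sum fischer_Var fischer_partial
      fischer_cscale_left fischer_cscale_right)

lemma fischer_weights:
  assumes "sl2_euler m f = cscale (of_nat m / 2 + of_int n) f" "sl2_euler m g = cscale (of_nat m / 2 + of_int k) g" "n \<noteq> k"
  shows "fischer f g = 0"
proof -
  have "(of_nat m / 2 + of_int n) * fischer f g = (of_nat m / 2 + of_int k) * fischer f g"
    using fischer_euler[of m f g] unfolding assms(1,2) by (simp add: fischer_cscale_left fischer_cscale_right)
  then show ?thesis using assms(3) by simp
qed

text \<open>Minus the adjoint of \<open>D_s\<close> for the Fischer product twisted by the sign of
  y: \<open>quad m BX BZ\<close> is adjoint to \<open>lap m BX BZ\<close>, and
  \<open>polar m BY BZ\<close> to \<open>polar m BZ BY\<close>.\<close>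

definition D_s_adjoint :: "nat \<Rightarrow> cpoly \<Rightarrow> cpoly" where
  "D_s_adjoint m h = quad m BX BZ * h + polar m BY BZ h"

lemma D_s_z_only:
  assumes "f \<in> xy_linear m"
  shows "D_s m f \<in> z_only m"
proof -
  have "D_s m f = (\<Sum>j<m. Var (vr BZ j) * partial (vr BY j) f) - (\<Sum>j<m. partial (vr BZ j) (partial (vr BX j) f))"
    by (simp add: D_s_eq polar_def lap_def partial_commute)
  moreover have "Var (vr BZ j) * g \<in> z_only m" if "g \<in> z_only m" "j < m" for g j
    using that by (auto simp: z_only_def polys_mult polys_Var partial_Var_mult)
  moreover have "partial (vr BX j) f \<in> z_only m" "partial (vr BY j) f \<in> z_only m" for j
    using xy_linear_partial[OF assms] by simp_all
  ultimately show ?thesis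
    by (simp only:) (rule cv.subspace_diff[OF subspace_z_only]; rule cv.subspace_sum[OF subspace_z_only]; simp add: z_only_ops(1))
qed

text \<open>The first term of \<open>D_s\<close> gives E_z h and the second subtracts (m + E_z) h.
  That only the constant -m remains makes the correction by \<open>D_s_adjoint\<close>
  explicit.\<close>

lemma D_s_adjoint_facts:
  assumes h: "h \<in> z_only m"
  shows "D_s m (D_s_adjoint m h) = - of_nat m * h" "D_s_adjoint m h \<in> xy_linear m"
proof -
  note H = z_onlyD[OF h]
  have YZ: "polar m BZ BY (polar m BY BZ h) = polar m BZ BZ h" "polar m BX BX (polar m BY BZ h) = 0"
    "polar m BY BY (polar m BY BZ h) = polar m BY BZ h"
    using polar_polar[of m BZ BY BY BZ h] polar_polar[of m BX BX BY BZ h] polar_polar[of m BY BY BY BZ h]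
    by (simp_all add: H op_linear)
  show "D_s m (D_s_adjoint m h) = - of_nat m * h"
    by (simp add: D_s_adjoint_def D_s_eq op_linear polar_mult polar_quad lap_quad_mult lap_polar H YZ)
  have "D_s_adjoint m h \<in> polys m"
    unfolding D_s_adjoint_def using H(2) by (auto intro!: polys_lin polys_ops)
  then show "D_s_adjoint m h \<in> xy_linear m"
    by (simp add: xy_linear_def) (simp add: D_s_adjoint_def op_linear polar_mult polar_quad H YZ)
qed

lemma z_only_y_sign:
  assumes "f \<in> polys m" "polar m BY BY f = 0"
  shows "y_sign m f = f"
proof (rule poly_mapping_eqI)
  fix t
  have "of_nat (\<Sum>j<m. Poly_Mapping.lookup t (vr BY j)) * Poly_Mapping.lookup f t = 0"
    using assms(2) lookup_polar_self[of m BY f t] by simp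
  then have "Poly_Mapping.lookup f t = 0 \<or> (\<Sum>j<m. Poly_Mapping.lookup t (vr BY j)) = 0"
    by (metis mult_eq_0_iff of_nat_eq_0_iff)
  then show "Poly_Mapping.lookup (y_sign m f) t = Poly_Mapping.lookup f t"
    by (auto simp: y_sign_def simp del: sum_eq_0_iff)
qed

lemma sum_ops_sign:
  "y_sign m (quad m BX BZ * h) = quad m BX BZ * y_sign m h" "y_sign m (polar m BY BZ h) = - polar m BY BZ (y_sign m h)"
  "y_sign m (polar m p p h) = polar m p p (y_sign m h)"
proof -
  have "y_sign m (\<Sum>j<m. Var (vr BX j) * (Var (vr BZ j) * h)) = (\<Sum>j<m. Var (vr BX j) * (Var (vr BZ j) * y_sign m h))"
    unfolding y_sign_linear by (intro sum.cong refl) (simp add: y_sign_ops)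
  then show "y_sign m (quad m BX BZ * h) = quad m BX BZ * y_sign m h"
    by (simp add: quad_def sum_distrib_right mult.assoc)
  show "y_sign m (polar m BY BZ h) = - polar m BY BZ (y_sign m h)"
    unfolding polar_def y_sign_linear sum_negf [symmetric]
    by (intro sum.cong refl) (simp add: y_sign_ops cv.scale_minus_left)
  show "y_sign m (polar m p p h) = polar m p p (y_sign m h)"
    unfolding polar_def y_sign_linear
    by (intro sum.cong refl) (simp add: y_sign_ops cscale_mult_right)
qed

lemma fischer_D_s_adjoint:
  assumes "h \<in> z_only m"
  shows "fischer (y_sign m (D_s_adjoint m h)) g = - fischer h (D_s m g)"
proof -
  have h: "y_sign m h = h" using assms z_onlyD(3)[OF assms, of BY BY] by (intro z_only_y_sign) (auto simp: z_only_def)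
  have "fischer (quad m BX BZ * h) g = fischer h (lap m BX BZ g)"
    by (simp add: quad_def lap_def sum_distrib_right mult.assoc fischer_sum fischer_Var partial_commute)
  moreover have "fischer (polar m BY BZ h) g = fischer h (polar m BZ BY g)"
    by (simp add: polar_def fischer_sum fischer_Var fischer_partial)
  ultimately show ?thesis
    by (simp add: D_s_adjoint_def y_sign_linear sum_ops_sign h fischer_add_left D_s_eq fischer_diff)
qed

lemma z_parity_D_s:
  "z_parity m (D_s m f) = - D_s m (z_parity m f)" "z_parity m (D_s_adjoint m f) = - D_s_adjoint m (z_parity m f)"
proof -
  have 1: "z_parity m (polar m BZ BY f) = - polar m BZ BY (z_parity m f)" "z_parity m (polar m BY BZ f) = - polar m BY BZ (z_parity m f)"
    "z_parity m (lap m BX BZ f) = - lap m BX BZ (z_parity m f)"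
    unfolding polar_def lap_def z_parity_linear sum_negf [symmetric]
    by (intro sum.cong refl; simp add: z_parity_ops cv.scale_minus_left cv.scale_minus_right)+
  have "z_parity m (\<Sum>j<m. Var (vr BX j) * (Var (vr BZ j) * f)) = - (\<Sum>j<m. Var (vr BX j) * (Var (vr BZ j) * z_parity m f))"
    unfolding z_parity_linear sum_negf [symmetric] by (intro sum.cong refl) (simp add: z_parity_ops cv.scale_minus_left)
  then have 2: "z_parity m (quad m BX BZ * f) = - (quad m BX BZ * z_parity m f)"
    by (simp add: quad_def sum_distrib_right mult.assoc)
  show "z_parity m (D_s m f) = - D_s m (z_parity m f)" "z_parity m (D_s_adjoint m f) = - D_s_adjoint m (z_parity m f)"
    by (simp_all add: D_s_eq D_s_adjoint_def z_parity_linear 1 2)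
qed

lemma y_sign_z_parity: "y_sign m (z_parity m f) = z_parity m (y_sign m f)"
  by (rule poly_mapping_eqI) (simp add: y_sign_def z_parity_def)

lemma y_sign_xy_linear:
  assumes "f \<in> xy_linear m"
  shows "y_sign m f \<in> xy_linear m"
proof -
  have "Poly_Mapping.keys (y_sign m f) \<subseteq> Poly_Mapping.keys f" by (auto simp: in_keys_iff y_sign_def)
  then have "y_sign m f \<in> polys m" using assms unfolding xy_linear_def polys_def by blast
  moreover have "polar m BX BX (y_sign m f) + polar m BY BY (y_sign m f) = y_sign m (polar m BX BX f + polar m BY BY f)"
    by (simp add: y_sign_linear sum_ops_sign)
  ultimately show ?thesis using assms by (simp add: xy_linear_def)
qed

definition monogenic_spinors :: "nat \<Rightarrow> complex \<Rightarrow> cpoly set" where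
  "monogenic_spinors m \<epsilon> = {f \<in> symplectic_monogenics m 1. z_parity m f = cscale \<epsilon> f}"

lemma subspace_monogenic_spinors: "cv.subspace (monogenic_spinors m \<epsilon>)"
  unfolding monogenic_spinors_def using subspace_symplectic_monogenics[of m]
  by (auto simp: cv.subspace_def z_parity_linear cv.scale_right_distrib mult.commute)

lemma monogenic_spinors_iff:
  "f \<in> monogenic_spinors m \<epsilon> \<longleftrightarrow> f \<in> xy_linear m \<and> D_s m f = 0 \<and> z_parity m f = cscale \<epsilon> f"
  unfolding monogenic_spinors_def symplectic_monogenics_1 by blast

lemma monogenic_spinors_sp:
  assumes "f \<in> monogenic_spinors m \<epsilon>" "j < m" "k < m"
  shows "spX j k f \<in> monogenic_spinors m \<epsilon> \<and> spY j k f \<in> monogenic_spinors m \<epsilon> \<and> spZ j k f \<in> monogenic_spinors m \<epsilon>"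
  using assms linear_op_sp[THEN linear_opD(2)] linear_op_sp[THEN linear_opD(3)]
  by (simp add: monogenic_spinors_iff xy_linear_sp D_s_sp z_parity_sp)

lemma euler_of_spX:
  assumes "cv.subspace U" "\<And>j k f. j < m \<Longrightarrow> k < m \<Longrightarrow> f \<in> U \<Longrightarrow> spX j k f \<in> U"
  shows "sl2_euler m ` U \<subseteq> U"
  using assms by (auto simp: euler_spX intro!: cv.subspace_diff cv.subspace_scale cv.subspace_sum)

text \<open>
  The sign change in \<open>y\<close> does not preserve the kernel of \<open>D_s\<close>.  In the proof it is corrected by an
  element of the image of \<open>D_s_adjoint\<close>, which is orthogonal to this kernel.
\<close>

lemma y_sign_orthogonal_vector:
  assumes m: "0 < m" and U: "cv.subspace U" "U \<subset> monogenic_spinors m \<epsilon>"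
    and inv: "\<And>j k f. j < m \<Longrightarrow> k < m \<Longrightarrow> f \<in> U \<Longrightarrow> spX j k f \<in> U"
  shows "\<exists>w\<in>monogenic_spinors m \<epsilon>. w \<noteq> 0 \<and> (\<forall>u\<in>U. fischer (y_sign m w) u = 0)"
proof -
  let ?V = "monogenic_spinors m \<epsilon>"
  note V = subspace_monogenic_spinors[of m \<epsilon>]
  have EV: "sl2_euler m ` ?V \<subseteq> ?V" using monogenic_spinors_sp by (intro euler_of_spX[OF V]) blast
  have EU: "sl2_euler m ` U \<subseteq> U" by (rule euler_of_spX[OF U(1) inv])
  obtain f0 where f0: "f0 \<in> ?V" "f0 \<notin> U" using U(2) by blast
  \<comment> \<open>Some weight component of \<open>f0\<close> is outside \<open>U\<close>. For it
    the projection takes place in the finite-dimensional part of \<open>U\<close> of the same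
    weight.\<close>
  obtain J w where w: "finite J" "f0 = (\<Sum>n\<in>J. w n)" "\<And>n. n \<in> J \<Longrightarrow> w n \<in> ?V"
    "\<And>n. sl2_euler m (w n) = cscale (of_nat m / 2 + of_int n) (w n)"
    using weight_decomposition[OF V EV f0(1)] by blast
  then obtain n where n: "n \<in> J" "w n \<notin> U" using f0(2) cv.subspace_sum[OF U(1)] by metis
  define f where "f = w n"
  have f: "f \<in> ?V" "f \<notin> U" "sl2_euler m f = cscale (of_nat m / 2 + of_int n) f"
    using w(3,4) n by (simp_all add: f_def)
  define Uw where "Uw = {u \<in> U. sl2_euler m u = cscale (of_nat m / 2 + of_int n) u}"
  have Uw: "cv.subspace Uw"
    unfolding Uw_def using U(1) by (auto simp: cv.subspace_def sl2_linear cv.scale_right_distrib mult.commute)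
  have "Uw \<subseteq> xy_linear m" using U(2) by (auto simp: Uw_def monogenic_spinors_iff)
  moreover have "sl2_euler m u = cscale (of_nat m / 2 + of_int n) u" if "u \<in> Uw" for u
    using that by (simp add: Uw_def)
  ultimately obtain B where B: "finite B" "cv.span B = Uw"
    using finite_dimensional_weight_space[OF Uw] by metis
  then obtain p where p: "p \<in> Uw" "\<forall>b\<in>Uw. fischer (f - p) b = 0" using fischer_projection[OF B(1), of f] by auto
  define g where "g = f - p"
  have g: "g \<in> ?V" "sl2_euler m g = cscale (of_nat m / 2 + of_int n) g" "g \<noteq> 0"
  proof -
    have pU: "p \<in> U" "sl2_euler m p = cscale (of_nat m / 2 + of_int n) p" using p(1) by (simp_all add: Uw_def)
    then have "p \<in> ?V" using U(2) by blast
    then show "g \<in> ?V" unfolding g_def using f(1) V cv.subspace_diff by blast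
    show "sl2_euler m g = cscale (of_nat m / 2 + of_int n) g"
      by (simp only: g_def sl2_linear pU f(3) cv.scale_right_diff_distrib)
    show "g \<noteq> 0" using pU(1) f(2) by (auto simp: g_def)
  qed
  \<comment> \<open>Different weight spaces are orthogonal, so orthogonality to one weight space of
    \<open>U\<close> extends to \<open>U\<close>.\<close>
  have gU: "fischer g u = 0" if u: "u \<in> U" for u
  proof -
    obtain K v where v: "finite K" "u = (\<Sum>k\<in>K. v k)" "\<And>k. k \<in> K \<Longrightarrow> v k \<in> U"
      "\<And>k. sl2_euler m (v k) = cscale (of_nat m / 2 + of_int k) (v k)"
      using weight_decomposition[OF U(1) EU u] by blast
    have "fischer g (v k) = 0" if "k \<in> K" for k
    proof (cases "k = n")
      case True
      then have "v k \<in> Uw" using v(3)[OF that] v(4)[of k] by (simp add: Uw_def)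
      then show ?thesis using p(2) by (simp add: g_def)
    next
      case False
      then show ?thesis using fischer_weights[OF g(2) v(4)] by simp
    qed
    then show ?thesis by (simp add: v(2) fischer_sum)
  qed
  let ?J = "y_sign m g"
  have J: "?J \<in> xy_linear m" using g(1) y_sign_xy_linear by (simp add: monogenic_spinors_iff)
  define h where "h = D_s m ?J"
  have h: "h \<in> z_only m" unfolding h_def by (rule D_s_z_only[OF J])
  \<comment> \<open>The factor is dictated by the value -m of \<open>D_s\<close> after
    \<open>D_s_adjoint\<close>.\<close>
  define x where "x = ?J + cscale (1 / of_nat m) (D_s_adjoint m h)"
  have "D_s m x = h + cscale (1 / of_nat m) (- of_nat m * h)"
    by (simp add: x_def sl2_linear D_s_adjoint_facts[OF h] flip: h_def)
  also have "\<dots> = 0" using m by (simp flip: cscale_of_nat)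
  finally have D: "D_s m x = 0" .
  have x_xy: "x \<in> xy_linear m"
    unfolding x_def using J D_s_adjoint_facts(2)[OF h]
    by (intro cv.subspace_add[OF subspace_xy_linear] cv.subspace_scale[OF subspace_xy_linear])
  have "z_parity m ?J = cscale \<epsilon> ?J"
    using g(1) by (simp add: monogenic_spinors_iff y_sign_linear flip: y_sign_z_parity)
  moreover then have "z_parity m (D_s_adjoint m h) = cscale \<epsilon> (D_s_adjoint m h)"
  proof -
    assume J: "z_parity m ?J = cscale \<epsilon> ?J"
    have "z_parity m h = - cscale \<epsilon> h" by (simp add: h_def z_parity_D_s J sl2_linear)
    then have "z_parity m (D_s_adjoint m h) = - D_s_adjoint m (- cscale \<epsilon> h)" by (simp only: z_parity_D_s(2))
    then show ?thesis
      by (simp add: D_s_adjoint_def op_linear cscale_mult_right cv.scale_right_distrib)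
  qed
  ultimately have "z_parity m x = cscale \<epsilon> x"
    by (simp add: x_def z_parity_linear cv.scale_right_distrib mult.commute)
  then have xV: "x \<in> ?V" using x_xy D by (simp add: monogenic_spinors_iff)
  have xu: "fischer (y_sign m x) u = fischer g u" if "u \<in> ?V" for u
    using that by (simp add: x_def y_sign_linear y_sign_y_sign fischer_add_left fischer_cscale_left
        fischer_D_s_adjoint[OF h] monogenic_spinors_iff)
  have "x \<noteq> 0"
  proof
    assume "x = 0"
    then have "fischer g g = 0" using xu[OF g(1)] by (simp add: y_sign_linear)
    then show False using g(3) by (simp add: fischer_self)
  qed
  then show ?thesis using xV xu gU U(2) by (intro bexI[of _ x]) auto
qed

lemma monogenic_spinors_irreducible:
  assumes m: "0 < m" and k: "k \<in> monogenic_spinors m \<epsilon>" "k \<noteq> 0" "y_sign m k = k"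
    and cyc: "\<And>U. cv.subspace U \<Longrightarrow> U \<subseteq> monogenic_spinors m \<epsilon> \<Longrightarrow> U \<noteq> {0} \<Longrightarrow>
      (\<And>i j f. i < m \<Longrightarrow> j < m \<Longrightarrow> f \<in> U \<Longrightarrow> spX i j f \<in> U \<and> spY i j f \<in> U \<and> spZ i j f \<in> U) \<Longrightarrow> k \<in> U"
  shows "irreducible_under (sp_operators m) (monogenic_spinors m \<epsilon>)"
  unfolding irreducible_under_def
proof (intro conjI allI impI)
  let ?V = "monogenic_spinors m \<epsilon>"
  show "cv.subspace ?V" by (rule subspace_monogenic_spinors)
  show "?V \<noteq> {0}" using k by auto
  show "\<forall>F\<in>sp_operators m. F ` ?V \<subseteq> ?V"
    unfolding sp_invariant_iff[OF subspace_monogenic_spinors] using monogenic_spinors_sp by blast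
  fix U assume "cv.subspace U \<and> U \<subseteq> ?V \<and> (\<forall>F\<in>sp_operators m. F ` U \<subseteq> U)"
  then have U: "cv.subspace U" "U \<subseteq> ?V"
    and inv: "\<And>i j f. i < m \<Longrightarrow> j < m \<Longrightarrow> f \<in> U \<Longrightarrow> spX i j f \<in> U \<and> spY i j f \<in> U \<and> spZ i j f \<in> U"
    using sp_invariant_iff[of U m] by auto
  show "U = {0} \<or> U = ?V"
  proof (rule ccontr)
    assume n: "\<not> (U = {0} \<or> U = ?V)"
    then have kU: "k \<in> U" using cyc[OF U _ inv] by blast
    define X where "X = {w \<in> ?V. \<forall>u\<in>U. fischer (y_sign m w) u = 0}"
    have X: "cv.subspace X"
      unfolding X_def using subspace_monogenic_spinors[of m \<epsilon>]
      by (auto simp: cv.subspace_def y_sign_linear fischer_add_left fischer_cscale_left)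
    have "U \<subset> ?V" using U(2) n by blast
    moreover have "spX i j f \<in> U" if "i < m" "j < m" "f \<in> U" for i j f
      using inv[OF that] by blast
    ultimately have "\<exists>w\<in>?V. w \<noteq> 0 \<and> (\<forall>u\<in>U. fischer (y_sign m w) u = 0)"
      by (rule y_sign_orthogonal_vector[OF m U(1)])
    then have "X \<noteq> {0}" unfolding X_def by blast
    moreover have "X \<subseteq> ?V" by (auto simp: X_def)
    moreover have "spX i j f \<in> X \<and> spY i j f \<in> X \<and> spZ i j f \<in> X" if "i < m" "j < m" "f \<in> X" for i j f
    proof -
      have f: "f \<in> ?V" "\<And>u. u \<in> U \<Longrightarrow> fischer (y_sign m f) u = 0" using that(3) by (simp_all add: X_def)
      have "fischer (y_sign m (spX i j f)) u = 0 \<and> fischer (y_sign m (spY i j f)) u = 0 \<and> fischer (y_sign m (spZ i j f)) u = 0"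
        if "u \<in> U" for u
        using inv[OF \<open>j < m\<close> \<open>i < m\<close> that] inv[OF \<open>i < m\<close> \<open>j < m\<close> that] f(2)
        by (simp add: fischer_sp[OF \<open>i < m\<close> \<open>j < m\<close>])
      then show ?thesis using monogenic_spinors_sp[OF f(1) that(1,2)] unfolding X_def by blast
    qed
    ultimately have "k \<in> X" using cyc[OF X] by blast
    then have "fischer (y_sign m k) k = 0" using kU by (simp add: X_def)
    then show False using k(2,3) by (simp add: fischer_self)
  qed
qed

subsection \<open>The lowest component\<close>

text \<open>The operators Y commute, and each lowers the weight by 2, hence is locally
  nilpotent.\<close>

lemma spY_kernel_nonzero:
  assumes U: "cv.subspace U" "U \<subseteq> xy_linear m" "U \<noteq> {0}"
    and inv: "\<And>i j f. i < m \<Longrightarrow> j < m \<Longrightarrow> f \<in> U \<Longrightarrow> spY i j f \<in> U"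
  shows "\<exists>u\<in>U. u \<noteq> 0 \<and> (\<forall>j<m. \<forall>k<m. spY j k u = 0)"
proof -
  obtain u where u: "u \<in> U" "u \<noteq> 0" using U cv.subspace_0 by blast
  have "\<exists>v\<in>U. v \<noteq> 0 \<and> (\<forall>i\<in>{..<m} \<times> {..<m}. (\<lambda>(j, k). spY j k) i v = 0)"
  proof (rule common_kernel_nonzero[OF _ u])
    fix i v assume i: "i \<in> {..<m} \<times> {..<m}" and v: "v \<in> U"
    obtain j k where jk: "i = (j, k)" "j < m" "k < m" using i by auto
    have "spY j k ` xy_linear m \<subseteq> xy_linear m" using xy_linear_sp jk by blast
    then show "\<exists>n. ((\<lambda>(j, k). spY j k) i ^^ n) v = 0"
      using weight_lowering_nilpotent[OF linear_op_sp(2) _ spY_weight[OF jk(2,3)]] v U(2) jk(1) by auto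
  qed (use inv spY_commute linear_opD(3)[OF linear_op_sp(2)] in auto)
  then show ?thesis by auto
qed

text \<open>The equations express the second z-derivatives of the coefficients \<open>F i\<close> of
  x through the coefficients \<open>G i\<close> of y. Equality of mixed third derivatives makes the
  \<open>G k\<close> constant in z, and the Dirac equation then makes them vanish.\<close>

lemma spY_kernel:
  assumes m: "3 \<le> m" and u: "u \<in> xy_linear m" "D_s m u = 0" and Y: "\<And>j k. j < m \<Longrightarrow> k < m \<Longrightarrow> spY j k u = 0"
  shows "partial (vr BY k) u = 0" "partial (vr BZ j) (partial (vr BZ k) (partial (vr BX i) u)) = 0"
proof -
  define F where "F i = partial (vr BX i) u" for i
  define G where "G i = partial (vr BY i) u" for i
  have z: "F i \<in> z_only m" "G i \<in> z_only m" for i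
    unfolding F_def G_def using xy_linear_partial[OF u(1)] by auto
  have pol: "u \<in> polys m" using u(1) by (simp add: xy_linear_def)
  have FF: "partial (vr BZ j) (partial (vr BZ k) (F i)) = (if i = j then G k else 0) + (if i = k then G j else 0)"
    if jk: "j < m" "k < m" for i j k
  proof -
    have 0: "partial (vr BX i) (partial (vr BY l) u) = 0" for l
      by (rule z_onlyD(1)[OF xy_linear_partial[OF u(1)]]) auto
    have "partial (vr BX i) (spY j k u) = (if i = j then G k else 0) + (if i = k then G j else 0)
        - partial (vr BX i) (partial (vr BZ j) (partial (vr BZ k) u))"
      by (auto simp: spY_def partial_Var_mult 0 G_def)
    then show ?thesis using Y[OF jk] by (simp add: F_def partial_commute)
  qed
  have dG: "partial (vr BZ l) (G k) = 0" for l k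
  proof (cases "l < m \<and> k < m")
    case True
    \<comment> \<open>With a third index \<open>i\<close> the coefficient \<open>G k\<close> is a
      second derivative of \<open>F i\<close> that involves direction \<open>i\<close>, while the
      second derivative in directions \<open>l\<close> and \<open>k\<close> vanishes.\<close>
    have "\<exists>i<m. i \<noteq> k \<and> i \<noteq> l"
    proof (rule ccontr)
      assume "\<not> ?thesis"
      then have A: "\<And>i. i < m \<Longrightarrow> i = k \<or> i = l" by blast
      from A[of 0] A[of 1] A[of 2] m show False by auto
    qed
    then obtain i where i: "i < m" "i \<noteq> k" "i \<noteq> l" by blast
    have "partial (vr BZ l) (G k) = partial (vr BZ l) (partial (vr BZ i) (partial (vr BZ k) (F i)))"
      using FF[of i k i] i True by simp
    also have "\<dots> = partial (vr BZ i) (partial (vr BZ l) (partial (vr BZ k) (F i)))"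
      by (rule partial_commute)
    also have "\<dots> = 0" using FF[of l k i] i True by simp
    finally show ?thesis .
  next
    case False
    show ?thesis
    proof (cases "k < m")
      case True
      have "G k \<in> polys m" unfolding G_def using pol by (rule polys_partial)
      then show ?thesis using False True by (simp add: polys_iff)
    next
      case False
      then have "G k = 0" using pol by (simp add: G_def polys_iff)
      then show ?thesis by (simp add: op_linear)
    qed
  qed
  have G0: "G k = 0" for k
  proof (cases "k < m")
    case True
    \<comment> \<open>Differentiated in direction \<open>k\<close>, the Dirac equation reads G k =
      (m + 1) G k.\<close>
    have "(\<Sum>j<m. Var (vr BZ j) * G j) = (\<Sum>j<m. partial (vr BZ j) (F j))"
      using u(2) by (simp add: D_s_eq polar_def lap_def F_def G_def partial_commute)
    then have "partial (vr BZ k) (\<Sum>j<m. Var (vr BZ j) * G j) = partial (vr BZ k) (\<Sum>j<m. partial (vr BZ j) (F j))" by simp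
    then have "(\<Sum>j<m. if k = j then G j else 0) = (\<Sum>j<m. (if j = k then G j else 0) + G k)"
      using True FF by (simp add: partial_Var_mult dG)
    then have "of_nat m * G k = 0" using True by (simp add: sum.distrib)
    then have "cscale (of_nat m) (G k) = 0" by (simp add: cscale_of_nat)
    then show ?thesis using m by simp
  next
    case False
    then show ?thesis using pol by (simp add: G_def polys_iff)
  qed
  then show "partial (vr BY k) u = 0" by (simp add: G_def)
  show "partial (vr BZ j) (partial (vr BZ k) (partial (vr BX i) u)) = 0"
  proof (cases "j < m \<and> k < m")
    case True
    then show ?thesis using FF[of j k i] G0 by (simp add: F_def)
  next
    case False
    have p: "partial (vr BX i) u \<in> polys m" using pol by (rule polys_partial)
    have "partial (vr BZ l) (partial (vr BX i) u) = 0" if "\<not> l < m" for l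
      using p that by (simp add: polys_iff)
    then show ?thesis using False partial_commute[of "vr BZ j" "vr BZ k" "partial (vr BX i) u"]
      by (cases "k < m") (simp_all add: op_linear)
  qed
qed

lemma z_only_const:
  assumes "f \<in> z_only m" "\<And>j. partial (vr BZ j) f = 0"
  shows "f = Cst (Poly_Mapping.lookup f 0)"
  using assms by (intro z_only_degree_0) (auto simp: polar_def)

lemma z_parity_Cst: "z_parity m (Cst c) = Cst c"
  by (rule poly_mapping_eqI) (simp add: z_parity_def Cst_def lookup_single when_def z_degree_def)

lemma eq_uminus_self: "f = - f \<Longrightarrow> f = 0" for f :: cpoly
  using half_plus_half[of f] by (metis add.right_inverse cv.scale_zero_right)

lemma z_only_affine:
  assumes f: "f \<in> z_only m" and Z: "\<And>j k. partial (vr BZ j) (partial (vr BZ k) f) = 0"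
  shows "z_parity m f = f \<Longrightarrow> f = Cst (Poly_Mapping.lookup f 0)"
    "z_parity m f = - f \<Longrightarrow> f = (\<Sum>j<m. cscale (Poly_Mapping.lookup (partial (vr BZ j) f) 0) (Var (vr BZ j)))"
proof -
  have pol: "f \<in> polys m" using f by (simp add: z_only_def)
  define b where "b k = Poly_Mapping.lookup (partial (vr BZ k) f) 0" for k
  have b: "partial (vr BZ k) f = Cst (b k)" for k
    unfolding b_def by (rule z_only_const[OF z_only_ops(1)[OF f] Z])
  have big: "partial (vr BZ k) f = 0" if "\<not> k < m" for k
    using pol that by (simp add: polys_iff)
  show "f = Cst (Poly_Mapping.lookup f 0)" if p: "z_parity m f = f"
  proof (rule z_only_const[OF f])
    fix k
    show "partial (vr BZ k) f = 0"
    proof (cases "k < m")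
      case True
      have "z_parity m (partial (vr BZ k) f) = - partial (vr BZ k) f"
        using z_parity_ops(2)[OF True, of BZ f] by (simp add: p cv.scale_minus_left)
      then show ?thesis by (intro eq_uminus_self) (simp add: b z_parity_Cst)
    qed (rule big)
  qed
  show "f = (\<Sum>j<m. cscale (Poly_Mapping.lookup (partial (vr BZ j) f) 0) (Var (vr BZ j)))" if p: "z_parity m f = - f"
  proof -
    let ?g = "f - (\<Sum>j<m. cscale (b j) (Var (vr BZ j)))"
    have 1: "?g \<in> z_only m"
      using f by (auto simp: z_only_def op_linear intro!: polys_lin polys_sum polys_Var)
    have "partial (vr BZ k) (\<Sum>j<m. cscale (b j) (Var (vr BZ j))) = (\<Sum>j<m. if k = j then Cst (b j) else 0)" for k
      unfolding op_linear by (intro sum.cong refl) (auto simp: cscale_eq)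
    then have "partial (vr BZ k) ?g = 0" for k
      using big[of k] by (cases "k < m") (simp_all add: op_linear b)
    then have g: "?g = Cst (Poly_Mapping.lookup ?g 0)" using z_only_const[OF 1] by blast
    have "z_parity m (\<Sum>j<m. cscale (b j) (Var (vr BZ j))) = - (\<Sum>j<m. cscale (b j) (Var (vr BZ j)))"
    proof -
      have "z_parity m (Var (vr BZ j)) = - Var (vr BZ j)" if "j < m" for j
        using z_parity_ops(1)[OF that, of BZ 1] z_parity_Cst[of m 1] by (simp add: Cst_def cv.scale_minus_left)
      then show ?thesis by (simp add: z_parity_linear sum_negf)
    qed
    then have n: "z_parity m ?g = - ?g" by (simp add: z_parity_linear p)
    have "z_parity m ?g = ?g" by (subst (1 2) g) (rule z_parity_Cst)
    then have "?g = 0" using n by (intro eq_uminus_self) simp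
    then show ?thesis by (simp add: b_def)
  qed
qed

lemma lowest_spinor:
  assumes m: "3 \<le> m" and U: "cv.subspace U" "U \<subseteq> monogenic_spinors m \<epsilon>" "U \<noteq> {0}"
    and inv: "\<And>i j f. i < m \<Longrightarrow> j < m \<Longrightarrow> f \<in> U \<Longrightarrow> spY i j f \<in> U"
  shows "\<exists>u\<in>U. u \<noteq> 0 \<and> (\<forall>k. partial (vr BY k) u = 0) \<and>
    (\<Sum>i<m. Var (vr BX i) * partial (vr BX i) u) = u \<and> (\<forall>i. partial (vr BX i) u \<in> z_only m) \<and>
    (\<forall>i j k. partial (vr BZ j) (partial (vr BZ k) (partial (vr BX i) u)) = 0) \<and>
    (\<forall>i<m. z_parity m (partial (vr BX i) u) = cscale \<epsilon> (partial (vr BX i) u))"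
proof -
  have "U \<subseteq> xy_linear m" using U(2) by (auto simp: monogenic_spinors_iff)
  then obtain u where u: "u \<in> U" "u \<noteq> 0" "\<forall>j<m. \<forall>k<m. spY j k u = 0"
    using spY_kernel_nonzero[OF U(1) _ U(3) inv] by blast
  have u': "u \<in> xy_linear m" "D_s m u = 0" "z_parity m u = cscale \<epsilon> u"
    using u(1) U(2) by (auto simp: monogenic_spinors_iff)
  have K: "spY j k u = 0" if "j < m" "k < m" for j k using u(3) that by blast
  note k = spY_kernel[OF m u'(1,2) K]
  have "(\<Sum>i<m. Var (vr BX i) * partial (vr BX i) u) = u"
    using xy_linear_expand[OF u'(1)] by (simp add: k(1))
  moreover have "z_parity m (partial (vr BX i) u) = cscale \<epsilon> (partial (vr BX i) u)" if "i < m" for i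
    using z_parity_ops(2)[OF that, of BX u] by (simp add: u'(3) op_linear)
  moreover have "partial (vr BX i) u \<in> z_only m" for i by (rule xy_linear_partial[OF u'(1)]) simp
  ultimately show ?thesis using u(1,2) k by blast
qed

lemma spX_Var_X: "spX a c (Var (vr BX i)) = (if c = i then Var (vr BX a) else 0)"
  by (simp add: spX_def)

text \<open>Among even spinors the vectors killed by all Y are linear forms in x, on which the X act
  by matrix units; one of these reaches the first coordinate.\<close>

lemma even_spinors_irreducible:
  assumes m: "3 \<le> m"
  shows "irreducible_under (sp_operators m) (symplectic_monogenics m 1 \<inter> even_spinors m)"
proof -
  let ?k = "Var (vr BX 0)"
  have k: "?k \<in> polys m" "polar m BY BY ?k = 0" "polar m BX BX ?k = ?k" "polar m BZ BY ?k = 0"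
    using m by (auto simp: polys_Var polar_Var)
  have "lap m BX BZ ?k = 0" by (simp add: lap_def)
  then have kD: "D_s m ?k = 0" using k by (simp add: D_s_eq)
  have kp: "z_parity m ?k = ?k"
    using z_parity_ops(1)[of 0 m BX 1] z_parity_Cst[of m 1] m by (simp add: Cst_def)
  have "irreducible_under (sp_operators m) (monogenic_spinors m 1)"
  proof (rule monogenic_spinors_irreducible[where k = ?k])
    show "?k \<in> monogenic_spinors m 1" using k kD kp by (simp add: monogenic_spinors_iff xy_linear_def)
    show "?k \<noteq> 0" using partial_Var[of "vr BX 0" "vr BX 0"] op_linear by (metis zero_neq_one)
    show "y_sign m ?k = ?k" using z_only_y_sign k by blast
    fix U assume U: "cv.subspace U" "U \<subseteq> monogenic_spinors m 1" "U \<noteq> {0}"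
      and inv: "\<And>i j f. i < m \<Longrightarrow> j < m \<Longrightarrow> f \<in> U \<Longrightarrow> spX i j f \<in> U \<and> spY i j f \<in> U \<and> spZ i j f \<in> U"
    have invY: "spY i j f \<in> U" if "i < m" "j < m" "f \<in> U" for i j f using inv[OF that] by blast
    obtain u where u: "u \<in> U" "u \<noteq> 0" "\<And>k. partial (vr BY k) u = 0"
      "(\<Sum>i<m. Var (vr BX i) * partial (vr BX i) u) = u" "\<And>i. partial (vr BX i) u \<in> z_only m"
      "\<And>i j k. partial (vr BZ j) (partial (vr BZ k) (partial (vr BX i) u)) = 0"
      "\<And>i. i < m \<Longrightarrow> z_parity m (partial (vr BX i) u) = cscale 1 (partial (vr BX i) u)"
      using lowest_spinor[OF m U invY] by blast
    define c where "c i = Poly_Mapping.lookup (partial (vr BX i) u) 0" for i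
    have "partial (vr BX i) u = Cst (c i)" if "i < m" for i
      unfolding c_def using z_only_affine(1)[OF u(5,6)] u(7)[OF that] by simp
    then have uc: "u = (\<Sum>i<m. cscale (c i) (Var (vr BX i)))"
      using u(4) [symmetric] by (simp add: cscale_eq mult.commute)
    then obtain k where k: "k < m" "c k \<noteq> 0"
      using u(2) by (metis (no_types, lifting) cv.scale_zero_left lessThan_iff sum.neutral)
    have "spX 0 k u = (\<Sum>i<m. if k = i then cscale (c i) ?k else 0)"
      unfolding uc linear_opD[OF linear_op_sp(1)] by (intro sum.cong refl) (simp add: spX_Var_X)
    then have "spX 0 k u = cscale (c k) ?k" using k(1) by simp
    then have "cscale (c k) ?k \<in> U" using inv[of 0 k u] k(1) u(1) m by simp
    from cv.subspace_scale[OF U(1) this, of "inverse (c k)"] show "?k \<in> U" using k(2) by simp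
  qed (use m in simp)
  moreover have "monogenic_spinors m 1 = symplectic_monogenics m 1 \<inter> even_spinors m"
    by (auto simp: monogenic_spinors_def spinor_parity)
  ultimately show ?thesis by simp
qed

definition xz :: "nat \<Rightarrow> nat \<Rightarrow> cpoly" where
  "xz i j = Var (vr BX i) * Var (vr BZ j)"

lemma spX_xz: "spX a c (xz i j) = (if c = i then xz a j else 0) - (if a = j then xz i c else 0)"
  by (simp add: spX_def xz_def partial_Var_mult mult.commute)

text \<open>The operators X change one index at a time. Moves that would make both indices equal are
  avoided, since they produce a second term.\<close>

lemma xz_reach:
  assumes m: "3 \<le> m" and U: "cv.subspace U" and inv: "\<And>i j f. i < m \<Longrightarrow> j < m \<Longrightarrow> f \<in> U \<Longrightarrow> spX i j f \<in> U"
    and lk: "xz l k \<in> U" "l < m" "k < m" "l \<noteq> k"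
  shows "xz 0 1 \<in> U"
proof -
  have 1: "xz a k \<in> U" if "xz l k \<in> U" "l < m" "a < m" "a \<noteq> k" for a l k
    using inv[of a l "xz l k"] that by (simp add: spX_xz)
  have 2: "xz l b \<in> U" if "xz l k \<in> U" "k < m" "b < m" "b \<noteq> l" for b l k
    using inv[of k b "xz l k"] that cv.subspace_neg[OF U, of "- xz l b"] by (simp add: spX_xz)
  have m': "0 < m" "1 < m" "2 < m" using m by auto
  show ?thesis
  proof (cases "k = 0")
    case False
    then show ?thesis using 2[OF 1[OF lk(1,2), of 0], of 1] lk m' by simp
  next
    case k: True
    show ?thesis
    proof (cases "l = 1")
      case False
      then show ?thesis using 1[OF 2[OF lk(1,3), of 1], of 0] lk m' by simp
    next
      case True
      \<comment> \<open>Exchanging the indices 1 and 0 takes a detour through a third index.\<close>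
      have "xz 1 2 \<in> U" using 2[OF lk(1,3), of 2] True m' by simp
      then have "xz 0 2 \<in> U" using 1[of 1 2 0] m' by simp
      then show ?thesis using 2[of 0 2 1] m' by simp
    qed
  qed
qed

text \<open>Among odd spinors the vectors killed by all Y are bilinear forms in x and z with
  coefficient matrix \<open>b\<close>, and the Dirac equation says that \<open>b\<close> has trace
  0. This is the adjoint representation of sl(m), treated by isolating an off-diagonal
  entry.\<close>

lemma odd_spinors_irreducible:
  assumes m: "3 \<le> m"
  shows "irreducible_under (sp_operators m) (symplectic_monogenics m 1 \<inter> odd_spinors m)"
proof -
  let ?k = "xz 0 1"
  have m': "0 < m" "Suc 0 < m" using m by auto
  have k: "?k \<in> polys m" "polar m BY BY ?k = 0" "polar m BX BX ?k = ?k" "polar m BZ BY ?k = 0"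
    unfolding xz_def using m by (auto simp: polys_mult polys_Var polar_Var polar_mult)
  have "lap m BX BZ ?k = 0" by (auto simp: lap_def xz_def partial_Var_mult intro!: sum.neutral)
  then have kD: "D_s m ?k = 0" using k by (simp add: D_s_eq)
  have kp: "z_parity m ?k = cscale (- 1) ?k"
    using z_parity_ops(1)[OF m'(1), of BX "Var (vr BZ 1)"] z_parity_ops(1)[OF m'(2), of BZ 1] z_parity_Cst[of m 1]
    by (simp add: Cst_def xz_def cscale_mult_right)
  have "irreducible_under (sp_operators m) (monogenic_spinors m (- 1))"
  proof (rule monogenic_spinors_irreducible[where k = ?k])
    show "?k \<in> monogenic_spinors m (- 1)" using k kD kp by (simp add: monogenic_spinors_iff xy_linear_def)
    have "partial (vr BZ 1) (partial (vr BX 0) ?k) = 1" by (simp add: xz_def partial_Var_mult)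
    then show "?k \<noteq> 0" using op_linear by (metis zero_neq_one)
    show "y_sign m ?k = ?k" using z_only_y_sign k by blast
    fix U assume U: "cv.subspace U" "U \<subseteq> monogenic_spinors m (- 1)" "U \<noteq> {0}"
      and inv: "\<And>i j f. i < m \<Longrightarrow> j < m \<Longrightarrow> f \<in> U \<Longrightarrow> spX i j f \<in> U \<and> spY i j f \<in> U \<and> spZ i j f \<in> U"
    have invX: "spX i j f \<in> U" if "i < m" "j < m" "f \<in> U" for i j f using inv[OF that] by blast
    have invY: "spY i j f \<in> U" if "i < m" "j < m" "f \<in> U" for i j f using inv[OF that] by blast
    obtain u where u: "u \<in> U" "u \<noteq> 0" "\<And>k. partial (vr BY k) u = 0"
      "(\<Sum>i<m. Var (vr BX i) * partial (vr BX i) u) = u" "\<And>i. partial (vr BX i) u \<in> z_only m"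
      "\<And>i j k. partial (vr BZ j) (partial (vr BZ k) (partial (vr BX i) u)) = 0"
      "\<And>i. i < m \<Longrightarrow> z_parity m (partial (vr BX i) u) = cscale (- 1) (partial (vr BX i) u)"
      using lowest_spinor[OF m U invY] by blast
    define b where "b i j = Poly_Mapping.lookup (partial (vr BZ j) (partial (vr BX i) u)) 0" for i j
    have F: "partial (vr BX i) u = (\<Sum>j<m. cscale (b i j) (Var (vr BZ j)))" if "i < m" for i
      unfolding b_def using z_only_affine(2)[OF u(5,6)] u(7)[OF that] by (simp add: cv.scale_minus_left)
    have uc: "u = (\<Sum>i<m. \<Sum>j<m. cscale (b i j) (xz i j))"
      using u(4) [symmetric] F by (simp add: sum_distrib_left cscale_mult_right xz_def)
    have X: "spX a c u = (\<Sum>j<m. cscale (b c j) (xz a j)) - (\<Sum>i<m. cscale (b i a) (xz i c))" if ac: "a < m" "c < m" for a c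
    proof -
      have "spX a c u = (\<Sum>i<m. \<Sum>j<m. (if c = i then cscale (b i j) (xz a j) else 0) - (if a = j then cscale (b i j) (xz i c) else 0))"
        unfolding uc linear_opD[OF linear_op_sp(1)]
        by (intro sum.cong refl) (simp add: spX_xz cv.scale_right_diff_distrib)
      also have "\<dots> = (\<Sum>i<m. if c = i then \<Sum>j<m. cscale (b i j) (xz a j) else 0) - (\<Sum>i<m. cscale (b i a) (xz i c))"
        unfolding sum_subtractf using ac by (intro arg_cong2[where f = "(-)"] sum.cong refl) auto
      finally show ?thesis using ac by simp
    qed
    have scale: "xz l k \<in> U" if "cscale c (xz l k) \<in> U" "c \<noteq> 0" for c l k
      using cv.subspace_scale[OF U(1) that(1), of "inverse c"] that(2) by simp
    have "\<exists>l<m. \<exists>k<m. l \<noteq> k \<and> xz l k \<in> U"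
    proof (cases "\<exists>l<m. \<exists>k<m. l \<noteq> k \<and> b k l \<noteq> 0")
      case True
      then obtain l k where lk: "l < m" "k < m" "l \<noteq> k" "b k l \<noteq> 0" by blast
      \<comment> \<open>Applying the same root vector twice annihilates all entries except
        \<open>b k l\<close>, which both sums in \<open>X\<close> contribute.\<close>
      have "spX l k (\<Sum>j<m. cscale (b k j) (xz l j)) = - cscale (b k l) (xz l k)"
      proof -
        have "spX l k (\<Sum>j<m. cscale (b k j) (xz l j)) = (\<Sum>j<m. if l = j then - cscale (b k j) (xz l k) else 0)"
          unfolding linear_opD[OF linear_op_sp(1)] using lk by (intro sum.cong refl) (auto simp: spX_xz cv.scale_minus_right)
        then show ?thesis using lk by simp
      qed
      moreover have "spX l k (\<Sum>i<m. cscale (b i l) (xz i k)) = cscale (b k l) (xz l k)"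
      proof -
        have "spX l k (\<Sum>i<m. cscale (b i l) (xz i k)) = (\<Sum>i<m. if k = i then cscale (b i l) (xz l k) else 0)"
          unfolding linear_opD[OF linear_op_sp(1)] using lk by (intro sum.cong refl) (auto simp: spX_xz)
        then show ?thesis using lk by simp
      qed
      ultimately have "spX l k (spX l k u) = cscale (- 2 * b k l) (xz l k)"
        unfolding X[OF lk(1,2)] linear_opD[OF linear_op_sp(1)]
        by (simp add: poly_mapping_eq_iff fun_eq_iff lookup_simps)
      moreover have "spX l k (spX l k u) \<in> U" using invX lk u(1) by blast
      ultimately have "xz l k \<in> U" using scale[of "- 2 * b k l"] lk(4) by simp
      then show ?thesis using lk by blast
    next
      case False
      then have off: "b k l = 0" if "k < m" "l < m" "k \<noteq> l" for k l using that by metis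
      have Xd: "spX k l u = cscale (b l l - b k k) (xz k l)" if "k < m" "l < m" for k l
      proof -
        have "(\<Sum>j<m. cscale (b l j) (xz k j)) = (\<Sum>j<m. if l = j then cscale (b l j) (xz k j) else 0)"
          "(\<Sum>i<m. cscale (b i k) (xz i l)) = (\<Sum>i<m. if k = i then cscale (b i k) (xz i l) else 0)"
          using that off by (intro sum.cong refl; simp)+
        then show ?thesis unfolding X[OF that] using that by (simp add: cv.scale_left_diff_distrib)
      qed
      \<comment> \<open>A scalar matrix of trace 0 is 0, so a nonzero diagonal \<open>b\<close> has
        two different entries and some X produces an off-diagonal monomial.\<close>
      have "\<exists>l<m. \<exists>k<m. b l l \<noteq> b k k"
      proof (rule ccontr)
        assume "\<not> ?thesis"
        then have eq: "b l l = b 0 0" if "l < m" for l using that m'(1) by blast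
        have "D_s m u = 0" using u(1) U(2) by (auto simp: monogenic_spinors_iff)
        then have "(\<Sum>j<m. partial (vr BZ j) (partial (vr BX j) u)) = 0"
          by (simp add: D_s_eq polar_def lap_def u(3) partial_commute)
        then have "(\<Sum>j<m. b j j) = 0" unfolding b_def lookup_sum [symmetric] by simp
        moreover have "(\<Sum>j<m. b j j) = (\<Sum>j<m. b 0 0)" by (intro sum.cong refl eq) simp
        ultimately have "b 0 0 = 0" using m by simp
        then have "b k l = 0" if "k < m" "l < m" for k l
          using off[OF that] eq[OF that(1)] by (cases "k = l") simp_all
        then have "u = 0" unfolding uc by (simp add: sum.neutral)
        then show False using u(2) by simp
      qed
      then obtain l k where lk: "l < m" "k < m" "b l l \<noteq> b k k" by blast
      have "spX k l u \<in> U" using invX lk u(1) by blast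
      then have "xz k l \<in> U" using scale[of "b l l - b k k"] lk by (simp add: Xd)
      then show ?thesis using lk by metis
    qed
    then show "?k \<in> U" using xz_reach[OF m U(1) invX] by blast
  qed (use m in simp)
  moreover have "monogenic_spinors m (- 1) = symplectic_monogenics m 1 \<inter> odd_spinors m"
    by (auto simp: monogenic_spinors_def spinor_parity cv.scale_minus_left)
  ultimately show ?thesis by simp
qed

section \<open>Assembling the decomposition\<close>

context
  fixes m :: nat
  assumes m: "6 \<le> m"
begin

definition sl2_eigenvalue :: "int \<Rightarrow> complex" where
  "sl2_eigenvalue s = (of_nat m / 2 + of_int s) * (of_nat m / 2 + of_int s - 2)"

lemma branch_casimirs:
  assumes "(a, b, s) \<in> branching_index" "f \<in> branch m (a, b, s)"
  shows "so_casimir m f = cscale (of_int (so_eigenvalue m a b)) f" "sl2_casimir m f = cscale (sl2_eigenvalue s) f"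
  using branch_so_casimir[OF m assms] branch_sl2_casimir[OF m assms] by (simp_all add: sl2_eigenvalue_def)

lemma eigenvalues_separate:
  assumes "(a, b, s) \<in> branching_index" "(a', b', s') \<in> branching_index" "(a, b, s) \<noteq> (a', b', s')"
  shows "of_int (so_eigenvalue m a b) \<noteq> (of_int (so_eigenvalue m a' b') :: complex) \<or> sl2_eigenvalue s \<noteq> sl2_eigenvalue s'"
  using casimirs_separate[OF m assms(1,2)] assms(3) unfolding sl2_eigenvalue_def of_int_eq_iff by blast

lemma subspace_branch:
  assumes "i \<in> branching_index"
  shows "cv.subspace (branch m i)"
proof -
  obtain a b s where i: "i = (a, b, s)" by (cases i)
  interpret lowest_weight_embedding m "branch_module m a b" "branch_map m a b s" "of_nat m / 2 + of_int s"
    using assms branch_embedding[OF m] unfolding i by blast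
  show ?thesis using subspace_W by (simp add: i branch_def[OF m])
qed

text \<open>Independence is the separation of eigenvectors inside the subspace 0, with whichever
  Casimir operator distinguishes the given pair.\<close>

lemma branch_direct_sum: "internal_direct_sum (symplectic_monogenics m 1) branching_index (branch m)"
  unfolding internal_direct_sum_def
proof (intro conjI allI impI ballI)
  show "symplectic_monogenics m 1 = cv.span (\<Union>i\<in>branching_index. branch m i)"
    using branch_sum_eq[OF m] by (simp add: branch_sum_def[OF m])
  fix J and w :: "nat \<times> nat \<times> int \<Rightarrow> cpoly" and i
  assume J: "finite J \<and> J \<subseteq> branching_index \<and> (\<forall>i\<in>J. w i \<in> branch m i) \<and> sum w J = 0" and i: "i \<in> J"
  define so where "so = (\<lambda>(a :: nat, b :: nat, s :: int). of_int (so_eigenvalue m a b) :: complex)"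
  define sl where "sl = (\<lambda>(a :: nat, b :: nat, s :: int). sl2_eigenvalue s)"
  have e: "so_casimir m (w k) = cscale (so k) (w k)" "sl2_casimir m (w k) = cscale (sl k) (w k)" if "k \<in> J" for k
  proof -
    obtain a b s where k: "k = (a, b, s)" by (cases k)
    have "k \<in> branching_index" "w k \<in> branch m k" using that J by blast+
    then show "so_casimir m (w k) = cscale (so k) (w k)" "sl2_casimir m (w k) = cscale (sl k) (w k)"
      using branch_casimirs[of a b s "w k"] by (simp_all add: k so_def sl_def)
  qed
  have "w i \<in> {0}"
  proof (rule eigenvector_components_in_subspace[OF _ cv.subspace_single_0 _ _ i])
    fix j k assume jk: "j \<in> J" "k \<in> J" "j \<noteq> k"
    obtain a b s where j: "j = (a, b, s)" by (cases j)
    obtain a' b' s' where k: "k = (a', b', s')" by (cases k)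
    have "so j \<noteq> so k \<or> sl j \<noteq> sl k"
      using eigenvalues_separate[of a b s a' b' s'] jk J by (auto simp: j k so_def sl_def)
    then show "\<exists>F \<mu>. linear_op F \<and> F ` {0 :: cpoly} \<subseteq> {0} \<and> (\<forall>k\<in>J. F (w k) = cscale (\<mu> k) (w k)) \<and> \<mu> j \<noteq> \<mu> k"
    proof
      assume "so j \<noteq> so k"
      then show ?thesis using e(1) linear_op_so_casimir linear_opD(3)[OF linear_op_so_casimir]
        by (intro exI[of _ "so_casimir m"] exI[of _ so]) simp
    next
      assume "sl j \<noteq> sl k"
      then show ?thesis using e(2) linear_op_sl2_casimir linear_opD(3)[OF linear_op_sl2_casimir]
        by (intro exI[of _ "sl2_casimir m"] exI[of _ sl]) simp
    qed
  qed (use J in auto)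
  then show "w i = 0" by simp
qed (rule subspace_branch)

lemma branch_irreducible:
  assumes "i \<in> branching_index"
  shows "irreducible_rep (lie_prod (so m) sl2) (branch m i) (so_sl2_action m)"
proof -
  obtain a b s where i: "i = (a, b, s)" by (cases i)
  interpret lowest_weight_embedding m "branch_module m a b" "branch_map m a b s" "of_nat m / 2 + of_int s"
    using assms branch_embedding[OF m] unfolding i by blast
  show ?thesis using W_irreducible by (simp add: i branch_def[OF m])
qed

lemma branch_module_highest_weight:
  assumes "(a, b, s) \<in> branching_index"
  shows "\<exists>v\<in>branch_module m a b. so_highest_weight_vector m (so_action m) (two_row_weight a b) v"
proof -
  have m4: "4 \<le> m" using m by simp
  consider "b = 0" | "b = 1" "a \<noteq> 0" using assms by (auto simp: branching_index_iff[OF m])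
  then show ?thesis
  proof cases
    case 1
    then show ?thesis using nv_power_harmonic[of m a] harmonics_highest_weight[OF m4, of a] m
      by (intro bexI[of _ "nv BZ ^ a"]) (simp_all add: branch_module_def[OF m])
  next
    case 2
    then obtain c where c: "a = Suc c" using not0_implies_Suc by blast
    have "two_row_vector c \<in> two_row m a"
      unfolding two_row_vector_def c using m
      by (intro cv.subspace_add[OF subspace_two_row] cv.subspace_scale[OF subspace_two_row] null_wedge_two_row) auto
    then show ?thesis using two_row_highest_weight[OF m4, of c] 2(1) c
      by (intro bexI[of _ "two_row_vector c"]) (simp_all add: branch_module_def[OF m])
  qed
qed

lemma branch_outer_tensor:
  assumes "(a, b, s) \<in> branching_index"
  shows "\<exists>(M :: cpoly set) \<rho> (N :: (nat \<Rightarrow>\<^sub>0 complex) set) \<sigma>.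
    so_irrep m (two_row_weight a b) M \<rho> \<and> lowest_weight_verma (of_nat m / 2 + of_int s) N \<sigma> \<and>
    outer_tensor_rep (so m) M \<rho> sl2 N \<sigma> (branch m (a, b, s)) (so_sl2_action m)"
proof -
  interpret lowest_weight_embedding m "branch_module m a b" "branch_map m a b s" "of_nat m / 2 + of_int s"
    by (rule branch_embedding[OF m assms])
  have "so_irrep m (two_row_weight a b) (branch_module m a b) (so_action m)"
    using M_irreducible branch_module_highest_weight[OF assms] by (simp add: so_irrep_def)
  moreover have "outer_tensor_rep (so m) (branch_module m a b) (so_action m) sl2 UNIV verma (branch m (a, b, s)) (so_sl2_action m)"
    using outer_tensor_W by (simp add: branch_def[OF m])
  ultimately show ?thesis using lowest_weight_verma_verma by blast
qed

lemma branch_not_isomorphic: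
  assumes i: "i \<in> branching_index" and j: "j \<in> branching_index" and ij: "i \<noteq> j"
  shows "\<not> isomorphic_rep (lie_prod (so m) sl2) (branch m i) (so_sl2_action m) (branch m j) (so_sl2_action m)"
proof
  assume iso: "isomorphic_rep (lie_prod (so m) sl2) (branch m i) (so_sl2_action m) (branch m j) (so_sl2_action m)"
  obtain a b s where abs: "i = (a, b, s)" by (cases i)
  obtain a' b' s' where abs': "j = (a', b', s')" by (cases j)
  have rep: "representation (lie_prod (so m) sl2) (branch m k) (so_sl2_action m)" "branch m k \<noteq> {0}"
    if "k \<in> branching_index" for k
    using branch_irreducible[OF that] unfolding irreducible_rep_def irreducible_under_def by blast+
  have "of_int (so_eigenvalue m a b) = (of_int (so_eigenvalue m a' b') :: complex) \<and> sl2_eigenvalue s = sl2_eigenvalue s'"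
  proof (rule isomorphic_casimirs[OF iso rep(1)[OF i] rep(2)[OF i] rep(1)[OF j]])
    fix f
    show "so_casimir m f = cscale (of_int (so_eigenvalue m a b)) f" "sl2_casimir m f = cscale (sl2_eigenvalue s) f"
      if "f \<in> branch m i"
      using branch_casimirs[of a b s f] i that by (simp_all add: abs)
    show "so_casimir m f = cscale (of_int (so_eigenvalue m a' b')) f" "sl2_casimir m f = cscale (sl2_eigenvalue s') f"
      if "f \<in> branch m j"
      using branch_casimirs[of a' b' s' f] j that by (simp_all add: abs')
  qed
  then show False using eigenvalues_separate[of a b s a' b' s'] i j ij by (simp add: abs abs')
qed

end

theorem theorem5p7:
  fixes m :: nat
  assumes "m \<ge> 6"
  shows
    "irreducible_under (sp_operators m) (symplectic_monogenics m 1 \<inter> even_spinors m) \<and>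
     irreducible_under (sp_operators m) (symplectic_monogenics m 1 \<inter> odd_spinors m) \<and>
     (\<exists>W :: nat \<times> nat \<times> int \<Rightarrow> cpoly set.
        internal_direct_sum (symplectic_monogenics m 1) branching_index W \<and>
        (\<forall>i\<in>branching_index. irreducible_rep (lie_prod (so m) sl2) (W i) (so_sl2_action m)) \<and>
        (\<forall>(a, b, s)\<in>branching_index.
           \<exists>(M :: cpoly set) \<rho> (N :: (nat \<Rightarrow>\<^sub>0 complex) set) \<sigma>.
             so_irrep m (two_row_weight a b) M \<rho> \<and>
             lowest_weight_verma (of_nat m / 2 + of_int s) N \<sigma> \<and>
             outer_tensor_rep (so m) M \<rho> sl2 N \<sigma> (W (a, b, s)) (so_sl2_action m)) \<and>
        (\<forall>i\<in>branching_index. \<forall>j\<in>branching_index. i \<noteq> j \<longrightarrow>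
           \<not> isomorphic_rep (lie_prod (so m) sl2) (W i) (so_sl2_action m) (W j) (so_sl2_action m)))"
proof (intro conjI exI[of _ "branch m"] ballI impI)
  have "3 \<le> m" using assms by simp
  then show "irreducible_under (sp_operators m) (symplectic_monogenics m 1 \<inter> even_spinors m)"
    "irreducible_under (sp_operators m) (symplectic_monogenics m 1 \<inter> odd_spinors m)"
    by (rule even_spinors_irreducible odd_spinors_irreducible)+
  show "internal_direct_sum (symplectic_monogenics m 1) branching_index (branch m)"
    by (rule branch_direct_sum[OF assms])
  show "case i of (a, b, s) \<Rightarrow>
      \<exists>(M :: cpoly set) \<rho> (N :: (nat \<Rightarrow>\<^sub>0 complex) set) \<sigma>.
        so_irrep m (two_row_weight a b) M \<rho> \<and> lowest_weight_verma (of_nat m / 2 + of_int s) N \<sigma> \<and>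
        outer_tensor_rep (so m) M \<rho> sl2 N \<sigma> (branch m (a, b, s)) (so_sl2_action m)"
    if "i \<in> branching_index" for i
    using branch_outer_tensor[OF assms] that by (auto split: prod.split)
qed (use branch_irreducible[OF assms] branch_not_isomorphic[OF assms] in blast)+

end
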